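(* Let $X$ and $Y$ be two smooth manifolds. Let $\alpha^X(t):\mathbb{R}_{>0}\to H^*(X)$ and $\alpha^Y(t):\mathbb{R}_{>0}\to H^*(Y)$ be two cohomology-valued functions with series expansions $$\alpha^X(t)=\sum_{m=0}^\infty\alpha^X_{r_Xm}t^{r_Xm+\beta_X},\qquad\alpha^Y(t)=\sum_{m=0}^\infty\alpha^Y_{r_Ym}t^{r_Ym+\beta_Y},$$ where $r_X,r_Y\in\mathbb{N}_{>0}$, $\alpha^X_{r_Xm},\beta_X\in H^*(X)$ and $\alpha^Y_{r_Ym},\beta_Y\in H^*(Y)$. Suppose that $\alpha^X(t)$ and $\alpha^Y(t)$ are asymptotically Mittag-Leffler with scalings $(T_X,A_X)$ and $(T_Y,A_Y)$, respectively, where $T_X,T_Y\in\mathbb{R}_{>0}$, $A_X\in H^*(X)$, $A_Y\in H^*(Y)$. Then the product $$\alpha^X(t)\alpha^Y(t):\mathbb{R}_{>0}\to H^*(X)\otimes H^*(Y)=H^*(X\times Y)$$ is $\left(T_X+T_Y,\ \frac{r}{r_Xr_Y}A_X\otimes A_Y\right)$-scaled asymptotically Mittag-Leffler, where $r=\mathrm{GCD}(r_X,r_Y)$.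
   Context: Cohomology is with complex coefficients. The manifolds are connected with finite-dimensional cohomology, $H^0=\mathbb{C}$; exponent classes $\beta$ are of even degree (sums of even-degree components), $\beta=\beta_0+\beta_{\ge2}$ with $\beta_0\in\mathbb{C}$ and $\beta_{\ge2}$ nilpotent. Functions of such classes are defined by Taylor expansion in the nilpotent part, $f(\beta)=\sum_{k\ge0}\frac1{k!}f^{(k)}(\beta_0)\beta_{\ge2}^k$ (applied to $\Gamma$, $1/\Gamma$); $s^{\beta}=\exp(\beta\log s)$ for $s>0$. For a manifold $W$, a series $\alpha(t)=\sum_{m\ge0}\alpha_{rm}t^{rm+\beta}$ with $r\in\mathbb{N}_{>0}$, $\alpha_{rm},\beta\in H^*(W)$, is $(T,A)$-scaled asymptotically Mittag-Leffler, for $T\in\mathbb{R}_{>0}$ and $A\in H^*(W)$, if as $m\to\infty$ $$\alpha_{rm}=\frac{T^{rm+\beta}}{\Gamma(1+rm+\beta)}\cdot(A+o(1)).$$ Products of classes from $X$ and $Y$ are taken in $H^*(X)\otimes H^*(Y)$, i.e. $\alpha_1\alpha_2$ means $\alpha_1\otimes\alpha_2$. The product series is expanded as $\alpha^X(t)\alpha^Y(t)=\sum_{m\ge0}(\alpha^X\alpha^Y)_{rm}t^{rm+\beta_X+\beta_Y}$ with $r=\mathrm{GCD}(r_X,r_Y)$ and $(\alpha^X\alpha^Y)_{rm}=\sum_{r_Xm_X+r_Ym_Y=rm}\alpha^X_{r_Xm_X}\alpha^Y_{r_Ym_Y}$, the sum being over $(m_X,m_Y)\in\mathbb{N}^2$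 ($\mathbb{N}\ni0$); the asymptotically Mittag-Leffler property of the product refers to this expansion. *)

theory Defs
  imports
    "HOL-Analysis.Analysis"
    "HOL-Library.Poly_Mapping"
    "HOL-Algebra.QuotRing"
    "HOL-Algebra.Module"
    "HOL-Homology.Homology"
begin

section \<open>Smooth manifolds\<close>

text \<open>
  The model space is \<open>Euclidean_space n\<close>, the set of \<open>x :: nat \<Rightarrow> real\<close> supported on
  \<open>{..<n}\<close>.  As this is not a normed space, differentiability of class \<open>C\<^sup>k\<close> on an open set is
  expressed by existence and continuity of all iterated partial derivatives of order at most \<open>k\<close>.
\<close>

primrec Ck_on :: "nat \<Rightarrow> nat \<Rightarrow> (nat \<Rightarrow> real) set \<Rightarrow> ((nat \<Rightarrow> real) \<Rightarrow> real) \<Rightarrow> bool" where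
  "Ck_on 0 n U f \<longleftrightarrow> continuous_map (subtopology (Euclidean_space n) U) euclideanreal f"
| "Ck_on (Suc k) n U f \<longleftrightarrow>
     continuous_map (subtopology (Euclidean_space n) U) euclideanreal f \<and>
     (\<exists>g. \<forall>i<n. (\<forall>x\<in>U. ((\<lambda>t. f (x(i := t))) has_real_derivative g i x) (at (x i))) \<and>
                 Ck_on k n U (g i))"

definition smooth_map_on :: "nat \<Rightarrow> (nat \<Rightarrow> real) set \<Rightarrow> ((nat \<Rightarrow> real) \<Rightarrow> nat \<Rightarrow> real) \<Rightarrow> bool" where
  "smooth_map_on n U f \<longleftrightarrow> (\<forall>k. \<forall>j<n. Ck_on k n U (\<lambda>x. f x j))"

definition smooth_atlas ::
    "nat \<Rightarrow> 'a topology \<Rightarrow> ('a set \<times> ('a \<Rightarrow> nat \<Rightarrow> real)) set \<Rightarrow> bool" where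
  "smooth_atlas n X \<A> \<longleftrightarrow>
     (\<forall>(U, \<phi>)\<in>\<A>. openin X U \<and>
        (\<exists>V. openin (Euclidean_space n) V \<and>
             homeomorphic_map (subtopology X U) (subtopology (Euclidean_space n) V) \<phi>)) \<and>
     \<Union>(fst ` \<A>) = topspace X \<and>
     (\<forall>(U, \<phi>)\<in>\<A>. \<forall>(V, \<psi>)\<in>\<A>. smooth_map_on n (\<phi> ` (U \<inter> V)) (\<psi> \<circ> inv_into U \<phi>))"

definition smooth_manifold ::
    "nat \<Rightarrow> 'a topology \<Rightarrow> ('a set \<times> ('a \<Rightarrow> nat \<Rightarrow> real)) set \<Rightarrow> bool" where
  "smooth_manifold n X \<A> \<longleftrightarrow> Hausdorff_space X \<and> second_countable X \<and> smooth_atlas n X \<A>"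


section \<open>Graded complex algebras and quotients\<close>

text \<open>
  The grading is recorded by the projections: \<open>hcomp R k x\<close> is the homogeneous component of
  degree \<open>k\<close> of \<open>x\<close>.
\<close>

record 'b graded_algebra = "(complex, 'b) module" +
  hcomp :: "nat \<Rightarrow> 'b \<Rightarrow> 'b"

text \<open>
  This is \<open>R Quot I\<close>, together with the scalar multiplication and the grading induced on cosets.
\<close>

definition graded_quot :: "'b graded_algebra \<Rightarrow> 'b set \<Rightarrow> 'b set graded_algebra" where
  "graded_quot R I =
     \<lparr> carrier = a_rcosets\<^bsub>R\<^esub> I,
       mult = rcoset_mult R I,
       one = I +>\<^bsub>R\<^esub> \<one>\<^bsub>R\<^esub>,
       ring.zero = I,
       add = set_add R,
       smult = (\<lambda>z S. I <+>\<^bsub>R\<^esub> ((\<lambda>x. z \<odot>\<^bsub>R\<^esub> x) ` S)),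
       hcomp = (\<lambda>k S. I <+>\<^bsub>R\<^esub> (hcomp R k ` S)) \<rparr>"

definition finite_dimensional :: "'b graded_algebra \<Rightarrow> bool" where
  "finite_dimensional R \<longleftrightarrow>
     (\<exists>B. finite B \<and> B \<subseteq> carrier R \<and>
          (\<forall>x\<in>carrier R. \<exists>c. x = (\<Oplus>\<^bsub>R\<^esub>b\<in>B. c b \<odot>\<^bsub>R\<^esub> b)))"

definition even_class :: "'b graded_algebra \<Rightarrow> 'b \<Rightarrow> bool" where
  "even_class R x \<longleftrightarrow> x \<in> carrier R \<and> (\<forall>k. odd k \<longrightarrow> hcomp R k x = \<zero>\<^bsub>R\<^esub>)"


section \<open>The singular cohomology algebra with complex coefficients\<close>

text \<open>
  An element of \<open>Hom(C\<^sub>k(X), \<complex>)\<close> is a complex function on singular \<open>k\<close>-simplices, extended by \<open>0\<close>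
  to arguments that are not singular \<open>k\<close>-simplices of \<open>X\<close>.  A (total) cochain is a finite sum of
  such elements over all degrees.
\<close>

type_synonym 'a cochain = "nat \<Rightarrow> ((nat \<Rightarrow> real) \<Rightarrow> 'a) \<Rightarrow> complex"

definition cochains :: "'a topology \<Rightarrow> 'a cochain set" where
  "cochains X =
     {c. (\<forall>k \<sigma>. \<not> singular_simplex k X \<sigma> \<longrightarrow> c k \<sigma> = 0) \<and> finite {k. \<exists>\<sigma>. c k \<sigma> \<noteq> 0}}"

definition coboundary :: "'a topology \<Rightarrow> 'a cochain \<Rightarrow> 'a cochain" where
  "coboundary X c =
     (\<lambda>k \<sigma>. if 0 < k \<and> singular_simplex k X \<sigma>
            then \<Sum>i\<le>k. (- 1) ^ i * c (k - 1) (singular_face k i \<sigma>) else 0)"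

definition cocycles :: "'a topology \<Rightarrow> 'a cochain set" where
  "cocycles X = {c \<in> cochains X. coboundary X c = (\<lambda>k \<sigma>. 0)}"

definition front_face :: "nat \<Rightarrow> ((nat \<Rightarrow> real) \<Rightarrow> 'a) \<Rightarrow> (nat \<Rightarrow> real) \<Rightarrow> 'a" where
  "front_face p \<sigma> = restrict \<sigma> (standard_simplex p)"

text \<open>The back \<open>q\<close>-face of a \<open>(p + q)\<close>-simplex, spanned by the vertices \<open>p, \<dots>, p + q\<close>.\<close>

definition back_face :: "nat \<Rightarrow> nat \<Rightarrow> ((nat \<Rightarrow> real) \<Rightarrow> 'a) \<Rightarrow> (nat \<Rightarrow> real) \<Rightarrow> 'a" where
  "back_face p q \<sigma> = restrict (\<lambda>x. \<sigma> (\<lambda>i. if i < p then 0 else x (i - p))) (standard_simplex q)"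

definition cup :: "'a topology \<Rightarrow> 'a cochain \<Rightarrow> 'a cochain \<Rightarrow> 'a cochain" where
  "cup X c d =
     (\<lambda>n \<sigma>. if singular_simplex n X \<sigma>
            then \<Sum>p\<le>n. c p (front_face p \<sigma>) * d (n - p) (back_face p (n - p) \<sigma>) else 0)"

definition cocycle_algebra :: "'a topology \<Rightarrow> 'a cochain graded_algebra" where
  "cocycle_algebra X =
     \<lparr> carrier = cocycles X,
       mult = cup X,
       one = (\<lambda>k \<sigma>. if k = 0 \<and> singular_simplex k X \<sigma> then 1 else 0),
       ring.zero = (\<lambda>k \<sigma>. 0),
       add = (\<lambda>c d k \<sigma>. c k \<sigma> + d k \<sigma>),
       smult = (\<lambda>z c k \<sigma>. z * c k \<sigma>),
       hcomp = (\<lambda>j c k \<sigma>. if k = j then c k \<sigma> else 0) \<rparr>"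

definition cohomology :: "'a topology \<Rightarrow> 'a cochain set graded_algebra" where
  "cohomology X = graded_quot (cocycle_algebra X) (coboundary X ` cochains X)"


section \<open>The tensor product of graded algebras\<close>

text \<open>
  The free complex vector space on \<open>carrier A \<times> carrier B\<close>.  The product descends to the tensor
  product, where it is \<open>(a \<otimes> b) (a' \<otimes> b') = (-1)\<^bsup>deg b deg a'\<^esup> a a' \<otimes> b b'\<close> for homogeneous
  \<open>b\<close> and \<open>a'\<close>; before passing to the quotient it is in general not associative.
\<close>

definition free_tensor ::
    "'a graded_algebra \<Rightarrow> 'b graded_algebra \<Rightarrow> ('a \<times> 'b \<Rightarrow>\<^sub>0 complex) graded_algebra" where
  "free_tensor A B =
     \<lparr> carrier = {F. Poly_Mapping.keys F \<subseteq> carrier A \<times> carrier B},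
       mult = (\<lambda>F G.
         \<Sum>(a, b)\<in>Poly_Mapping.keys F. \<Sum>(a', b')\<in>Poly_Mapping.keys G.
           \<Sum>p\<in>{p. hcomp A p a' \<noteq> \<zero>\<^bsub>A\<^esub>}. \<Sum>q\<in>{q. hcomp B q b \<noteq> \<zero>\<^bsub>B\<^esub>}.
             Poly_Mapping.single (a \<otimes>\<^bsub>A\<^esub> hcomp A p a', hcomp B q b \<otimes>\<^bsub>B\<^esub> b')
               ((- 1) ^ (p * q) * Poly_Mapping.lookup F (a, b) * Poly_Mapping.lookup G (a', b'))),
       one = Poly_Mapping.single (\<one>\<^bsub>A\<^esub>, \<one>\<^bsub>B\<^esub>) 1,
       ring.zero = 0,
       add = (+),
       smult = (\<lambda>z. Poly_Mapping.map ((*) z)),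
       hcomp = (\<lambda>n F.
         \<Sum>(a, b)\<in>Poly_Mapping.keys F. \<Sum>p\<le>n.
           Poly_Mapping.single (hcomp A p a, hcomp B (n - p) b) (Poly_Mapping.lookup F (a, b))) \<rparr>"

inductive_set bilinear_relations ::
    "'a graded_algebra \<Rightarrow> 'b graded_algebra \<Rightarrow> ('a \<times> 'b \<Rightarrow>\<^sub>0 complex) set"
  for A :: "'a graded_algebra" and B :: "'b graded_algebra" where
  zero_rel: "0 \<in> bilinear_relations A B"
| lincomb: "F \<in> bilinear_relations A B \<Longrightarrow> G \<in> bilinear_relations A B \<Longrightarrow>
    Poly_Mapping.map ((*) z) F + G \<in> bilinear_relations A B"
| add_left: "a \<in> carrier A \<Longrightarrow> a' \<in> carrier A \<Longrightarrow> b \<in> carrier B \<Longrightarrow>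
    Poly_Mapping.single (a \<oplus>\<^bsub>A\<^esub> a', b) 1
      - Poly_Mapping.single (a, b) 1 - Poly_Mapping.single (a', b) 1 \<in> bilinear_relations A B"
| add_right: "a \<in> carrier A \<Longrightarrow> b \<in> carrier B \<Longrightarrow> b' \<in> carrier B \<Longrightarrow>
    Poly_Mapping.single (a, b \<oplus>\<^bsub>B\<^esub> b') 1
      - Poly_Mapping.single (a, b) 1 - Poly_Mapping.single (a, b') 1 \<in> bilinear_relations A B"
| smult_left: "a \<in> carrier A \<Longrightarrow> b \<in> carrier B \<Longrightarrow>
    Poly_Mapping.single (z \<odot>\<^bsub>A\<^esub> a, b) 1 - Poly_Mapping.single (a, b) z \<in> bilinear_relations A B"
| smult_right: "a \<in> carrier A \<Longrightarrow> b \<in> carrier B \<Longrightarrow>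
    Poly_Mapping.single (a, z \<odot>\<^bsub>B\<^esub> b) 1 - Poly_Mapping.single (a, b) z \<in> bilinear_relations A B"

definition tensor_algebra ::
    "'a graded_algebra \<Rightarrow> 'b graded_algebra \<Rightarrow> ('a \<times> 'b \<Rightarrow>\<^sub>0 complex) set graded_algebra" where
  "tensor_algebra A B = graded_quot (free_tensor A B) (bilinear_relations A B)"

definition tensor ::
    "'a graded_algebra \<Rightarrow> 'b graded_algebra \<Rightarrow> 'a \<Rightarrow> 'b \<Rightarrow> ('a \<times> 'b \<Rightarrow>\<^sub>0 complex) set" where
  "tensor A B a b = bilinear_relations A B +>\<^bsub>free_tensor A B\<^esub> Poly_Mapping.single (a, b) 1"


section \<open>Functions of cohomology classes\<close>

text \<open>
  \<open>degree_zero R x\<close> is the complex number \<open>x\<^sub>0\<close> when the degree-zero part of \<open>R\<close> is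
  one-dimensional, spanned by the unit.
\<close>

definition degree_zero :: "'b graded_algebra \<Rightarrow> 'b \<Rightarrow> complex" where
  "degree_zero R x = (THE z. hcomp R 0 x = z \<odot>\<^bsub>R\<^esub> \<one>\<^bsub>R\<^esub>)"

definition positive_part :: "'b graded_algebra \<Rightarrow> 'b \<Rightarrow> 'b" where
  "positive_part R x = x \<ominus>\<^bsub>R\<^esub> hcomp R 0 x"

text \<open>
  Taylor expansion in the positive-degree part; the sum is finite because that part is nilpotent.
\<close>

definition class_fun :: "'b graded_algebra \<Rightarrow> (complex \<Rightarrow> complex) \<Rightarrow> 'b \<Rightarrow> 'b" where
  "class_fun R f x =
     (\<Oplus>\<^bsub>R\<^esub>k\<in>{k::nat. positive_part R x [^]\<^bsub>R\<^esub> k \<noteq> \<zero>\<^bsub>R\<^esub>}.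
        ((deriv ^^ k) f (degree_zero R x) / fact k) \<odot>\<^bsub>R\<^esub> (positive_part R x [^]\<^bsub>R\<^esub> k))"

definition class_powr :: "'b graded_algebra \<Rightarrow> real \<Rightarrow> 'b \<Rightarrow> 'b" where
  "class_powr R s x = class_fun R exp (complex_of_real (ln s) \<odot>\<^bsub>R\<^esub> x)"

definition nat_plus :: "'b graded_algebra \<Rightarrow> nat \<Rightarrow> 'b \<Rightarrow> 'b" where
  "nat_plus R n x = (of_nat n \<odot>\<^bsub>R\<^esub> \<one>\<^bsub>R\<^esub>) \<oplus>\<^bsub>R\<^esub> x"


section \<open>Series and the asymptotic Mittag-Leffler property\<close>

text \<open>
  Convergence in a finite-dimensional complex vector space: the difference is a linear combination
  of finitely many fixed vectors with coefficients tending to \<open>0\<close>.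
\<close>

definition tends_to :: "'b graded_algebra \<Rightarrow> (nat \<Rightarrow> 'b) \<Rightarrow> 'b \<Rightarrow> bool" where
  "tends_to R v l \<longleftrightarrow> l \<in> carrier R \<and>
     (\<exists>B c. finite B \<and> B \<subseteq> carrier R \<and> (\<forall>b\<in>B. c b \<longlonglongrightarrow> (0::complex)) \<and>
        (\<forall>m. v m = l \<oplus>\<^bsub>R\<^esub> (\<Oplus>\<^bsub>R\<^esub>b\<in>B. c b m \<odot>\<^bsub>R\<^esub> b)))"

text \<open>
  The coefficients \<open>\<alpha>\<^sub>r\<^sub>m\<close> are given by \<open>a :: nat \<Rightarrow> 'b\<close>, of which only the values at
  multiples of \<open>r\<close> are used.
\<close>

definition has_series_expansion ::
    "'b graded_algebra \<Rightarrow> (real \<Rightarrow> 'b) \<Rightarrow> nat \<Rightarrow> (nat \<Rightarrow> 'b) \<Rightarrow> 'b \<Rightarrow> bool" where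
  "has_series_expansion R \<alpha> r a \<beta> \<longleftrightarrow>
     (\<forall>t>0. tends_to R
        (\<lambda>N. \<Oplus>\<^bsub>R\<^esub>m\<in>{..<N}. a (r * m) \<otimes>\<^bsub>R\<^esub> class_powr R t (nat_plus R (r * m) \<beta>)) (\<alpha> t))"

definition asymptotically_Mittag_Leffler ::
    "'b graded_algebra \<Rightarrow> nat \<Rightarrow> (nat \<Rightarrow> 'b) \<Rightarrow> 'b \<Rightarrow> real \<Rightarrow> 'b \<Rightarrow> bool" where
  "asymptotically_Mittag_Leffler R r a \<beta> T A \<longleftrightarrow>
     (\<exists>e. tends_to R e \<zero>\<^bsub>R\<^esub> \<and>
        (\<forall>\<^sub>F m in sequentially.
           a (r * m) =
             (class_powr R T (nat_plus R (r * m) \<beta>) \<otimes>\<^bsub>R\<^esub>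
              class_fun R rGamma (nat_plus R 1 (nat_plus R (r * m) \<beta>))) \<otimes>\<^bsub>R\<^esub> (A \<oplus>\<^bsub>R\<^esub> e m)))"

definition product_coeff ::
    "'a graded_algebra \<Rightarrow> 'b graded_algebra \<Rightarrow> nat \<Rightarrow> nat \<Rightarrow> (nat \<Rightarrow> 'a) \<Rightarrow> (nat \<Rightarrow> 'b) \<Rightarrow>
     nat \<Rightarrow> ('a \<times> 'b \<Rightarrow>\<^sub>0 complex) set" where
  "product_coeff A B r\<^sub>1 r\<^sub>2 a b n =
     (\<Oplus>\<^bsub>tensor_algebra A B\<^esub>ij\<in>{(i, j). r\<^sub>1 * i + r\<^sub>2 * j = n}.
        tensor A B (a (r\<^sub>1 * fst ij)) (b (r\<^sub>2 * snd ij)))"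

text \<open>The class \<open>\<beta>\<^sub>1 + \<beta>\<^sub>2\<close>, i.e. \<open>\<beta>\<^sub>1 \<otimes> 1 + 1 \<otimes> \<beta>\<^sub>2\<close>.\<close>

definition tensor_sum ::
    "'a graded_algebra \<Rightarrow> 'b graded_algebra \<Rightarrow> 'a \<Rightarrow> 'b \<Rightarrow> ('a \<times> 'b \<Rightarrow>\<^sub>0 complex) set" where
  "tensor_sum A B \<beta>\<^sub>1 \<beta>\<^sub>2 =
     tensor A B \<beta>\<^sub>1 \<one>\<^bsub>B\<^esub> \<oplus>\<^bsub>tensor_algebra A B\<^esub> tensor A B \<one>\<^bsub>A\<^esub> \<beta>\<^sub>2"

end

theory Submission
  imports Defs "HOL-Complex_Analysis.Complex_Analysis" "HOL-Probability.Probability" "HOL-Real_Asymp.Real_Asymp"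
begin

text \<open>
  Let \<open>k! k\<^sup>x / \<Gamma>(1 + k + x)\<close> be called the Gamma quotient.  It tends to \<open>1\<close> as \<open>k \<rightarrow> \<infinity>\<close>, together with all of its
  derivatives in \<open>x\<close> (\<open>tendsto_fps_gamma_ratio\<close>).  A series with coefficients \<open>\<alpha>\<^sub>k\<close>, \<open>k = r m\<close>, is therefore
  \<open>(T, A)\<close>-scaled asymptotically Mittag-Leffler if and only if its normalised coefficients satisfy
  \<open>(k! / T\<^sup>k) \<alpha>\<^sub>k = (T / k)\<^sup>\<beta> (A + o(1))\<close>.

  For the product put \<open>T = T\<^sub>X + T\<^sub>Y\<close> and \<open>p = T\<^sub>X / T\<close>.  If \<open>k + l = n\<close>, then \<open>n! / T\<^sup>n\<close> is the product of
  \<open>k! / T\<^sub>X\<^sup>k\<close>, \<open>l! / T\<^sub>Y\<^sup>l\<close> and the binomial weight \<open>(n choose k) p\<^sup>k (1 - p)\<^sup>l\<close>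
  (\<open>binomial_weight_factorials\<close>).  Hence the \<open>n\<close>-th coefficient of the product, multiplied by
  \<open>(n! / T\<^sup>n) (n / T)\<^sup>\<beta>\<close> with \<open>\<beta> = \<beta>\<^sub>X + \<beta>\<^sub>Y\<close>, is a weighted sum over the lattice points \<open>(i, j)\<close> with
  \<open>r\<^sub>X i + r\<^sub>Y j = n\<close>; its terms are the tensors of \<open>(n / T)\<close> to the power \<open>\<beta>\<^sub>X\<close>, times the normalised coefficient of
  degree \<open>k = r\<^sub>X i\<close>, with the same expression for \<open>Y\<close> (\<open>product_coeff_as_average\<close>).  The exponents can be
  distributed to the two factors since classes of even degree cause no signs.

  By Hoeffding's inequality the weights concentrate at \<open>k / n = p\<close>, that is where \<open>k / T\<^sub>X\<close>, \<open>l / T\<^sub>Y\<close> and \<open>n / T\<close>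
  have quotients close to \<open>1\<close>, and there the two factors tend to \<open>A\<^sub>X\<close> and \<open>A\<^sub>Y\<close>
  (\<open>normalised_coefficients_tame\<close>).  Elsewhere the factors grow at most polynomially, against
  exponentially small weights (\<open>tendsto_lattice_average_null\<close>).  It remains to find the limit of the total
  weight of the lattice points.  Detecting divisibility by roots of unity, it is the mean, over all \<open>\<zeta>\<close>
  and \<open>\<eta>\<close> with \<open>\<zeta>\<^sup>r = 1\<close> for \<open>r = r\<^sub>X\<close> and \<open>\<eta>\<^sup>s = 1\<close> for \<open>s = r\<^sub>Y\<close>, of \<open>(p \<zeta> + (1 - p) \<eta>)\<^sup>n\<close>.  This power tends to
  \<open>0\<close> unless \<open>\<zeta> = \<eta>\<close>; the equality holds for \<open>gcd r s\<close> of the \<open>r s\<close> pairs, and then the power is \<open>1\<close> because \<open>n\<close> is a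
  multiple of the gcd (\<open>tendsto_sum_binomial_weight_lattice\<close>).  Division by the Gamma quotient of the total
  degree gives the asserted form of the coefficients (\<open>product_asymptotically_mittag_leffler\<close>).

  Polynomial growth of the normalised coefficients also makes the series converge absolutely, being
  dominated by an exponential series, so that the series of the product is a rearrangement of the double
  series (\<open>product_series_expansion\<close>).

  All of this is analysis of scalars.  The passage from classes to scalars uses only that the cohomology of a
  connected manifold with finite-dimensional cohomology is an associative graded algebra whose degree-zero
  part is spanned by the unit (\<open>connected_graded_algebra_cohomology\<close>).  Positive-degree parts are then nilpotent, and a function
  of an exponent is the value of its Taylor series at such a nilpotent element; limits of classes are limits
  of the coefficients with respect to finitely many fixed classes.
\<close>

section \<open>Complex algebras\<close>

locale complex_algebra = ring R for R :: "'b graded_algebra" (structure) +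
  assumes smult_closed [simp, intro]: "x \<in> carrier R \<Longrightarrow> z \<odot> x \<in> carrier R"
    and smult_l_distr: "x \<in> carrier R \<Longrightarrow> (z + w) \<odot> x = z \<odot> x \<oplus> w \<odot> x"
    and smult_r_distr: "x \<in> carrier R \<Longrightarrow> y \<in> carrier R \<Longrightarrow> z \<odot> (x \<oplus> y) = z \<odot> x \<oplus> z \<odot> y"
    and smult_smult: "x \<in> carrier R \<Longrightarrow> z \<odot> (w \<odot> x) = (z * w) \<odot> x"
    and smult_one [simp]: "x \<in> carrier R \<Longrightarrow> 1 \<odot> x = x"
    and smult_mult_left: "x \<in> carrier R \<Longrightarrow> y \<in> carrier R \<Longrightarrow> (z \<odot> x) \<otimes> y = z \<odot> (x \<otimes> y)"
    and smult_mult_right: "x \<in> carrier R \<Longrightarrow> y \<in> carrier R \<Longrightarrow> x \<otimes> (z \<odot> y) = z \<odot> (x \<otimes> y)"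
begin

lemma smult_zero_left [simp]: "x \<in> carrier R \<Longrightarrow> 0 \<odot> x = \<zero>"
  using smult_l_distr[of x 0 0] add.r_cancel_one'[of "0 \<odot> x" "0 \<odot> x"] by simp

lemma smult_zero_right [simp]: "z \<odot> \<zero> = \<zero>"
  using smult_r_distr[of \<zero> \<zero> z] add.r_cancel_one'[of "z \<odot> \<zero>" "z \<odot> \<zero>"] by simp

lemma smult_minus_one: "x \<in> carrier R \<Longrightarrow> (- 1) \<odot> x = \<ominus> x"
  using smult_l_distr[of x "- 1" 1] add.inv_equality[of "(- 1) \<odot> x" x] by (simp add: a_inv_def)

lemma finsum_smult_right:
  "f \<in> A \<rightarrow> carrier R \<Longrightarrow> z \<odot> finsum R f A = (\<Oplus>i\<in>A. z \<odot> f i)"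
proof (induction A rule: infinite_finite_induct)
  case (insert a A)
  then have "f \<in> A \<rightarrow> carrier R" "f a \<in> carrier R" "(\<lambda>i. z \<odot> f i) \<in> A \<rightarrow> carrier R" by auto
  with insert show ?case by (simp add: smult_r_distr)
qed auto

lemma finsum_smult_left:
  "x \<in> carrier R \<Longrightarrow> sum c A \<odot> x = (\<Oplus>i\<in>A. c i \<odot> x)"
proof (induction A rule: infinite_finite_induct)
  case (insert a A)
  then have "(\<lambda>i. c i \<odot> x) \<in> A \<rightarrow> carrier R" by auto
  with insert show ?case by (simp add: smult_l_distr)
qed auto


subsection \<open>Families with coefficients in a function space\<close>

text \<open>
  \<open>span_families S\<close> consists of the families of elements of the algebra whose coefficients with respect
  to finitely many fixed vectors can be chosen in the set \<open>S\<close> of scalar families.  Estimates for classes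
  are reduced in this way to estimates for complex numbers, without the choice of a norm or a basis.
\<close>

inductive_set span_families :: "('i \<Rightarrow> complex) set \<Rightarrow> ('i \<Rightarrow> 'b) set" for S where
  zero: "(\<lambda>i. \<zero>) \<in> span_families S"
| single: "c \<in> S \<Longrightarrow> v \<in> carrier R \<Longrightarrow> (\<lambda>i. c i \<odot> v) \<in> span_families S"
| add: "x \<in> span_families S \<Longrightarrow> y \<in> span_families S \<Longrightarrow> (\<lambda>i. x i \<oplus> y i) \<in> span_families S"

lemma span_families_closed: "x \<in> span_families S \<Longrightarrow> x i \<in> carrier R"
  by (induction arbitrary: i rule: span_families.induct) auto

lemma span_families_mono:
  assumes "x \<in> span_families S" "S \<subseteq> S'" shows "x \<in> span_families S'"
  using assms(1) by induction (use assms(2) in \<open>auto intro: span_families.intros\<close>)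

lemma span_families_smult:
  assumes "x \<in> span_families S" "\<And>f. f \<in> S \<Longrightarrow> (\<lambda>i. c i * f i) \<in> S'"
  shows "(\<lambda>i. c i \<odot> x i) \<in> span_families S'"
  using assms(1)
proof induction
  case (add x y)
  then show ?case
    using span_families.add[of "\<lambda>i. c i \<odot> x i" S' "\<lambda>i. c i \<odot> y i"]
    by (simp add: smult_r_distr span_families_closed)
next
  case (single d v)
  then show ?case using span_families.single[OF assms(2)[OF single(1)] single(2)]
    by (simp add: smult_smult)
qed (auto intro: span_families.zero)

lemma span_families_minus:
  assumes "x \<in> span_families S" "y \<in> span_families S" "\<And>f. f \<in> S \<Longrightarrow> (\<lambda>i. - f i) \<in> S"
  shows "(\<lambda>i. x i \<ominus> y i) \<in> span_families S"
proof -
  have "(\<lambda>i. (- 1) \<odot> y i) \<in> span_families S"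
    by (rule span_families_smult[OF assms(2)]) (use assms(3) in simp)
  from span_families.add[OF assms(1) this] show ?thesis
    by (simp add: smult_minus_one span_families_closed[OF assms(2)] a_minus_def)
qed

lemma span_families_reindex:
  assumes "x \<in> span_families S" "\<And>f. f \<in> S \<Longrightarrow> (\<lambda>i. f (g i)) \<in> S'"
  shows "(\<lambda>i. x (g i)) \<in> span_families S'"
  using assms(1)
proof induction
  case (single d v) then show ?case using span_families.single[OF assms(2)] by auto
qed (auto intro: span_families.zero span_families.add)

lemma span_families_finsum:
  assumes "\<And>j. j \<in> J \<Longrightarrow> x j \<in> span_families S"
  shows "(\<lambda>i. \<Oplus>j\<in>J. x j i) \<in> span_families S"
  using assms
proof (induction J rule: infinite_finite_induct)
  case (insert a J)
  have "(\<lambda>j. x j i) \<in> J \<rightarrow> carrier R" for i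
    using insert.prems by (auto intro!: span_families_closed[of _ S])
  with insert show ?case
    using span_families.add[of "x a" S "\<lambda>i. \<Oplus>j\<in>J. x j i"]
    by (simp add: span_families_closed[of "x a" S])
qed (auto intro: span_families.zero)

lemma span_families_mult:
  assumes "x \<in> span_families S" "y \<in> span_families S'"
    "\<And>f g. f \<in> S \<Longrightarrow> g \<in> S' \<Longrightarrow> (\<lambda>i. f i * g i) \<in> S''"
  shows "(\<lambda>i. x i \<otimes> y i) \<in> span_families S''"
  using assms(1)
proof induction
  case zero
  then show ?case using assms(2) by (auto simp: span_families_closed intro: span_families.zero)
next
  case (add x1 x2)
  then show ?case using span_families.add[OF add.IH] by (simp add: l_distr span_families_closed[OF assms(2)] span_families_closed)
next
  case (single c v)
  from assms(2) show ?case
  proof induction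
    case zero
    then show ?case using single by (auto intro: span_families.zero)
  next
    case (add x1 x2)
    then show ?case using span_families.add[OF add.IH] by (simp add: r_distr span_families_closed single)
  next
    case (single d w)
    then show ?case using \<open>c \<in> S\<close> \<open>v \<in> carrier R\<close> span_families.single[OF assms(3)[OF \<open>c \<in> S\<close> single(1)], of "v \<otimes> w"]
      by (simp add: smult_mult_left smult_mult_right smult_smult mult.commute)
  qed
qed

text \<open>Weighted sums over finite fibres act on such families through their coefficients.\<close>

lemma span_families_weighted_sum:
  assumes "x \<in> span_families S" "\<And>f. f \<in> S \<Longrightarrow> (\<lambda>m. \<Sum>d\<in>D m. w m d * f d) \<in> S'"
  shows "(\<lambda>m. \<Oplus>d\<in>D m. w m d \<odot> x d) \<in> span_families S'"
  using assms(1)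
proof induction
  case (add x y)
  have "(\<Oplus>d\<in>D m. w m d \<odot> (x d \<oplus> y d)) = (\<Oplus>d\<in>D m. w m d \<odot> x d) \<oplus> (\<Oplus>d\<in>D m. w m d \<odot> y d)" for m
    by (subst finsum_addf[symmetric]) (use add in \<open>auto simp: smult_r_distr span_families_closed intro!: finsum_cong'\<close>)
  then show ?case using span_families.add[OF add.IH] by simp
next
  case (single c v)
  have "(\<Oplus>d\<in>D m. w m d \<odot> (c d \<odot> v)) = (\<Sum>d\<in>D m. w m d * c d) \<odot> v" for m
    using single by (simp add: finsum_smult_left smult_smult)
  then show ?case using span_families.single[OF assms(2)[OF single(1)] single(2)] by simp
qed (auto intro: span_families.zero)

text \<open>
  Finitely many members can be changed at will: the correction is a finite sum of families supported at
  one index.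
\<close>

lemma span_families_finite_support:
  fixes x :: "nat \<Rightarrow> 'b"
  assumes "\<And>m. m \<ge> M \<Longrightarrow> x m = y m" "y \<in> span_families S" "\<And>m. x m \<in> carrier R"
    "\<And>m. (\<lambda>i. if i = m then 1 else 0) \<in> S"
  shows "x \<in> span_families S"
proof -
  have "(\<lambda>i. \<Oplus>m\<in>{..<M}. (if i = m then 1 else 0) \<odot> (x m \<ominus> y m)) \<in> span_families S"
    using assms by (intro span_families_finsum span_families.single) (auto simp: span_families_closed)
  then have 1: "(\<lambda>i. y i \<oplus> (\<Oplus>m\<in>{..<M}. (if i = m then 1 else 0) \<odot> (x m \<ominus> y m))) \<in> span_families S"
    using assms(2) by (rule span_families.add[rotated])
  have yc: "y i \<in> carrier R" for i by (rule span_families_closed[OF assms(2)])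
  have "(\<Oplus>m\<in>{..<M}. (if i = m then 1 else 0) \<odot> (x m \<ominus> y m)) = x i \<ominus> y i" for i
  proof (cases "i < M")
    case True
    have "(\<Oplus>m\<in>{..<M}. (if i = m then 1 else 0) \<odot> (x m \<ominus> y m)) = (\<Oplus>m\<in>{..<M}. if i = m then x m \<ominus> y m else \<zero>)"
      by (rule finsum_cong') (use yc assms(3) in auto)
    also have "\<dots> = x i \<ominus> y i"
      by (rule finsum_singleton) (use True yc assms(3) in auto)
    finally show ?thesis .
  next
    case False
    have "(\<Oplus>m\<in>{..<M}. (if i = m then 1 else 0) \<odot> (x m \<ominus> y m)) = (\<Oplus>m\<in>{..<M}. \<zero>)"
      by (rule finsum_cong') (use yc assms(3) False in auto)
    then show ?thesis using False assms(1)[of i] yc by (simp add: r_neg a_minus_def)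
  qed
  then have "y i \<oplus> (\<Oplus>m\<in>{..<M}. (if i = m then 1 else 0) \<odot> (x m \<ominus> y m)) = x i" for i
    using yc[of i] assms(3)[of i] by (simp add: a_minus_def a_lcomm r_neg)
  with 1 show ?thesis by simp
qed

text \<open>
  Null families are exactly the perturbations in the definition of convergence; the two directions of this
  correspondence translate limits of classes into membership in a span.  Vectors that occur in both
  summands have to be merged, as the definition asks for one coefficient per vector.
\<close>

lemma tends_to_if_span_families:
  assumes "x \<in> span_families {c. c \<longlonglongrightarrow> 0}" "l \<in> carrier R"
  shows "tends_to R (\<lambda>m. l \<oplus> x m) l"
proof -
  have "\<exists>B c. finite B \<and> B \<subseteq> carrier R \<and> (\<forall>b\<in>B. c b \<longlonglongrightarrow> 0) \<and> (\<forall>m. x m = (\<Oplus>b\<in>B. c b m \<odot> b))"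
    using assms(1)
  proof induction
    case zero
    show ?case by (rule exI[of _ "{}"]) auto
  next
    case (single c v)
    then show ?case by (intro exI[of _ "{v}"] exI[of _ "\<lambda>b. c"]) auto
  next
    case (add x y)
    then obtain B c B' c' where B: "finite B" "B \<subseteq> carrier R" "\<forall>b\<in>B. c b \<longlonglongrightarrow> 0" "\<And>m. x m = (\<Oplus>b\<in>B. c b m \<odot> b)"
      and B': "finite B'" "B' \<subseteq> carrier R" "\<forall>b\<in>B'. c' b \<longlonglongrightarrow> 0" "\<And>m. y m = (\<Oplus>b\<in>B'. c' b m \<odot> b)"
      by blast
    define d where "d b m = (if b \<in> B then c b m else 0)" for b m
    define d' where "d' b m = (if b \<in> B' then c' b m else 0)" for b m
    have "x m = (\<Oplus>b\<in>B \<union> B'. d b m \<odot> b)" for m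
      unfolding B(4) by (rule add.finprod_mono_neutral_cong_left) (use B B' in \<open>auto simp: d_def\<close>)
    moreover have "y m = (\<Oplus>b\<in>B \<union> B'. d' b m \<odot> b)" for m
      unfolding B'(4) by (rule add.finprod_mono_neutral_cong_left) (use B B' in \<open>auto simp: d'_def\<close>)
    ultimately have "x m \<oplus> y m = (\<Oplus>b\<in>B \<union> B'. (d b m + d' b m) \<odot> b)" for m
      apply (simp only:)
      apply (subst finsum_addf[symmetric])
      using B(2) B'(2) by (auto simp: smult_l_distr intro!: finsum_cong')
    moreover have "\<forall>b\<in>B \<union> B'. (\<lambda>m. d b m + d' b m) \<longlonglongrightarrow> 0"
    proof (intro ballI tendsto_add_zero)
      fix b show "d b \<longlonglongrightarrow> 0" "d' b \<longlonglongrightarrow> 0"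
        using B(3) B'(3) by (cases "b \<in> B"; cases "b \<in> B'"; simp add: d_def[abs_def] d'_def[abs_def])+
    qed
    ultimately show ?case using B B'
      by (intro exI[of _ "B \<union> B'"] exI[of _ "\<lambda>b m. d b m + d' b m"]) auto
  qed
  then obtain B c where "finite B" "B \<subseteq> carrier R" "\<forall>b\<in>B. c b \<longlonglongrightarrow> 0" "\<And>m. x m = (\<Oplus>b\<in>B. c b m \<odot> b)"
    by blast
  then show ?thesis unfolding tends_to_def using assms(2)
    by (intro conjI exI[of _ B] exI[of _ c]) auto
qed

lemma tends_toD:
  assumes "tends_to R v l"
  shows "l \<in> carrier R" "\<exists>x\<in>span_families {c. c \<longlonglongrightarrow> 0}. v = (\<lambda>m. l \<oplus> x m)"
proof -
  from assms obtain B c where B: "finite B" "B \<subseteq> carrier R" "\<forall>b\<in>B. c b \<longlonglongrightarrow> 0"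
     and v: "\<And>m. v m = l \<oplus> (\<Oplus>b\<in>B. c b m \<odot> b)" and l: "l \<in> carrier R"
    unfolding tends_to_def by blast
  show "l \<in> carrier R" by fact
  have "(\<lambda>m. \<Oplus>b\<in>B. c b m \<odot> b) \<in> span_families {c. c \<longlonglongrightarrow> 0}"
    by (intro span_families_finsum span_families.single) (use B in auto)
  with v show "\<exists>x\<in>span_families {c. c \<longlonglongrightarrow> 0}. v = (\<lambda>m. l \<oplus> x m)" by (intro bexI) auto
qed


subsection \<open>Power series in a nilpotent element\<close>

text \<open>The index set is that of \<open>class_fun\<close>, so that functions of classes are values of this evaluation.\<close>

definition fps_eval :: "'b \<Rightarrow> complex fps \<Rightarrow> 'b" where
  "fps_eval P F = (\<Oplus>k\<in>{k::nat. P [^] k \<noteq> \<zero>}. fps_nth F k \<odot> (P [^] k))"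

lemma class_fun_eq_fps_eval:
  "class_fun R f x = fps_eval (positive_part R x) (fps_expansion f (degree_zero R x))"
  by (simp add: class_fun_def fps_eval_def fps_expansion_def)

context
  fixes P :: 'b and N :: nat
  assumes P: "P \<in> carrier R" and nilpotent: "P [^] N = \<zero>"
begin

lemma power_commutes: "P \<otimes> P [^] k = P [^] (k::nat) \<otimes> P"
  using P by (induction k) (auto simp: m_assoc[symmetric])

lemma power_zero_beyond: "k \<ge> N \<Longrightarrow> P [^] k = \<zero>"
  using nat_pow_mult[OF P, of N "k - N"] nilpotent P by simp

lemma finite_nonzero_powers: "finite {k::nat. P [^] k \<noteq> \<zero>}"
  by (rule finite_subset[of _ "{..<N}"]) (use power_zero_beyond in \<open>auto simp: not_le[symmetric]\<close>)

lemma fps_eval_truncate: "fps_eval P F = (\<Oplus>k\<in>{..<N}. fps_nth F k \<odot> (P [^] k))"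
  unfolding fps_eval_def
  by (rule add.finprod_mono_neutral_cong_left) (use P power_zero_beyond in \<open>auto simp: not_le[symmetric]\<close>)

lemma fps_eval_closed [simp]: "fps_eval P F \<in> carrier R"
  unfolding fps_eval_truncate using P by auto

lemma fps_eval_add: "fps_eval P (F + G) = fps_eval P F \<oplus> fps_eval P G"
  unfolding fps_eval_truncate using P
  by (subst finsum_addf[symmetric]) (auto simp: smult_l_distr intro!: finsum_cong')

lemma fps_eval_const_mult: "fps_eval P (fps_const c * F) = c \<odot> fps_eval P F"
  unfolding fps_eval_truncate using P
  by (subst finsum_smult_right) (auto simp: smult_smult intro!: finsum_cong')

lemma fps_eval_0 [simp]: "fps_eval P 0 = \<zero>"
  using fps_eval_const_mult[of 0 0] by simp

lemma fps_eval_sum: "fps_eval P (sum F A) = (\<Oplus>i\<in>A. fps_eval P (F i))"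
  by (induction A rule: infinite_finite_induct) (auto simp: fps_eval_add)

lemma fps_eval_cong: "(\<And>k. k < N \<Longrightarrow> fps_nth F k = fps_nth G k) \<Longrightarrow> fps_eval P F = fps_eval P G"
  unfolding fps_eval_truncate using P by (intro finsum_cong') auto

lemma fps_eval_X_mult: "fps_eval P (fps_X * F) = P \<otimes> fps_eval P F"
proof -
  have "fps_eval P F = (\<Oplus>k\<in>{..<N}. fps_nth F k \<odot> (P [^] k))" by (rule fps_eval_truncate)
  then have "P \<otimes> fps_eval P F = (\<Oplus>k\<in>{..<N}. P \<otimes> (fps_nth F k \<odot> (P [^] k)))"
    using P by (auto intro!: finsum_rdistr)
  also have "\<dots> = (\<Oplus>k\<in>{..<N}. fps_nth F k \<odot> (P [^] Suc k))"
    using P by (intro finsum_cong') (auto simp: smult_mult_right power_commutes)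
  also have "\<dots> = (\<Oplus>k\<in>Suc ` {..<N}. fps_nth (fps_X * F) k \<odot> (P [^] k))"
    using P by (subst finsum_reindex) (auto intro!: finsum_cong')
  also have "\<dots> = fps_eval P (fps_X * F)"
    unfolding fps_eval_def
  proof (rule add.finprod_mono_neutral_cong[symmetric])
    fix k assume k: "k \<in> {k. P [^] k \<noteq> \<zero>} - Suc ` {..<N}"
    then have "k < N" using power_zero_beyond by (auto simp: not_le[symmetric])
    then have "k = 0" using k by (cases k) auto
    then show "fps_nth (fps_X * F) k \<odot> P [^] k = \<zero>" by simp
  qed (use P finite_nonzero_powers in auto)
  finally show ?thesis by simp
qed

lemma fps_eval_X_power_mult: "fps_eval P (fps_X ^ i * F) = P [^] i \<otimes> fps_eval P F"
proof (induction i)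
  case (Suc i)
  have "fps_eval P (fps_X ^ Suc i * F) = P \<otimes> (P [^] i \<otimes> fps_eval P F)"
    by (simp add: mult.assoc fps_eval_X_mult Suc)
  also have "\<dots> = (P \<otimes> P [^] i) \<otimes> fps_eval P F" using P by (simp add: m_assoc)
  finally show ?case using P by (simp add: power_commutes)
qed (use P in simp)

text \<open>
  Evaluation is additive, homogeneous and compatible with multiplication by \<open>X\<close>, hence multiplicative on
  truncated series.
\<close>

lemma fps_eval_mult: "fps_eval P (F * G) = fps_eval P F \<otimes> fps_eval P G"
proof -
  have "fps_eval P F = (\<Oplus>k\<in>{..<N}. fps_nth F k \<odot> (P [^] k))" by (rule fps_eval_truncate)
  then have "fps_eval P F \<otimes> fps_eval P G = (\<Oplus>k\<in>{..<N}. (fps_nth F k \<odot> (P [^] k)) \<otimes> fps_eval P G)"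
    using P by (auto intro!: finsum_ldistr)
  also have "\<dots> = (\<Oplus>k\<in>{..<N}. fps_eval P (fps_const (fps_nth F k) * (fps_X ^ k * G)))"
    using P by (intro finsum_cong') (auto simp: smult_mult_left fps_eval_const_mult fps_eval_X_power_mult)
  also have "\<dots> = fps_eval P (\<Sum>k<N. fps_const (fps_nth F k) * (fps_X ^ k * G))"
    by (rule fps_eval_sum[symmetric])
  also have "\<dots> = fps_eval P (F * G)"
  proof (rule fps_eval_cong)
    fix m assume "m < N"
    have "fps_nth (\<Sum>k<N. fps_const (fps_nth F k) * (fps_X ^ k * G)) m
        = (\<Sum>k<N. if k \<le> m then fps_nth F k * fps_nth G (m - k) else 0)"
      by (simp add: fps_sum_nth fps_X_power_mult_nth not_le if_distrib cong: if_cong)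
         (rule sum.cong, auto)
    also have "\<dots> = (\<Sum>k=0..m. fps_nth F k * fps_nth G (m - k))"
      using \<open>m < N\<close> by (intro sum.mono_neutral_cong_right) auto
    finally show "fps_nth (\<Sum>k<N. fps_const (fps_nth F k) * (fps_X ^ k * G)) m = fps_nth (F * G) m"
      by (simp add: fps_mult_nth)
  qed
  finally show ?thesis by simp
qed

lemma fps_eval_one [simp]: "fps_eval P 1 = \<one>"
proof (cases "N = 0")
  case True
  then have "\<one> = \<zero>" using nilpotent by simp
  then show ?thesis using one_zeroD[OF \<open>\<one> = \<zero>\<close>] fps_eval_closed[of 1] by simp
next
  case False
  have "fps_eval P 1 = (\<Oplus>k\<in>{..<N}. if 0 = k then \<one> else \<zero>)"
    unfolding fps_eval_truncate using P by (intro finsum_cong') auto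
  also have "\<dots> = \<one>" using False by (intro finsum_singleton) auto
  finally show ?thesis .
qed

lemma span_families_fps_eval:
  assumes "\<And>k. (\<lambda>i. fps_nth (F i) k) \<in> S"
  shows "(\<lambda>i. fps_eval P (F i)) \<in> span_families S"
  unfolding fps_eval_truncate using P assms
  by (intro span_families_finsum span_families.single) auto

end

end


section \<open>Quotients of graded algebras\<close>

text \<open>
  The two algebras of the development are quotients of structures in which associativity and the unit
  laws may hold only modulo the subspace that is divided out: the cocycle algebra modulo coboundaries, and
  the free vector space on pairs modulo bilinearity.
\<close>

locale algebra_modulo = abelian_group R for R :: "'b graded_algebra" (structure) +
  fixes I :: "'b set"
  assumes subgroup: "additive_subgroup I R"
    and mult_closed: "x \<in> carrier R \<Longrightarrow> y \<in> carrier R \<Longrightarrow> x \<otimes> y \<in> carrier R"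
    and one_in: "\<one> \<in> carrier R"
    and distrib_right: "x \<in> carrier R \<Longrightarrow> y \<in> carrier R \<Longrightarrow> z \<in> carrier R \<Longrightarrow> (x \<oplus> y) \<otimes> z = x \<otimes> z \<oplus> y \<otimes> z"
    and distrib_left: "x \<in> carrier R \<Longrightarrow> y \<in> carrier R \<Longrightarrow> z \<in> carrier R \<Longrightarrow> z \<otimes> (x \<oplus> y) = z \<otimes> x \<oplus> z \<otimes> y"
    and absorb_left: "x \<in> carrier R \<Longrightarrow> i \<in> I \<Longrightarrow> x \<otimes> i \<in> I"
    and absorb_right: "x \<in> carrier R \<Longrightarrow> i \<in> I \<Longrightarrow> i \<otimes> x \<in> I"
    and assoc_mod: "x \<in> carrier R \<Longrightarrow> y \<in> carrier R \<Longrightarrow> z \<in> carrier R \<Longrightarrow> (x \<otimes> y) \<otimes> z \<ominus> x \<otimes> (y \<otimes> z) \<in> I"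
    and one_left_mod: "x \<in> carrier R \<Longrightarrow> \<one> \<otimes> x \<ominus> x \<in> I"
    and one_right_mod: "x \<in> carrier R \<Longrightarrow> x \<otimes> \<one> \<ominus> x \<in> I"
    and scale_closed: "x \<in> carrier R \<Longrightarrow> c \<odot> x \<in> carrier R"
    and scale_ideal: "i \<in> I \<Longrightarrow> c \<odot> i \<in> I"
    and scale_l_distr: "x \<in> carrier R \<Longrightarrow> (c + d) \<odot> x = c \<odot> x \<oplus> d \<odot> x"
    and scale_r_distr: "x \<in> carrier R \<Longrightarrow> y \<in> carrier R \<Longrightarrow> c \<odot> (x \<oplus> y) = c \<odot> x \<oplus> c \<odot> y"
    and scale_scale: "x \<in> carrier R \<Longrightarrow> c \<odot> (d \<odot> x) = (c * d) \<odot> x"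
    and scale_one: "x \<in> carrier R \<Longrightarrow> 1 \<odot> x = x"
    and scale_mult_left: "x \<in> carrier R \<Longrightarrow> y \<in> carrier R \<Longrightarrow> (c \<odot> x) \<otimes> y = c \<odot> (x \<otimes> y)"
    and scale_mult_right: "x \<in> carrier R \<Longrightarrow> y \<in> carrier R \<Longrightarrow> x \<otimes> (c \<odot> y) = c \<odot> (x \<otimes> y)"
begin

sublocale abelian_subgroup I R
  using subgroup by (rule abelian_subgroupI3) (rule abelian_group_axioms)

abbreviation coset :: "'b \<Rightarrow> 'b set" where "coset x \<equiv> I +> x"

abbreviation Q :: "'b set graded_algebra" where "Q \<equiv> graded_quot R I"

lemma in_coset_iff: "y \<in> coset x \<longleftrightarrow> (\<exists>i\<in>I. y = i \<oplus> x)"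
  by (auto simp: a_r_coset_def')

lemma coset_eq_iff:
  assumes "x \<in> carrier R" "y \<in> carrier R"
  shows "coset x = coset y \<longleftrightarrow> x \<ominus> y \<in> I"
proof
  assume "coset x = coset y"
  then have "x \<in> coset y" using a_rcos_self[OF assms(1)] by simp
  then obtain i where "i \<in> I" "x = i \<oplus> y" by (auto simp: in_coset_iff)
  then show "x \<ominus> y \<in> I" using assms a_Hcarr by (simp add: a_minus_def a_assoc r_neg)
next
  assume "x \<ominus> y \<in> I"
  moreover have "x = (x \<ominus> y) \<oplus> y" using assms by (simp add: a_minus_def a_assoc l_neg)
  ultimately have "x \<in> coset y" unfolding in_coset_iff by blast
  then show "coset x = coset y" using a_repr_independence[OF _ assms(2) a_subgroup] by simp
qed

lemma coset_eqI: "x \<in> carrier R \<Longrightarrow> y \<in> carrier R \<Longrightarrow> x \<ominus> y \<in> I \<Longrightarrow> coset x = coset y"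
  by (simp add: coset_eq_iff)

lemma carrier_quot: "carrier Q = coset ` carrier R"
  by (auto simp: graded_quot_def A_RCOSETS_def')

lemma coset_in [simp]: "x \<in> carrier R \<Longrightarrow> coset x \<in> carrier Q"
  by (auto simp: carrier_quot)

lemma add_coset: "x \<in> carrier R \<Longrightarrow> y \<in> carrier R \<Longrightarrow> coset x \<oplus>\<^bsub>Q\<^esub> coset y = coset (x \<oplus> y)"
  by (simp add: graded_quot_def a_rcos_sum)

lemma zero_quot: "\<zero>\<^bsub>Q\<^esub> = coset \<zero>"
  by (simp add: graded_quot_def a_coset_add_zero[OF a_subset])

lemma one_quot: "\<one>\<^bsub>Q\<^esub> = coset \<one>"
  by (simp add: graded_quot_def)

lemma mult_coset:
  assumes xy: "x \<in> carrier R" "y \<in> carrier R"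
  shows "coset x \<otimes>\<^bsub>Q\<^esub> coset y = coset (x \<otimes> y)"
proof -
  have *: "coset (a \<otimes> b) = coset (x \<otimes> y)" if ab: "a \<in> coset x" "b \<in> coset y" for a b
  proof -
    obtain i j where ij: "i \<in> I" "j \<in> I" "a = i \<oplus> x" "b = j \<oplus> y" using ab in_coset_iff by auto
    note c = xy a_Hcarr[OF ij(1)] a_Hcarr[OF ij(2)]
    have "a \<otimes> b = (i \<otimes> (j \<oplus> y) \<oplus> x \<otimes> j) \<oplus> x \<otimes> y"
      unfolding ij using c by (simp add: distrib_right distrib_left a_assoc mult_closed a_lcomm)
    moreover have mem: "i \<otimes> (j \<oplus> y) \<oplus> x \<otimes> j \<in> I"
      using ij c by (simp add: absorb_left absorb_right)
    ultimately have "a \<otimes> b \<ominus> x \<otimes> y \<in> I"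
      using c a_Hcarr[OF mem] by (simp add: a_minus_def a_assoc r_neg mult_closed)
    then show ?thesis using c ij by (intro coset_eqI) (auto simp: mult_closed)
  qed
  have "x \<in> coset x" "y \<in> coset y" using a_rcos_self xy by auto
  moreover have "coset x \<otimes>\<^bsub>Q\<^esub> coset y = (\<Union>a\<in>coset x. \<Union>b\<in>coset y. coset (a \<otimes> b))"
    by (simp add: graded_quot_def rcoset_mult_def)
  ultimately show ?thesis using * by blast
qed

text \<open>Scalar multiplication and grading are induced on cosets by maps of the following kind.\<close>

lemma image_coset:
  assumes "\<And>x. x \<in> carrier R \<Longrightarrow> f x \<in> carrier R"
    and "\<And>x y. x \<in> carrier R \<Longrightarrow> y \<in> carrier R \<Longrightarrow> f (x \<oplus> y) = f x \<oplus> f y"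
    and "\<And>i. i \<in> I \<Longrightarrow> f i \<in> I" and x: "x \<in> carrier R"
  shows "I <+>\<^bsub>R\<^esub> (f ` coset x) = coset (f x)"
proof (intro equalityI subsetI)
  have cs: "coset x = (\<lambda>j. j \<oplus> x) ` I" by (auto simp: in_coset_iff)
  have eq: "i \<oplus> f (j \<oplus> x) = (i \<oplus> f j) \<oplus> f x" if "i \<in> I" "j \<in> I" for i j
    using that a_Hcarr[of i] a_Hcarr[of j] assms(1)[of j] assms(1)[OF x] assms(2)[of j x] x
    by (simp add: a_assoc)
  {
    fix y assume "y \<in> I <+>\<^bsub>R\<^esub> (f ` coset x)"
    then obtain i j where ij: "i \<in> I" "j \<in> I" "y = i \<oplus> f (j \<oplus> x)" unfolding set_add_def' cs by blast
    moreover have "i \<oplus> f j \<in> I" using ij assms(3) by simp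
    ultimately show "y \<in> coset (f x)" unfolding in_coset_iff using eq by blast
  next
    fix y assume "y \<in> coset (f x)"
    then obtain i where i: "i \<in> I" "y = i \<oplus> f x" unfolding in_coset_iff by blast
    have f0: "f \<zero> \<in> I" using assms(3) by simp
    have "i \<ominus> f \<zero> \<oplus> f (\<zero> \<oplus> x) = ((i \<ominus> f \<zero>) \<oplus> f \<zero>) \<oplus> f x"
      using eq[of "i \<ominus> f \<zero>" \<zero>] f0 i(1) by (simp add: a_minus_def)
    also have "(i \<ominus> f \<zero>) \<oplus> f \<zero> = i"
      using i f0 a_Hcarr by (simp add: a_minus_def a_assoc l_neg)
    finally have "y = (i \<ominus> f \<zero>) \<oplus> f (\<zero> \<oplus> x)" using i(2) by simp
    moreover have "i \<ominus> f \<zero> \<in> I" using i f0 by (simp add: a_minus_def)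
    ultimately show "y \<in> I <+>\<^bsub>R\<^esub> (f ` coset x)"
      unfolding set_add_def' cs using zero_closed by blast
  }
qed

lemma smult_coset: "x \<in> carrier R \<Longrightarrow> z \<odot>\<^bsub>Q\<^esub> coset x = coset (z \<odot> x)"
  using image_coset[of "\<lambda>x. z \<odot> x" x] by (simp add: graded_quot_def scale_closed scale_r_distr scale_ideal)

lemma hcomp_coset:
  assumes "\<And>x. x \<in> carrier R \<Longrightarrow> hcomp R k x \<in> carrier R"
    and "\<And>x y. x \<in> carrier R \<Longrightarrow> y \<in> carrier R \<Longrightarrow> hcomp R k (x \<oplus> y) = hcomp R k x \<oplus> hcomp R k y"
    and "\<And>i. i \<in> I \<Longrightarrow> hcomp R k i \<in> I" and x: "x \<in> carrier R"
  shows "hcomp Q k (coset x) = coset (hcomp R k x)"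
  using image_coset[of "hcomp R k" x] assms by (simp add: graded_quot_def)

theorem complex_algebra_quot: "complex_algebra Q"
proof -
  have ag: "abelian_group Q"
  proof (rule abelian_groupI)
    fix S assume "S \<in> carrier Q"
    then obtain x where x: "x \<in> carrier R" "S = coset x" unfolding carrier_quot by blast
    then have "coset (\<ominus> x) \<oplus>\<^bsub>Q\<^esub> S = \<zero>\<^bsub>Q\<^esub>" by (simp add: add_coset zero_quot l_neg)
    then show "\<exists>T\<in>carrier Q. T \<oplus>\<^bsub>Q\<^esub> S = \<zero>\<^bsub>Q\<^esub>"
      by (rule bexI) (use x in auto)
  qed (auto simp add: carrier_quot add_coset zero_quot a_ac)
  have mon: "Group.monoid Q"
  proof (rule monoidI)
    fix S T U assume "S \<in> carrier Q" "T \<in> carrier Q" "U \<in> carrier Q"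
    then obtain x y z where "x \<in> carrier R" "S = coset x" "y \<in> carrier R" "T = coset y" "z \<in> carrier R" "U = coset z"
      unfolding carrier_quot by blast
    then show "S \<otimes>\<^bsub>Q\<^esub> T \<otimes>\<^bsub>Q\<^esub> U = S \<otimes>\<^bsub>Q\<^esub> (T \<otimes>\<^bsub>Q\<^esub> U)"
      by (simp add: mult_coset mult_closed coset_eq_iff assoc_mod)
  next
    fix S assume "S \<in> carrier Q"
    then obtain x where "x \<in> carrier R" "S = coset x" unfolding carrier_quot by blast
    then show "\<one>\<^bsub>Q\<^esub> \<otimes>\<^bsub>Q\<^esub> S = S" "S \<otimes>\<^bsub>Q\<^esub> \<one>\<^bsub>Q\<^esub> = S"
      by (simp_all add: one_quot mult_coset one_in mult_closed coset_eq_iff one_left_mod one_right_mod)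
  qed (auto simp: carrier_quot mult_coset one_quot one_in mult_closed)
  have "ring Q"
    by (intro ringI ag mon) (auto simp: carrier_quot mult_coset add_coset mult_closed distrib_left distrib_right)
  then show ?thesis
  proof (rule complex_algebra.intro)
    show "complex_algebra_axioms Q"
      by (rule complex_algebra_axioms.intro)
        (auto simp: carrier_quot mult_coset add_coset smult_coset scale_closed mult_closed scale_l_distr
         scale_r_distr scale_scale scale_one scale_mult_left scale_mult_right)
  qed
qed

end


section \<open>The cup product on singular cochains\<close>

subsection \<open>Faces of a singular simplex\<close>

definition back_inclusion :: "nat \<Rightarrow> (nat \<Rightarrow> real) \<Rightarrow> nat \<Rightarrow> real" where
  "back_inclusion p x = (\<lambda>i. if i < p then 0 else x (i - p))"

lemma back_face_alt: "back_face p q \<sigma> = restrict (\<sigma> \<circ> back_inclusion p) (standard_simplex q)"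
  by (simp add: back_face_def back_inclusion_def o_def)

lemma back_inclusion_in_standard_simplex:
  assumes "x \<in> standard_simplex q"
  shows "back_inclusion p x \<in> standard_simplex (p + q)"
proof -
  have "(\<Sum>i\<le>p + q. back_inclusion p x i) = (\<Sum>i\<in>(\<lambda>i. i + p) ` {..q}. back_inclusion p x i)"
  proof (rule sum.mono_neutral_right)
    show "\<forall>i\<in>{..p + q} - (\<lambda>i. i + p) ` {..q}. back_inclusion p x i = 0"
    proof
      fix i assume i: "i \<in> {..p + q} - (\<lambda>i. i + p) ` {..q}"
      have "i < p"
      proof (rule ccontr)
        assume "\<not> i < p"
        then have "i = (i - p) + p" "i - p \<le> q" using i by auto
        then show False using i by blast
      qed
      then show "back_inclusion p x i = 0" by (simp add: back_inclusion_def)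
    qed
  qed auto
  also have "\<dots> = (\<Sum>i\<le>q. x i)"
    by (subst sum.reindex) (auto simp: back_inclusion_def inj_on_def)
  finally show ?thesis
    using assms by (auto simp: standard_simplex_def back_inclusion_def)
qed

lemma singular_simplex_front_face:
  assumes "singular_simplex n X \<sigma>" "p \<le> n"
  shows "singular_simplex p X (front_face p \<sigma>)"
proof -
  have "continuous_map (subtopology (powertop_real UNIV) (standard_simplex p)) X \<sigma>"
    using assms continuous_map_from_subtopology_mono[OF _ standard_simplex_mono[OF assms(2)]]
    by (auto simp: singular_simplex_def)
  then show ?thesis
    unfolding singular_simplex_def front_face_def
    by (auto intro: continuous_map_eq)
qed

lemma singular_simplex_back_face:
  assumes "singular_simplex (p + q) X \<sigma>"
  shows "singular_simplex q X (back_face p q \<sigma>)"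
proof -
  let ?PT = "powertop_real UNIV"
  have 1: "continuous_map (subtopology ?PT (standard_simplex q)) (subtopology ?PT (standard_simplex (p + q)))
             (back_inclusion p)"
  proof (clarsimp simp add: continuous_map_in_subtopology continuous_map_componentwise back_inclusion_in_standard_simplex Pi_iff)
    fix i
    have "continuous_map ?PT euclideanreal (\<lambda>x. if i < p then 0 else x (i - p))"
      by (auto intro: continuous_map_product_projection)
    then show "continuous_map (subtopology ?PT (standard_simplex q)) euclideanreal (\<lambda>x. back_inclusion p x i)"
      by (simp add: back_inclusion_def continuous_map_from_subtopology)
  qed
  have 2: "continuous_map (subtopology ?PT (standard_simplex (p + q))) X \<sigma>"
    using assms singular_simplex_def by blast
  show ?thesis
    by (simp add: singular_simplex_def back_face_alt continuous_map_compose [OF 1 2])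
qed

lemma front_face_self: "singular_simplex n X \<sigma> \<Longrightarrow> front_face n \<sigma> = \<sigma>"
  by (simp add: front_face_def singular_simplex_def extensional_restrict)

lemma back_face_zero: "singular_simplex n X \<sigma> \<Longrightarrow> back_face 0 n \<sigma> = \<sigma>"
  by (simp add: back_face_def singular_simplex_def extensional_restrict)

lemma front_front_face: "s \<le> p \<Longrightarrow> front_face s (front_face p \<sigma>) = front_face s \<sigma>"
  using standard_simplex_mono[of s p] by (auto simp: front_face_def simp del: restrict_restrict intro!: restrict_ext)

lemma back_front_face: "back_face s t (front_face (s + t) \<sigma>) = front_face t (back_face s (t + u) \<sigma>)"
  using standard_simplex_mono[of t "t + u"] back_inclusion_in_standard_simplex
  by (auto simp: front_face_def back_face_alt simp del: restrict_restrict intro!: restrict_ext)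

lemma back_back_face: "back_face (s + t) u \<sigma> = back_face t u (back_face s (t + u) \<sigma>)"
proof -
  have "back_inclusion (s + t) x = back_inclusion s (back_inclusion t x)" for x
    by (auto simp: back_inclusion_def fun_eq_iff)
  then show ?thesis
    using back_inclusion_in_standard_simplex by (auto simp: back_face_alt simp del: restrict_restrict intro!: restrict_ext)
qed

lemma front_face_singular_face_le:
  assumes "i \<le> p" "p < n"
  shows "front_face p (singular_face n i \<sigma>) = singular_face (Suc p) i (front_face (Suc p) \<sigma>)"
proof -
  have "standard_simplex p \<subseteq> standard_simplex (n - Suc 0)" using assms by (intro standard_simplex_mono) auto
  then show ?thesis using assms simplical_face_in_standard_simplex[of "Suc p" i]
  by (auto simp: front_face_def singular_face_def simp del: restrict_restrict intro!: restrict_ext)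
qed

lemma front_face_singular_face_gt:
  assumes "p < i" "i \<le> n"
  shows "front_face p (singular_face n i \<sigma>) = front_face p \<sigma>"
proof -
  have "simplical_face i x = x" if "x \<in> standard_simplex p" for x :: "nat \<Rightarrow> real"
    using that assms by (auto simp: simplical_face_def standard_simplex_def fun_eq_iff)
  moreover have "standard_simplex p \<subseteq> standard_simplex (n - Suc 0)" using assms by (intro standard_simplex_mono) auto
  ultimately show ?thesis
    using assms
    by (auto simp: front_face_def singular_face_def simp del: restrict_restrict intro!: restrict_ext)
qed

lemma back_face_singular_face_le:
  assumes "i \<le> p"
  shows "back_face p q (singular_face (Suc (p + q)) i \<sigma>) = back_face (Suc p) q \<sigma>"
proof -
  have "simplical_face i (back_inclusion p x) = back_inclusion (Suc p) x" for x
    using assms by (auto simp: simplical_face_def back_inclusion_def fun_eq_iff)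
  then show ?thesis
    using back_inclusion_in_standard_simplex[of _ q p]
    by (auto simp: back_face_alt singular_face_def simp del: restrict_restrict intro!: restrict_ext)
qed

lemma back_face_singular_face_ge:
  assumes "j \<le> Suc q" "p + j > p \<or> p = 0"
  shows "back_face p q (singular_face (Suc (p + q)) (p + j) \<sigma>) = singular_face (Suc q) j (back_face p (Suc q) \<sigma>)"
proof -
  have "simplical_face (p + j) (back_inclusion p x) = back_inclusion p (simplical_face j x)" for x
    by (auto simp: simplical_face_def back_inclusion_def fun_eq_iff)
  then show ?thesis
    using back_inclusion_in_standard_simplex[of _ q p] simplical_face_in_standard_simplex[of "Suc q" j] assms
    by (auto simp: back_face_alt singular_face_def simp del: restrict_restrict intro!: restrict_ext)
qed

lemma last_face_front_face: "singular_face (Suc p) (Suc p) (front_face (Suc p) \<sigma>) = front_face p \<sigma>"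
proof -
  have "simplical_face (Suc p) x = x" if "x \<in> standard_simplex p" for x :: "nat \<Rightarrow> real"
    using that by (auto simp: simplical_face_def standard_simplex_def fun_eq_iff)
  then show ?thesis
    using standard_simplex_mono[of p "Suc p"]
    by (auto simp: front_face_def singular_face_def simp del: restrict_restrict intro!: restrict_ext)
qed

lemma first_face_back_face: "singular_face (Suc q) 0 (back_face p (Suc q) \<sigma>) = back_face (Suc p) q \<sigma>"
proof -
  have "back_inclusion p (simplical_face 0 x) = back_inclusion (Suc p) x" for x
    by (auto simp: simplical_face_def back_inclusion_def fun_eq_iff)
  then show ?thesis
    using simplical_face_in_standard_simplex[of "Suc q" 0]
    by (auto simp: back_face_alt singular_face_def simp del: restrict_restrict intro!: restrict_ext)
qed

lemma singular_face_singular_face: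
  assumes "j < i" "i \<le> Suc (Suc n)"
  shows "singular_face (Suc n) j (singular_face (Suc (Suc n)) i \<sigma>)
       = singular_face (Suc n) (i - 1) (singular_face (Suc (Suc n)) j \<sigma>)"
proof -
  have "simplical_face i (simplical_face j x) = simplical_face j (simplical_face (i - 1) x)" for x :: "nat \<Rightarrow> real"
    using assms by (auto simp: simplical_face_def fun_eq_iff)
  then show ?thesis
    using simplical_face_in_standard_simplex[of "Suc n" j] simplical_face_in_standard_simplex[of "Suc n" "i - 1"] assms
    by (auto simp: singular_face_def simp del: restrict_restrict intro!: restrict_ext)
qed


subsection \<open>The differential graded algebra of cochains\<close>

lemma cochains_iff:
  "c \<in> cochains X \<longleftrightarrow> (\<forall>k \<sigma>. \<not> singular_simplex k X \<sigma> \<longrightarrow> c k \<sigma> = 0) \<and> (\<exists>N. \<forall>k\<ge>N. \<forall>\<sigma>. c k \<sigma> = 0)"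
proof -
  have "finite {k. \<exists>\<sigma>. c k \<sigma> \<noteq> 0} \<longleftrightarrow> (\<exists>N. \<forall>k\<ge>N. \<forall>\<sigma>. c k \<sigma> = 0)"
    unfolding finite_nat_set_iff_bounded
    by (intro ex_cong1) (auto simp: not_le[symmetric])
  then show ?thesis by (auto simp: cochains_def)
qed

lemma cochainsI:
  "(\<And>k \<sigma>. \<not> singular_simplex k X \<sigma> \<Longrightarrow> c k \<sigma> = 0) \<Longrightarrow> (\<And>k \<sigma>. k \<ge> N \<Longrightarrow> c k \<sigma> = 0) \<Longrightarrow> c \<in> cochains X"
  unfolding cochains_iff by blast

lemma cup_cochains: assumes "c \<in> cochains X" "d \<in> cochains X" shows "cup X c d \<in> cochains X"
proof -
  obtain N where N: "\<And>k \<sigma>. k \<ge> N \<Longrightarrow> c k \<sigma> = 0" using assms(1) unfolding cochains_iff by blast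
  obtain M where M: "\<And>k \<sigma>. k \<ge> M \<Longrightarrow> d k \<sigma> = 0" using assms(2) unfolding cochains_iff by blast
  show ?thesis
  proof (rule cochainsI[where N = "N + M"])
    fix k \<sigma> assume k: "k \<ge> N + M"
    have "c p s * d (k - p) t = 0" for p s t
    proof (cases "p \<ge> N")
      case False
      then have "k - p \<ge> M" using k by auto
      then show ?thesis using M by simp
    qed (use N in simp)
    then show "cup X c d k \<sigma> = 0" unfolding cup_def by (simp only: sum.neutral_const if_cancel)
  qed (simp add: cup_def)
qed

lemma coboundary_cochains: assumes "c \<in> cochains X" shows "coboundary X c \<in> cochains X"
proof -
  obtain N where N: "\<And>k \<sigma>. k \<ge> N \<Longrightarrow> c k \<sigma> = 0" using assms(1) unfolding cochains_iff by blast
  then show ?thesis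
    by (intro cochainsI[where N = "Suc N"]) (auto simp: coboundary_def)
qed

lemma coboundary_Suc:
  "singular_simplex (Suc n) X \<sigma> \<Longrightarrow>
   coboundary X c (Suc n) \<sigma> = (\<Sum>i\<le>Suc n. (- 1) ^ i * c n (singular_face (Suc n) i \<sigma>))"
  by (simp add: coboundary_def)

lemma coboundary_coboundary: "coboundary X (coboundary X c) = (\<lambda>k \<sigma>. 0)"
proof (intro ext)
  fix k \<sigma>
  show "coboundary X (coboundary X c) k \<sigma> = 0"
  proof (cases "singular_simplex k X \<sigma> \<and> k \<ge> 2")
    case False
    then show ?thesis by (auto simp: coboundary_def not_le less_Suc_eq numeral_2_eq_2)
  next
    case True
    then obtain n where k: "k = Suc (Suc n)" by (metis add_2_eq_Suc le_Suc_ex)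
    have ss: "singular_simplex (Suc n) X (singular_face k i \<sigma>)" if "i \<le> k" for i
      using singular_simplex_singular_face[of k X \<sigma> i] True that k by simp
    define y where "y i j = c n (singular_face (Suc n) j (singular_face k i \<sigma>))" for i j
    have "coboundary X (coboundary X c) k \<sigma> = (\<Sum>i\<le>k. (- 1) ^ i * coboundary X c (Suc n) (singular_face k i \<sigma>))"
      using True unfolding k by (intro coboundary_Suc) simp
    also have "\<dots> = (\<Sum>i\<le>k. \<Sum>j\<le>Suc n. (- 1) ^ (i + j) * y i j)"
    proof (rule sum.cong[OF refl])
      fix i assume "i \<in> {..k}"
      then have "singular_simplex (Suc n) X (singular_face k i \<sigma>)" using ss by simp
      then show "(- 1) ^ i * coboundary X c (Suc n) (singular_face k i \<sigma>) = (\<Sum>j\<le>Suc n. (- 1) ^ (i + j) * y i j)"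
        by (simp add: coboundary_def sum_distrib_left y_def power_add mult.assoc del: sum.atMost_Suc)
    qed
    also have "\<dots> = (\<Sum>(i, j)\<in>{..k} \<times> {..Suc n}. (- 1) ^ (i + j) * y i j)"
      by (rule sum.cartesian_product)
    also have "\<dots> = (\<Sum>(i, j)\<in>{(i, j). j < i \<and> i \<le> k}. (- 1) ^ (i + j) * y i j)
                 + (\<Sum>(i, j)\<in>{(i, j). i \<le> j \<and> j \<le> Suc n}. (- 1) ^ (i + j) * y i j)"
    proof (subst sum.union_disjoint[symmetric])
      show "finite {(i, j). j < i \<and> i \<le> k}" by (rule finite_subset[of _ "{..k} \<times> {..k}"]) auto
      show "finite {(i, j). i \<le> j \<and> j \<le> Suc n}" by (rule finite_subset[of _ "{..Suc n} \<times> {..Suc n}"]) auto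
    qed (auto simp: k intro!: sum.cong)
    \<comment> \<open>The simplicial identity matches the two halves of the double sum with opposite signs.\<close>
    also have "(\<Sum>(i, j)\<in>{(i, j). j < i \<and> i \<le> k}. (- 1) ^ (i + j) * y i j)
             = (\<Sum>(i, j)\<in>{(i, j). i \<le> j \<and> j \<le> Suc n}. - ((- 1) ^ (i + j) * y i j))"
    proof (rule sum.reindex_bij_witness[of _ "\<lambda>(i, j). (Suc j, i)" "\<lambda>(i, j). (j, i - 1)"])
      fix p assume "p \<in> {(i, j). j < i \<and> i \<le> k}"
      then obtain a b where p: "p = (Suc a, b)" "b \<le> a" "a \<le> Suc n" by (cases p; cases "fst p") (auto simp: k)
      have "y (Suc a) b = y b a" using singular_face_singular_face[of b "Suc a" n \<sigma>] p by (simp add: y_def k)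
      then show "(case case p of (i, j) \<Rightarrow> (j, i - 1) of (i, j) \<Rightarrow> - ((- 1) ^ (i + j) * y i j))
          = (case p of (i, j) \<Rightarrow> (- 1) ^ (i + j) * y i j)"
        by (simp add: p add.commute)
      show "(case case p of (i, j) \<Rightarrow> (j, i - 1) of (i, j) \<Rightarrow> (Suc j, i)) = p"
        "(case p of (i, j) \<Rightarrow> (j, i - 1)) \<in> {(i, j). i \<le> j \<and> j \<le> Suc n}"
        using p by auto
    qed (auto simp: k)
    finally show ?thesis by (simp add: sum_negf case_prod_unfold)
  qed
qed

text \<open>
  The twist carries the sign of the Leibniz rule, so that the rule can be stated for cochains that are not
  homogeneous.
\<close>

definition sign_twist :: "'a cochain \<Rightarrow> 'a cochain" where
  "sign_twist c = (\<lambda>k \<sigma>. (- 1) ^ k * c k \<sigma>)"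

text \<open>
  The faces of a simplex up to the splitting vertex are faces of its front part, the later ones are faces of
  its back part.  The coboundaries of the two factors have one further term each: the last face of the
  front part and the first face of the back part, which cancel.
\<close>

lemma coboundary_cup:
  "coboundary X (cup X c d) = (\<lambda>k \<sigma>. cup X (coboundary X c) d k \<sigma> + cup X (sign_twist c) (coboundary X d) k \<sigma>)"
proof (intro ext)
  fix k \<sigma>
  show "coboundary X (cup X c d) k \<sigma> = cup X (coboundary X c) d k \<sigma> + cup X (sign_twist c) (coboundary X d) k \<sigma>"
  proof (cases "singular_simplex k X \<sigma> \<and> k > 0")
    case False
    then show ?thesis by (auto simp: coboundary_def cup_def)
  next
    case True
    then obtain n where k: "k = Suc n" using gr0_implies_Suc by blast
    have sf: "singular_simplex n X (singular_face (Suc n) i \<sigma>)" if "i \<le> Suc n" for i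
      using singular_simplex_singular_face[of k X \<sigma> i] True that k by simp
    have sfr: "singular_simplex p X (front_face p \<sigma>)" if "p \<le> Suc n" for p
      using singular_simplex_front_face True that k by blast
    have sb: "singular_simplex (Suc n - p) X (back_face p (Suc n - p) \<sigma>)" if "p \<le> Suc n" for p
      using singular_simplex_back_face[of p "Suc n - p" X \<sigma>] True that k by simp
    \<comment> \<open>The terms \<open>A\<close> and \<open>B\<close> come from faces of the front and of the back part, and \<open>M\<close> is the term that cancels.\<close>
    define A where "A p = (\<Sum>i\<le>p. (- 1) ^ i * c p (singular_face (Suc p) i (front_face (Suc p) \<sigma>)))
        * d (n - p) (back_face (Suc p) (n - p) \<sigma>)" for p
    define B where "B p = c p (front_face p \<sigma>)
        * (\<Sum>j=1..Suc n - p. (- 1) ^ (p + j) * d (n - p) (singular_face (Suc n - p) j (back_face p (Suc n - p) \<sigma>)))" for p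
    define M where "M p = (- 1) ^ p * c p (front_face p \<sigma>) * d (n - p) (back_face (Suc p) (n - p) \<sigma>)" for p
    have "coboundary X (cup X c d) k \<sigma> = (\<Sum>i\<le>Suc n. (- 1) ^ i * (\<Sum>p\<le>n.
        c p (front_face p (singular_face (Suc n) i \<sigma>)) * d (n - p) (back_face p (n - p) (singular_face (Suc n) i \<sigma>))))"
      using True by (simp add: coboundary_def cup_def k sf del: sum.atMost_Suc cong: sum.cong_simp)
    also have "\<dots> = (\<Sum>p\<le>n. \<Sum>i\<le>Suc n. (- 1) ^ i *
        (c p (front_face p (singular_face (Suc n) i \<sigma>)) * d (n - p) (back_face p (n - p) (singular_face (Suc n) i \<sigma>))))"
      by (subst sum.swap) (simp add: sum_distrib_left del: sum.atMost_Suc)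
    also have "\<dots> = (\<Sum>p\<le>n. A p + B p)"
    proof (intro sum.cong refl)
      fix p assume "p \<in> {..n}"
      then obtain q where n: "n = p + q" using le_Suc_ex by auto
      let ?t = "\<lambda>i. (- 1) ^ i *
        (c p (front_face p (singular_face (Suc n) i \<sigma>)) * d (n - p) (back_face p (n - p) (singular_face (Suc n) i \<sigma>)))"
      have "(\<Sum>i\<le>Suc n. ?t i) = (\<Sum>i\<in>{..p} \<union> {p+1..Suc n}. ?t i)"
        by (rule sum.cong) (auto simp: n)
      also have "\<dots> = (\<Sum>i\<le>p. ?t i) + (\<Sum>i=p+1..Suc n. ?t i)"
        by (rule sum.union_disjoint) auto
      also have "(\<Sum>i\<le>p. ?t i) = A p"
        unfolding A_def sum_distrib_right
        by (intro sum.cong refl) (simp add: front_face_singular_face_le back_face_singular_face_le n)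
      also have "(\<Sum>i=p+1..Suc n. ?t i) = (\<Sum>j=1..Suc n - p. ?t (p + j))"
        by (rule sum.reindex_bij_witness[of _ "\<lambda>j. p + j" "\<lambda>i. i - p"]) auto
      also have "\<dots> = B p"
        unfolding B_def sum_distrib_left
      proof (intro sum.cong refl)
        fix j assume j: "j \<in> {1..Suc n - p}"
        have "front_face p (singular_face (Suc n) (p + j) \<sigma>) = front_face p \<sigma>"
          using j by (intro front_face_singular_face_gt) auto
        moreover have "back_face p q (singular_face (Suc (p + q)) (p + j) \<sigma>) = singular_face (Suc q) j (back_face p (Suc q) \<sigma>)"
          using j by (intro back_face_singular_face_ge) (auto simp: n)
        ultimately show "?t (p + j) = c p (front_face p \<sigma>) *
           ((- 1) ^ (p + j) * d (n - p) (singular_face (Suc n - p) j (back_face p (Suc n - p) \<sigma>)))"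
          by (simp add: n Suc_diff_le)
      qed
      finally show "(\<Sum>i\<le>Suc n. ?t i) = A p + B p" .
    qed
    also have "\<dots> = (\<Sum>p\<le>n. A p - M p) + (\<Sum>p\<le>n. M p + B p)"
      by (simp add: sum.distrib sum_subtractf)
    also have "(\<Sum>p\<le>n. A p - M p) = cup X (coboundary X c) d k \<sigma>"
    proof -
      have "cup X (coboundary X c) d k \<sigma>
          = (\<Sum>p\<le>Suc n. coboundary X c p (front_face p \<sigma>) * d (Suc n - p) (back_face p (Suc n - p) \<sigma>))"
        using True by (simp add: cup_def k del: sum.atMost_Suc)
      also have "\<dots> = (\<Sum>p\<le>n. coboundary X c (Suc p) (front_face (Suc p) \<sigma>) * d (n - p) (back_face (Suc p) (n - p) \<sigma>))"
        by (subst sum.atMost_Suc_shift) (simp add: coboundary_def)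
      also have "\<dots> = (\<Sum>p\<le>n. A p - M p)"
      proof (intro sum.cong refl)
        fix p assume p: "p \<in> {..n}"
        then have "coboundary X c (Suc p) (front_face (Suc p) \<sigma>) =
           (\<Sum>i\<le>p. (- 1) ^ i * c p (singular_face (Suc p) i (front_face (Suc p) \<sigma>))) - (- 1) ^ p * c p (front_face p \<sigma>)"
          by (simp add: coboundary_def sfr last_face_front_face)
        then show "coboundary X c (Suc p) (front_face (Suc p) \<sigma>) * d (n - p) (back_face (Suc p) (n - p) \<sigma>) = A p - M p"
          by (simp add: A_def M_def left_diff_distrib)
      qed
      finally show ?thesis by simp
    qed
    also have "(\<Sum>p\<le>n. M p + B p) = cup X (sign_twist c) (coboundary X d) k \<sigma>"
    proof -
      have "cup X (sign_twist c) (coboundary X d) k \<sigma>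
          = (\<Sum>p\<le>Suc n. sign_twist c p (front_face p \<sigma>) * coboundary X d (Suc n - p) (back_face p (Suc n - p) \<sigma>))"
        using True by (simp add: cup_def k del: sum.atMost_Suc)
      also have "\<dots> = (\<Sum>p\<le>n. sign_twist c p (front_face p \<sigma>) * coboundary X d (Suc n - p) (back_face p (Suc n - p) \<sigma>))"
        by (simp add: coboundary_def)
      also have "\<dots> = (\<Sum>p\<le>n. M p + B p)"
      proof (intro sum.cong refl)
        fix p assume "p \<in> {..n}"
        then obtain q where n: "n = p + q" using le_Suc_ex by auto
        have sb': "singular_simplex (Suc q) X (back_face p (Suc q) \<sigma>)" using sb[of p] by (simp add: n Suc_diff_le)
        have "coboundary X d (Suc q) (back_face p (Suc q) \<sigma>) =
           (\<Sum>j\<le>Suc q. (- 1) ^ j * d q (singular_face (Suc q) j (back_face p (Suc q) \<sigma>)))"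
          by (simp add: coboundary_def sb' del: sum.atMost_Suc)
        also have "\<dots> = d q (back_face (Suc p) q \<sigma>)
            + (\<Sum>j=1..Suc q. (- 1) ^ j * d q (singular_face (Suc q) j (back_face p (Suc q) \<sigma>)))"
          by (simp add: atMost_atLeast0 sum.atLeast_Suc_atMost first_face_back_face del: sum.cl_ivl_Suc)
        finally show "sign_twist c p (front_face p \<sigma>) * coboundary X d (Suc n - p) (back_face p (Suc n - p) \<sigma>) = M p + B p"
          by (simp add: n Suc_diff_le M_def B_def sign_twist_def distrib_left sum_distrib_left power_add mult_ac
              del: sum.cl_ivl_Suc)
      qed
      finally show ?thesis by simp
    qed
    finally show ?thesis .
  qed
qed

lemma cup_assoc: "cup X (cup X c d) e = cup X c (cup X d e)"
proof (intro ext)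
  fix n \<sigma>
  show "cup X (cup X c d) e n \<sigma> = cup X c (cup X d e) n \<sigma>"
  proof (cases "singular_simplex n X \<sigma>")
    case False
    then show ?thesis by (simp add: cup_def)
  next
    case True
    have "cup X (cup X c d) e n \<sigma> = (\<Sum>p\<le>n. \<Sum>s\<le>p. c s (front_face s \<sigma>) *
        d (p - s) (front_face (p - s) (back_face s (n - s) \<sigma>)) * e (n - p) (back_face (p - s) (n - p) (back_face s (n - s) \<sigma>)))"
      unfolding cup_def using True
    proof (simp add: singular_simplex_front_face sum_distrib_right, intro sum.cong refl)
      fix p s assume "p \<in> {..n}" "s \<in> {..p}"
      then obtain t u where ps: "p = s + t" "n = s + t + u" by (metis atMost_iff le_Suc_ex)
      show "c s (front_face s (front_face p \<sigma>)) * d (p - s) (back_face s (p - s) (front_face p \<sigma>)) *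
           e (n - p) (back_face p (n - p) \<sigma>) =
           c s (front_face s \<sigma>) * d (p - s) (front_face (p - s) (back_face s (n - s) \<sigma>)) *
           e (n - p) (back_face (p - s) (n - p) (back_face s (n - s) \<sigma>))"
        unfolding ps using back_front_face[of s t \<sigma> u] back_back_face[of s t u \<sigma>]
        by (simp add: front_front_face add.assoc)
    qed
    also have "\<dots> = (\<Sum>(p, s)\<in>(SIGMA p:{..n}. {..p}). c s (front_face s \<sigma>) *
        d (p - s) (front_face (p - s) (back_face s (n - s) \<sigma>)) * e (n - p) (back_face (p - s) (n - p) (back_face s (n - s) \<sigma>)))"
      by (subst sum.Sigma) auto
    also have "\<dots> = (\<Sum>(s, t)\<in>(SIGMA s:{..n}. {..n - s}). c s (front_face s \<sigma>) *
        d t (front_face t (back_face s (n - s) \<sigma>)) * e (n - s - t) (back_face t (n - s - t) (back_face s (n - s) \<sigma>)))"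
      by (rule sum.reindex_bij_witness[of _ "\<lambda>(s, t). (s + t, s)" "\<lambda>(p, s). (s, p - s)"]) auto
    also have "\<dots> = (\<Sum>s\<le>n. \<Sum>t\<le>n - s. c s (front_face s \<sigma>) *
        d t (front_face t (back_face s (n - s) \<sigma>)) * e (n - s - t) (back_face t (n - s - t) (back_face s (n - s) \<sigma>)))"
      by (subst sum.Sigma) auto
    also have "\<dots> = cup X c (cup X d e) n \<sigma>"
    proof -
      have "singular_simplex (n - s) X (back_face s (n - s) \<sigma>)" if "s \<le> n" for s
        using singular_simplex_back_face[of s "n - s" X \<sigma>] True that by simp
      then show ?thesis using True
        by (simp add: cup_def sum_distrib_left mult.assoc cong: sum.cong_simp)
    qed
    finally show ?thesis .
  qed
qed



lemma cup_add_left: "cup X (\<lambda>k \<sigma>. c k \<sigma> + d k \<sigma>) e = (\<lambda>k \<sigma>. cup X c e k \<sigma> + cup X d e k \<sigma>)"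
  by (auto simp: cup_def fun_eq_iff sum.distrib distrib_right)

lemma cup_add_right: "cup X e (\<lambda>k \<sigma>. c k \<sigma> + d k \<sigma>) = (\<lambda>k \<sigma>. cup X e c k \<sigma> + cup X e d k \<sigma>)"
  by (auto simp: cup_def fun_eq_iff sum.distrib distrib_left)

lemma cup_scale_left: "cup X (\<lambda>k \<sigma>. z * c k \<sigma>) d = (\<lambda>k \<sigma>. z * cup X c d k \<sigma>)"
  by (auto simp: cup_def fun_eq_iff sum_distrib_left mult.assoc)

lemma cup_scale_right: "cup X c (\<lambda>k \<sigma>. z * d k \<sigma>) = (\<lambda>k \<sigma>. z * cup X c d k \<sigma>)"
  by (auto simp: cup_def fun_eq_iff sum_distrib_left mult.left_commute)

lemma cup_zero: "cup X (\<lambda>k \<sigma>. 0) c = (\<lambda>k \<sigma>. 0)" "cup X c (\<lambda>k \<sigma>. 0) = (\<lambda>k \<sigma>. 0)"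
  by (auto simp: cup_def fun_eq_iff)

lemma coboundary_add: "coboundary X (\<lambda>k \<sigma>. c k \<sigma> + d k \<sigma>) = (\<lambda>k \<sigma>. coboundary X c k \<sigma> + coboundary X d k \<sigma>)"
  by (auto simp: coboundary_def fun_eq_iff sum.distrib distrib_left)

lemma coboundary_scale: "coboundary X (\<lambda>k \<sigma>. z * c k \<sigma>) = (\<lambda>k \<sigma>. z * coboundary X c k \<sigma>)"
  by (auto simp: coboundary_def fun_eq_iff sum_distrib_left mult.left_commute)

lemma coboundary_zero: "coboundary X (\<lambda>k \<sigma>. 0) = (\<lambda>k \<sigma>. 0)"
  by (auto simp: coboundary_def fun_eq_iff)

lemma coboundary_sign_twist: "coboundary X (sign_twist c) = (\<lambda>k \<sigma>. - sign_twist (coboundary X c) k \<sigma>)"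
proof (intro ext)
  fix k \<sigma>
  show "coboundary X (sign_twist c) k \<sigma> = - sign_twist (coboundary X c) k \<sigma>"
    by (cases k) (auto simp: coboundary_def sign_twist_def sum_distrib_left mult.left_commute sum_negf
        simp del: sum.atMost_Suc)
qed

definition unit_cochain :: "'a topology \<Rightarrow> 'a cochain" where
  "unit_cochain X = (\<lambda>k \<sigma>. if k = 0 \<and> singular_simplex k X \<sigma> then 1 else 0)"

lemma cup_unit_left: assumes "c \<in> cochains X" shows "cup X (unit_cochain X) c = c"
proof (intro ext)
  fix n \<sigma>
  show "cup X (unit_cochain X) c n \<sigma> = c n \<sigma>"
  proof (cases "singular_simplex n X \<sigma>")
    case True
    have "cup X (unit_cochain X) c n \<sigma> = (\<Sum>p\<le>n. if p = 0 then c n \<sigma> else 0)"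
      using singular_simplex_front_face[OF True, of 0] back_face_zero[OF True]
      unfolding cup_def if_P[OF True] by (intro sum.cong refl) (auto simp: unit_cochain_def)
    then show ?thesis by simp
  qed (use assms in \<open>simp add: cup_def cochains_iff\<close>)
qed

lemma cup_unit_right: assumes "c \<in> cochains X" shows "cup X c (unit_cochain X) = c"
proof (intro ext)
  fix n \<sigma>
  show "cup X c (unit_cochain X) n \<sigma> = c n \<sigma>"
  proof (cases "singular_simplex n X \<sigma>")
    case True
    have "cup X c (unit_cochain X) n \<sigma> = (\<Sum>p\<le>n. if p = n then c n \<sigma> else 0)"
      using True singular_simplex_back_face[of n 0 X \<sigma>] front_face_self[OF True]
      unfolding cup_def if_P[OF True] by (intro sum.cong refl) (auto simp: unit_cochain_def)
    then show ?thesis by simp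
  qed (use assms in \<open>simp add: cup_def cochains_iff\<close>)
qed

lemma unit_cochain_in: "unit_cochain X \<in> cochains X"
  by (rule cochainsI[where N = 1]) (auto simp: unit_cochain_def)

lemma coboundary_unit: "coboundary X (unit_cochain X) = (\<lambda>k \<sigma>. 0)"
proof (intro ext)
  fix k :: nat and \<sigma>
  have "k = 0 \<or> k = 1 \<or> k > 1" by arith
  then consider "k = 1" "singular_simplex 1 X \<sigma>" | "\<not> (k > 0 \<and> singular_simplex k X \<sigma>)" | "k > 1"
    by (cases "singular_simplex k X \<sigma>") auto
  then show "coboundary X (unit_cochain X) k \<sigma> = 0"
  proof cases
    case 1
    then have "singular_simplex 0 X (singular_face 1 i \<sigma>)" if "i \<le> 1" for i
      using singular_simplex_singular_face[of 1 X \<sigma> i] that by simp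
    with 1 show ?thesis by (simp add: coboundary_def unit_cochain_def atMost_Suc)
  qed (auto simp: coboundary_def unit_cochain_def)
qed


subsection \<open>The algebra of cocycles and its quotient\<close>

lemma cochains_add: "c \<in> cochains X \<Longrightarrow> d \<in> cochains X \<Longrightarrow> (\<lambda>k \<sigma>. c k \<sigma> + d k \<sigma>) \<in> cochains X"
proof -
  assume "c \<in> cochains X" "d \<in> cochains X"
  then obtain N M where "\<And>k \<sigma>. k \<ge> N \<Longrightarrow> c k \<sigma> = 0" "\<And>k \<sigma>. k \<ge> M \<Longrightarrow> d k \<sigma> = 0"
    "\<And>k \<sigma>. \<not> singular_simplex k X \<sigma> \<Longrightarrow> c k \<sigma> = 0" "\<And>k \<sigma>. \<not> singular_simplex k X \<sigma> \<Longrightarrow> d k \<sigma> = 0"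
    unfolding cochains_iff by blast
  then show ?thesis by (intro cochainsI[where N = "max N M"]) auto
qed

lemma cochains_scale: "c \<in> cochains X \<Longrightarrow> (\<lambda>k \<sigma>. z * c k \<sigma>) \<in> cochains X"
  unfolding cochains_iff by fastforce

lemma cochains_zero: "(\<lambda>k \<sigma>. 0) \<in> cochains X"
  unfolding cochains_iff by auto

lemma cochains_sign_twist: "c \<in> cochains X \<Longrightarrow> sign_twist c \<in> cochains X"
  unfolding cochains_iff sign_twist_def by auto

lemma cocycles_iff: "c \<in> cocycles X \<longleftrightarrow> c \<in> cochains X \<and> coboundary X c = (\<lambda>k \<sigma>. 0)"
  by (auto simp: cocycles_def)

lemma cocycles_cup: "c \<in> cocycles X \<Longrightarrow> d \<in> cocycles X \<Longrightarrow> cup X c d \<in> cocycles X"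
  by (auto simp: cocycles_iff cup_cochains coboundary_cup cup_zero)

lemma cup_coboundary_left:
  "c \<in> cocycles X \<Longrightarrow> cup X (coboundary X x) c = coboundary X (cup X x c)"
  by (auto simp: cocycles_iff coboundary_cup cup_zero)

lemma cup_coboundary_right:
  assumes "c \<in> cocycles X" shows "cup X c (coboundary X x) = coboundary X (cup X (sign_twist c) x)"
proof -
  have "sign_twist (sign_twist c) = c"
    by (auto simp: sign_twist_def fun_eq_iff mult.assoc[symmetric] power_mult_distrib[symmetric])
  moreover have "coboundary X (sign_twist c) = (\<lambda>k \<sigma>. 0)"
    using assms by (simp add: coboundary_sign_twist cocycles_iff) (simp add: sign_twist_def)
  ultimately show ?thesis by (simp add: coboundary_cup cup_zero)
qed

lemma cocycle_algebra_simps: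
  "carrier (cocycle_algebra X) = cocycles X"
  "x \<otimes>\<^bsub>cocycle_algebra X\<^esub> y = cup X x y"
  "\<one>\<^bsub>cocycle_algebra X\<^esub> = unit_cochain X"
  "\<zero>\<^bsub>cocycle_algebra X\<^esub> = (\<lambda>k \<sigma>. 0)"
  "x \<oplus>\<^bsub>cocycle_algebra X\<^esub> y = (\<lambda>k \<sigma>. x k \<sigma> + y k \<sigma>)"
  "z \<odot>\<^bsub>cocycle_algebra X\<^esub> x = (\<lambda>k \<sigma>. z * x k \<sigma>)"
  "hcomp (cocycle_algebra X) j x = (\<lambda>k \<sigma>. if k = j then x k \<sigma> else 0)"
  by (simp_all add: cocycle_algebra_def unit_cochain_def)

lemma cocycles_scale: "c \<in> cocycles X \<Longrightarrow> (\<lambda>k \<sigma>. z * c k \<sigma>) \<in> cocycles X"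
  by (simp add: cocycles_iff cochains_scale coboundary_scale)

lemma cocycles_uminus: "c \<in> cocycles X \<Longrightarrow> (\<lambda>k \<sigma>. - c k \<sigma>) \<in> cocycles X"
  using cocycles_scale[of c X "- 1"] by simp

lemma cocycles_add: "c \<in> cocycles X \<Longrightarrow> d \<in> cocycles X \<Longrightarrow> (\<lambda>k \<sigma>. c k \<sigma> + d k \<sigma>) \<in> cocycles X"
  by (simp add: cocycles_iff cochains_add coboundary_add)

lemma cocycles_zero: "(\<lambda>k \<sigma>. 0) \<in> cocycles X"
  by (simp add: cocycles_iff cochains_zero coboundary_zero)

lemma abelian_group_cocycle_algebra: "abelian_group (cocycle_algebra X)"
proof (rule abelian_groupI; simp add: cocycle_algebra_simps cocycles_add cocycles_zero)
  fix x assume "x \<in> cocycles X"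
  then show "\<exists>y\<in>cocycles X. (\<lambda>k \<sigma>. y k \<sigma> + x k \<sigma>) = (\<lambda>k \<sigma>. 0)"
    by (intro bexI[of _ "\<lambda>k \<sigma>. - x k \<sigma>"]) (auto simp: cocycles_uminus)
qed (auto simp: add_ac)

lemma cocycle_algebra_uminus: "c \<in> cocycles X \<Longrightarrow> \<ominus>\<^bsub>cocycle_algebra X\<^esub> c = (\<lambda>k \<sigma>. - c k \<sigma>)"
  using abelian_group.minus_equality[OF abelian_group_cocycle_algebra[of X], of "\<lambda>k \<sigma>. - c k \<sigma>" c]
  by (simp add: cocycle_algebra_simps cocycles_uminus)

text \<open>By the Leibniz rule the product of a cocycle and a coboundary is a coboundary.\<close>

lemma algebra_modulo_coboundaries: "algebra_modulo (cocycle_algebra X) (coboundary X ` cochains X)"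
proof -
  interpret abelian_group "cocycle_algebra X" by (rule abelian_group_cocycle_algebra)
  have sub: "coboundary X ` cochains X \<subseteq> cocycles X"
    by (auto simp: cocycles_iff coboundary_cochains coboundary_coboundary)
  have zero: "(\<lambda>k \<sigma>. 0) \<in> coboundary X ` cochains X"
    using coboundary_zero[of X] cochains_zero[of X] by (metis imageI)
  have scale: "(\<lambda>k \<sigma>. z * i k \<sigma>) \<in> coboundary X ` cochains X" if i: "i \<in> coboundary X ` cochains X" for i z
  proof -
    obtain y where "y \<in> cochains X" "i = coboundary X y" using i by blast
    then show ?thesis using cochains_scale[of y X z] coboundary_scale[of X z y]
      by (intro image_eqI[of _ _ "\<lambda>k \<sigma>. z * y k \<sigma>"]) auto
  qed
  have add: "(\<lambda>k \<sigma>. i k \<sigma> + j k \<sigma>) \<in> coboundary X ` cochains X"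
    if ij: "i \<in> coboundary X ` cochains X" "j \<in> coboundary X ` cochains X" for i j
  proof -
    obtain y w where "y \<in> cochains X" "i = coboundary X y" "w \<in> cochains X" "j = coboundary X w"
      using ij by blast
    then show ?thesis using cochains_add[of y X w] coboundary_add[of X y w]
      by (intro image_eqI[of _ _ "\<lambda>k \<sigma>. y k \<sigma> + w k \<sigma>"]) auto
  qed
  have minus: "x \<ominus>\<^bsub>cocycle_algebra X\<^esub> y = (\<lambda>k \<sigma>. 0)" if "x \<in> cocycles X" "x = y" for x y
    using that by (simp add: a_minus_def cocycle_algebra_uminus cocycle_algebra_simps)
  have sg: "additive_subgroup (coboundary X ` cochains X) (cocycle_algebra X)"
  proof (rule additive_subgroupI, rule group.subgroupI)
    show "Group.group (add_monoid (cocycle_algebra X))" by (rule a_group)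
    fix a b assume a: "a \<in> coboundary X ` cochains X" and b: "b \<in> coboundary X ` cochains X"
    have "inv\<^bsub>add_monoid (cocycle_algebra X)\<^esub> a = (\<lambda>k \<sigma>. - a k \<sigma>)"
      using cocycle_algebra_uminus[of a X] a sub by (auto simp: a_inv_def)
    then show "inv\<^bsub>add_monoid (cocycle_algebra X)\<^esub> a \<in> coboundary X ` cochains X"
      using scale[OF a, of "- 1"] by simp
    show "a \<otimes>\<^bsub>add_monoid (cocycle_algebra X)\<^esub> b \<in> coboundary X ` cochains X"
      using add[OF a b] by (simp add: cocycle_algebra_simps)
  qed (use sub zero in \<open>auto simp: cocycle_algebra_simps\<close>)
  show ?thesis
  proof (intro algebra_modulo.intro algebra_modulo_axioms.intro abelian_group_cocycle_algebra sg; unfold cocycle_algebra_simps)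
    fix x i assume "x \<in> cocycles X" "i \<in> coboundary X ` cochains X"
    then show "cup X x i \<in> coboundary X ` cochains X" "cup X i x \<in> coboundary X ` cochains X"
      by (auto simp: cup_coboundary_left cup_coboundary_right cocycles_iff cup_cochains cochains_sign_twist)
  next
    fix x y z assume "x \<in> cocycles X" "y \<in> cocycles X" "z \<in> cocycles X"
    then show "cup X (cup X x y) z \<ominus>\<^bsub>cocycle_algebra X\<^esub> cup X x (cup X y z) \<in> coboundary X ` cochains X"
      by (subst minus) (auto simp: cup_assoc cocycles_cup zero)
  next
    fix x assume "x \<in> cocycles X"
    then show "cup X (unit_cochain X) x \<ominus>\<^bsub>cocycle_algebra X\<^esub> x \<in> coboundary X ` cochains X"
      "cup X x (unit_cochain X) \<ominus>\<^bsub>cocycle_algebra X\<^esub> x \<in> coboundary X ` cochains X"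
      by (auto simp: minus zero cup_unit_left cup_unit_right cocycles_iff)
  next
    show "unit_cochain X \<in> cocycles X" by (simp add: cocycles_iff unit_cochain_in coboundary_unit)
  qed (auto simp: cocycles_cup cocycles_scale scale cup_add_left cup_add_right cup_scale_left cup_scale_right
      fun_eq_iff algebra_simps)
qed


section \<open>Graded algebras with one-dimensional degree-zero part\<close>

locale connected_graded_algebra = complex_algebra R for R :: "'b graded_algebra" (structure) +
  assumes hcomp_closed [simp]: "x \<in> carrier R \<Longrightarrow> hcomp R k x \<in> carrier R"
    and hcomp_add: "x \<in> carrier R \<Longrightarrow> y \<in> carrier R \<Longrightarrow> hcomp R k (x \<oplus> y) = hcomp R k x \<oplus> hcomp R k y"
    and hcomp_smult: "x \<in> carrier R \<Longrightarrow> hcomp R k (c \<odot> x) = c \<odot> hcomp R k x"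
    and hcomp_hcomp: "x \<in> carrier R \<Longrightarrow> hcomp R j (hcomp R k x) = (if j = k then hcomp R k x else \<zero>)"
    and hcomp_decomposition:
      "x \<in> carrier R \<Longrightarrow> \<exists>M. (\<forall>k\<ge>M. hcomp R k x = \<zero>) \<and> x = (\<Oplus>k\<in>{..<M}. hcomp R k x)"
    and hcomp_mult: "x \<in> carrier R \<Longrightarrow> y \<in> carrier R \<Longrightarrow> hcomp R p x = x \<Longrightarrow> hcomp R q y = y \<Longrightarrow>
      hcomp R (p + q) (x \<otimes> y) = x \<otimes> y"
    and hcomp_one: "hcomp R 0 \<one> = \<one>"
    and hcomp_zero_scalar: "x \<in> carrier R \<Longrightarrow> \<exists>c. hcomp R 0 x = c \<odot> \<one>"
    and one_not_zero: "\<one> \<noteq> \<zero>"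
    and finite_dim: "finite_dimensional R"


subsection \<open>The degree-zero cohomology of a connected manifold\<close>

text \<open>Charts make a manifold locally path connected, and then connectedness implies path connectedness.\<close>

lemma path_connected_manifold:
  assumes "smooth_manifold n X \<A>" "connected_space X"
  shows "path_connected_space X"
proof -
  have "locally_path_connected_space X"
    unfolding locally_path_connected_space_def neighbourhood_base_of_def
  proof (intro ballI)
    fix x assume x: "x \<in> topspace X"
    have atlas: "smooth_atlas n X \<A>" using assms(1) by (simp add: smooth_manifold_def)
    then have "x \<in> \<Union>(fst ` \<A>)" using x by (simp add: smooth_atlas_def)
    then obtain U \<phi> where U: "(U, \<phi>) \<in> \<A>" "x \<in> U" by auto
    from atlas have charts: "\<forall>(U, \<phi>)\<in>\<A>. openin X U \<and> (\<exists>V. openin (Euclidean_space n) V \<and>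
        homeomorphic_map (subtopology X U) (subtopology (Euclidean_space n) V) \<phi>)"
      by (simp add: smooth_atlas_def)
    have oU: "openin X U" using bspec[OF charts U(1)] by simp
    obtain V where V: "openin (Euclidean_space n) V"
      "homeomorphic_map (subtopology X U) (subtopology (Euclidean_space n) V) \<phi>"
      using bspec[OF charts U(1)] by auto
    have "locally_path_connected_space (subtopology (Euclidean_space n) V)"
      using V(1) locally_path_connected_Euclidean_space locally_path_connected_space_open_subset by blast
    then have lU: "locally_path_connected_space (subtopology X U)"
      using homeomorphic_locally_path_connected_space[of "subtopology X U" "subtopology (Euclidean_space n) V"]
        V(2) homeomorphic_map_imp_homeomorphic_space by blast
    show "neighbourhood_base_at x (path_connectedin X) X"
      unfolding neighbourhood_base_at_def
    proof (intro allI impI, elim conjE)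
      fix W assume W: "openin X W" "x \<in> W"
      then have "openin (subtopology X U) (U \<inter> W)" by (auto simp: openin_subtopology)
      moreover have "x \<in> U \<inter> W" using U(2) W(2) by simp
      ultimately obtain S T where ST: "openin (subtopology X U) S" "path_connectedin (subtopology X U) T"
          "x \<in> S" "S \<subseteq> T" "T \<subseteq> U \<inter> W"
        using lU[unfolded locally_path_connected_space_def neighbourhood_base_of, rule_format, of "U \<inter> W" x] by blast
      have "openin X S" using ST(1) openin_open_subtopology[OF oU] by simp
      moreover have "path_connectedin X T" using ST(2) by (simp add: path_connectedin_subtopology)
      ultimately show "\<exists>S T. openin X S \<and> path_connectedin X T \<and> x \<in> S \<and> S \<subseteq> T \<and> T \<subseteq> W"
        using ST(3-5) by blast
    qed
  qed
  then show ?thesis using assms(2) path_connected_eq_connected_space by blast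
qed

abbreviation vertex0 :: "nat \<Rightarrow> real" where "vertex0 \<equiv> (\<lambda>j. if j = 0 then 1 else 0)"

definition point_simplex :: "'a \<Rightarrow> (nat \<Rightarrow> real) \<Rightarrow> 'a" where
  "point_simplex x = restrict (\<lambda>_. x) (standard_simplex 0)"

lemma singular_simplex_point: "x \<in> topspace X \<Longrightarrow> singular_simplex 0 X (point_simplex x)"
  unfolding singular_simplex_def point_simplex_def by (auto intro: continuous_map_eq[of _ _ "\<lambda>_. x"])

lemma singular_0_simplex_eq_point:
  assumes "singular_simplex 0 X \<sigma>"
  shows "\<sigma> vertex0 \<in> topspace X" "\<sigma> = point_simplex (\<sigma> vertex0)"
proof -
  have \<sigma>: "\<sigma> \<in> extensional (standard_simplex 0)" "\<sigma> ` standard_simplex 0 \<subseteq> topspace X"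
    using assms by (auto simp: singular_simplex_def continuous_map_def)
  then show "\<sigma> vertex0 \<in> topspace X" by auto
  show "\<sigma> = point_simplex (\<sigma> vertex0)"
    by (rule extensionalityI[OF \<sigma>(1)]) (auto simp: point_simplex_def standard_simplex_0)
qed

text \<open>A path, read as a singular simplex in the second barycentric coordinate.\<close>

lemma path_simplex:
  assumes "pathin X g"
  obtains \<tau> where "singular_simplex 1 X \<tau>" "singular_face 1 0 \<tau> = point_simplex (g 1)"
    "singular_face 1 1 \<tau> = point_simplex (g 0)"
proof
  define \<tau> where "\<tau> = restrict (\<lambda>x. g (x 1)) (standard_simplex 1)"
  have "continuous_map (subtopology (powertop_real UNIV) (standard_simplex 1)) (top_of_set {0..1}) (\<lambda>x. x (1::nat))"
    by (auto simp: continuous_map_in_subtopology standard_simplex_def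
        intro: continuous_map_from_subtopology continuous_map_product_projection)
  from continuous_map_compose[OF this] assms
  have "continuous_map (subtopology (powertop_real UNIV) (standard_simplex 1)) X (g \<circ> (\<lambda>x. x 1))"
    unfolding pathin_def by blast
  then show "singular_simplex 1 X \<tau>"
    unfolding singular_simplex_def \<tau>_def by (auto intro: continuous_map_eq)
  have "simplical_face 0 vertex0 \<in> standard_simplex 1" "simplical_face 1 vertex0 \<in> standard_simplex 1"
    using simplical_face_in_standard_simplex[of 1 _ vertex0] by auto
  then show "singular_face 1 0 \<tau> = point_simplex (g 1)" "singular_face 1 1 \<tau> = point_simplex (g 0)"
    by (auto simp: singular_face_def point_simplex_def \<tau>_def standard_simplex_0 simplical_face_def[of _ vertex0]
        intro!: restrict_ext)
qed

text \<open>The coboundary, evaluated on a path, is the difference of the values at its ends.\<close>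

lemma cocycle_degree_zero_constant:
  assumes "path_connected_space X" "c \<in> cocycles X" "x \<in> topspace X" "y \<in> topspace X"
  shows "c 0 (point_simplex x) = c 0 (point_simplex y)"
proof -
  obtain g where g: "pathin X g" "g 0 = x" "g 1 = y"
    using assms unfolding path_connected_space_def by blast
  from g(1) obtain \<tau> where \<tau>: "singular_simplex 1 X \<tau>" "singular_face 1 0 \<tau> = point_simplex (g 1)"
    "singular_face 1 1 \<tau> = point_simplex (g 0)"
    by (rule path_simplex)
  have "0 = coboundary X c 1 \<tau>" using assms(2) by (simp add: cocycles_iff)
  also have "\<dots> = c 0 (point_simplex y) - c 0 (point_simplex x)"
    using \<tau> g by (simp add: coboundary_def atMost_Suc)
  finally show ?thesis by simp
qed

lemma cocycle_degree_zero_scalar: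
  assumes "path_connected_space X" "c \<in> cocycles X" "x \<in> topspace X"
  shows "(\<lambda>k \<sigma>. if k = 0 then c k \<sigma> else 0) = (\<lambda>k \<sigma>. c 0 (point_simplex x) * unit_cochain X k \<sigma>)"
proof (intro ext)
  fix k :: nat and \<sigma>
  consider "k > 0" | "k = 0" "singular_simplex 0 X \<sigma>" | "k = 0" "\<not> singular_simplex 0 X \<sigma>" by blast
  then show "(if k = 0 then c k \<sigma> else 0) = c 0 (point_simplex x) * unit_cochain X k \<sigma>"
  proof cases
    case 2
    then have "c 0 \<sigma> = c 0 (point_simplex x)"
      using singular_0_simplex_eq_point[OF 2(2)] cocycle_degree_zero_constant[OF assms(1,2) _ assms(3)] by metis
    with 2 show ?thesis by (simp add: unit_cochain_def)
  qed (use assms(2) in \<open>auto simp: unit_cochain_def cocycles_iff cochains_iff\<close>)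
qed


subsection \<open>Cohomology\<close>

lemma cocycles_hcomp:
  assumes "c \<in> cocycles X" shows "(\<lambda>k \<sigma>. if k = j then c k \<sigma> else 0) \<in> cocycles X"
proof -
  have "(\<lambda>k \<sigma>. if k = j then c k \<sigma> else 0) \<in> cochains X"
    using assms unfolding cocycles_iff cochains_iff by fastforce
  moreover have "coboundary X (\<lambda>k \<sigma>. if k = j then c k \<sigma> else 0) = (\<lambda>k \<sigma>. if k = Suc j then coboundary X c k \<sigma> else 0)"
  proof (intro ext)
    fix k \<sigma>
    show "coboundary X (\<lambda>k \<sigma>. if k = j then c k \<sigma> else 0) k \<sigma> = (if k = Suc j then coboundary X c k \<sigma> else 0)"
      by (cases k) (auto simp: coboundary_def simp del: sum.atMost_Suc)
  qed
  moreover have "coboundary X c = (\<lambda>k \<sigma>. 0)" using assms by (simp add: cocycles_iff)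
  ultimately show ?thesis by (auto simp: cocycles_iff fun_eq_iff)
qed

lemma hcomp_coboundary:
  "(\<lambda>k \<sigma>. if k = j then coboundary X c k \<sigma> else 0)
     = coboundary X (\<lambda>k \<sigma>. if Suc k = j then c k \<sigma> else 0)"
proof (intro ext)
  fix k \<sigma>
  show "(if k = j then coboundary X c k \<sigma> else 0) = coboundary X (\<lambda>k \<sigma>. if Suc k = j then c k \<sigma> else 0) k \<sigma>"
    by (cases k) (auto simp: coboundary_def simp del: sum.atMost_Suc)
qed

lemma finsum_cocycles:
  "(\<And>i. i \<in> A \<Longrightarrow> f i \<in> cocycles X) \<Longrightarrow> finsum (cocycle_algebra X) f A = (\<lambda>k \<sigma>. \<Sum>i\<in>A. f i k \<sigma>)"
proof (induction A rule: infinite_finite_induct)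
  case (insert a A)
  interpret abelian_group "cocycle_algebra X" by (rule abelian_group_cocycle_algebra)
  have "f \<in> A \<rightarrow> carrier (cocycle_algebra X)" "f a \<in> carrier (cocycle_algebra X)"
    using insert.prems by (auto simp: cocycle_algebra_simps)
  with insert show ?case by (simp add: cocycle_algebra_simps)
qed (use abelian_group_cocycle_algebra[of X] in
    \<open>auto simp: abelian_monoid.finsum_infinite abelian_monoid.finsum_empty abelian_group_def cocycle_algebra_simps\<close>)

text \<open>
  The grading of cochains passes to classes, since the homogeneous components of a coboundary are
  coboundaries.  A cocycle of degree zero is constant on points, hence a multiple of the unit; the unit is
  not a coboundary because coboundaries vanish in degree zero.
\<close>

theorem connected_graded_algebra_cohomology:
  assumes manifold: "smooth_manifold n X \<A>" "connected_space X" "topspace X \<noteq> {}"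
    and fd: "finite_dimensional (cohomology X)"
  shows "connected_graded_algebra (cohomology X)"
proof -
  let ?I = "coboundary X ` cochains X"
  interpret algebra_modulo "cocycle_algebra X" ?I by (rule algebra_modulo_coboundaries)
  have Q: "cohomology X = Q" by (simp add: cohomology_def)
  interpret H: complex_algebra "cohomology X" unfolding Q by (rule complex_algebra_quot)
  have carr: "carrier (cohomology X) = coset ` cocycles X"
    by (simp add: Q carrier_quot cocycle_algebra_simps)
  note simps = cocycle_algebra_simps
  have hc: "hcomp (cohomology X) j (coset c) = coset (\<lambda>k \<sigma>. if k = j then c k \<sigma> else 0)" if "c \<in> cocycles X" for c j
  proof -
    have "hcomp (cocycle_algebra X) j i \<in> ?I" if i: "i \<in> ?I" for i
    proof -
      obtain y where y: "y \<in> cochains X" "i = coboundary X y" using i by blast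
      have "(\<lambda>k \<sigma>. if Suc k = j then y k \<sigma> else 0) \<in> cochains X"
        using y(1) unfolding cochains_iff by fastforce
      then show ?thesis unfolding y(2) simps hcomp_coboundary by (rule imageI)
    qed
    then have "hcomp Q j (coset c) = coset (hcomp (cocycle_algebra X) j c)"
      using that by (intro hcomp_coset) (auto simp: simps cocycles_hcomp fun_eq_iff)
    then show ?thesis by (simp add: Q simps)
  qed
  have add: "coset c \<oplus>\<^bsub>cohomology X\<^esub> coset d = coset (\<lambda>k \<sigma>. c k \<sigma> + d k \<sigma>)" if "c \<in> cocycles X" "d \<in> cocycles X" for c d
    using add_coset[of c d] that by (simp add: Q simps)
  have smult: "z \<odot>\<^bsub>cohomology X\<^esub> coset c = coset (\<lambda>k \<sigma>. z * c k \<sigma>)" if "c \<in> cocycles X" for c z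
    using smult_coset[of c z] that by (simp add: Q simps)
  have mult: "coset c \<otimes>\<^bsub>cohomology X\<^esub> coset d = coset (cup X c d)" if "c \<in> cocycles X" "d \<in> cocycles X" for c d
    using mult_coset[of c d] that by (simp add: Q simps)
  have one: "\<one>\<^bsub>cohomology X\<^esub> = coset (unit_cochain X)" and zero: "\<zero>\<^bsub>cohomology X\<^esub> = coset (\<lambda>k \<sigma>. 0)"
    by (simp_all add: Q one_quot zero_quot simps)
  have unit: "unit_cochain X \<in> cocycles X" by (simp add: cocycles_iff unit_cochain_in coboundary_unit)
  obtain x where x: "x \<in> topspace X" using manifold(3) by blast
  have pc: "path_connected_space X" using path_connected_manifold manifold(1,2) by blast
  have hcup: "(\<lambda>k \<sigma>. if k = p + q then cup X (\<lambda>k \<sigma>. if k = p then c k \<sigma> else 0) (\<lambda>k \<sigma>. if k = q then d k \<sigma> else 0) k \<sigma> else 0)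
     = cup X (\<lambda>k \<sigma>. if k = p then c k \<sigma> else 0) (\<lambda>k \<sigma>. if k = q then d k \<sigma> else 0)" for p q c d
  proof (intro ext)
    fix k \<sigma>
    have "(\<Sum>s\<le>k. (if s = p then c s (front_face s \<sigma>) else 0) * (if k - s = q then d (k - s) (back_face s (k - s) \<sigma>) else 0)) = 0"
      if "k \<noteq> p + q"
      using that by (intro sum.neutral) auto
    then show "(if k = p + q then cup X (\<lambda>k \<sigma>. if k = p then c k \<sigma> else 0) (\<lambda>k \<sigma>. if k = q then d k \<sigma> else 0) k \<sigma> else 0)
     = cup X (\<lambda>k \<sigma>. if k = p then c k \<sigma> else 0) (\<lambda>k \<sigma>. if k = q then d k \<sigma> else 0) k \<sigma>"
      by (cases "k = p + q") (simp_all add: cup_def)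
  qed
  have coset_sum: "finsum (cohomology X) (\<lambda>i. coset (f i)) A = coset (\<lambda>k \<sigma>. \<Sum>i\<in>A. f i k \<sigma>)"
    if "\<And>i. i \<in> A \<Longrightarrow> f i \<in> cocycles X" for f and A :: "nat set"
    using that
  proof (induction A rule: infinite_finite_induct)
    case (insert a A)
    have "(\<lambda>k \<sigma>. \<Sum>i\<in>A. f i k \<sigma>) = finsum (cocycle_algebra X) f A"
      using insert by (simp add: finsum_cocycles)
    also have "\<dots> \<in> carrier (cocycle_algebra X)" using insert by (intro finsum_closed) (auto simp: simps)
    finally have "(\<lambda>k \<sigma>. \<Sum>i\<in>A. f i k \<sigma>) \<in> cocycles X" by (simp add: simps)
    moreover have "(\<lambda>i. coset (f i)) \<in> A \<rightarrow> carrier (cohomology X)" "coset (f a) \<in> carrier (cohomology X)"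
      using insert.prems by (auto simp: carr)
    ultimately show ?case using insert by (simp add: add)
  qed (auto simp: zero)
  show ?thesis
  proof (intro connected_graded_algebra.intro connected_graded_algebra_axioms.intro H.complex_algebra_axioms fd)
    fix S assume "S \<in> carrier (cohomology X)"
    then obtain c where c: "c \<in> cocycles X" "S = coset c" by (auto simp: carr)
    show "hcomp (cohomology X) k S \<in> carrier (cohomology X)" for k
      using c by (simp add: hc carr cocycles_hcomp)
    show "hcomp (cohomology X) k (z \<odot>\<^bsub>cohomology X\<^esub> S) = z \<odot>\<^bsub>cohomology X\<^esub> hcomp (cohomology X) k S" for k z
      using c by (simp add: hc smult cocycles_hcomp cocycles_scale) (rule arg_cong[of _ _ coset], auto simp: fun_eq_iff)
    show "hcomp (cohomology X) j (hcomp (cohomology X) k S) = (if j = k then hcomp (cohomology X) k S else \<zero>\<^bsub>cohomology X\<^esub>)" for j k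
      using c by (auto simp: hc cocycles_hcomp zero fun_eq_iff intro!: arg_cong[of _ _ coset])
    show "\<exists>z. hcomp (cohomology X) 0 S = z \<odot>\<^bsub>cohomology X\<^esub> \<one>\<^bsub>cohomology X\<^esub>"
      using c cocycle_degree_zero_scalar[OF pc c(1) x] by (auto simp: hc one smult unit)
    obtain M where M: "\<And>k \<sigma>. k \<ge> M \<Longrightarrow> c k \<sigma> = 0" using c(1) unfolding cocycles_iff cochains_iff by blast
    show "\<exists>M. (\<forall>k\<ge>M. hcomp (cohomology X) k S = \<zero>\<^bsub>cohomology X\<^esub>) \<and>
        S = (\<Oplus>\<^bsub>cohomology X\<^esub>k\<in>{..<M}. hcomp (cohomology X) k S)"
    proof (intro exI[of _ M] conjI allI impI)
      fix k assume "k \<ge> M"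
      then show "hcomp (cohomology X) k S = \<zero>\<^bsub>cohomology X\<^esub>"
        using c M by (simp add: hc zero) (rule arg_cong[of _ _ coset], auto simp: fun_eq_iff)
    next
      have "(\<lambda>k \<sigma>. \<Sum>j<M. if k = j then c k \<sigma> else 0) = c"
        using M by (auto simp: fun_eq_iff not_less)
      then show "S = (\<Oplus>\<^bsub>cohomology X\<^esub>k\<in>{..<M}. hcomp (cohomology X) k S)"
        using c by (simp add: hc coset_sum cocycles_hcomp)
    qed
    fix T assume "T \<in> carrier (cohomology X)"
    then obtain d where d: "d \<in> cocycles X" "T = coset d" by (auto simp: carr)
    show "hcomp (cohomology X) k (S \<oplus>\<^bsub>cohomology X\<^esub> T) = hcomp (cohomology X) k S \<oplus>\<^bsub>cohomology X\<^esub> hcomp (cohomology X) k T" for k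
      using c d by (simp add: hc add cocycles_hcomp cocycles_add) (rule arg_cong[of _ _ coset], auto simp: fun_eq_iff)
    fix p q assume pq: "hcomp (cohomology X) p S = S" "hcomp (cohomology X) q T = T"
    define c' where "c' = (\<lambda>k \<sigma>. if k = p then c k \<sigma> else 0)"
    define d' where "d' = (\<lambda>k \<sigma>. if k = q then d k \<sigma> else 0)"
    have c': "c' \<in> cocycles X" "S = coset c'" using c pq(1) by (auto simp: hc c'_def cocycles_hcomp)
    have d': "d' \<in> cocycles X" "T = coset d'" using d pq(2) by (auto simp: hc d'_def cocycles_hcomp)
    show "hcomp (cohomology X) (p + q) (S \<otimes>\<^bsub>cohomology X\<^esub> T) = S \<otimes>\<^bsub>cohomology X\<^esub> T"
      using c' d' hcup[of p q c d, folded c'_def d'_def] by (simp add: mult hc cocycles_cup)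
  next
    show "hcomp (cohomology X) 0 \<one>\<^bsub>cohomology X\<^esub> = \<one>\<^bsub>cohomology X\<^esub>"
      by (simp add: one hc unit) (rule arg_cong[of _ _ coset], auto simp: unit_cochain_def fun_eq_iff)
    show "\<one>\<^bsub>cohomology X\<^esub> \<noteq> \<zero>\<^bsub>cohomology X\<^esub>"
    proof
      assume "\<one>\<^bsub>cohomology X\<^esub> = \<zero>\<^bsub>cohomology X\<^esub>"
      then have "unit_cochain X \<in> coset (\<lambda>k \<sigma>. 0)"
        using a_rcos_self[of "unit_cochain X"] unit by (simp add: one zero simps)
      then obtain y where "unit_cochain X = coboundary X y" by (auto simp: in_coset_iff simps)
      then have "unit_cochain X 0 (point_simplex x) = 0" by (simp add: coboundary_def)
      then show False using singular_simplex_point[OF x] by (simp add: unit_cochain_def)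
    qed
  qed
qed


section \<open>Exponent classes\<close>

text \<open>
  What is required of a class in order that its functions are values of power series at its nilpotent part.
  Of the grading only the projection to degree zero enters, so that the setting also applies to the tensor
  product, where no more of the grading is established.
\<close>

locale exponent_class = complex_algebra R for R :: "'b graded_algebra" (structure) +
  fixes \<beta> :: 'b and \<beta>0 :: complex and N :: nat
  assumes hcomp0_closed: "x \<in> carrier R \<Longrightarrow> hcomp R 0 x \<in> carrier R"
    and hcomp0_add: "x \<in> carrier R \<Longrightarrow> y \<in> carrier R \<Longrightarrow> hcomp R 0 (x \<oplus> y) = hcomp R 0 x \<oplus> hcomp R 0 y"
    and hcomp0_smult: "x \<in> carrier R \<Longrightarrow> hcomp R 0 (c \<odot> x) = c \<odot> hcomp R 0 x"
    and hcomp0_one: "hcomp R 0 \<one> = \<one>"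
    and one_not_zero: "\<one> \<noteq> \<zero>"
    and exponent_closed: "\<beta> \<in> carrier R"
    and hcomp0_exponent: "hcomp R 0 \<beta> = \<beta>0 \<odot> \<one>"
    and exponent_nilpotent: "positive_part R \<beta> [^] N = \<zero>"
begin

abbreviation "P \<equiv> positive_part R \<beta>"

lemma P_closed: "P \<in> carrier R"
  by (simp add: positive_part_def exponent_closed hcomp0_closed)

abbreviation "eval_P \<equiv> fps_eval P"

lemmas eval_P_closed = fps_eval_closed[OF P_closed exponent_nilpotent]
lemmas eval_P_mult = fps_eval_mult[OF P_closed exponent_nilpotent]
lemmas eval_P_one = fps_eval_one[OF P_closed exponent_nilpotent]
lemmas eval_P_const_mult = fps_eval_const_mult[OF P_closed exponent_nilpotent]
lemmas span_families_eval_P = span_families_fps_eval[OF P_closed exponent_nilpotent]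

lemma (in complex_algebra) smult_one_inject:
  assumes one_not_zero: "\<one> \<noteq> \<zero>" and eq: "z \<odot> \<one> = w \<odot> \<one>" shows "z = w"
proof (rule ccontr)
  assume "z \<noteq> w"
  have "(z - w) \<odot> \<one> = z \<odot> \<one> \<oplus> (- 1) \<odot> (w \<odot> \<one>)"
    using smult_l_distr[of \<one> z "- w"] by (simp add: smult_smult)
  also have "\<dots> = \<zero>" using eq by (simp add: smult_minus_one r_neg)
  finally have "(1 / (z - w)) \<odot> ((z - w) \<odot> \<one>) = \<zero>" by simp
  then show False using \<open>z \<noteq> w\<close> one_not_zero by (simp add: smult_smult)
qed

lemma degree_zero_eqI: "hcomp R 0 x = z \<odot> \<one> \<Longrightarrow> degree_zero R x = z"
  unfolding degree_zero_def by (rule the_equality) (auto intro: smult_one_inject[OF one_not_zero])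

lemma nat_plus_closed: "x \<in> carrier R \<Longrightarrow> nat_plus R n x \<in> carrier R"
  by (simp add: nat_plus_def)

lemma hcomp0_nat_plus: "x \<in> carrier R \<Longrightarrow> hcomp R 0 x = z \<odot> \<one> \<Longrightarrow> hcomp R 0 (nat_plus R n x) = (of_nat n + z) \<odot> \<one>"
  by (simp add: nat_plus_def hcomp0_add hcomp0_smult hcomp0_one smult_l_distr)

lemma positive_part_nat_plus: "x \<in> carrier R \<Longrightarrow> positive_part R (nat_plus R n x) = positive_part R x"
proof -
  assume x: "x \<in> carrier R"
  have "positive_part R (nat_plus R n x) = (of_nat n \<odot> \<one> \<oplus> x) \<ominus> (of_nat n \<odot> \<one> \<oplus> hcomp R 0 x)"
    using x by (simp add: positive_part_def nat_plus_def hcomp0_add hcomp0_smult hcomp0_one)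
  also have "\<dots> = x \<ominus> hcomp R 0 x"
    using x hcomp0_closed[OF x] smult_closed[of \<one> "of_nat n"] by algebra
  finally show ?thesis by (simp add: positive_part_def)
qed

lemma positive_part_smult: "x \<in> carrier R \<Longrightarrow> positive_part R (z \<odot> x) = z \<odot> positive_part R x"
  by (simp add: positive_part_def hcomp0_smult hcomp0_closed a_minus_def smult_r_distr smult_smult
      smult_minus_one[symmetric] mult.commute)

lemma class_fun_nat_plus_twice:
  "class_fun R f (nat_plus R k (nat_plus R n \<beta>)) = eval_P (fps_expansion f (of_nat k + (of_nat n + \<beta>0)))"
  by (simp add: class_fun_eq_fps_eval positive_part_nat_plus exponent_closed nat_plus_closed
      degree_zero_eqI[OF hcomp0_nat_plus[OF nat_plus_closed hcomp0_nat_plus[OF exponent_closed hcomp0_exponent]]])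

lemma smult_power: "x \<in> carrier R \<Longrightarrow> (z \<odot> x) [^] (k::nat) = z ^ k \<odot> (x [^] k)"
  by (induction k) (auto simp: smult_mult_left smult_mult_right smult_smult mult.commute)

lemma higher_deriv_exp: "(deriv ^^ k) exp = (exp :: complex \<Rightarrow> complex)"
proof (induction k)
  case (Suc k)
  have "deriv exp z = exp z" for z :: complex by (rule DERIV_imp_deriv) (rule DERIV_exp)
  then have "deriv exp = (exp :: complex \<Rightarrow> complex)" by (rule ext)
  with Suc show ?case by simp
qed auto

text \<open>
  Here the exponential is expanded in \<open>log s\<close> times the nilpotent part, and the powers of \<open>log s\<close> are
  absorbed into the coefficients, which gives a series in the nilpotent part itself.
\<close>

lemma class_powr_nat_plus:
  "class_powr R s (nat_plus R n \<beta>) = eval_P (fps_const (exp (complex_of_real (ln s) * (of_nat n + \<beta>0))) * fps_exp (of_real (ln s)))"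
proof -
  let ?l = "complex_of_real (ln s)" and ?F = "fps_expansion exp (complex_of_real (ln s) * (of_nat n + \<beta>0))"
  have deg: "degree_zero R (?l \<odot> nat_plus R n \<beta>) = ?l * (of_nat n + \<beta>0)"
    by (rule degree_zero_eqI)
      (simp add: hcomp0_smult nat_plus_closed exponent_closed hcomp0_nat_plus[OF exponent_closed hcomp0_exponent] smult_smult)
  have pos: "positive_part R (?l \<odot> nat_plus R n \<beta>) = ?l \<odot> P"
    by (simp add: positive_part_smult nat_plus_closed exponent_closed positive_part_nat_plus)
  have nil: "(?l \<odot> P) [^] N = \<zero>" by (simp add: smult_power P_closed exponent_nilpotent)
  have "class_powr R s (nat_plus R n \<beta>) = fps_eval (?l \<odot> P) ?F"
    by (simp add: class_powr_def class_fun_eq_fps_eval deg pos)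
  also have "\<dots> = (\<Oplus>k\<in>{..<N}. fps_nth ?F k \<odot> ((?l \<odot> P) [^] k))"
    by (rule fps_eval_truncate[OF smult_closed[OF P_closed] nil])
  also have "\<dots> = (\<Oplus>k\<in>{..<N}. fps_nth (fps_const (exp (complex_of_real (ln s) * (of_nat n + \<beta>0))) * fps_exp ?l) k \<odot> (P [^] k))"
    using P_closed by (intro finsum_cong')
      (auto simp: smult_power smult_smult fps_expansion_def higher_deriv_exp Pi_iff)
  also have "\<dots> = eval_P (fps_const (exp (complex_of_real (ln s) * (of_nat n + \<beta>0))) * fps_exp ?l)"
    by (rule fps_eval_truncate[OF P_closed exponent_nilpotent, symmetric])
  finally show ?thesis .
qed

end


context connected_graded_algebra
begin

lemma hcomp_zero: "hcomp R k \<zero> = \<zero>"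
  using hcomp_smult[of \<zero> k 0] by simp

lemma hcomp_uminus: "x \<in> carrier R \<Longrightarrow> hcomp R k (\<ominus> x) = \<ominus> hcomp R k x"
  using hcomp_smult[of x k "- 1"] by (simp add: smult_minus_one)

lemma degree_zero:
  assumes "x \<in> carrier R" shows "hcomp R 0 x = degree_zero R x \<odot> \<one>"
proof -
  obtain z where z: "hcomp R 0 x = z \<odot> \<one>" using hcomp_zero_scalar[OF assms] by blast
  then have "degree_zero R x = z"
    unfolding degree_zero_def by (intro the_equality) (auto intro: smult_one_inject[OF one_not_zero])
  with z show ?thesis by simp
qed

lemma degree_zero_add:
  assumes "x \<in> carrier R" "y \<in> carrier R"
  shows "degree_zero R (x \<oplus> y) = degree_zero R x + degree_zero R y"
  by (rule smult_one_inject[OF one_not_zero])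
    (use assms in \<open>simp add: degree_zero[symmetric] hcomp_add smult_l_distr\<close>)

lemma degree_zero_smult:
  assumes "x \<in> carrier R" shows "degree_zero R (z \<odot> x) = z * degree_zero R x"
  by (rule smult_one_inject[OF one_not_zero])
    (use assms in \<open>simp add: degree_zero[symmetric] hcomp_smult smult_smult[symmetric]\<close>)

lemma degree_zero_one: "degree_zero R \<one> = 1"
  by (rule smult_one_inject[OF one_not_zero]) (simp add: degree_zero[symmetric] hcomp_one)

lemma hcomp_finsum: "f \<in> A \<rightarrow> carrier R \<Longrightarrow> hcomp R k (finsum R f A) = (\<Oplus>i\<in>A. hcomp R k (f i))"
proof (induction A rule: infinite_finite_induct)
  case (insert a A)
  then have "f \<in> A \<rightarrow> carrier R" "f a \<in> carrier R" by auto
  moreover from this have "(\<lambda>i. hcomp R k (f i)) \<in> A \<rightarrow> carrier R" by (auto simp: Pi_iff)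
  ultimately have "f \<in> A \<rightarrow> carrier R" "f a \<in> carrier R" "(\<lambda>i. hcomp R k (f i)) \<in> A \<rightarrow> carrier R" by auto
  with insert show ?case by (simp add: hcomp_add)
qed (auto simp: hcomp_zero)

text \<open>In a finite-dimensional algebra the degrees of a finite spanning set bound all degrees.\<close>

lemma hcomp_bounded: "\<exists>N. \<forall>x\<in>carrier R. \<forall>k\<ge>N. hcomp R k x = \<zero>"
proof -
  obtain B where B: "finite B" "B \<subseteq> carrier R" "\<And>x. x \<in> carrier R \<Longrightarrow> \<exists>c. x = (\<Oplus>b\<in>B. c b \<odot> b)"
    using finite_dim unfolding finite_dimensional_def by blast
  have "\<forall>b\<in>B. \<exists>M. \<forall>k\<ge>M. hcomp R k b = \<zero>" using hcomp_decomposition B(2) by blast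
  then obtain M where M: "\<And>b k. b \<in> B \<Longrightarrow> k \<ge> M b \<Longrightarrow> hcomp R k b = \<zero>" by metis
  show ?thesis
  proof (intro exI ballI allI impI)
    fix x k assume x: "x \<in> carrier R" and k: "k \<ge> sum M B"
    obtain c where c: "x = (\<Oplus>b\<in>B. c b \<odot> b)" using B(3)[OF x] by blast
    have "hcomp R k x = (\<Oplus>b\<in>B. hcomp R k (c b \<odot> b))"
      unfolding c using B(2) by (intro hcomp_finsum) auto
    also have "\<dots> = (\<Oplus>b\<in>B. \<zero>)"
    proof (rule finsum_cong')
      fix b assume b: "b \<in> B"
      then have "M b \<le> sum M B" using B(1) by (intro member_le_sum) auto
      then show "hcomp R k (c b \<odot> b) = \<zero>" using M[of b k] k b B(2) by (auto simp: hcomp_smult)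
    qed auto
    finally show "hcomp R k x = \<zero>" by simp
  qed
qed

lemma hcomp_decomposition_bounded:
  assumes "\<And>x k. x \<in> carrier R \<Longrightarrow> k \<ge> N \<Longrightarrow> hcomp R k x = \<zero>" "x \<in> carrier R"
  shows "x = (\<Oplus>k\<in>{..<N}. hcomp R k x)"
proof -
  obtain M where M: "\<And>k. k \<ge> M \<Longrightarrow> hcomp R k x = \<zero>" "x = (\<Oplus>k\<in>{..<M}. hcomp R k x)"
    using hcomp_decomposition[OF assms(2)] by blast
  note M(2)
  also have "(\<Oplus>k\<in>{..<M}. hcomp R k x) = (\<Oplus>k\<in>{..<max M N}. hcomp R k x)"
    by (rule add.finprod_mono_neutral_cong_left) (use assms(2) M(1) in auto)
  also have "\<dots> = (\<Oplus>k\<in>{..<N}. hcomp R k x)"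
    by (rule add.finprod_mono_neutral_cong_right) (use assms in auto)
  finally show ?thesis .
qed

definition supported :: "nat set \<Rightarrow> 'b set" where
  "supported S = {x \<in> carrier R. \<forall>k. k \<notin> S \<longrightarrow> hcomp R k x = \<zero>}"

lemma supported_closed: "x \<in> supported S \<Longrightarrow> x \<in> carrier R"
  by (simp add: supported_def)

lemma supported_finsum: "(\<And>i. i \<in> A \<Longrightarrow> f i \<in> supported S) \<Longrightarrow> finsum R f A \<in> supported S"
proof -
  assume *: "\<And>i. i \<in> A \<Longrightarrow> f i \<in> supported S"
  then have f: "f \<in> A \<rightarrow> carrier R" by (auto simp: supported_def)
  have "hcomp R k (finsum R f A) = \<zero>" if "k \<notin> S" for k
  proof -
    have "(\<Oplus>i\<in>A. hcomp R k (f i)) = (\<Oplus>i\<in>A. \<zero>)"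
      using * that by (intro finsum_cong') (auto simp: supported_def)
    then show ?thesis by (simp add: hcomp_finsum[OF f])
  qed
  then show ?thesis using f by (auto simp: supported_def)
qed

lemma supported_smult: "x \<in> supported S \<Longrightarrow> z \<odot> x \<in> supported S"
  by (auto simp: supported_def hcomp_smult)

lemma supported_mult:
  assumes x: "x \<in> supported S" and y: "y \<in> supported T" and ST: "\<And>i j. i \<in> S \<Longrightarrow> j \<in> T \<Longrightarrow> i + j \<in> U"
  shows "x \<otimes> y \<in> supported U"
proof -
  obtain N where N: "\<And>x k. x \<in> carrier R \<Longrightarrow> k \<ge> N \<Longrightarrow> hcomp R k x = \<zero>" using hcomp_bounded by blast
  note xy = supported_closed[OF x] supported_closed[OF y]
  have 1: "hcomp R i x \<otimes> hcomp R j y \<in> supported U" for i j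
  proof (cases "i \<in> S \<and> j \<in> T")
    case True
    let ?z = "hcomp R i x \<otimes> hcomp R j y"
    have z: "hcomp R (i + j) ?z = ?z" using xy by (intro hcomp_mult) (auto simp: hcomp_hcomp)
    have "hcomp R k ?z = \<zero>" if "k \<notin> U" for k
    proof -
      have "k \<noteq> i + j" using ST True that by blast
      then show ?thesis using hcomp_hcomp[of ?z k "i + j"] xy by (simp add: z)
    qed
    then show ?thesis using xy by (simp add: supported_def)
  next
    case False
    then have "hcomp R i x \<otimes> hcomp R j y = \<zero>" using x y xy by (auto simp: supported_def)
    then show ?thesis by (simp add: supported_def hcomp_zero)
  qed
  have "x = (\<Oplus>i\<in>{..<N}. hcomp R i x)" by (rule hcomp_decomposition_bounded[OF N xy(1)])
  then have "x \<otimes> y = (\<Oplus>i\<in>{..<N}. hcomp R i x) \<otimes> y" by (rule arg_cong)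
  also have "\<dots> = (\<Oplus>i\<in>{..<N}. hcomp R i x \<otimes> y)"
    by (rule finsum_ldistr) (use xy in auto)
  also have "\<dots> \<in> supported U"
  proof (rule supported_finsum)
    fix i
    have "y = (\<Oplus>j\<in>{..<N}. hcomp R j y)" by (rule hcomp_decomposition_bounded[OF N xy(2)])
    then have "hcomp R i x \<otimes> y = hcomp R i x \<otimes> (\<Oplus>j\<in>{..<N}. hcomp R j y)" by (rule arg_cong)
    also have "\<dots> = (\<Oplus>j\<in>{..<N}. hcomp R i x \<otimes> hcomp R j y)"
      by (rule finsum_rdistr) (use xy in auto)
    also have "\<dots> \<in> supported U" by (intro supported_finsum 1)
    finally show "hcomp R i x \<otimes> y \<in> supported U" .
  qed
  finally show ?thesis .
qed

lemma positive_part_supported: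
  assumes "x \<in> supported S" shows "positive_part R x \<in> supported (S - {0})"
proof -
  have x: "x \<in> carrier R" using assms by (simp add: supported_def)
  have "hcomp R k (positive_part R x) = (if k = 0 then \<zero> else hcomp R k x)" for k
    using x by (simp add: positive_part_def a_minus_def hcomp_add hcomp_uminus hcomp_hcomp r_neg)
  then show ?thesis using assms x by (auto simp: supported_def positive_part_def)
qed

lemma carrier_supported: "x \<in> carrier R \<Longrightarrow> x \<in> supported UNIV"
  by (simp add: supported_def)

text \<open>The \<open>k\<close>-th power lives in degrees at least \<open>k\<close>, and degrees are bounded.\<close>

lemma positive_part_nilpotent:
  assumes "x \<in> carrier R" shows "\<exists>N. positive_part R x [^] (N::nat) = \<zero>"
proof -
  obtain N where N: "\<And>x k. x \<in> carrier R \<Longrightarrow> k \<ge> N \<Longrightarrow> hcomp R k x = \<zero>" using hcomp_bounded by blast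
  have "positive_part R x [^] k \<in> supported {k..}" for k :: nat
  proof (induction k)
    case 0
    then show ?case using carrier_supported[of \<one>] by (simp add: supported_def)
  next
    case (Suc k)
    then show ?case
      using supported_mult[OF Suc positive_part_supported[OF carrier_supported[OF assms]], of "{Suc k..}"] by auto
  qed
  then have *: "positive_part R x [^] N \<in> supported {N..}" .
  then have c: "positive_part R x [^] N \<in> carrier R" by (rule supported_closed)
  have "positive_part R x [^] N = (\<Oplus>k\<in>{..<N}. hcomp R k (positive_part R x [^] N))"
    by (rule hcomp_decomposition_bounded[OF N c])
  also have "\<dots> = (\<Oplus>k\<in>{..<N}. \<zero>)" using * by (intro finsum_cong') (auto simp: supported_def)
  finally show ?thesis by auto
qed

lemma even_class_iff: "even_class R x \<longleftrightarrow> x \<in> supported {k. even k}"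
  by (auto simp: even_class_def supported_def)

lemma even_one: "even_class R \<one>"
proof -
  have "hcomp R k \<one> = \<zero>" if "odd k" for k
    using hcomp_hcomp[of \<one> k 0] that by (cases k) (simp_all add: hcomp_one)
  then show ?thesis by (simp add: even_class_def)
qed

lemma even_mult:
  assumes "even_class R x" "even_class R y" shows "even_class R (x \<otimes> y)"
  using assms supported_mult[of x "{k. even k}" y "{k. even k}" "{k. even k}"] by (simp add: even_class_iff)

lemma even_positive_part:
  assumes "even_class R x" shows "even_class R (positive_part R x)"
  using assms positive_part_supported[of x "{k. even k}"] by (auto simp: even_class_iff supported_def)

lemma even_power: "even_class R x \<Longrightarrow> even_class R (x [^] (k::nat))"
  by (induction k) (simp_all add: even_one even_mult)

lemma even_fps_eval:
  assumes "even_class R x" shows "even_class R (fps_eval x F)"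
proof -
  have "c \<odot> x [^] (k::nat) \<in> supported {k. even k}" for c k
    using even_power[OF assms, of k] unfolding even_class_iff by (rule supported_smult)
  then show ?thesis unfolding fps_eval_def even_class_iff by (intro supported_finsum)
qed

lemma exponent_class_if_closed:
  assumes "\<beta> \<in> carrier R"
  shows "\<exists>N \<beta>0. exponent_class R \<beta> \<beta>0 N"
proof -
  obtain N where N: "positive_part R \<beta> [^] (N::nat) = \<zero>" using positive_part_nilpotent[OF assms] by blast
  obtain z where z: "hcomp R 0 \<beta> = z \<odot> \<one>" using hcomp_zero_scalar[OF assms] by blast
  have "exponent_class_axioms R \<beta> z N"
    by (rule exponent_class_axioms.intro)
      (simp_all add: assms N z hcomp_add hcomp_smult hcomp_one one_not_zero)
  then have "exponent_class R \<beta> z N" by (rule exponent_class.intro[OF complex_algebra_axioms])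
  then show ?thesis by blast
qed

end


section \<open>The tensor product\<close>

subsection \<open>Linear extension of functions on pairs\<close>

abbreviation scale :: "complex \<Rightarrow> ('k \<Rightarrow>\<^sub>0 complex) \<Rightarrow> ('k \<Rightarrow>\<^sub>0 complex)" where
  "scale z \<equiv> Poly_Mapping.map ((*) z)"

lemma lookup_scale: "Poly_Mapping.lookup (scale z F) k = z * Poly_Mapping.lookup F k"
  by (simp add: Poly_Mapping.map.rep_eq when_def)

lemma scale_add: "scale z (F + G) = scale z F + scale z G"
  by (rule poly_mapping_eqI) (simp add: lookup_scale lookup_add distrib_left)

lemma scale_minus: "scale z (F - G) = scale z F - scale z G"
  by (rule poly_mapping_eqI) (simp add: lookup_scale lookup_minus right_diff_distrib)

lemma scale_add_left: "scale (z + w) F = scale z F + scale w F"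
  by (rule poly_mapping_eqI) (simp add: lookup_scale lookup_add distrib_right)

lemma scale_scale: "scale z (scale w F) = scale (z * w) F"
  by (rule poly_mapping_eqI) (simp add: lookup_scale)

lemma scale_one [simp]: "scale 1 F = F"
  by (rule poly_mapping_eqI) (simp add: lookup_scale)

lemma scale_zero [simp]: "scale 0 F = 0" "scale z 0 = 0"
  by (rule poly_mapping_eqI, simp add: lookup_scale)+

lemma scale_uminus: "scale (- 1) F = - F"
  by (rule poly_mapping_eqI) (simp add: lookup_scale)

lemma scale_single: "scale z (Poly_Mapping.single k c) = Poly_Mapping.single k (z * c)"
  by (rule poly_mapping_eqI) (simp add: lookup_scale lookup_single when_def)

lemma scale_sum: "scale z (sum f A) = (\<Sum>i\<in>A. scale z (f i))"
  by (induction A rule: infinite_finite_induct) (simp_all add: scale_add)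

lemma keys_scale: "Poly_Mapping.keys (scale z F) \<subseteq> Poly_Mapping.keys F"
  by (auto simp: in_keys_iff lookup_scale)

definition extend_linear :: "('k \<Rightarrow> ('l \<Rightarrow>\<^sub>0 complex)) \<Rightarrow> ('k \<Rightarrow>\<^sub>0 complex) \<Rightarrow> ('l \<Rightarrow>\<^sub>0 complex)" where
  "extend_linear g F = (\<Sum>k\<in>Poly_Mapping.keys F. scale (Poly_Mapping.lookup F k) (g k))"

lemma extend_linear_superset:
  "finite S \<Longrightarrow> Poly_Mapping.keys F \<subseteq> S \<Longrightarrow> extend_linear g F = (\<Sum>k\<in>S. scale (Poly_Mapping.lookup F k) (g k))"
  unfolding extend_linear_def by (rule sum.mono_neutral_left) (auto simp: in_keys_iff)

lemma extend_linear_add: "extend_linear g (F + G) = extend_linear g F + extend_linear g G"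
  using extend_linear_superset[of "Poly_Mapping.keys F \<union> Poly_Mapping.keys G" F g]
    extend_linear_superset[of "Poly_Mapping.keys F \<union> Poly_Mapping.keys G" G g]
    extend_linear_superset[OF _ keys_add, of F G g]
  by (simp add: lookup_add scale_add_left sum.distrib)

lemma extend_linear_scale: "extend_linear g (scale z F) = scale z (extend_linear g F)"
  using extend_linear_superset[OF _ keys_scale, of F g z]
  by (simp add: extend_linear_def lookup_scale scale_sum scale_scale)

lemma extend_linear_zero [simp]: "extend_linear g 0 = 0"
  by (simp add: extend_linear_def)

lemma extend_linear_minus: "extend_linear g (F - G) = extend_linear g F - extend_linear g G"
proof -
  have "extend_linear g (F + scale (- 1) G) = extend_linear g F + scale (- 1) (extend_linear g G)"
    unfolding extend_linear_add extend_linear_scale ..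
  then show ?thesis unfolding scale_uminus by simp
qed

lemma extend_linear_single: "extend_linear g (Poly_Mapping.single k c) = scale c (g k)"
  using extend_linear_superset[of "{k}" "Poly_Mapping.single k c" g] by (simp add: lookup_single)


subsection \<open>Bilinear relations\<close>

locale tensor_product = A: connected_graded_algebra A + B: connected_graded_algebra B
  for A :: "'a graded_algebra" and B :: "'b graded_algebra"
begin

abbreviation "T \<equiv> free_tensor A B"
abbreviation "I \<equiv> bilinear_relations A B"
abbreviation pure :: "'a \<Rightarrow> 'b \<Rightarrow> ('a \<times> 'b \<Rightarrow>\<^sub>0 complex)" where "pure a b \<equiv> Poly_Mapping.single (a, b) 1"

lemma carrier_free: "carrier T = {F. Poly_Mapping.keys F \<subseteq> carrier A \<times> carrier B}"
  by (simp add: free_tensor_def)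

lemma pure_in: "a \<in> carrier A \<Longrightarrow> b \<in> carrier B \<Longrightarrow> Poly_Mapping.single (a, b) c \<in> carrier T"
  by (simp add: carrier_free)

lemma free_add: "F \<in> carrier T \<Longrightarrow> G \<in> carrier T \<Longrightarrow> F + G \<in> carrier T"
  using keys_add[of F G] by (auto simp: carrier_free)

lemma free_minus: "F \<in> carrier T \<Longrightarrow> G \<in> carrier T \<Longrightarrow> F - G \<in> carrier T"
  using keys_diff[of F G] by (auto simp: carrier_free)

lemma free_scale: "F \<in> carrier T \<Longrightarrow> scale z F \<in> carrier T"
  using keys_scale[of z F] by (auto simp: carrier_free)

lemma free_zero: "0 \<in> carrier T"
  by (simp add: carrier_free)

lemma free_sum: "(\<And>i. i \<in> S \<Longrightarrow> f i \<in> carrier T) \<Longrightarrow> sum f S \<in> carrier T"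
  by (induction S rule: infinite_finite_induct) (auto intro: free_zero free_add)

lemma free_extend_linear:
  "F \<in> carrier T \<Longrightarrow> (\<And>a b. a \<in> carrier A \<Longrightarrow> b \<in> carrier B \<Longrightarrow> g (a, b) \<in> carrier T) \<Longrightarrow> extend_linear g F \<in> carrier T"
  unfolding extend_linear_def by (intro free_sum free_scale) (auto simp: carrier_free)

lemma relations_in_free: "F \<in> I \<Longrightarrow> F \<in> carrier T"
  by (induction rule: bilinear_relations.induct) (auto intro!: free_add free_scale free_minus free_zero pure_in)

lemma relations_scale: "F \<in> I \<Longrightarrow> scale z F \<in> I"
  using bilinear_relations.lincomb[OF _ bilinear_relations.zero_rel, of F A B z] by simp

lemma relations_add: "F \<in> I \<Longrightarrow> G \<in> I \<Longrightarrow> F + G \<in> I"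
  using bilinear_relations.lincomb[of F A B G 1] by simp

lemma relations_uminus: "F \<in> I \<Longrightarrow> - F \<in> I"
  using relations_scale[of F "- 1"] by (simp add: scale_uminus)

lemma relations_sum: "(\<And>i. i \<in> S \<Longrightarrow> f i \<in> I) \<Longrightarrow> sum f S \<in> I"
  by (induction S rule: infinite_finite_induct) (auto intro: relations_add bilinear_relations.zero_rel)

definition eqv :: "('a \<times> 'b \<Rightarrow>\<^sub>0 complex) \<Rightarrow> ('a \<times> 'b \<Rightarrow>\<^sub>0 complex) \<Rightarrow> bool" (infix \<open>\<bumpeq>\<close> 50) where
  "F \<bumpeq> G \<longleftrightarrow> F - G \<in> I"

lemma eqv_refl [simp]: "F \<bumpeq> F"
  by (simp add: eqv_def bilinear_relations.zero_rel)

lemma eqv_sym: "F \<bumpeq> G \<Longrightarrow> G \<bumpeq> F"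
  using relations_uminus[of "F - G"] by (simp add: eqv_def)

lemma eqv_trans [trans]: "F \<bumpeq> G \<Longrightarrow> G \<bumpeq> H \<Longrightarrow> F \<bumpeq> H"
  using relations_add[of "F - G" "G - H"] by (simp add: eqv_def)

lemma eqv_eq_trans [trans]: "F \<bumpeq> G \<Longrightarrow> G = H \<Longrightarrow> F \<bumpeq> H" "F = G \<Longrightarrow> G \<bumpeq> H \<Longrightarrow> F \<bumpeq> H"
  by auto

lemma eqv_add: "F \<bumpeq> G \<Longrightarrow> F' \<bumpeq> G' \<Longrightarrow> F + F' \<bumpeq> G + G'"
  using relations_add[of "F - G" "F' - G'"] by (simp add: eqv_def algebra_simps)

lemma eqv_scale: "F \<bumpeq> G \<Longrightarrow> scale z F \<bumpeq> scale z G"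
  using relations_scale[of "F - G" z] by (simp add: eqv_def scale_minus)

lemma eqv_sum: "(\<And>i. i \<in> S \<Longrightarrow> f i \<bumpeq> g i) \<Longrightarrow> sum f S \<bumpeq> sum g S"
  using relations_sum[of S "\<lambda>i. f i - g i"] by (simp add: eqv_def sum_subtractf)

text \<open>
  The linear extensions of such functions descend to the quotient by the relations; in particular the
  multiplication is of this kind in each of its arguments.
\<close>

definition bilinear_mod :: "('a \<times> 'b \<Rightarrow> ('a \<times> 'b \<Rightarrow>\<^sub>0 complex)) \<Rightarrow> bool" where
  "bilinear_mod g \<longleftrightarrow>
     (\<forall>a\<in>carrier A. \<forall>a'\<in>carrier A. \<forall>b\<in>carrier B. g (a \<oplus>\<^bsub>A\<^esub> a', b) \<bumpeq> g (a, b) + g (a', b)) \<and>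
     (\<forall>a\<in>carrier A. \<forall>b\<in>carrier B. \<forall>b'\<in>carrier B. g (a, b \<oplus>\<^bsub>B\<^esub> b') \<bumpeq> g (a, b) + g (a, b')) \<and>
     (\<forall>z. \<forall>a\<in>carrier A. \<forall>b\<in>carrier B. g (z \<odot>\<^bsub>A\<^esub> a, b) \<bumpeq> scale z (g (a, b))) \<and>
     (\<forall>z. \<forall>a\<in>carrier A. \<forall>b\<in>carrier B. g (a, z \<odot>\<^bsub>B\<^esub> b) \<bumpeq> scale z (g (a, b)))"

lemma bilinear_mod_relations:
  assumes g: "bilinear_mod g" shows "F \<in> I \<Longrightarrow> extend_linear g F \<in> I"
proof (induction rule: bilinear_relations.induct)
  case zero_rel
  then show ?case by (simp add: bilinear_relations.zero_rel)
next
  case (lincomb F G z)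
  then show ?case by (simp add: extend_linear_add extend_linear_scale relations_add relations_scale)
next
  case (add_left a a' b)
  then show ?case using g by (auto simp: extend_linear_minus extend_linear_single bilinear_mod_def eqv_def extend_linear_add diff_diff_eq)
next
  case (add_right a b b')
  then show ?case using g by (auto simp: extend_linear_minus extend_linear_single bilinear_mod_def eqv_def extend_linear_add diff_diff_eq)
next
  case (smult_left a b z)
  then show ?case using g by (auto simp: extend_linear_minus extend_linear_single bilinear_mod_def eqv_def extend_linear_add diff_diff_eq)
next
  case (smult_right a b z)
  then show ?case using g by (auto simp: extend_linear_minus extend_linear_single bilinear_mod_def eqv_def extend_linear_add diff_diff_eq)
qed

lemma bilinear_modI:
  assumes "\<And>a a' b. a \<in> carrier A \<Longrightarrow> a' \<in> carrier A \<Longrightarrow> b \<in> carrier B \<Longrightarrow> g (a \<oplus>\<^bsub>A\<^esub> a', b) \<bumpeq> g (a, b) + g (a', b)"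
    "\<And>a b b'. a \<in> carrier A \<Longrightarrow> b \<in> carrier B \<Longrightarrow> b' \<in> carrier B \<Longrightarrow> g (a, b \<oplus>\<^bsub>B\<^esub> b') \<bumpeq> g (a, b) + g (a, b')"
    "\<And>z a b. a \<in> carrier A \<Longrightarrow> b \<in> carrier B \<Longrightarrow> g (z \<odot>\<^bsub>A\<^esub> a, b) \<bumpeq> scale z (g (a, b))"
    "\<And>z a b. a \<in> carrier A \<Longrightarrow> b \<in> carrier B \<Longrightarrow> g (a, z \<odot>\<^bsub>B\<^esub> b) \<bumpeq> scale z (g (a, b))"
  shows "bilinear_mod g"
  unfolding bilinear_mod_def by (intro conjI ballI allI assms)

lemma bilinear_modD:
  assumes "bilinear_mod g"
  shows "a \<in> carrier A \<Longrightarrow> a' \<in> carrier A \<Longrightarrow> b \<in> carrier B \<Longrightarrow> g (a \<oplus>\<^bsub>A\<^esub> a', b) \<bumpeq> g (a, b) + g (a', b)"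
    "a \<in> carrier A \<Longrightarrow> b \<in> carrier B \<Longrightarrow> b' \<in> carrier B \<Longrightarrow> g (a, b \<oplus>\<^bsub>B\<^esub> b') \<bumpeq> g (a, b) + g (a, b')"
    "a \<in> carrier A \<Longrightarrow> b \<in> carrier B \<Longrightarrow> g (z \<odot>\<^bsub>A\<^esub> a, b) \<bumpeq> scale z (g (a, b))"
    "a \<in> carrier A \<Longrightarrow> b \<in> carrier B \<Longrightarrow> g (a, z \<odot>\<^bsub>B\<^esub> b) \<bumpeq> scale z (g (a, b))"
  using assms unfolding bilinear_mod_def by simp_all

lemma pure_add_left: "a \<in> carrier A \<Longrightarrow> a' \<in> carrier A \<Longrightarrow> b \<in> carrier B \<Longrightarrow> pure (a \<oplus>\<^bsub>A\<^esub> a') b \<bumpeq> pure a b + pure a' b"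
  unfolding eqv_def diff_diff_eq[symmetric] by (rule bilinear_relations.add_left)

lemma pure_add_right: "a \<in> carrier A \<Longrightarrow> b \<in> carrier B \<Longrightarrow> b' \<in> carrier B \<Longrightarrow> pure a (b \<oplus>\<^bsub>B\<^esub> b') \<bumpeq> pure a b + pure a b'"
  unfolding eqv_def diff_diff_eq[symmetric] by (rule bilinear_relations.add_right)

lemma pure_smult_left: "a \<in> carrier A \<Longrightarrow> b \<in> carrier B \<Longrightarrow> pure (z \<odot>\<^bsub>A\<^esub> a) b \<bumpeq> scale z (pure a b)"
  unfolding eqv_def scale_single mult_1_right by (rule bilinear_relations.smult_left)

lemma pure_smult_right: "a \<in> carrier A \<Longrightarrow> b \<in> carrier B \<Longrightarrow> pure a (z \<odot>\<^bsub>B\<^esub> b) \<bumpeq> scale z (pure a b)"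
  unfolding eqv_def scale_single mult_1_right by (rule bilinear_relations.smult_right)

lemma bilinear_mod_scale:
  assumes g: "bilinear_mod g" shows "bilinear_mod (\<lambda>k. scale c (g k))"
proof (rule bilinear_modI)
  fix a a' b assume "a \<in> carrier A" "a' \<in> carrier A" "b \<in> carrier B"
  then show "scale c (g (a \<oplus>\<^bsub>A\<^esub> a', b)) \<bumpeq> scale c (g (a, b)) + scale c (g (a', b))"
    unfolding scale_add[symmetric] by (intro eqv_scale bilinear_modD[OF g])
next
  fix a b b' assume "a \<in> carrier A" "b \<in> carrier B" "b' \<in> carrier B"
  then show "scale c (g (a, b \<oplus>\<^bsub>B\<^esub> b')) \<bumpeq> scale c (g (a, b)) + scale c (g (a, b'))"
    unfolding scale_add[symmetric] by (intro eqv_scale bilinear_modD[OF g])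
next
  fix z a b assume "a \<in> carrier A" "b \<in> carrier B"
  then have "scale c (g (z \<odot>\<^bsub>A\<^esub> a, b)) \<bumpeq> scale c (scale z (g (a, b)))"
    "scale c (g (a, z \<odot>\<^bsub>B\<^esub> b)) \<bumpeq> scale c (scale z (g (a, b)))"
    by - (rule eqv_scale, rule bilinear_modD[OF g], assumption+)+
  then show "scale c (g (z \<odot>\<^bsub>A\<^esub> a, b)) \<bumpeq> scale z (scale c (g (a, b)))"
    "scale c (g (a, z \<odot>\<^bsub>B\<^esub> b)) \<bumpeq> scale z (scale c (g (a, b)))"
    by (simp_all only: scale_scale mult.commute[of c])
qed

lemma bilinear_mod_sum:
  assumes g: "\<And>i. i \<in> S \<Longrightarrow> bilinear_mod (g i)" shows "bilinear_mod (\<lambda>k. \<Sum>i\<in>S. g i k)"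
  by (rule bilinear_modI; unfold sum.distrib[symmetric] scale_sum; rule eqv_sum; rule bilinear_modD[OF g])

lemma bilinear_mod_eqv:
  assumes g: "bilinear_mod g" and h: "\<And>a b. a \<in> carrier A \<Longrightarrow> b \<in> carrier B \<Longrightarrow> h (a, b) \<bumpeq> g (a, b)"
  shows "bilinear_mod h"
proof (rule bilinear_modI)
  fix a a' b assume c: "a \<in> carrier A" "a' \<in> carrier A" "b \<in> carrier B"
  have "h (a \<oplus>\<^bsub>A\<^esub> a', b) \<bumpeq> g (a \<oplus>\<^bsub>A\<^esub> a', b)" using c by (intro h A.a_closed)
  also have "\<dots> \<bumpeq> g (a, b) + g (a', b)" using c by (rule bilinear_modD[OF g])
  also have "\<dots> \<bumpeq> h (a, b) + h (a', b)" using c by (intro eqv_add eqv_sym[OF h])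
  finally show "h (a \<oplus>\<^bsub>A\<^esub> a', b) \<bumpeq> h (a, b) + h (a', b)" .
next
  fix a b b' assume c: "a \<in> carrier A" "b \<in> carrier B" "b' \<in> carrier B"
  have "h (a, b \<oplus>\<^bsub>B\<^esub> b') \<bumpeq> g (a, b \<oplus>\<^bsub>B\<^esub> b')" using c by (intro h B.a_closed)
  also have "\<dots> \<bumpeq> g (a, b) + g (a, b')" using c by (rule bilinear_modD[OF g])
  also have "\<dots> \<bumpeq> h (a, b) + h (a, b')" using c by (intro eqv_add eqv_sym[OF h])
  finally show "h (a, b \<oplus>\<^bsub>B\<^esub> b') \<bumpeq> h (a, b) + h (a, b')" .
next
  fix z a b assume c: "a \<in> carrier A" "b \<in> carrier B"
  have "h (z \<odot>\<^bsub>A\<^esub> a, b) \<bumpeq> g (z \<odot>\<^bsub>A\<^esub> a, b)" using c by (intro h A.smult_closed)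
  also have "\<dots> \<bumpeq> scale z (g (a, b))" using c by (rule bilinear_modD[OF g])
  also have "\<dots> \<bumpeq> scale z (h (a, b))" using c by (intro eqv_scale eqv_sym[OF h])
  finally show "h (z \<odot>\<^bsub>A\<^esub> a, b) \<bumpeq> scale z (h (a, b))" .
  have "h (a, z \<odot>\<^bsub>B\<^esub> b) \<bumpeq> g (a, z \<odot>\<^bsub>B\<^esub> b)" using c by (intro h B.smult_closed)
  also have "\<dots> \<bumpeq> scale z (g (a, b))" using c by (rule bilinear_modD[OF g])
  also have "\<dots> \<bumpeq> scale z (h (a, b))" using c by (intro eqv_scale eqv_sym[OF h])
  finally show "h (a, z \<odot>\<^bsub>B\<^esub> b) \<bumpeq> scale z (h (a, b))" .
qed

text \<open>
  Projections to homogeneous components and multiplications by a fixed element are of this form, and the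
  product of basis elements is a signed sum of such compositions.
\<close>

lemma bilinear_mod_compose:
  assumes "\<And>a. a \<in> carrier A \<Longrightarrow> f a \<in> carrier A" "\<And>b. b \<in> carrier B \<Longrightarrow> h b \<in> carrier B"
    "\<And>a a'. a \<in> carrier A \<Longrightarrow> a' \<in> carrier A \<Longrightarrow> f (a \<oplus>\<^bsub>A\<^esub> a') = f a \<oplus>\<^bsub>A\<^esub> f a'"
    "\<And>b b'. b \<in> carrier B \<Longrightarrow> b' \<in> carrier B \<Longrightarrow> h (b \<oplus>\<^bsub>B\<^esub> b') = h b \<oplus>\<^bsub>B\<^esub> h b'"
    "\<And>a z. a \<in> carrier A \<Longrightarrow> f (z \<odot>\<^bsub>A\<^esub> a) = z \<odot>\<^bsub>A\<^esub> f a"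
    "\<And>b z. b \<in> carrier B \<Longrightarrow> h (z \<odot>\<^bsub>B\<^esub> b) = z \<odot>\<^bsub>B\<^esub> h b"
  shows "bilinear_mod (\<lambda>(a, b). pure (f a) (h b))"
  by (rule bilinear_modI)
    (simp_all add: assms pure_add_left pure_add_right pure_smult_left pure_smult_right del: map_single)

lemma pure_zero:
  assumes "a \<in> carrier A" "b \<in> carrier B"
  shows "pure \<zero>\<^bsub>A\<^esub> b \<bumpeq> 0" "pure a \<zero>\<^bsub>B\<^esub> \<bumpeq> 0"
  using pure_smult_left[OF assms, of 0] pure_smult_right[OF assms, of 0] assms by simp_all

lemma pure_finsum_left:
  assumes "\<And>i. i \<in> S \<Longrightarrow> f i \<in> carrier A" "b \<in> carrier B" "finite S"
  shows "pure (finsum A f S) b \<bumpeq> (\<Sum>i\<in>S. pure (f i) b)"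
  using assms(3,1)
proof (induction S rule: finite_induct)
  case (insert x S)
  then have f: "f \<in> S \<rightarrow> carrier A" "f x \<in> carrier A" by auto
  then have "pure (f x \<oplus>\<^bsub>A\<^esub> finsum A f S) b \<bumpeq> pure (f x) b + pure (finsum A f S) b"
    using assms(2) by (intro pure_add_left) auto
  also have "\<dots> \<bumpeq> pure (f x) b + (\<Sum>i\<in>S. pure (f i) b)" using insert by (intro eqv_add) auto
  finally show ?case using insert f by simp
qed (use pure_zero(1)[OF A.zero_closed assms(2)] in simp)

lemma pure_finsum_right:
  assumes "\<And>i. i \<in> S \<Longrightarrow> f i \<in> carrier B" "a \<in> carrier A" "finite S"
  shows "pure a (finsum B f S) \<bumpeq> (\<Sum>i\<in>S. pure a (f i))"
  using assms(3,1)
proof (induction S rule: finite_induct)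
  case (insert x S)
  then have f: "f \<in> S \<rightarrow> carrier B" "f x \<in> carrier B" by auto
  then have "pure a (f x \<oplus>\<^bsub>B\<^esub> finsum B f S) \<bumpeq> pure a (f x) + pure a (finsum B f S)"
    using assms(2) by (intro pure_add_right) auto
  also have "\<dots> \<bumpeq> pure a (f x) + (\<Sum>i\<in>S. pure a (f i))" using insert by (intro eqv_add) auto
  finally show ?case using insert f by simp
qed (use pure_zero(2)[OF assms(2) B.zero_closed] in simp)


subsection \<open>Multiplication\<close>

text \<open>
  The product of two basis elements in the free algebra, with the sign that arises from the interchange of
  the two inner factors.
\<close>

definition basis_mult :: "'a \<times> 'b \<Rightarrow> 'a \<times> 'b \<Rightarrow> ('a \<times> 'b \<Rightarrow>\<^sub>0 complex)" where
  "basis_mult = (\<lambda>(a, b) (a', b'). \<Sum>p\<in>{p. hcomp A p a' \<noteq> \<zero>\<^bsub>A\<^esub>}. \<Sum>q\<in>{q. hcomp B q b \<noteq> \<zero>\<^bsub>B\<^esub>}.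
     scale ((- 1) ^ (p * q)) (pure (a \<otimes>\<^bsub>A\<^esub> hcomp A p a') (hcomp B q b \<otimes>\<^bsub>B\<^esub> b')))"

lemma mult_free: "F \<otimes>\<^bsub>T\<^esub> G = extend_linear (\<lambda>k. extend_linear (basis_mult k) G) F"
  by (simp add: free_tensor_def extend_linear_def basis_mult_def scale_sum scale_scale scale_single
      case_prod_unfold mult_ac)

lemma free_simps:
  "\<one>\<^bsub>T\<^esub> = pure \<one>\<^bsub>A\<^esub> \<one>\<^bsub>B\<^esub>" "\<zero>\<^bsub>T\<^esub> = 0" "F \<oplus>\<^bsub>T\<^esub> G = F + G" "z \<odot>\<^bsub>T\<^esub> F = scale z F"
  by (simp_all add: free_tensor_def)

text \<open>
  The index sets of the defining sum depend on the arguments.  Modulo the relations the sum can be taken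
  over a fixed range, in which form it is visibly bilinear.
\<close>

lemma basis_mult_eqv:
  assumes NA: "\<And>x k. x \<in> carrier A \<Longrightarrow> k \<ge> NA \<Longrightarrow> hcomp A k x = \<zero>\<^bsub>A\<^esub>"
    and NB: "\<And>x k. x \<in> carrier B \<Longrightarrow> k \<ge> NB \<Longrightarrow> hcomp B k x = \<zero>\<^bsub>B\<^esub>"
    and c: "a \<in> carrier A" "b \<in> carrier B" "a' \<in> carrier A" "b' \<in> carrier B"
  shows "basis_mult (a, b) (a', b') \<bumpeq> (\<Sum>p<NA. \<Sum>q<NB. scale ((- 1) ^ (p * q)) (pure (a \<otimes>\<^bsub>A\<^esub> hcomp A p a') (hcomp B q b \<otimes>\<^bsub>B\<^esub> b')))"
proof -
  let ?t = "\<lambda>p q. scale ((- 1) ^ (p * q)) (pure (a \<otimes>\<^bsub>A\<^esub> hcomp A p a') (hcomp B q b \<otimes>\<^bsub>B\<^esub> b'))"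
  have z: "?t p q \<bumpeq> 0" if "hcomp A p a' = \<zero>\<^bsub>A\<^esub> \<or> hcomp B q b = \<zero>\<^bsub>B\<^esub>" for p q
    using eqv_scale[OF pure_zero(1)[of a "hcomp B q b \<otimes>\<^bsub>B\<^esub> b'"], of "(- 1) ^ (p * q)"]
      eqv_scale[OF pure_zero(2)[of "a \<otimes>\<^bsub>A\<^esub> hcomp A p a'" b'], of "(- 1) ^ (p * q)"] that c by auto
  have "basis_mult (a, b) (a', b') = (\<Sum>p<NA. \<Sum>q<NB. if hcomp A p a' \<noteq> \<zero>\<^bsub>A\<^esub> \<and> hcomp B q b \<noteq> \<zero>\<^bsub>B\<^esub> then ?t p q else 0)"
  proof -
    have "{q. hcomp B q b \<noteq> \<zero>\<^bsub>B\<^esub>} \<subseteq> {..<NB}" "{p. hcomp A p a' \<noteq> \<zero>\<^bsub>A\<^esub>} \<subseteq> {..<NA}"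
      using NA[OF c(3)] NB[OF c(2)] by (auto simp: not_le[symmetric])
    then show ?thesis unfolding basis_mult_def prod.case
      by (intro sum.mono_neutral_cong_left) (auto intro!: sum.mono_neutral_cong_left)
  qed
  also have "\<dots> \<bumpeq> (\<Sum>p<NA. \<Sum>q<NB. ?t p q)"
  proof (intro eqv_sum)
    fix p q
    show "(if hcomp A p a' \<noteq> \<zero>\<^bsub>A\<^esub> \<and> hcomp B q b \<noteq> \<zero>\<^bsub>B\<^esub> then ?t p q else 0) \<bumpeq> ?t p q"
    proof (cases "hcomp A p a' = \<zero>\<^bsub>A\<^esub> \<or> hcomp B q b = \<zero>\<^bsub>B\<^esub>")
      case True
      then show ?thesis using eqv_sym[OF z[OF True]] by (simp only: de_Morgan_disj[symmetric] not_True_eq_False if_False)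
    next
      case False
      then show ?thesis by (simp only: de_Morgan_disj[symmetric] not_False_eq_True if_True eqv_refl)
    qed
  qed
  finally show ?thesis .
qed

lemma bilinear_mod_basis_mult:
  assumes "a \<in> carrier A" "b \<in> carrier B"
  shows "bilinear_mod (basis_mult (a, b))" "bilinear_mod (\<lambda>k. basis_mult k (a, b))"
proof -
  obtain NA where NA: "\<And>x k. x \<in> carrier A \<Longrightarrow> k \<ge> NA \<Longrightarrow> hcomp A k x = \<zero>\<^bsub>A\<^esub>" using A.hcomp_bounded by blast
  obtain NB where NB: "\<And>x k. x \<in> carrier B \<Longrightarrow> k \<ge> NB \<Longrightarrow> hcomp B k x = \<zero>\<^bsub>B\<^esub>" using B.hcomp_bounded by blast
  note simps = A.hcomp_add A.hcomp_smult B.hcomp_add B.hcomp_smult A.l_distr A.r_distr B.l_distr B.r_distr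
     A.smult_mult_left A.smult_mult_right B.smult_mult_left B.smult_mult_right
  have "bilinear_mod (\<lambda>k. \<Sum>p<NA. \<Sum>q<NB. scale ((- 1) ^ (p * q)) ((\<lambda>(a', b'). pure (a \<otimes>\<^bsub>A\<^esub> hcomp A p a') (hcomp B q b \<otimes>\<^bsub>B\<^esub> b')) k))"
    by (intro bilinear_mod_sum bilinear_mod_scale bilinear_mod_compose) (use assms in \<open>auto simp: simps\<close>)
  then show "bilinear_mod (basis_mult (a, b))"
    by (rule bilinear_mod_eqv) (use basis_mult_eqv[OF NA NB assms] in simp)
  have "bilinear_mod (\<lambda>k. \<Sum>p<NA. \<Sum>q<NB. scale ((- 1) ^ (p * q)) ((\<lambda>(a', b'). pure (a' \<otimes>\<^bsub>A\<^esub> hcomp A p a) (hcomp B q b' \<otimes>\<^bsub>B\<^esub> b)) k))"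
    by (intro bilinear_mod_sum bilinear_mod_scale bilinear_mod_compose) (use assms in \<open>auto simp: simps\<close>)
  then show "bilinear_mod (\<lambda>k. basis_mult k (a, b))"
    by (rule bilinear_mod_eqv) (use basis_mult_eqv[OF NA NB _ _ assms] in simp)
qed

lemma basis_mult_in:
  "a \<in> carrier A \<Longrightarrow> b \<in> carrier B \<Longrightarrow> a' \<in> carrier A \<Longrightarrow> b' \<in> carrier B \<Longrightarrow> basis_mult (a, b) (a', b') \<in> carrier T"
  unfolding basis_mult_def by (auto intro!: free_sum free_scale pure_in)

lemma mult_in: "F \<in> carrier T \<Longrightarrow> G \<in> carrier T \<Longrightarrow> F \<otimes>\<^bsub>T\<^esub> G \<in> carrier T"
  unfolding mult_free by (intro free_extend_linear basis_mult_in)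

lemma mult_relations_right:
  assumes "F \<in> carrier T" "G \<in> I" shows "F \<otimes>\<^bsub>T\<^esub> G \<in> I"
  unfolding mult_free extend_linear_def[of _ F]
  using assms(1) by (intro relations_sum relations_scale bilinear_mod_relations[OF _ assms(2)])
    (auto simp: carrier_free intro!: bilinear_mod_basis_mult)

lemma mult_free_swap: "F \<otimes>\<^bsub>T\<^esub> G = extend_linear (\<lambda>k'. extend_linear (\<lambda>k. basis_mult k k') F) G"
  unfolding mult_free extend_linear_def scale_sum
  by (subst sum.swap) (simp add: scale_scale mult.commute)

lemma mult_relations_left:
  assumes "F \<in> carrier T" "G \<in> I" shows "G \<otimes>\<^bsub>T\<^esub> F \<in> I"
  unfolding mult_free_swap extend_linear_def[of _ F]
  using assms(1) by (intro relations_sum relations_scale bilinear_mod_relations[OF _ assms(2)])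
    (auto simp: carrier_free intro!: bilinear_mod_basis_mult)

lemma mult_add_left: "(F + G) \<otimes>\<^bsub>T\<^esub> H = F \<otimes>\<^bsub>T\<^esub> H + G \<otimes>\<^bsub>T\<^esub> H"
  by (simp add: mult_free extend_linear_add)

lemma mult_add_right: "H \<otimes>\<^bsub>T\<^esub> (F + G) = H \<otimes>\<^bsub>T\<^esub> F + H \<otimes>\<^bsub>T\<^esub> G"
  by (simp add: mult_free_swap extend_linear_add)

lemma mult_minus_left: "(F - G) \<otimes>\<^bsub>T\<^esub> H = F \<otimes>\<^bsub>T\<^esub> H - G \<otimes>\<^bsub>T\<^esub> H"
  by (simp add: mult_free extend_linear_minus)

lemma mult_minus_right: "H \<otimes>\<^bsub>T\<^esub> (F - G) = H \<otimes>\<^bsub>T\<^esub> F - H \<otimes>\<^bsub>T\<^esub> G"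
  by (simp add: mult_free_swap extend_linear_minus)

lemma mult_scale_left: "scale z F \<otimes>\<^bsub>T\<^esub> G = scale z (F \<otimes>\<^bsub>T\<^esub> G)"
  by (simp add: mult_free extend_linear_scale)

lemma mult_scale_right: "F \<otimes>\<^bsub>T\<^esub> scale z G = scale z (F \<otimes>\<^bsub>T\<^esub> G)"
  by (simp add: mult_free_swap extend_linear_scale)

lemma eqv_mult_left: "F \<bumpeq> G \<Longrightarrow> H \<in> carrier T \<Longrightarrow> F \<otimes>\<^bsub>T\<^esub> H \<bumpeq> G \<otimes>\<^bsub>T\<^esub> H"
  using mult_relations_left[of H "F - G"] by (simp add: eqv_def mult_minus_left)

lemma eqv_mult_right: "F \<bumpeq> G \<Longrightarrow> H \<in> carrier T \<Longrightarrow> H \<otimes>\<^bsub>T\<^esub> F \<bumpeq> H \<otimes>\<^bsub>T\<^esub> G"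
  using mult_relations_right[of H "F - G"] by (simp add: eqv_def mult_minus_right)

lemma pure_mult_pure: "pure a b \<otimes>\<^bsub>T\<^esub> pure a' b' = basis_mult (a, b) (a', b')"
  by (simp add: mult_free extend_linear_single)

lemma pure_mult_homogeneous:
  assumes c: "a \<in> carrier A" "b \<in> carrier B" "a' \<in> carrier A" "b' \<in> carrier B"
    and h: "hcomp B q b = b" "hcomp A p a' = a'"
  shows "pure a b \<otimes>\<^bsub>T\<^esub> pure a' b' \<bumpeq> scale ((- 1) ^ (p * q)) (pure (a \<otimes>\<^bsub>A\<^esub> a') (b \<otimes>\<^bsub>B\<^esub> b'))"
proof -
  have A0: "hcomp A j a' = (if j = p then a' else \<zero>\<^bsub>A\<^esub>)" for j using A.hcomp_hcomp[OF c(3), of j p] h by simp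
  have B0: "hcomp B j b = (if j = q then b else \<zero>\<^bsub>B\<^esub>)" for j using B.hcomp_hcomp[OF c(2), of j q] h by simp
  show ?thesis
  proof (cases "a' = \<zero>\<^bsub>A\<^esub> \<or> b = \<zero>\<^bsub>B\<^esub>")
    case True
    then have "basis_mult (a, b) (a', b') = 0" by (auto simp: basis_mult_def A0 B0)
    moreover have "pure (a \<otimes>\<^bsub>A\<^esub> a') (b \<otimes>\<^bsub>B\<^esub> b') \<bumpeq> 0" using True c pure_zero by auto
    ultimately show ?thesis
      using eqv_sym[OF eqv_scale[of "pure (a \<otimes>\<^bsub>A\<^esub> a') (b \<otimes>\<^bsub>B\<^esub> b')" 0]] by (simp add: pure_mult_pure)
  next
    case False
    then have "{p. hcomp A p a' \<noteq> \<zero>\<^bsub>A\<^esub>} = {p}" "{q. hcomp B q b \<noteq> \<zero>\<^bsub>B\<^esub>} = {q}" by (auto simp: A0 B0)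
    then show ?thesis by (simp add: pure_mult_pure basis_mult_def h)
  qed
qed

lemma pure_homogeneous_sum:
  assumes "a \<in> carrier A" "b \<in> carrier B"
    and NA: "\<And>x k. x \<in> carrier A \<Longrightarrow> k \<ge> NA \<Longrightarrow> hcomp A k x = \<zero>\<^bsub>A\<^esub>"
    and NB: "\<And>x k. x \<in> carrier B \<Longrightarrow> k \<ge> NB \<Longrightarrow> hcomp B k x = \<zero>\<^bsub>B\<^esub>"
  shows "(\<Sum>p<NA. \<Sum>q<NB. pure (hcomp A p a) (hcomp B q b)) \<bumpeq> pure a b"
proof -
  have "pure a b = pure (finsum A (\<lambda>p. hcomp A p a) {..<NA}) b"
    using A.hcomp_decomposition_bounded[OF NA assms(1)] by simp
  also have "\<dots> \<bumpeq> (\<Sum>p<NA. pure (hcomp A p a) b)" using assms by (intro pure_finsum_left) auto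
  also have "(\<Sum>p<NA. pure (hcomp A p a) b) = (\<Sum>p<NA. pure (hcomp A p a) (finsum B (\<lambda>q. hcomp B q b) {..<NB}))"
    using B.hcomp_decomposition_bounded[OF NB assms(2)] by simp
  also have "\<dots> \<bumpeq> (\<Sum>p<NA. \<Sum>q<NB. pure (hcomp A p a) (hcomp B q b))"
    using assms by (intro eqv_sum pure_finsum_right) auto
  finally show ?thesis by (rule eqv_sym)
qed

text \<open>Statements that are linear and depend only on classes need only be checked on homogeneous tensors.\<close>

lemma free_induct_homogeneous:
  assumes "F \<in> carrier T"
    and hom: "\<And>a b p q. a \<in> carrier A \<Longrightarrow> b \<in> carrier B \<Longrightarrow> hcomp A p a = a \<Longrightarrow> hcomp B q b = b \<Longrightarrow> Q (pure a b)"
    and zero: "Q 0" and add: "\<And>F G. F \<in> carrier T \<Longrightarrow> G \<in> carrier T \<Longrightarrow> Q F \<Longrightarrow> Q G \<Longrightarrow> Q (F + G)"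
    and scale: "\<And>z F. F \<in> carrier T \<Longrightarrow> Q F \<Longrightarrow> Q (scale z F)"
    and eqv: "\<And>F G. F \<in> carrier T \<Longrightarrow> G \<in> carrier T \<Longrightarrow> F \<bumpeq> G \<Longrightarrow> Q F \<Longrightarrow> Q G"
  shows "Q F"
proof -
  obtain NA where NA: "\<And>x k. x \<in> carrier A \<Longrightarrow> k \<ge> NA \<Longrightarrow> hcomp A k x = \<zero>\<^bsub>A\<^esub>" using A.hcomp_bounded by blast
  obtain NB where NB: "\<And>x k. x \<in> carrier B \<Longrightarrow> k \<ge> NB \<Longrightarrow> hcomp B k x = \<zero>\<^bsub>B\<^esub>" using B.hcomp_bounded by blast
  have sum': "Q (sum f S)" if "\<And>i. i \<in> S \<Longrightarrow> f i \<in> carrier T \<and> Q (f i)" for f and S :: "('a \<times> 'b) set"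
    using that by (induction S rule: infinite_finite_induct) (auto intro!: zero add free_sum)
  have nsum: "Q (sum f S)" if "\<And>i. i \<in> S \<Longrightarrow> f i \<in> carrier T \<and> Q (f i)" for f and S :: "nat set"
    using that by (induction S rule: infinite_finite_induct) (auto intro!: zero add free_sum)
  have pure: "Q (pure a b)" if ab: "a \<in> carrier A" "b \<in> carrier B" for a b
  proof (rule eqv[OF _ _ pure_homogeneous_sum[OF ab NA NB]])
    show "Q (\<Sum>p<NA. \<Sum>q<NB. pure (hcomp A p a) (hcomp B q b))"
      using ab by (intro nsum conjI free_sum) (auto intro!: pure_in hom simp: A.hcomp_hcomp B.hcomp_hcomp)
  qed (use ab in \<open>auto intro!: free_sum pure_in\<close>)
  have "F = extend_linear (\<lambda>(a, b). pure a b) F"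
    by (rule poly_mapping_eqI)
      (auto simp: extend_linear_def case_prod_unfold lookup_sum lookup_scale lookup_single when_def in_keys_iff)
  moreover have "Q (extend_linear (\<lambda>(a, b). pure a b) F)"
    unfolding extend_linear_def using assms(1)[unfolded carrier_free]
    by (intro sum') (auto simp del: map_single intro!: scale pure pure_in free_scale)
  ultimately show ?thesis by simp
qed

text \<open>
  On homogeneous tensors both products carry the same sign, because the degrees of the middle factor add to
  those of its neighbours.
\<close>

lemma mult_assoc_eqv:
  assumes "F \<in> carrier T" "G \<in> carrier T" "H \<in> carrier T"
  shows "(F \<otimes>\<^bsub>T\<^esub> G) \<otimes>\<^bsub>T\<^esub> H \<bumpeq> F \<otimes>\<^bsub>T\<^esub> (G \<otimes>\<^bsub>T\<^esub> H)"
  using assms(1)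
proof (rule free_induct_homogeneous)
  fix a b p q assume a: "a \<in> carrier A" "b \<in> carrier B" "hcomp A p a = a" "hcomp B q b = b"
  show "(pure a b \<otimes>\<^bsub>T\<^esub> G) \<otimes>\<^bsub>T\<^esub> H \<bumpeq> pure a b \<otimes>\<^bsub>T\<^esub> (G \<otimes>\<^bsub>T\<^esub> H)"
    using assms(2)
  proof (rule free_induct_homogeneous)
    fix a' b' p' q' assume a': "a' \<in> carrier A" "b' \<in> carrier B" "hcomp A p' a' = a'" "hcomp B q' b' = b'"
    show "(pure a b \<otimes>\<^bsub>T\<^esub> pure a' b') \<otimes>\<^bsub>T\<^esub> H \<bumpeq> pure a b \<otimes>\<^bsub>T\<^esub> (pure a' b' \<otimes>\<^bsub>T\<^esub> H)"
      using assms(3)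
    proof (rule free_induct_homogeneous)
      fix a'' b'' p'' q'' assume a'': "a'' \<in> carrier A" "b'' \<in> carrier B" "hcomp A p'' a'' = a''" "hcomp B q'' b'' = b''"
      let ?s = "\<lambda>n::nat. (- 1 :: complex) ^ n"
      have "(pure a b \<otimes>\<^bsub>T\<^esub> pure a' b') \<otimes>\<^bsub>T\<^esub> pure a'' b''
          \<bumpeq> scale (?s (p' * q)) (pure (a \<otimes>\<^bsub>A\<^esub> a') (b \<otimes>\<^bsub>B\<^esub> b')) \<otimes>\<^bsub>T\<^esub> pure a'' b''"
        using a a' a'' by (intro eqv_mult_left pure_mult_homogeneous pure_in) auto
      also have "\<dots> \<bumpeq> scale (?s (p' * q)) (scale (?s (p'' * (q + q'))) (pure ((a \<otimes>\<^bsub>A\<^esub> a') \<otimes>\<^bsub>A\<^esub> a'') ((b \<otimes>\<^bsub>B\<^esub> b') \<otimes>\<^bsub>B\<^esub> b'')))"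
        unfolding mult_scale_left using a a' a'' B.hcomp_mult[of b b' q q']
        by (intro eqv_scale pure_mult_homogeneous) auto
      also have "\<dots> = scale (?s (p'' * q')) (scale (?s ((p' + p'') * q)) (pure (a \<otimes>\<^bsub>A\<^esub> (a' \<otimes>\<^bsub>A\<^esub> a'')) (b \<otimes>\<^bsub>B\<^esub> (b' \<otimes>\<^bsub>B\<^esub> b''))))"
        using a a' a'' by (simp add: A.m_assoc B.m_assoc scale_scale power_add[symmetric] algebra_simps)
      also have "\<dots> \<bumpeq> scale (?s (p'' * q')) (pure a b \<otimes>\<^bsub>T\<^esub> pure (a' \<otimes>\<^bsub>A\<^esub> a'') (b' \<otimes>\<^bsub>B\<^esub> b''))"
        using a a' a'' A.hcomp_mult[of a' a'' p' p'']
        by (intro eqv_scale eqv_sym[OF pure_mult_homogeneous]) auto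
      also have "\<dots> = pure a b \<otimes>\<^bsub>T\<^esub> scale (?s (p'' * q')) (pure (a' \<otimes>\<^bsub>A\<^esub> a'') (b' \<otimes>\<^bsub>B\<^esub> b''))"
        by (rule mult_scale_right[symmetric])
      also have "\<dots> \<bumpeq> pure a b \<otimes>\<^bsub>T\<^esub> (pure a' b' \<otimes>\<^bsub>T\<^esub> pure a'' b'')"
        using a a' a'' by (intro eqv_mult_right eqv_sym[OF pure_mult_homogeneous] pure_in) auto
      finally show "(pure a b \<otimes>\<^bsub>T\<^esub> pure a' b') \<otimes>\<^bsub>T\<^esub> pure a'' b'' \<bumpeq> pure a b \<otimes>\<^bsub>T\<^esub> (pure a' b' \<otimes>\<^bsub>T\<^esub> pure a'' b'')" .
    next
      fix F G assume FG: "F \<in> carrier T" "G \<in> carrier T" "F \<bumpeq> G"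
        "(pure a b \<otimes>\<^bsub>T\<^esub> pure a' b') \<otimes>\<^bsub>T\<^esub> F \<bumpeq> pure a b \<otimes>\<^bsub>T\<^esub> (pure a' b' \<otimes>\<^bsub>T\<^esub> F)"
      have "(pure a b \<otimes>\<^bsub>T\<^esub> pure a' b') \<otimes>\<^bsub>T\<^esub> G \<bumpeq> (pure a b \<otimes>\<^bsub>T\<^esub> pure a' b') \<otimes>\<^bsub>T\<^esub> F"
        using FG a a' by (intro eqv_mult_right mult_in pure_in eqv_sym[OF FG(3)])
      also note FG(4)
      also have "pure a b \<otimes>\<^bsub>T\<^esub> (pure a' b' \<otimes>\<^bsub>T\<^esub> F) \<bumpeq> pure a b \<otimes>\<^bsub>T\<^esub> (pure a' b' \<otimes>\<^bsub>T\<^esub> G)"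
        using FG a a' by (intro eqv_mult_right pure_in)
      finally show "(pure a b \<otimes>\<^bsub>T\<^esub> pure a' b') \<otimes>\<^bsub>T\<^esub> G \<bumpeq> pure a b \<otimes>\<^bsub>T\<^esub> (pure a' b' \<otimes>\<^bsub>T\<^esub> G)" .
    qed (auto simp: mult_add_right mult_scale_right mult_free_swap[of _ 0] intro: eqv_add eqv_scale)
  next
    fix F G assume FG: "F \<in> carrier T" "G \<in> carrier T" "F \<bumpeq> G"
      "(pure a b \<otimes>\<^bsub>T\<^esub> F) \<otimes>\<^bsub>T\<^esub> H \<bumpeq> pure a b \<otimes>\<^bsub>T\<^esub> (F \<otimes>\<^bsub>T\<^esub> H)"
    have "(pure a b \<otimes>\<^bsub>T\<^esub> G) \<otimes>\<^bsub>T\<^esub> H \<bumpeq> (pure a b \<otimes>\<^bsub>T\<^esub> F) \<otimes>\<^bsub>T\<^esub> H"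
      using FG a assms by (intro eqv_mult_left eqv_mult_right mult_in pure_in eqv_sym[OF FG(3)])
    also note FG(4)
    also have "pure a b \<otimes>\<^bsub>T\<^esub> (F \<otimes>\<^bsub>T\<^esub> H) \<bumpeq> pure a b \<otimes>\<^bsub>T\<^esub> (G \<otimes>\<^bsub>T\<^esub> H)"
      using FG a assms by (intro eqv_mult_left eqv_mult_right pure_in)
    finally show "(pure a b \<otimes>\<^bsub>T\<^esub> G) \<otimes>\<^bsub>T\<^esub> H \<bumpeq> pure a b \<otimes>\<^bsub>T\<^esub> (G \<otimes>\<^bsub>T\<^esub> H)" .
  qed (auto simp: mult_add_right mult_scale_right mult_add_left mult_scale_left mult_free_swap[of _ 0] mult_free[of 0] intro: eqv_add eqv_scale)
next
  fix F F' assume FG: "F \<in> carrier T" "F' \<in> carrier T" "F \<bumpeq> F'" "(F \<otimes>\<^bsub>T\<^esub> G) \<otimes>\<^bsub>T\<^esub> H \<bumpeq> F \<otimes>\<^bsub>T\<^esub> (G \<otimes>\<^bsub>T\<^esub> H)"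
  have "(F' \<otimes>\<^bsub>T\<^esub> G) \<otimes>\<^bsub>T\<^esub> H \<bumpeq> (F \<otimes>\<^bsub>T\<^esub> G) \<otimes>\<^bsub>T\<^esub> H"
    using FG assms by (intro eqv_mult_left mult_in eqv_sym[OF FG(3)])
  also note FG(4)
  also have "F \<otimes>\<^bsub>T\<^esub> (G \<otimes>\<^bsub>T\<^esub> H) \<bumpeq> F' \<otimes>\<^bsub>T\<^esub> (G \<otimes>\<^bsub>T\<^esub> H)"
    using FG assms by (intro eqv_mult_left mult_in)
  finally show "(F' \<otimes>\<^bsub>T\<^esub> G) \<otimes>\<^bsub>T\<^esub> H \<bumpeq> F' \<otimes>\<^bsub>T\<^esub> (G \<otimes>\<^bsub>T\<^esub> H)" .
qed (auto simp: mult_add_left mult_scale_left mult_free[of 0] intro: eqv_add eqv_scale)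

lemma one_mult_eqv:
  assumes "F \<in> carrier T" shows "pure \<one>\<^bsub>A\<^esub> \<one>\<^bsub>B\<^esub> \<otimes>\<^bsub>T\<^esub> F \<bumpeq> F" "F \<otimes>\<^bsub>T\<^esub> pure \<one>\<^bsub>A\<^esub> \<one>\<^bsub>B\<^esub> \<bumpeq> F"
proof -
  have one: "pure \<one>\<^bsub>A\<^esub> \<one>\<^bsub>B\<^esub> \<in> carrier T" by (rule pure_in) auto
  show "pure \<one>\<^bsub>A\<^esub> \<one>\<^bsub>B\<^esub> \<otimes>\<^bsub>T\<^esub> F \<bumpeq> F" using assms
  proof (rule free_induct_homogeneous)
    fix a b p q assume "a \<in> carrier A" "b \<in> carrier B" "hcomp A p a = a" "hcomp B q b = b"
    then show "pure \<one>\<^bsub>A\<^esub> \<one>\<^bsub>B\<^esub> \<otimes>\<^bsub>T\<^esub> pure a b \<bumpeq> pure a b"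
      using pure_mult_homogeneous[of "\<one>\<^bsub>A\<^esub>" "\<one>\<^bsub>B\<^esub>" a b 0 p] by (simp add: B.hcomp_one)
  next
    fix F G assume FG: "F \<in> carrier T" "G \<in> carrier T" "F \<bumpeq> G" "pure \<one>\<^bsub>A\<^esub> \<one>\<^bsub>B\<^esub> \<otimes>\<^bsub>T\<^esub> F \<bumpeq> F"
    show "pure \<one>\<^bsub>A\<^esub> \<one>\<^bsub>B\<^esub> \<otimes>\<^bsub>T\<^esub> G \<bumpeq> G"
      using eqv_mult_right[OF eqv_sym[OF FG(3)] one] FG(3,4) eqv_trans by blast
  qed (auto simp: mult_add_right mult_scale_right mult_free_swap[of _ 0] intro: eqv_add eqv_scale)
  show "F \<otimes>\<^bsub>T\<^esub> pure \<one>\<^bsub>A\<^esub> \<one>\<^bsub>B\<^esub> \<bumpeq> F" using assms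
  proof (rule free_induct_homogeneous)
    fix a b p q assume "a \<in> carrier A" "b \<in> carrier B" "hcomp A p a = a" "hcomp B q b = b"
    then show "pure a b \<otimes>\<^bsub>T\<^esub> pure \<one>\<^bsub>A\<^esub> \<one>\<^bsub>B\<^esub> \<bumpeq> pure a b"
      using pure_mult_homogeneous[of a b "\<one>\<^bsub>A\<^esub>" "\<one>\<^bsub>B\<^esub>" q 0] by (simp add: A.hcomp_one)
  next
    fix F G assume FG: "F \<in> carrier T" "G \<in> carrier T" "F \<bumpeq> G" "F \<otimes>\<^bsub>T\<^esub> pure \<one>\<^bsub>A\<^esub> \<one>\<^bsub>B\<^esub> \<bumpeq> F"
    show "G \<otimes>\<^bsub>T\<^esub> pure \<one>\<^bsub>A\<^esub> \<one>\<^bsub>B\<^esub> \<bumpeq> G"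
      using eqv_mult_left[OF eqv_sym[OF FG(3)] one] FG(3,4) eqv_trans by blast
  qed (auto simp: mult_add_left mult_scale_left mult_free[of 0] intro: eqv_add eqv_scale)
qed

lemma abelian_group_free: "abelian_group T"
proof (rule abelian_groupI; simp add: free_simps free_add free_zero)
  fix F assume "F \<in> carrier T"
  then show "\<exists>G\<in>carrier T. G + F = 0"
    using free_minus[OF free_zero, of F] by (intro bexI[of _ "- F"]) auto
qed

lemma free_uminus: "F \<in> carrier T \<Longrightarrow> \<ominus>\<^bsub>T\<^esub> F = - F"
  using abelian_group.minus_equality[OF abelian_group_free, of "- F" F] free_minus[OF free_zero, of F]
  by (simp add: free_simps)

lemma algebra_modulo_relations: "algebra_modulo T I"
proof -
  interpret abelian_group T by (rule abelian_group_free)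
  have minus: "F \<ominus>\<^bsub>T\<^esub> G = F - G" if "G \<in> carrier T" for F G
    using that by (simp add: a_minus_def free_uminus free_simps)
  have sg: "additive_subgroup I T"
  proof (rule additive_subgroupI, rule group.subgroupI)
    show "Group.group (add_monoid T)" by (rule a_group)
    fix F G assume F: "F \<in> I" and G: "G \<in> I"
    have "inv\<^bsub>add_monoid T\<^esub> F = - F"
      using free_uminus[OF relations_in_free[OF F]] by (simp add: a_inv_def)
    then show "inv\<^bsub>add_monoid T\<^esub> F \<in> I" using relations_uminus[OF F] by simp
    show "F \<otimes>\<^bsub>add_monoid T\<^esub> G \<in> I" using relations_add[OF F G] by (simp add: free_simps)
  qed (use relations_in_free bilinear_relations.zero_rel in auto)
  show ?thesis
    by (intro algebra_modulo.intro algebra_modulo_axioms.intro abelian_group_free sg)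
      (simp_all add: free_simps mult_in pure_in mult_add_left mult_add_right mult_relations_left mult_relations_right
        minus mult_assoc_eqv[unfolded eqv_def] one_mult_eqv[unfolded eqv_def] free_scale relations_scale
        scale_add_left scale_add scale_scale mult_scale_left mult_scale_right)
qed

sublocale Q: algebra_modulo T I
  by (rule algebra_modulo_relations)

abbreviation "AB \<equiv> tensor_algebra A B"

lemma tensor_algebra_eq: "AB = graded_quot T I"
  by (simp add: tensor_algebra_def)

sublocale AB: complex_algebra AB
  unfolding tensor_algebra_eq by (rule Q.complex_algebra_quot)


subsection \<open>Tensors of classes\<close>

lemma coset_eqv: "F \<in> carrier T \<Longrightarrow> G \<in> carrier T \<Longrightarrow> F \<bumpeq> G \<Longrightarrow> Q.coset F = Q.coset G"
  by (simp add: Q.coset_eq_iff a_minus_def free_uminus free_simps eqv_def)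

lemma tensor_coset: "tensor A B a b = Q.coset (pure a b)"
  by (simp add: tensor_def)

lemma carrier_AB: "carrier AB = Q.coset ` carrier T"
  by (simp add: tensor_algebra_eq Q.carrier_quot)

lemma tensor_closed [simp]: "a \<in> carrier A \<Longrightarrow> b \<in> carrier B \<Longrightarrow> tensor A B a b \<in> carrier AB"
  by (simp add: tensor_coset carrier_AB pure_in)

lemma AB_add: "F \<in> carrier T \<Longrightarrow> G \<in> carrier T \<Longrightarrow> Q.coset F \<oplus>\<^bsub>AB\<^esub> Q.coset G = Q.coset (F + G)"
  using Q.add_coset[of F G] by (simp add: tensor_algebra_eq free_simps)

lemma AB_smult: "F \<in> carrier T \<Longrightarrow> z \<odot>\<^bsub>AB\<^esub> Q.coset F = Q.coset (scale z F)"
  using Q.smult_coset[of F z] by (simp add: tensor_algebra_eq free_simps)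

lemma AB_mult: "F \<in> carrier T \<Longrightarrow> G \<in> carrier T \<Longrightarrow> Q.coset F \<otimes>\<^bsub>AB\<^esub> Q.coset G = Q.coset (F \<otimes>\<^bsub>T\<^esub> G)"
  using Q.mult_coset[of F G] by (simp add: tensor_algebra_eq)

lemma AB_one: "\<one>\<^bsub>AB\<^esub> = tensor A B \<one>\<^bsub>A\<^esub> \<one>\<^bsub>B\<^esub>"
  by (simp add: tensor_algebra_eq Q.one_quot free_simps tensor_coset)

lemma AB_zero: "\<zero>\<^bsub>AB\<^esub> = Q.coset 0"
  by (simp add: tensor_algebra_eq Q.zero_quot free_simps)

lemma tensor_add_left: "a \<in> carrier A \<Longrightarrow> a' \<in> carrier A \<Longrightarrow> b \<in> carrier B \<Longrightarrow>
    tensor A B (a \<oplus>\<^bsub>A\<^esub> a') b = tensor A B a b \<oplus>\<^bsub>AB\<^esub> tensor A B a' b"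
  unfolding tensor_coset
  by (subst AB_add, rule pure_in, assumption+, rule pure_in, assumption+,
      intro coset_eqv pure_in free_add pure_add_left A.a_closed)

lemma tensor_add_right: "a \<in> carrier A \<Longrightarrow> b \<in> carrier B \<Longrightarrow> b' \<in> carrier B \<Longrightarrow>
    tensor A B a (b \<oplus>\<^bsub>B\<^esub> b') = tensor A B a b \<oplus>\<^bsub>AB\<^esub> tensor A B a b'"
  unfolding tensor_coset
  by (subst AB_add, rule pure_in, assumption+, rule pure_in, assumption+,
      intro coset_eqv pure_in free_add pure_add_right B.a_closed)

lemma tensor_smult_left: "a \<in> carrier A \<Longrightarrow> b \<in> carrier B \<Longrightarrow>
    tensor A B (z \<odot>\<^bsub>A\<^esub> a) b = z \<odot>\<^bsub>AB\<^esub> tensor A B a b"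
  unfolding tensor_coset
  by (subst AB_smult, rule pure_in, assumption+, intro coset_eqv pure_in free_scale pure_smult_left A.smult_closed)

lemma tensor_smult_right: "a \<in> carrier A \<Longrightarrow> b \<in> carrier B \<Longrightarrow>
    tensor A B a (z \<odot>\<^bsub>B\<^esub> b) = z \<odot>\<^bsub>AB\<^esub> tensor A B a b"
  unfolding tensor_coset
  by (subst AB_smult, rule pure_in, assumption+, intro coset_eqv pure_in free_scale pure_smult_right B.smult_closed)

lemma tensor_zero:
  "b \<in> carrier B \<Longrightarrow> tensor A B \<zero>\<^bsub>A\<^esub> b = \<zero>\<^bsub>AB\<^esub>" "a \<in> carrier A \<Longrightarrow> tensor A B a \<zero>\<^bsub>B\<^esub> = \<zero>\<^bsub>AB\<^esub>"
  using tensor_smult_left[OF A.zero_closed, of b 0] tensor_smult_right[OF _ B.zero_closed, of a 0] by simp_all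

lemma tensor_finsum_left:
  "(\<And>i. i \<in> S \<Longrightarrow> f i \<in> carrier A) \<Longrightarrow> b \<in> carrier B \<Longrightarrow>
    tensor A B (finsum A f S) b = (\<Oplus>\<^bsub>AB\<^esub>i\<in>S. tensor A B (f i) b)"
proof (induction S rule: infinite_finite_induct)
  case (insert x S)
  then have "f \<in> S \<rightarrow> carrier A" "f x \<in> carrier A" "(\<lambda>i. tensor A B (f i) b) \<in> S \<rightarrow> carrier AB" by auto
  with insert show ?case by (simp add: tensor_add_left)
qed (auto simp: tensor_zero)

lemma tensor_finsum_right:
  "(\<And>i. i \<in> S \<Longrightarrow> f i \<in> carrier B) \<Longrightarrow> a \<in> carrier A \<Longrightarrow>
    tensor A B a (finsum B f S) = (\<Oplus>\<^bsub>AB\<^esub>i\<in>S. tensor A B a (f i))"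
proof (induction S rule: infinite_finite_induct)
  case (insert x S)
  then have "f \<in> S \<rightarrow> carrier B" "f x \<in> carrier B" "(\<lambda>i. tensor A B a (f i)) \<in> S \<rightarrow> carrier AB" by auto
  with insert show ?case by (simp add: tensor_add_right)
qed (auto simp: tensor_zero)

text \<open>
  The sign depends only on the degrees of the two factors that change places; it is \<open>1\<close> if one of these is
  even.
\<close>

lemma tensor_mult:
  assumes c: "a \<in> carrier A" "b \<in> carrier B" "a' \<in> carrier A" "b' \<in> carrier B"
    and even: "even_class B b \<or> even_class A a'"
  shows "tensor A B a b \<otimes>\<^bsub>AB\<^esub> tensor A B a' b' = tensor A B (a \<otimes>\<^bsub>A\<^esub> a') (b \<otimes>\<^bsub>B\<^esub> b')"
proof -
  obtain NA where NA: "\<And>x k. x \<in> carrier A \<Longrightarrow> k \<ge> NA \<Longrightarrow> hcomp A k x = \<zero>\<^bsub>A\<^esub>" using A.hcomp_bounded by blast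
  obtain NB where NB: "\<And>x k. x \<in> carrier B \<Longrightarrow> k \<ge> NB \<Longrightarrow> hcomp B k x = \<zero>\<^bsub>B\<^esub>" using B.hcomp_bounded by blast
  define a1 where "a1 p = a \<otimes>\<^bsub>A\<^esub> hcomp A p a'" for p
  define b1 where "b1 q = hcomp B q b \<otimes>\<^bsub>B\<^esub> b'" for q
  have in1: "a1 p \<in> carrier A" "b1 q \<in> carrier B" for p q using c by (auto simp: a1_def b1_def)
  have sign: "scale ((- 1) ^ (p * q)) (pure (a1 p) (b1 q)) \<bumpeq> pure (a1 p) (b1 q)" for p q
  proof (cases "even p \<or> even q")
    case True
    then show ?thesis by (auto simp del: map_single)
  next
    case False
    then have "hcomp B q b = \<zero>\<^bsub>B\<^esub> \<or> hcomp A p a' = \<zero>\<^bsub>A\<^esub>" using even by (auto simp: even_class_def)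
    then have "a1 p = \<zero>\<^bsub>A\<^esub> \<or> b1 q = \<zero>\<^bsub>B\<^esub>" using c by (auto simp: a1_def b1_def)
    then have z: "pure (a1 p) (b1 q) \<bumpeq> 0" using pure_zero in1 by metis
    from eqv_scale[OF this, of "(- 1) ^ (p * q)"] have "scale ((- 1) ^ (p * q)) (pure (a1 p) (b1 q)) \<bumpeq> 0"
      unfolding scale_zero(2) .
    also have "0 \<bumpeq> pure (a1 p) (b1 q)" by (rule eqv_sym[OF z])
    finally show ?thesis .
  qed
  have a: "finsum A a1 {..<NA} = a \<otimes>\<^bsub>A\<^esub> a'"
  proof -
    have "a \<otimes>\<^bsub>A\<^esub> a' = a \<otimes>\<^bsub>A\<^esub> finsum A (\<lambda>p. hcomp A p a') {..<NA}"
      by (rule arg_cong[OF A.hcomp_decomposition_bounded[OF NA c(3)]])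
    also have "\<dots> = finsum A a1 {..<NA}" unfolding a1_def by (rule A.finsum_rdistr) (use c in auto)
    finally show ?thesis by simp
  qed
  have b: "finsum B b1 {..<NB} = b \<otimes>\<^bsub>B\<^esub> b'"
  proof -
    have "b \<otimes>\<^bsub>B\<^esub> b' = finsum B (\<lambda>q. hcomp B q b) {..<NB} \<otimes>\<^bsub>B\<^esub> b'"
      by (rule arg_cong[OF B.hcomp_decomposition_bounded[OF NB c(2)]])
    also have "\<dots> = finsum B b1 {..<NB}" unfolding b1_def by (rule B.finsum_ldistr) (use c in auto)
    finally show ?thesis by simp
  qed
  have "pure a b \<otimes>\<^bsub>T\<^esub> pure a' b' = basis_mult (a, b) (a', b')" by (rule pure_mult_pure)
  also have "\<dots> \<bumpeq> (\<Sum>p<NA. \<Sum>q<NB. scale ((- 1) ^ (p * q)) (pure (a1 p) (b1 q)))"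
    unfolding a1_def b1_def by (rule basis_mult_eqv[OF NA NB c])
  also have "\<dots> \<bumpeq> (\<Sum>p<NA. \<Sum>q<NB. pure (a1 p) (b1 q))" by (intro eqv_sum sign)
  also have "\<dots> \<bumpeq> (\<Sum>p<NA. pure (a1 p) (finsum B b1 {..<NB}))"
    by (intro eqv_sum eqv_sym[OF pure_finsum_right] in1 finite_lessThan)
  also have "\<dots> \<bumpeq> pure (finsum A a1 {..<NA}) (finsum B b1 {..<NB})"
    unfolding b using c by (intro eqv_sym[OF pure_finsum_left] in1 finite_lessThan B.m_closed)
  finally have "pure a b \<otimes>\<^bsub>T\<^esub> pure a' b' \<bumpeq> pure (a \<otimes>\<^bsub>A\<^esub> a') (b \<otimes>\<^bsub>B\<^esub> b')" unfolding a b .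
  then show ?thesis
    unfolding tensor_coset AB_mult[OF pure_in[OF c(1,2)] pure_in[OF c(3,4)]]
    using c by (intro coset_eqv mult_in pure_in A.m_closed B.m_closed)
qed

lemma hcomp0_free: "hcomp T 0 F = extend_linear (\<lambda>(a, b). pure (hcomp A 0 a) (hcomp B 0 b)) F"
  by (simp add: free_tensor_def extend_linear_def scale_single case_prod_unfold)

lemma hcomp0_coset: "F \<in> carrier T \<Longrightarrow> hcomp AB 0 (Q.coset F) = Q.coset (hcomp T 0 F)"
proof -
  assume "F \<in> carrier T"
  moreover have "bilinear_mod (\<lambda>(a, b). pure (hcomp A 0 a) (hcomp B 0 b))"
    by (intro bilinear_mod_compose) (auto simp: A.hcomp_add A.hcomp_smult B.hcomp_add B.hcomp_smult)
  ultimately show ?thesis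
    unfolding tensor_algebra_eq
    by (intro Q.hcomp_coset)
      (auto simp: hcomp0_free free_simps extend_linear_add intro!: free_extend_linear pure_in bilinear_mod_relations)
qed

lemma hcomp0_in: "F \<in> carrier T \<Longrightarrow> hcomp T 0 F \<in> carrier T"
  by (auto simp: hcomp0_free intro!: free_extend_linear pure_in)

lemma hcomp0_tensor:
  "a \<in> carrier A \<Longrightarrow> b \<in> carrier B \<Longrightarrow> hcomp AB 0 (tensor A B a b) = tensor A B (hcomp A 0 a) (hcomp B 0 b)"
  unfolding tensor_coset by (simp add: hcomp0_coset pure_in hcomp0_free extend_linear_single del: map_single)

text \<open>
  The product of the two augmentations is a linear functional that vanishes on the relations, so that the
  unit of the tensor product is not zero.
\<close>

lemma one_AB_not_zero: "\<one>\<^bsub>AB\<^esub> \<noteq> \<zero>\<^bsub>AB\<^esub>"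
proof
  define g where "g k = Poly_Mapping.single () (degree_zero A (fst k) * degree_zero B (snd k))" for k
  have "extend_linear g F = 0" if "F \<in> I" for F
    using that
  proof (induction rule: bilinear_relations.induct)
    case (lincomb F G z)
    then show ?case by (simp add: extend_linear_add extend_linear_scale)
  qed (simp_all add: extend_linear_minus extend_linear_add extend_linear_single g_def A.degree_zero_add B.degree_zero_add
        A.degree_zero_smult B.degree_zero_smult scale_single single_add single_diff[symmetric] algebra_simps)
  moreover assume "\<one>\<^bsub>AB\<^esub> = \<zero>\<^bsub>AB\<^esub>"
  then have "pure \<one>\<^bsub>A\<^esub> \<one>\<^bsub>B\<^esub> \<in> Q.coset 0"
    using Q.a_rcos_self[OF pure_in[OF A.one_closed B.one_closed, of 1]] by (simp add: AB_one AB_zero tensor_coset)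
  then have "pure \<one>\<^bsub>A\<^esub> \<one>\<^bsub>B\<^esub> \<in> I" by (auto simp: Q.in_coset_iff free_simps)
  ultimately have "extend_linear g (pure \<one>\<^bsub>A\<^esub> \<one>\<^bsub>B\<^esub>) = 0" by blast
  then have "Poly_Mapping.lookup (extend_linear g (pure \<one>\<^bsub>A\<^esub> \<one>\<^bsub>B\<^esub>)) () = 0" by simp
  then show False
    by (simp add: extend_linear_single g_def A.degree_zero_one B.degree_zero_one lookup_single)
qed

lemma span_families_tensor:
  assumes "x \<in> A.span_families S" "y \<in> B.span_families S'"
    "\<And>f g. f \<in> S \<Longrightarrow> g \<in> S' \<Longrightarrow> (\<lambda>i. f i * g i) \<in> S''"
  shows "(\<lambda>i. tensor A B (x i) (y i)) \<in> AB.span_families S''"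
  using assms(1)
proof induction
  case zero
  then show ?case using assms(2) by (auto simp: B.span_families_closed tensor_zero intro: AB.span_families.zero)
next
  case (add x1 x2)
  then show ?case using AB.span_families.add[OF add.IH]
    by (simp add: tensor_add_left B.span_families_closed[OF assms(2)] A.span_families_closed)
next
  case (single c v)
  from assms(2) show ?case
  proof induction
    case zero
    then show ?case using single by (auto simp: tensor_zero intro: AB.span_families.zero)
  next
    case (add x1 x2)
    then show ?case using AB.span_families.add[OF add.IH]
      by (simp add: tensor_add_right B.span_families_closed single)
  next
    case (single d w)
    then show ?case
      using \<open>c \<in> S\<close> \<open>v \<in> carrier A\<close> AB.span_families.single[OF assms(3)[OF \<open>c \<in> S\<close> single(1)], of "tensor A B v w"]
      by (simp add: tensor_smult_left tensor_smult_right AB.smult_smult mult.commute)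
  qed
qed

end


subsection \<open>Exponents on the tensor product\<close>

lemma (in abelian_monoid) finsum_shift:
  assumes "\<And>i. g i \<in> carrier G" "g N = \<zero>"
  shows "(\<Oplus>i\<in>{..<N}. g (Suc i)) = (\<Oplus>i\<in>{..<N}. if i = 0 then \<zero> else g i)"
proof -
  have "(\<Oplus>i\<in>{..<N}. g (Suc i)) = (\<Oplus>i\<in>Suc ` {..<N}. g i)"
    using assms by (subst finsum_reindex) auto
  also have "\<dots> = (\<Oplus>i\<in>{..<N}. if i = 0 then \<zero> else g i)"
  proof (rule add.finprod_mono_neutral_cong)
    fix i assume "i \<in> Suc ` {..<N} - {..<N}"
    then have "i = N" by auto
    then show "g i = \<zero>" using assms by simp
  next
    fix i assume "i \<in> {..<N} - Suc ` {..<N}"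
    then have "i = 0" by (cases i) auto
    then show "(if i = 0 then \<zero> else g i) = \<zero>" by simp
  qed (use assms in auto)
  finally show ?thesis .
qed

locale tensor_exponents = tensor_product A B + XA: exponent_class A \<beta> \<beta>0 NA + XB: exponent_class B \<gamma> \<gamma>0 NB
  for A :: "'a graded_algebra" and \<beta> \<beta>0 NA and B :: "'b graded_algebra" and \<gamma> \<gamma>0 NB +
  assumes even_beta: "even_class A \<beta>" and even_gamma: "even_class B \<gamma>"
begin

abbreviation "PA \<equiv> positive_part A \<beta>"
abbreviation "PB \<equiv> positive_part B \<gamma>"
abbreviation "\<delta> \<equiv> tensor_sum A B \<beta> \<gamma>"

lemma powers_in: "PA [^]\<^bsub>A\<^esub> (i::nat) \<in> carrier A" "PB [^]\<^bsub>B\<^esub> (i::nat) \<in> carrier B"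
  using XA.P_closed XB.P_closed by auto

lemma even_powers: "even_class A (PA [^]\<^bsub>A\<^esub> (i::nat))" "even_class B (PB [^]\<^bsub>B\<^esub> (i::nat))"
  using A.even_power[OF A.even_positive_part[OF even_beta]] B.even_power[OF B.even_positive_part[OF even_gamma]] by auto

text \<open>
  Linear combinations of the products of powers of the two nilpotent parts.  Multiplication by the
  nilpotent part of the sum is the Pascal recursion on coefficients.
\<close>

definition combination :: "(nat \<Rightarrow> nat \<Rightarrow> complex) \<Rightarrow> ('a \<times> 'b \<Rightarrow>\<^sub>0 complex) set" where
  "combination c = (\<Oplus>\<^bsub>AB\<^esub>i\<in>{..<NA}. \<Oplus>\<^bsub>AB\<^esub>j\<in>{..<NB}. c i j \<odot>\<^bsub>AB\<^esub> tensor A B (PA [^]\<^bsub>A\<^esub> i) (PB [^]\<^bsub>B\<^esub> j))"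

lemma combination_closed [simp]: "combination c \<in> carrier AB"
  unfolding combination_def by (intro AB.finsum_closed) (auto simp: powers_in)

lemma combination_cong: "(\<And>i j. i < NA \<Longrightarrow> j < NB \<Longrightarrow> c i j = d i j) \<Longrightarrow> combination c = combination d"
  unfolding combination_def by (intro AB.finsum_cong') (auto simp: powers_in)

lemma combination_add: "combination (\<lambda>i j. c i j + d i j) = combination c \<oplus>\<^bsub>AB\<^esub> combination d"
proof -
  let ?t = "\<lambda>i j. tensor A B (PA [^]\<^bsub>A\<^esub> (i::nat)) (PB [^]\<^bsub>B\<^esub> (j::nat))"
  have "(\<Oplus>\<^bsub>AB\<^esub>j\<in>{..<NB}. (c i j + d i j) \<odot>\<^bsub>AB\<^esub> ?t i j)
      = (\<Oplus>\<^bsub>AB\<^esub>j\<in>{..<NB}. c i j \<odot>\<^bsub>AB\<^esub> ?t i j) \<oplus>\<^bsub>AB\<^esub> (\<Oplus>\<^bsub>AB\<^esub>j\<in>{..<NB}. d i j \<odot>\<^bsub>AB\<^esub> ?t i j)" for i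
    by (subst AB.finsum_addf[symmetric]) (auto simp: powers_in AB.smult_l_distr intro!: AB.finsum_cong')
  then show ?thesis
    unfolding combination_def
    by (subst AB.finsum_addf[symmetric]) (auto simp: powers_in intro!: AB.finsum_cong' AB.finsum_closed)
qed

lemma combination_smult: "combination (\<lambda>i j. z * c i j) = z \<odot>\<^bsub>AB\<^esub> combination c"
proof -
  let ?t = "\<lambda>i j. tensor A B (PA [^]\<^bsub>A\<^esub> (i::nat)) (PB [^]\<^bsub>B\<^esub> (j::nat))"
  have "(\<Oplus>\<^bsub>AB\<^esub>j\<in>{..<NB}. (z * c i j) \<odot>\<^bsub>AB\<^esub> ?t i j) = z \<odot>\<^bsub>AB\<^esub> (\<Oplus>\<^bsub>AB\<^esub>j\<in>{..<NB}. c i j \<odot>\<^bsub>AB\<^esub> ?t i j)" for i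
    by (subst AB.finsum_smult_right) (auto simp: powers_in AB.smult_smult intro!: AB.finsum_cong')
  then show ?thesis
    unfolding combination_def
    by (subst AB.finsum_smult_right) (auto simp: powers_in intro!: AB.finsum_cong' AB.finsum_closed)
qed

lemma combination_zero: "combination (\<lambda>i j. 0) = \<zero>\<^bsub>AB\<^esub>"
  using combination_smult[of 0 "\<lambda>i j. 0"] by simp

lemma combination_sum: "combination (\<lambda>i j. \<Sum>k\<in>S. c k i j) = (\<Oplus>\<^bsub>AB\<^esub>k\<in>S. combination (c k))"
  by (induction S rule: infinite_finite_induct) (auto simp: combination_zero combination_add)

lemma tensor_fps_eval:
  "tensor A B (A.fps_eval PA F) (B.fps_eval PB G) = combination (\<lambda>i j. fps_nth F i * fps_nth G j)"
proof -
  have "tensor A B (A.fps_eval PA F) (B.fps_eval PB G)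
      = (\<Oplus>\<^bsub>AB\<^esub>i\<in>{..<NA}. tensor A B (fps_nth F i \<odot>\<^bsub>A\<^esub> PA [^]\<^bsub>A\<^esub> i) (B.fps_eval PB G))"
    unfolding A.fps_eval_truncate[OF XA.P_closed XA.exponent_nilpotent]
    by (rule tensor_finsum_left) (auto simp: powers_in XB.eval_P_closed)
  also have "\<dots> = combination (\<lambda>i j. fps_nth F i * fps_nth G j)"
    unfolding combination_def
  proof (rule AB.finsum_cong'[OF refl])
    fix i
    have "tensor A B (fps_nth F i \<odot>\<^bsub>A\<^esub> PA [^]\<^bsub>A\<^esub> i) (B.fps_eval PB G)
        = (\<Oplus>\<^bsub>AB\<^esub>j\<in>{..<NB}. tensor A B (fps_nth F i \<odot>\<^bsub>A\<^esub> PA [^]\<^bsub>A\<^esub> i) (fps_nth G j \<odot>\<^bsub>B\<^esub> PB [^]\<^bsub>B\<^esub> j))"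
      unfolding B.fps_eval_truncate[OF XB.P_closed XB.exponent_nilpotent]
      by (rule tensor_finsum_right) (auto simp: powers_in)
    also have "\<dots> = (\<Oplus>\<^bsub>AB\<^esub>j\<in>{..<NB}. (fps_nth F i * fps_nth G j) \<odot>\<^bsub>AB\<^esub> tensor A B (PA [^]\<^bsub>A\<^esub> i) (PB [^]\<^bsub>B\<^esub> j))"
      by (intro AB.finsum_cong') (auto simp: powers_in tensor_smult_left tensor_smult_right AB.smult_smult mult.commute)
    finally show "tensor A B (fps_nth F i \<odot>\<^bsub>A\<^esub> PA [^]\<^bsub>A\<^esub> i) (B.fps_eval PB G)
      = (\<Oplus>\<^bsub>AB\<^esub>j\<in>{..<NB}. (fps_nth F i * fps_nth G j) \<odot>\<^bsub>AB\<^esub> tensor A B (PA [^]\<^bsub>A\<^esub> i) (PB [^]\<^bsub>B\<^esub> j))" .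
  qed (auto simp: powers_in intro!: AB.finsum_closed)
  finally show ?thesis .
qed

lemma tensor_left_mult_combination:
  "tensor A B PA \<one>\<^bsub>B\<^esub> \<otimes>\<^bsub>AB\<^esub> combination c = combination (\<lambda>i j. if i = 0 then 0 else c (i - 1) j)"
proof -
  let ?t = "\<lambda>i j. tensor A B (PA [^]\<^bsub>A\<^esub> (i::nat)) (PB [^]\<^bsub>B\<^esub> (j::nat))"
  let ?p = "tensor A B PA \<one>\<^bsub>B\<^esub>"
  define g where "g i = (\<Oplus>\<^bsub>AB\<^esub>j\<in>{..<NB}. c (i - 1) j \<odot>\<^bsub>AB\<^esub> ?t i j)" for i
  have g_in: "g i \<in> carrier AB" for i unfolding g_def by (intro AB.finsum_closed) (auto simp: powers_in)
  have g_end: "g NA = \<zero>\<^bsub>AB\<^esub>"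
    by (simp add: g_def XA.exponent_nilpotent tensor_zero powers_in)
  have p: "?p \<in> carrier AB" using XA.P_closed by simp
  have "?p \<otimes>\<^bsub>AB\<^esub> combination c
      = (\<Oplus>\<^bsub>AB\<^esub>i\<in>{..<NA}. ?p \<otimes>\<^bsub>AB\<^esub> (\<Oplus>\<^bsub>AB\<^esub>j\<in>{..<NB}. c i j \<odot>\<^bsub>AB\<^esub> ?t i j))"
    unfolding combination_def by (rule AB.finsum_rdistr) (use p in \<open>auto simp: powers_in intro!: AB.finsum_closed\<close>)
  also have "\<dots> = (\<Oplus>\<^bsub>AB\<^esub>i\<in>{..<NA}. g (Suc i))"
  proof (rule AB.finsum_cong'[OF refl])
    fix i
    have "?p \<otimes>\<^bsub>AB\<^esub> (\<Oplus>\<^bsub>AB\<^esub>j\<in>{..<NB}. c i j \<odot>\<^bsub>AB\<^esub> ?t i j) = (\<Oplus>\<^bsub>AB\<^esub>j\<in>{..<NB}. ?p \<otimes>\<^bsub>AB\<^esub> (c i j \<odot>\<^bsub>AB\<^esub> ?t i j))"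
      by (rule AB.finsum_rdistr) (use p in \<open>auto simp: powers_in\<close>)
    also have "\<dots> = g (Suc i)"
      unfolding g_def
    proof (rule AB.finsum_cong'[OF refl])
      fix j
      have "?p \<otimes>\<^bsub>AB\<^esub> ?t i j = ?t (Suc i) j"
        using XA.P_closed powers_in B.even_one
        by (subst tensor_mult) (auto simp: A.power_commutes[OF XA.P_closed XA.exponent_nilpotent])
      then show "?p \<otimes>\<^bsub>AB\<^esub> (c i j \<odot>\<^bsub>AB\<^esub> ?t i j) = c (Suc i - 1) j \<odot>\<^bsub>AB\<^esub> ?t (Suc i) j"
        using p by (simp add: AB.smult_mult_right powers_in)
    qed (auto simp: powers_in XA.P_closed)
    finally show "?p \<otimes>\<^bsub>AB\<^esub> (\<Oplus>\<^bsub>AB\<^esub>j\<in>{..<NB}. c i j \<odot>\<^bsub>AB\<^esub> ?t i j) = g (Suc i)" .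
  qed (use g_in in auto)
  also have "\<dots> = (\<Oplus>\<^bsub>AB\<^esub>i\<in>{..<NA}. if i = 0 then \<zero>\<^bsub>AB\<^esub> else g i)"
    by (rule AB.finsum_shift[of g NA, OF g_in g_end])
  also have "\<dots> = combination (\<lambda>i j. if i = 0 then 0 else c (i - 1) j)"
    unfolding combination_def g_def
    by (intro AB.finsum_cong'[OF refl]) (auto simp: powers_in intro!: AB.finsum_closed)
  finally show ?thesis .
qed

lemma tensor_right_mult_combination:
  "tensor A B \<one>\<^bsub>A\<^esub> PB \<otimes>\<^bsub>AB\<^esub> combination c = combination (\<lambda>i j. if j = 0 then 0 else c i (j - 1))"
proof -
  let ?t = "\<lambda>i j. tensor A B (PA [^]\<^bsub>A\<^esub> (i::nat)) (PB [^]\<^bsub>B\<^esub> (j::nat))"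
  let ?p = "tensor A B \<one>\<^bsub>A\<^esub> PB"
  have p: "?p \<in> carrier AB" using XB.P_closed by simp
  have "?p \<otimes>\<^bsub>AB\<^esub> combination c
      = (\<Oplus>\<^bsub>AB\<^esub>i\<in>{..<NA}. ?p \<otimes>\<^bsub>AB\<^esub> (\<Oplus>\<^bsub>AB\<^esub>j\<in>{..<NB}. c i j \<odot>\<^bsub>AB\<^esub> ?t i j))"
    unfolding combination_def by (rule AB.finsum_rdistr) (use p in \<open>auto simp: powers_in intro!: AB.finsum_closed\<close>)
  also have "\<dots> = combination (\<lambda>i j. if j = 0 then 0 else c i (j - 1))"
    unfolding combination_def
  proof (rule AB.finsum_cong'[OF refl])
    fix i
    define g where "g j = c i (j - 1) \<odot>\<^bsub>AB\<^esub> ?t i j" for j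
    have g_in: "g j \<in> carrier AB" for j unfolding g_def by (auto simp: powers_in)
    have g_end: "g NB = \<zero>\<^bsub>AB\<^esub>"
      by (simp add: g_def XB.exponent_nilpotent tensor_zero powers_in)
    have "?p \<otimes>\<^bsub>AB\<^esub> (\<Oplus>\<^bsub>AB\<^esub>j\<in>{..<NB}. c i j \<odot>\<^bsub>AB\<^esub> ?t i j) = (\<Oplus>\<^bsub>AB\<^esub>j\<in>{..<NB}. ?p \<otimes>\<^bsub>AB\<^esub> (c i j \<odot>\<^bsub>AB\<^esub> ?t i j))"
      by (rule AB.finsum_rdistr) (use p in \<open>auto simp: powers_in\<close>)
    also have "\<dots> = (\<Oplus>\<^bsub>AB\<^esub>j\<in>{..<NB}. g (Suc j))"
    proof (rule AB.finsum_cong'[OF refl])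
      fix j
      have "?p \<otimes>\<^bsub>AB\<^esub> ?t i j = ?t i (Suc j)"
        using XB.P_closed powers_in even_powers
        by (subst tensor_mult) (auto simp: B.power_commutes[OF XB.P_closed XB.exponent_nilpotent])
      then show "?p \<otimes>\<^bsub>AB\<^esub> (c i j \<odot>\<^bsub>AB\<^esub> ?t i j) = g (Suc j)"
        using p by (simp add: AB.smult_mult_right powers_in g_def)
    qed (use g_in in auto)
    also have "\<dots> = (\<Oplus>\<^bsub>AB\<^esub>j\<in>{..<NB}. if j = 0 then \<zero>\<^bsub>AB\<^esub> else g j)"
      by (rule AB.finsum_shift[of g NB, OF g_in g_end])
    also have "\<dots> = (\<Oplus>\<^bsub>AB\<^esub>j\<in>{..<NB}. (if j = 0 then 0 else c i (j - 1)) \<odot>\<^bsub>AB\<^esub> ?t i j)"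
      unfolding g_def by (intro AB.finsum_cong'[OF refl]) (auto simp: powers_in)
    finally show "?p \<otimes>\<^bsub>AB\<^esub> (\<Oplus>\<^bsub>AB\<^esub>j\<in>{..<NB}. c i j \<odot>\<^bsub>AB\<^esub> ?t i j)
      = (\<Oplus>\<^bsub>AB\<^esub>j\<in>{..<NB}. (if j = 0 then 0 else c i (j - 1)) \<odot>\<^bsub>AB\<^esub> ?t i j)" .
  qed (auto simp: powers_in intro!: AB.finsum_closed)
  finally show ?thesis .
qed

lemma delta_closed: "\<delta> \<in> carrier AB"
  by (simp add: tensor_sum_def XA.exponent_closed XB.exponent_closed)

lemma hcomp0_AB_closed: "x \<in> carrier AB \<Longrightarrow> hcomp AB 0 x \<in> carrier AB"
  by (auto simp: carrier_AB hcomp0_coset hcomp0_in)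

lemma hcomp0_AB_add:
  "x \<in> carrier AB \<Longrightarrow> y \<in> carrier AB \<Longrightarrow> hcomp AB 0 (x \<oplus>\<^bsub>AB\<^esub> y) = hcomp AB 0 x \<oplus>\<^bsub>AB\<^esub> hcomp AB 0 y"
  unfolding carrier_AB
  by (elim imageE) (simp add: AB_add hcomp0_coset hcomp0_in free_add, simp add: hcomp0_free extend_linear_add)

lemma hcomp0_AB_smult: "x \<in> carrier AB \<Longrightarrow> hcomp AB 0 (z \<odot>\<^bsub>AB\<^esub> x) = z \<odot>\<^bsub>AB\<^esub> hcomp AB 0 x"
  unfolding carrier_AB
  by (elim imageE) (simp add: AB_smult hcomp0_coset hcomp0_in free_scale, simp add: hcomp0_free extend_linear_scale)

lemma hcomp0_AB_one: "hcomp AB 0 \<one>\<^bsub>AB\<^esub> = \<one>\<^bsub>AB\<^esub>"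
  by (simp add: AB_one hcomp0_tensor A.hcomp_one B.hcomp_one)

lemma hcomp0_delta: "hcomp AB 0 \<delta> = (\<beta>0 + \<gamma>0) \<odot>\<^bsub>AB\<^esub> \<one>\<^bsub>AB\<^esub>"
  by (simp add: tensor_sum_def hcomp0_AB_add hcomp0_tensor XA.exponent_closed XB.exponent_closed A.hcomp_one B.hcomp_one
      XA.hcomp0_exponent XB.hcomp0_exponent tensor_smult_left tensor_smult_right AB_one[symmetric] AB.smult_l_distr)

lemma positive_part_delta: "positive_part AB \<delta> = tensor A B PA \<one>\<^bsub>B\<^esub> \<oplus>\<^bsub>AB\<^esub> tensor A B \<one>\<^bsub>A\<^esub> PB"
proof -
  have A: "\<beta> = PA \<oplus>\<^bsub>A\<^esub> \<beta>0 \<odot>\<^bsub>A\<^esub> \<one>\<^bsub>A\<^esub>" and B: "\<gamma> = PB \<oplus>\<^bsub>B\<^esub> \<gamma>0 \<odot>\<^bsub>B\<^esub> \<one>\<^bsub>B\<^esub>"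
    using XA.exponent_closed XB.exponent_closed
    by (simp_all add: positive_part_def XA.hcomp0_exponent XB.hcomp0_exponent a_minus_def
        A.a_assoc B.a_assoc A.l_neg B.l_neg)
  have 1: "tensor A B \<beta> \<one>\<^bsub>B\<^esub> = tensor A B PA \<one>\<^bsub>B\<^esub> \<oplus>\<^bsub>AB\<^esub> \<beta>0 \<odot>\<^bsub>AB\<^esub> \<one>\<^bsub>AB\<^esub>"
    using XA.P_closed by (subst A) (simp add: tensor_add_left tensor_smult_left AB_one)
  have 2: "tensor A B \<one>\<^bsub>A\<^esub> \<gamma> = tensor A B \<one>\<^bsub>A\<^esub> PB \<oplus>\<^bsub>AB\<^esub> \<gamma>0 \<odot>\<^bsub>AB\<^esub> \<one>\<^bsub>AB\<^esub>"
    using XB.P_closed by (subst B) (simp add: tensor_add_right tensor_smult_right AB_one)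
  have "positive_part AB \<delta> = (tensor A B PA \<one>\<^bsub>B\<^esub> \<oplus>\<^bsub>AB\<^esub> \<beta>0 \<odot>\<^bsub>AB\<^esub> \<one>\<^bsub>AB\<^esub>) \<oplus>\<^bsub>AB\<^esub>
      (tensor A B \<one>\<^bsub>A\<^esub> PB \<oplus>\<^bsub>AB\<^esub> \<gamma>0 \<odot>\<^bsub>AB\<^esub> \<one>\<^bsub>AB\<^esub>) \<ominus>\<^bsub>AB\<^esub> (\<beta>0 \<odot>\<^bsub>AB\<^esub> \<one>\<^bsub>AB\<^esub> \<oplus>\<^bsub>AB\<^esub> \<gamma>0 \<odot>\<^bsub>AB\<^esub> \<one>\<^bsub>AB\<^esub>)"
  proof -
    have "positive_part AB \<delta> = \<delta> \<ominus>\<^bsub>AB\<^esub> (\<beta>0 \<odot>\<^bsub>AB\<^esub> \<one>\<^bsub>AB\<^esub> \<oplus>\<^bsub>AB\<^esub> \<gamma>0 \<odot>\<^bsub>AB\<^esub> \<one>\<^bsub>AB\<^esub>)"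
      by (simp add: positive_part_def[of AB] hcomp0_delta AB.smult_l_distr)
    then show ?thesis unfolding tensor_sum_def 1 2 .
  qed
  also have "\<dots> = tensor A B PA \<one>\<^bsub>B\<^esub> \<oplus>\<^bsub>AB\<^esub> tensor A B \<one>\<^bsub>A\<^esub> PB"
  proof -
    have c: "tensor A B PA \<one>\<^bsub>B\<^esub> \<in> carrier AB" "tensor A B \<one>\<^bsub>A\<^esub> PB \<in> carrier AB"
      "\<beta>0 \<odot>\<^bsub>AB\<^esub> \<one>\<^bsub>AB\<^esub> \<in> carrier AB" "\<gamma>0 \<odot>\<^bsub>AB\<^esub> \<one>\<^bsub>AB\<^esub> \<in> carrier AB"
      using XA.P_closed XB.P_closed by auto
    have "(x \<oplus>\<^bsub>AB\<^esub> u) \<oplus>\<^bsub>AB\<^esub> (y \<oplus>\<^bsub>AB\<^esub> v) \<ominus>\<^bsub>AB\<^esub> (u \<oplus>\<^bsub>AB\<^esub> v) = x \<oplus>\<^bsub>AB\<^esub> y"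
      if "x \<in> carrier AB" "y \<in> carrier AB" "u \<in> carrier AB" "v \<in> carrier AB" for x y u v
      using that by algebra
    then show ?thesis using c by blast
  qed
  finally show ?thesis .
qed

text \<open>
  The binomial theorem for the two nilpotent parts, which commute in the tensor product because one of them
  is multiplied into the first factor and the other, which is even, into the second.
\<close>

lemma positive_part_delta_power:
  "positive_part AB \<delta> [^]\<^bsub>AB\<^esub> (k::nat) = combination (\<lambda>i j. if i + j = k then of_nat (k choose i) else 0)"
proof (induction k)
  case 0
  have "\<one>\<^bsub>AB\<^esub> = tensor A B (A.fps_eval PA 1) (B.fps_eval PB 1)"
    by (simp add: XA.eval_P_one XB.eval_P_one AB_one)
  also have "\<dots> = combination (\<lambda>i j. if i + j = 0 then of_nat (0 choose i) else 0)"
    unfolding tensor_fps_eval by (rule combination_cong) auto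
  finally show ?case by simp
next
  case (Suc k)
  have c: "tensor A B PA \<one>\<^bsub>B\<^esub> \<in> carrier AB" "tensor A B \<one>\<^bsub>A\<^esub> PB \<in> carrier AB"
    using XA.P_closed XB.P_closed by auto
  have "positive_part AB \<delta> [^]\<^bsub>AB\<^esub> Suc k = positive_part AB \<delta> \<otimes>\<^bsub>AB\<^esub> positive_part AB \<delta> [^]\<^bsub>AB\<^esub> k"
    by (rule AB.nat_pow_Suc2) (simp add: positive_part_delta c)
  also have "\<dots> = tensor A B PA \<one>\<^bsub>B\<^esub> \<otimes>\<^bsub>AB\<^esub> combination (\<lambda>i j. if i + j = k then of_nat (k choose i) else 0)
      \<oplus>\<^bsub>AB\<^esub> tensor A B \<one>\<^bsub>A\<^esub> PB \<otimes>\<^bsub>AB\<^esub> combination (\<lambda>i j. if i + j = k then of_nat (k choose i) else 0)"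
    using c by (simp only: Suc) (simp only: positive_part_delta AB.l_distr combination_closed)
  also have "\<dots> = combination (\<lambda>i j. if i + j = Suc k then of_nat (Suc k choose i) else 0)"
    unfolding tensor_left_mult_combination tensor_right_mult_combination combination_add[symmetric]
  proof (rule combination_cong)
    fix i j
    show "(if i = 0 then 0 else if i - 1 + j = k then of_nat (k choose (i - 1)) else 0) +
        (if j = 0 then 0 else if i + (j - 1) = k then of_nat (k choose i) else 0)
        = (if i + j = Suc k then of_nat (Suc k choose i) else (0::complex))"
      by (cases i; cases j) auto
  qed
  finally show ?case .
qed

lemma exponent_class_delta: "exponent_class AB \<delta> (\<beta>0 + \<gamma>0) (NA + NB)"
proof -
  have "positive_part AB \<delta> [^]\<^bsub>AB\<^esub> (NA + NB) = combination (\<lambda>i j. 0)"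
    unfolding positive_part_delta_power by (rule combination_cong) auto
  then show ?thesis
    by (intro exponent_class.intro[OF AB.complex_algebra_axioms] exponent_class_axioms.intro)
      (auto simp: hcomp0_AB_closed hcomp0_AB_add hcomp0_AB_smult hcomp0_AB_one one_AB_not_zero delta_closed hcomp0_delta
        combination_zero)
qed

sublocale XAB: exponent_class AB \<delta> "\<beta>0 + \<gamma>0" "NA + NB"
  by (rule exponent_class_delta)

text \<open>By the binomial theorem the exponential series of the sum is the product of the exponential series.\<close>

lemma fps_exp_tensor:
  "XAB.eval_P (fps_exp \<mu>) = tensor A B (XA.eval_P (fps_exp \<mu>)) (XB.eval_P (fps_exp \<mu>))"
proof -
  have "XAB.eval_P (fps_exp \<mu>) = (\<Oplus>\<^bsub>AB\<^esub>k\<in>{..<NA + NB}. combination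
      (\<lambda>i j. (\<mu> ^ k / fact k) * (if i + j = k then of_nat (k choose i) else 0)))"
    unfolding AB.fps_eval_truncate[OF XAB.P_closed XAB.exponent_nilpotent] combination_smult
      positive_part_delta_power[symmetric]
    by simp
  also have "\<dots> = combination (\<lambda>i j. \<Sum>k<NA + NB. (\<mu> ^ k / fact k) * (if i + j = k then of_nat (k choose i) else 0))"
    by (rule combination_sum[symmetric])
  also have "\<dots> = combination (\<lambda>i j. fps_nth (fps_exp \<mu>) i * fps_nth (fps_exp \<mu>) j)"
  proof (rule combination_cong)
    fix i j assume ij: "i < NA" "j < NB"
    have "(\<Sum>k<NA + NB. (\<mu> ^ k / fact k) * (if i + j = k then of_nat (k choose i) else 0))
        = (\<Sum>k<NA + NB. if i + j = k then (\<mu> ^ k / fact k) * of_nat (k choose i) else 0)"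
      by (rule sum.cong) auto
    also have "\<dots> = (\<mu> ^ (i + j) / fact (i + j)) * of_nat ((i + j) choose i)"
      using ij by (subst sum.delta') auto
    also have "\<dots> = fps_nth (fps_exp \<mu>) i * fps_nth (fps_exp \<mu>) j"
      by (simp add: binomial_fact power_add field_simps)
    finally show "(\<Sum>k<NA + NB. (\<mu> ^ k / fact k) * (if i + j = k then of_nat (k choose i) else 0))
        = fps_nth (fps_exp \<mu>) i * fps_nth (fps_exp \<mu>) j" .
  qed
  also have "\<dots> = tensor A B (XA.eval_P (fps_exp \<mu>)) (XB.eval_P (fps_exp \<mu>))"
    by (rule tensor_fps_eval[symmetric])
  finally show ?thesis .
qed

end


section \<open>Stirling asymptotics for Taylor coefficients of the reciprocal Gamma function\<close>

text \<open>
  For \<open>k > 0\<close> this is \<open>k! k\<^sup>x / \<Gamma>(1 + k + x)\<close>.  It is an entire function of \<open>x\<close> because \<open>1 / \<Gamma>\<close> is entire and the power of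
  \<open>k\<close> is written as an exponential.
\<close>

definition gamma_ratio :: "nat \<Rightarrow> complex \<Rightarrow> complex" where
  "gamma_ratio k x = fact k * exp (x * of_real (ln (real k))) * rGamma (1 + of_nat k + x)"

lemma holomorphic_gamma_ratio: "gamma_ratio k holomorphic_on S"
  unfolding gamma_ratio_def by (intro holomorphic_intros)

text \<open>The Gamma quotient is the quotient of Euler's product approximation to \<open>\<Gamma>\<close> and of \<open>\<Gamma>\<close> itself.\<close>

lemma gamma_ratio_eq_exp:
  assumes "k > 0" "x \<notin> \<int>\<^sub>\<le>\<^sub>0"
  shows "gamma_ratio k x = exp (ln_Gamma_series x k - ln_Gamma x)"
proof -
  have rG: "rGamma x = pochhammer x (k + 1) * rGamma (x + of_nat (k + 1))"
    by (rule pochhammer_rGamma)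
  have nz: "rGamma x \<noteq> 0" using assms(2) by (simp add: rGamma_eq_zero_iff)
  then have nz': "pochhammer x (k + 1) \<noteq> 0" using rG by (metis mult_zero_left)
  have "Gamma_series x k * rGamma x
      = fact k * exp (x * of_real (ln (real k))) * rGamma (x + of_nat (k + 1))"
    unfolding rG Gamma_series_def using nz' by (simp del: pochhammer_Suc)
  also have "x + of_nat (k + 1) = 1 + of_nat k + x" by simp
  finally have "gamma_ratio k x = Gamma_series x k * rGamma x"
    unfolding gamma_ratio_def by (rule sym)
  also have "\<dots> = exp (ln_Gamma_series x k) * exp (- ln_Gamma x)"
    using assms by (simp add: exp_ln_Gamma_series_complex rGamma_complex_altdef)
  finally show ?thesis by (simp add: exp_minus exp_diff divide_inverse)
qed

lemma uniform_limit_ln_Gamma_series: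
  assumes "compact K" "K \<inter> \<int>\<^sub>\<le>\<^sub>0 = {}"
  shows "uniform_limit K (\<lambda>n z. ln_Gamma_series z n) (ln_Gamma :: complex \<Rightarrow> complex) sequentially"
proof -
  have "\<exists>d>0. uniform_limit (ball z d) (\<lambda>n z. ln_Gamma_series z n) ln_Gamma sequentially" if "z \<in> K" for z
  proof -
    have "z \<notin> \<int>\<^sub>\<le>\<^sub>0" using assms that by auto
    then obtain d where "d > 0" "uniformly_convergent_on (ball z d) (\<lambda>n z. ln_Gamma_series z n)"
      using ln_Gamma_series_complex_converges' by blast
    then show ?thesis unfolding uniformly_convergent_uniform_limit_iff ln_Gamma_def[symmetric] by auto
  qed
  then obtain d where d: "\<And>z. z \<in> K \<Longrightarrow> d z > 0"
    "\<And>z. z \<in> K \<Longrightarrow> uniform_limit (ball z (d z)) (\<lambda>n z. ln_Gamma_series z n) ln_Gamma sequentially"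
    by metis
  obtain C where C: "C \<subseteq> K" "finite C" "K \<subseteq> (\<Union>z\<in>C. ball z (d z))"
  proof (rule compactE_image[OF assms(1), of K "\<lambda>z. ball z (d z)"])
    show "K \<subseteq> (\<Union>z\<in>K. ball z (d z))" using d(1) by force
  qed auto
  have "uniform_limit (\<Union>z\<in>C. ball z (d z)) (\<lambda>n z. ln_Gamma_series z n) ln_Gamma sequentially"
    using C d(2) by (intro uniform_limit_on_UNION) auto
  then show ?thesis using C(3) by (rule uniform_limit_on_subset)
qed

text \<open>
  By Cauchy's inequality it suffices to have uniform convergence on a circle about \<open>x\<close>, and the circle can be
  chosen to avoid the poles of the Gamma function even if \<open>x\<close> is one of them.
\<close>

theorem tendsto_fps_gamma_ratio:
  "(\<lambda>k. fps_nth (fps_expansion (gamma_ratio k) x) j) \<longlonglongrightarrow> (if j = 0 then 1 else 0)"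
proof -
  have "uncountable ({0<..<1::real} - range (\<lambda>n. dist x (- of_nat n)))"
    by (intro uncountable_minus_countable) (auto simp: uncountable_open_interval)
  then have "{0<..<1::real} - range (\<lambda>n. dist x (- of_nat n)) \<noteq> {}" by force
  then obtain \<rho> where \<rho>'': "\<rho> \<in> {0<..<1::real} - range (\<lambda>n. dist x (- of_nat n))" by blast
  then have \<rho>: "0 < \<rho>" "\<rho> < 1" and \<rho>': "\<rho> \<notin> range (\<lambda>n. dist x (- of_nat n))" by simp_all
  have K: "sphere x \<rho> \<inter> \<int>\<^sub>\<le>\<^sub>0 = {}"
  proof -
    have False if "z \<in> sphere x \<rho>" "z \<in> \<int>\<^sub>\<le>\<^sub>0" for z
    proof -
      from that(2) obtain n where "z = - of_nat n" by (elim nonpos_Ints_cases')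
      then show False using that(1) \<rho>' by auto
    qed
    then show ?thesis by blast
  qed
  show ?thesis
    unfolding LIMSEQ_iff
  proof (intro allI impI)
    fix e :: real assume "e > 0"
    define e' where "e' = e / 2 * \<rho> ^ j"
    have "e' > 0" using \<open>e > 0\<close> \<rho> by (simp add: e'_def)
    have "(exp \<longlongrightarrow> exp (0::complex)) (nhds 0)"
      by (rule tendsto_exp) (rule filterlim_ident)
    then have "\<forall>\<^sub>F w in nhds (0::complex). dist (exp w) 1 < e'"
      using \<open>e' > 0\<close> by (auto dest: tendstoD)
    then obtain d where d: "d > 0" "\<And>w::complex. norm w < d \<Longrightarrow> dist (exp w) 1 < e'"
      by (auto simp: eventually_nhds_metric dist_norm)
    have "\<forall>\<^sub>F k in sequentially. \<forall>z\<in>sphere x \<rho>. dist (ln_Gamma_series z k) (ln_Gamma z) < d"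
      using uniform_limit_ln_Gamma_series[OF compact_sphere K] d(1) by (auto simp: uniform_limit_iff)
    then obtain N where N: "\<And>k z. k \<ge> N \<Longrightarrow> z \<in> sphere x \<rho> \<Longrightarrow> dist (ln_Gamma_series z k) (ln_Gamma z) < d"
      unfolding eventually_sequentially by blast
    show "\<exists>N. \<forall>k\<ge>N. norm (fps_nth (fps_expansion (gamma_ratio k) x) j - (if j = 0 then 1 else 0)) < e"
    proof (intro exI[of _ "max 1 N"] allI impI)
      fix k assume k: "max 1 N \<le> k"
      let ?g = "\<lambda>z. gamma_ratio k z - 1"
      have "norm ((deriv ^^ j) ?g x) \<le> fact j * e' / \<rho> ^ j"
      proof (rule Cauchy_inequality)
        show "?g holomorphic_on ball x \<rho>" by (intro holomorphic_intros holomorphic_gamma_ratio)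
        show "continuous_on (cball x \<rho>) ?g"
          by (intro continuous_intros holomorphic_on_imp_continuous_on holomorphic_gamma_ratio)
        fix z assume z: "norm (x - z) = \<rho>"
        then have zs: "z \<in> sphere x \<rho>" by (simp add: dist_norm)
        then have "gamma_ratio k z = exp (ln_Gamma_series z k - ln_Gamma z)"
          using K k by (intro gamma_ratio_eq_exp) auto
        moreover have "norm (ln_Gamma_series z k - ln_Gamma z) < d" using N[OF _ zs, of k] k by (simp add: dist_norm)
        ultimately show "norm (?g z) \<le> e'" using d(2)[of "ln_Gamma_series z k - ln_Gamma z"] by (simp add: dist_norm)
      qed (use \<rho> in auto)
      also have "(deriv ^^ j) ?g x = (deriv ^^ j) (gamma_ratio k) x - (if j = 0 then 1 else 0)"
        by (subst higher_deriv_diff[of _ UNIV]) (auto intro: holomorphic_gamma_ratio)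
      finally have "norm ((deriv ^^ j) (gamma_ratio k) x - (if j = 0 then 1 else 0)) / fact j \<le> e' / \<rho> ^ j"
        by (simp add: field_simps)
      moreover have "norm (fps_nth (fps_expansion (gamma_ratio k) x) j - (if j = 0 then 1 else 0))
          = norm ((deriv ^^ j) (gamma_ratio k) x - (if j = 0 then 1 else 0)) / fact j"
        by (cases "j = 0") (simp_all add: fps_expansion_def norm_divide)
      moreover have "e' / \<rho> ^ j < e" using \<open>e > 0\<close> \<rho> by (simp add: e'_def)
      ultimately show "norm (fps_nth (fps_expansion (gamma_ratio k) x) j - (if j = 0 then 1 else 0)) < e" by simp
    qed
  qed
qed

text \<open>
  The Taylor series of \<open>1 / \<Gamma>\<close> far to the right is, up to an explicit exponential factor, that of a function which
  tends to \<open>1\<close>.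
\<close>

lemma fps_expansion_rGamma:
  "fps_expansion rGamma (1 + (of_nat k + x))
     = fps_const (exp (- (x * of_real (ln (real k)))) / fact k) * (fps_exp (- of_real (ln (real k))) * fps_expansion (gamma_ratio k) x)"
proof (rule fps_expansion_unique_complex)
  show "(\<lambda>h. rGamma (1 + (of_nat k + x) + h)) has_fps_expansion fps_expansion rGamma (1 + (of_nat k + x))"
    by (rule analytic_at_imp_has_fps_expansion) (rule analytic_rGamma)
  have "(\<lambda>h. exp (- (x * of_real (ln (real k)))) / fact k * (exp ((- of_real (ln (real k))) * h) * gamma_ratio k (x + h)))
     has_fps_expansion fps_const (exp (- (x * of_real (ln (real k)))) / fact k) * (fps_exp (- of_real (ln (real k))) * fps_expansion (gamma_ratio k) x)"
    by (intro fps_expansion_intros analytic_at_imp_has_fps_expansion holomorphic_on_imp_analytic_at[of _ UNIV] holomorphic_gamma_ratio) auto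
  moreover have "exp (- (x * of_real (ln (real k)))) / fact k * (exp ((- of_real (ln (real k))) * h) * gamma_ratio k (x + h))
     = rGamma (1 + (of_nat k + x) + h)" for h
    by (simp add: gamma_ratio_def exp_add exp_minus distrib_right add_ac field_simps)
  ultimately show "(\<lambda>h. rGamma (1 + (of_nat k + x) + h)) has_fps_expansion
     fps_const (exp (- (x * of_real (ln (real k)))) / fact k) * (fps_exp (- of_real (ln (real k))) * fps_expansion (gamma_ratio k) x)"
    by simp
qed

text \<open>
  Induction along the recursion for the coefficients of the inverse series: of \<open>F n\<close> its sum contains only the
  coefficients of positive index, which tend to zero.
\<close>

lemma tendsto_fps_inverse:
  fixes F :: "nat \<Rightarrow> complex fps"
  assumes "\<And>j. (\<lambda>n. fps_nth (F n) j) \<longlonglongrightarrow> (if j = 0 then 1 else 0)"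
  shows "(\<lambda>n. fps_nth (inverse (F n)) j) \<longlonglongrightarrow> (if j = 0 then 1 else 0)"
proof (induction j rule: less_induct)
  case (less j)
  show ?case
  proof (cases j)
    case 0
    have "(\<lambda>n. inverse (fps_nth (F n) 0)) \<longlonglongrightarrow> inverse 1" using assms[of 0] by (intro tendsto_inverse) auto
    then show ?thesis by (simp add: 0)
  next
    case (Suc i)
    have "fps_nth (inverse (F n)) j = - inverse (fps_nth (F n) 0) * (\<Sum>l=1..j. fps_nth (F n) l * fps_nth (inverse (F n)) (j - l))" for n
      unfolding fps_inverse_def Suc fps_nth_Abs_fps by (rule fps_right_inverse_constructor.simps(2))
    moreover have "(\<lambda>n. - inverse (fps_nth (F n) 0) * (\<Sum>l=1..j. fps_nth (F n) l * fps_nth (inverse (F n)) (j - l)))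
       \<longlonglongrightarrow> - inverse 1 * (\<Sum>l=1..j. 0 * (if j - l = 0 then 1 else 0))"
    proof (intro tendsto_intros)
      show "(\<lambda>n. fps_nth (F n) 0) \<longlonglongrightarrow> 1" using assms[of 0] by simp
      fix l assume l: "l \<in> {1..j}"
      show "(\<lambda>n. fps_nth (F n) l) \<longlonglongrightarrow> 0" using assms[of l] l by simp
      show "(\<lambda>n. fps_nth (inverse (F n)) (j - l)) \<longlonglongrightarrow> (if j - l = 0 then 1 else 0)"
        using l by (intro less.IH) auto
    qed auto
    ultimately show ?thesis using Suc by simp
  qed
qed


section \<open>Binomial weights on a lattice\<close>

definition binomial_weight :: "real \<Rightarrow> nat \<Rightarrow> nat \<Rightarrow> real" where
  "binomial_weight p n k = real (n choose k) * p ^ k * (1 - p) ^ (n - k)"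

definition lattice_points :: "nat \<Rightarrow> nat \<Rightarrow> nat \<Rightarrow> (nat \<times> nat) set" where
  "lattice_points r s n = {(i, j). r * i + s * j = n}"

lemma finite_lattice_points: "r > 0 \<Longrightarrow> s > 0 \<Longrightarrow> finite (lattice_points r s n)"
proof (rule finite_subset)
  assume "r > 0" "s > 0"
  then have 1: "i \<le> r * i" "j \<le> s * j" for i j by (cases r; cases s; simp)+
  show "lattice_points r s n \<subseteq> {..n} \<times> {..n}"
  proof clarify
    fix i j assume "(i, j) \<in> lattice_points r s n"
    then have "r * i + s * j = n" by (simp add: lattice_points_def)
    then have "i \<le> n" "j \<le> n" using 1(1)[of i] 1(2)[of j] by linarith+
    then show "i \<in> {..n} \<and> j \<in> {..n}" by simp
  qed
qed auto

lemma cis_2pi_nat: "cis (2 * pi * real l) = 1"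
  using cis_multiple_2pi[of "real l"] by simp

lemma sum_roots_of_unity:
  assumes "r > 0"
  shows "(\<Sum>u<r. cis (2 * pi * real u * real k / real r)) = (if r dvd k then of_nat r else 0)"
proof -
  define z where "z = cis (2 * pi * real k / real r)"
  have zu: "cis (2 * pi * real u * real k / real r) = z ^ u" for u
    unfolding z_def Complex.DeMoivre by (rule arg_cong[of _ _ cis]) (simp add: mult_ac)
  have zr: "z ^ r = 1"
  proof -
    have "z ^ r = cis (2 * pi * real k)" using assms by (simp add: z_def Complex.DeMoivre)
    also have "\<dots> = 1" by (rule cis_2pi_nat)
    finally show ?thesis .
  qed
  show ?thesis
  proof (cases "r dvd k")
    case True
    then obtain l where "k = r * l" by auto
    then have "2 * pi * real k / real r = 2 * pi * real l" using assms by simp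
    then have "z = 1" unfolding z_def by (simp only: cis_2pi_nat)
    then show ?thesis using True by (simp add: zu)
  next
    case False
    have "z \<noteq> 1"
    proof
      assume "z = 1"
      then have "cos (2 * pi * real k / real r) = 1" by (simp add: z_def complex_eq_iff)
      then obtain l :: int where "2 * pi * real k / real r = of_int l * 2 * pi" by (auto simp: cos_one_2pi_int)
      then have "real k = of_int l * real r" using assms by (simp add: field_simps)
      then have "real_of_int (int k) = real_of_int (l * int r)" by simp
      then have "int k = l * int r" by (simp only: of_int_eq_iff)
      then have "int r dvd int k" by simp
      then show False using False by simp
    qed
    then have "(\<Sum>u<r. z ^ u) = (z ^ r - 1) / (z - 1)" by (rule geometric_sum)
    then show ?thesis using False by (simp add: zu zr)
  qed
qed

text \<open>The unit circle contains no line segments.\<close>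

lemma norm_convex_combination_cis_less_one:
  assumes "0 < p" "p < 1" "cis a \<noteq> cis b"
  shows "norm (of_real p * cis a + of_real (1 - p) * cis b) < 1"
proof -
  have "cos (a - b) \<noteq> 1"
  proof
    assume "cos (a - b) = 1"
    then obtain l :: int where "a - b = of_int l * 2 * pi" by (auto simp: cos_one_2pi_int)
    then have "a = b + 2 * pi * of_int l" by (simp add: algebra_simps)
    then have "cis a = cis b * cis (2 * pi * of_int l)" unfolding cis_mult by (rule arg_cong)
    also have "cis (2 * pi * of_int l) = 1" by (rule cis_multiple_2pi) simp
    finally have "cis a = cis b" by simp
    with assms(3) show False by simp
  qed
  then have c: "cos (a - b) < 1" using cos_le_one[of "a - b"] by linarith
  have "(norm (of_real p * cis a + of_real (1 - p) * cis b))\<^sup>2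
      = (p * cos a + (1 - p) * cos b)\<^sup>2 + (p * sin a + (1 - p) * sin b)\<^sup>2"
    by (simp add: cmod_power2)
  also have "\<dots> = p\<^sup>2 * ((sin a)\<^sup>2 + (cos a)\<^sup>2) + (1 - p)\<^sup>2 * ((sin b)\<^sup>2 + (cos b)\<^sup>2) + 2 * p * (1 - p) * cos (a - b)"
  proof -
    have "(p * x + q * y)\<^sup>2 + (p * u + q * v)\<^sup>2 = p\<^sup>2 * (u\<^sup>2 + x\<^sup>2) + q\<^sup>2 * (v\<^sup>2 + y\<^sup>2) + 2 * p * q * (x * y + u * v)"
      for q x y u v :: real by (simp add: power2_eq_square algebra_simps)
    then show ?thesis unfolding cos_diff .
  qed
  also have "\<dots> < p\<^sup>2 + (1 - p)\<^sup>2 + 2 * p * (1 - p) * 1"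
    using mult_strict_left_mono[OF c, of "2 * p * (1 - p)"] assms by simp
  also have "\<dots> = 1" by (simp add: power2_eq_square algebra_simps)
  finally show ?thesis by (simp add: power_less_one_iff)
qed

text \<open>
  The lattice condition is expressed by two root-of-unity filters; by the binomial theorem the weighted
  count becomes a mean of \<open>n\<close>-th powers of convex combinations of two roots of unity.
\<close>

lemma sum_binomial_weight_lattice:
  assumes "r > 0" "s > 0"
  shows "of_real (\<Sum>(i, j)\<in>lattice_points r s n. binomial_weight p n (r * i))
    = (\<Sum>u<r. \<Sum>v<s. (of_real p * cis (2 * pi * real u / real r) + of_real (1 - p) * cis (2 * pi * real v / real s)) ^ n)
       / (of_nat r * of_nat s)"
proof -
  let ?b = "binomial_weight p n"
  have "(\<Sum>(i, j)\<in>lattice_points r s n. ?b (r * i)) = (\<Sum>k\<in>{k\<in>{..n}. r dvd k \<and> s dvd (n - k)}. ?b k)"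
    by (rule sum.reindex_bij_witness[of _ "\<lambda>k. (k div r, (n - k) div s)" "\<lambda>(i, j). r * i"])
      (use assms in \<open>auto simp: lattice_points_def\<close>)
  also have "\<dots> = (\<Sum>k\<le>n. if r dvd k \<and> s dvd (n - k) then ?b k else 0)"
    by (rule sum.inter_filter) simp
  finally have "complex_of_real (\<Sum>(i, j)\<in>lattice_points r s n. ?b (r * i)) * (of_nat r * of_nat s)
     = (\<Sum>k\<le>n. of_real (?b k) * ((if r dvd k then of_nat r else 0) * (if s dvd (n - k) then of_nat s else 0)))"
    by (simp add: sum_distrib_right) (intro sum.cong, auto)
  also have "\<dots> = (\<Sum>k\<le>n. \<Sum>u<r. \<Sum>v<s. of_real (?b k) * (cis (2 * pi * real u * real k / real r) * cis (2 * pi * real v * real (n - k) / real s)))"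
    unfolding sum_roots_of_unity[OF assms(1), symmetric] sum_roots_of_unity[OF assms(2), symmetric]
    by (simp only: sum_product) (simp only: sum_distrib_left)
  also have "\<dots> = (\<Sum>u<r. \<Sum>v<s. \<Sum>k\<le>n. of_real (?b k) * (cis (2 * pi * real u * real k / real r) * cis (2 * pi * real v * real (n - k) / real s)))"
    by (subst sum.swap, rule sum.cong[OF refl], rule sum.swap)
  also have "\<dots> = (\<Sum>u<r. \<Sum>v<s. (of_real p * cis (2 * pi * real u / real r) + of_real (1 - p) * cis (2 * pi * real v / real s)) ^ n)"
  proof (intro sum.cong refl)
    fix u v
    have e: "cis (2 * pi * real u * real k / real r) = cis (2 * pi * real u / real r) ^ k"
      "cis (2 * pi * real v * real k / real s) = cis (2 * pi * real v / real s) ^ k" for k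
      unfolding Complex.DeMoivre by (rule arg_cong[of _ _ cis], simp add: mult_ac)+
    show "(\<Sum>k\<le>n. of_real (?b k) * (cis (2 * pi * real u * real k / real r) * cis (2 * pi * real v * real (n - k) / real s)))
      = (of_real p * cis (2 * pi * real u / real r) + of_real (1 - p) * cis (2 * pi * real v / real s)) ^ n"
      unfolding e by (simp add: binomial_ring binomial_weight_def power_mult_distrib mult_ac)
  qed
  finally show ?thesis using assms by (simp add: field_simps)
qed

lemma cis_fractions_eq_iff:
  assumes "u < r" "v < s"
  shows "cis (2 * pi * real u / real r) = cis (2 * pi * real v / real s) \<longleftrightarrow> u * s = v * r"
proof
  assume "u * s = v * r"
  then have "real u * real s = real v * real r" by (simp only: of_nat_mult[symmetric])
  then have "2 * pi * real u / real r = 2 * pi * real v / real s" using assms by (simp add: field_simps)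
  then show "cis (2 * pi * real u / real r) = cis (2 * pi * real v / real s)" by simp
next
  assume eq: "cis (2 * pi * real u / real r) = cis (2 * pi * real v / real s)"
  define a where "a = 2 * pi * real u / real r"
  define b where "b = 2 * pi * real v / real s"
  have eq': "cis a = cis b" using eq by (simp add: a_def b_def)
  have ab: "0 \<le> a" "a < 2 * pi" "0 \<le> b" "b < 2 * pi" using assms by (auto simp: a_def b_def field_simps)
  have "cis (a - b) = 1" using eq' by (simp add: cis_divide[symmetric])
  then have "cos (a - b) = 1" by (simp add: complex_eq_iff)
  then obtain l :: int where l: "a - b = of_int l * 2 * pi" by (auto simp: cos_one_2pi_int)
  have "\<bar>a - b\<bar> < 2 * pi" using ab by linarith
  then have "\<bar>of_int l\<bar> * (2 * pi) < 1 * (2 * pi)" unfolding l by (simp add: abs_mult)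
  then have "\<bar>of_int l :: real\<bar> < 1" by (simp add: mult_less_cancel_right_pos)
  then have "l = 0" by linarith
  then have "a = b" using l by simp
  then have "real u * real s = real v * real r" using assms by (simp add: a_def b_def field_simps)
  then show "u * s = v * r" by (simp only: of_nat_mult[symmetric] of_nat_eq_iff)
qed

text \<open>The common roots of unity of orders \<open>r\<close> and \<open>s\<close> are those of order \<open>gcd r s\<close>.\<close>

lemma coincident_fractions:
  fixes r s :: nat
  assumes "r > 0" "s > 0"
  defines "g \<equiv> gcd r s"
  shows "{(u, v). u < r \<and> v < s \<and> u * s = v * r} = (\<lambda>w. (r div g * w, s div g * w)) ` {..<g}"
proof -
  have pos: "g > 0" using assms by (simp add: g_def)
  define r' where "r' = r div g"
  define s' where "s' = s div g"
  have rs: "r = g * r'" "s = g * s'" by (simp_all add: r'_def s'_def g_def)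
  have cop: "coprime r' s'" unfolding r'_def s'_def g_def using assms(1) by (intro div_gcd_coprime) auto
  have pos': "r' > 0" "s' > 0" using assms(1,2) rs by (auto intro!: Nat.gr0I)
  have d: "r div g = r'" "s div g = s'" by (simp_all add: r'_def s'_def)
  show ?thesis unfolding d
  proof (intro equalityI subsetI)
    fix x assume "x \<in> {(u, v). u < r \<and> v < s \<and> u * s = v * r}"
    then obtain u v where uv: "x = (u, v)" "u < r" "v < s" "u * s = v * r" by auto
    have "g * (u * s') = g * (v * r')" using uv(4) unfolding rs by (simp only: mult_ac)
    then have e: "u * s' = v * r'" using pos by simp
    have "r' dvd u * s'" unfolding e by simp
    then have "r' dvd u" using cop by (simp add: coprime_dvd_mult_left_iff)
    then obtain w where w: "u = r' * w" by auto
    have "r' * (s' * w) = r' * v" using e unfolding w by (simp only: mult_ac)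
    then have "v = s' * w" using pos' by simp
    moreover have "r' * w < r' * g" using uv(2) unfolding w rs by (simp only: mult_ac)
    then have "w < g" by simp
    ultimately show "x \<in> (\<lambda>w. (r' * w, s' * w)) ` {..<g}" using w uv(1) by auto
  next
    fix x assume "x \<in> (\<lambda>w. (r' * w, s' * w)) ` {..<g}"
    then obtain w where w: "w < g" "x = (r' * w, s' * w)" by auto
    have "r' * w < r' * g" "s' * w < s' * g" using w(1) pos' by simp_all
    then show "x \<in> {(u, v). u < r \<and> v < s \<and> u * s = v * r}"
      unfolding w(2) rs by (simp add: mult_ac)
  qed
qed

text \<open>
  In the mean of powers only the pairs of equal roots of unity survive: there are \<open>gcd r s\<close> of them, and their
  powers are \<open>1\<close> as the exponent is a multiple of the gcd.
\<close>

theorem tendsto_sum_binomial_weight_lattice: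
  assumes "r > 0" "s > 0" "0 < p" "p < 1"
  shows "(\<lambda>m. \<Sum>(i, j)\<in>lattice_points r s (gcd r s * m). binomial_weight p (gcd r s * m) (r * i))
           \<longlonglongrightarrow> real (gcd r s) / (real r * real s)"
proof -
  let ?g = "gcd r s"
  let ?z = "\<lambda>u v. complex_of_real p * cis (2 * pi * real u / real r) + of_real (1 - p) * cis (2 * pi * real v / real s)"
  have g: "?g > 0" using assms by simp
  have lim: "(\<lambda>m. ?z u v ^ (?g * m)) \<longlonglongrightarrow> (if u * s = v * r then 1 else 0)" if "u < r" "v < s" for u v
  proof (cases "u * s = v * r")
    case True
    then have eq: "cis (2 * pi * real u / real r) = cis (2 * pi * real v / real s)"
      using that by (simp add: cis_fractions_eq_iff)
    have "(u, v) \<in> {(u, v). u < r \<and> v < s \<and> u * s = v * r}" using that True by simp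
    then obtain w where w: "u = r div ?g * w" unfolding coincident_fractions[OF assms(1,2)] by auto
    then have "u * ?g = r * w" by (simp add: mult_ac)
    then have "real u * real ?g = real r * real w" by (simp only: of_nat_mult[symmetric])
    then have "2 * pi * real u / real r * real ?g = 2 * pi * real w" using assms(1) by (simp add: field_simps)
    then have "cis (2 * pi * real u / real r) ^ ?g = cis (2 * pi * real w)" by (simp add: Complex.DeMoivre mult.commute)
    also have "\<dots> = 1" by (rule cis_2pi_nat)
    finally have one: "cis (2 * pi * real u / real r) ^ ?g = 1" .
    have "?z u v = cis (2 * pi * real u / real r)" unfolding eq[symmetric] by (simp add: algebra_simps)
    then have "?z u v ^ (?g * m) = 1" for m by (simp add: power_mult one)
    then show ?thesis using True by simp
  next
    case False
    then have "norm (?z u v) < 1"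
      using that assms by (intro norm_convex_combination_cis_less_one) (auto simp: cis_fractions_eq_iff)
    then have "(\<lambda>n. ?z u v ^ n) \<longlonglongrightarrow> 0" by (rule LIMSEQ_power_zero)
    moreover have "filterlim (\<lambda>m. ?g * m) at_top sequentially"
      using g by (intro filterlim_subseq) (simp add: strict_mono_def)
    ultimately show ?thesis using False by (auto intro: filterlim_compose)
  qed
  have "(\<lambda>m. (\<Sum>u<r. \<Sum>v<s. ?z u v ^ (?g * m)) / (of_nat r * of_nat s))
     \<longlonglongrightarrow> (\<Sum>u<r. \<Sum>v<s. if u * s = v * r then 1 else 0) / (of_nat r * of_nat s)"
    by (intro tendsto_intros lim) (use assms in auto)
  also have "(\<Sum>u<r. \<Sum>v<s. if u * s = v * r then 1 else (0::complex)) = of_nat ?g"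
  proof -
    have "(\<Sum>u<r. \<Sum>v<s. if u * s = v * r then 1 else (0::complex)) = (\<Sum>x\<in>{..<r} \<times> {..<s}. if fst x * s = snd x * r then 1 else 0)"
      by (simp add: sum.cartesian_product case_prod_unfold)
    also have "\<dots> = of_nat (card {x \<in> {..<r} \<times> {..<s}. fst x * s = snd x * r})"
      by (simp add: sum.inter_filter[symmetric])
    also have "{x \<in> {..<r} \<times> {..<s}. fst x * s = snd x * r} = {(u, v). u < r \<and> v < s \<and> u * s = v * r}" by auto
    also have "card \<dots> = ?g"
      unfolding coincident_fractions[OF assms(1,2)]
    proof (subst card_image)
      have "r div ?g > 0" using assms by (simp add: div_greater_zero_iff dvd_imp_le)
      then show "inj_on (\<lambda>w. (r div ?g * w, s div ?g * w)) {..<?g}" by (auto simp: inj_on_def)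
    qed simp
    finally show ?thesis .
  qed
  finally have "(\<lambda>m. complex_of_real (\<Sum>(i, j)\<in>lattice_points r s (?g * m). binomial_weight p (?g * m) (r * i)))
     \<longlonglongrightarrow> of_real (real ?g / (real r * real s))"
    unfolding sum_binomial_weight_lattice[OF assms(1,2)] by simp
  then show ?thesis by (subst (asm) tendsto_of_real_iff)
qed


section \<open>Polynomially bounded families and averages\<close>

text \<open>
  Polynomial growth is measured by a degree \<open>n i\<close> attached to the index, as the index sets are the natural
  numbers for a single series and pairs of natural numbers for a product.
\<close>

definition poly_bounded :: "('i \<Rightarrow> nat) \<Rightarrow> ('i \<Rightarrow> complex) set" where
  "poly_bounded n = {c. \<exists>C K. \<forall>i. norm (c i) \<le> C * (real (n i) + 1) ^ K}"

lemma poly_boundedI: "(\<And>i. norm (c i) \<le> C * (real (n i) + 1) ^ K) \<Longrightarrow> c \<in> poly_bounded n"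
  unfolding poly_bounded_def by blast

lemma poly_boundedE:
  assumes "c \<in> poly_bounded n"
  obtains C K where "C \<ge> 0" "\<And>i. norm (c i) \<le> C * (real (n i) + 1) ^ K"
proof -
  obtain C K where CK: "\<And>i. norm (c i) \<le> C * (real (n i) + 1) ^ K" using assms unfolding poly_bounded_def by blast
  have "norm (c i) \<le> \<bar>C\<bar> * (real (n i) + 1) ^ K" for i
  proof -
    have "C * (real (n i) + 1) ^ K \<le> \<bar>C\<bar> * (real (n i) + 1) ^ K" by (intro mult_right_mono) auto
    then show ?thesis using CK[of i] by linarith
  qed
  then show ?thesis by (rule that[of "\<bar>C\<bar>", rotated]) simp
qed

lemma poly_bounded_add:
  assumes "c \<in> poly_bounded n" "d \<in> poly_bounded n" shows "(\<lambda>i. c i + d i) \<in> poly_bounded n"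
proof -
  obtain C K where C: "C \<ge> 0" "\<And>i. norm (c i) \<le> C * (real (n i) + 1) ^ K" using poly_boundedE[OF assms(1)] by blast
  obtain D L where D: "D \<ge> 0" "\<And>i. norm (d i) \<le> D * (real (n i) + 1) ^ L" using poly_boundedE[OF assms(2)] by blast
  show ?thesis
  proof (rule poly_boundedI)
    fix i
    have "C * (real (n i) + 1) ^ K \<le> C * (real (n i) + 1) ^ (K + L)"
      "D * (real (n i) + 1) ^ L \<le> D * (real (n i) + 1) ^ (K + L)"
      using C(1) D(1) by (intro mult_left_mono power_increasing; simp)+
    then show "norm (c i + d i) \<le> (C + D) * (real (n i) + 1) ^ (K + L)"
      using norm_triangle_ineq[of "c i" "d i"] C(2)[of i] D(2)[of i] by (simp add: distrib_right)
  qed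
qed

lemma poly_bounded_mult:
  assumes "c \<in> poly_bounded n" "d \<in> poly_bounded n" shows "(\<lambda>i. c i * d i) \<in> poly_bounded n"
proof -
  obtain C K where C: "C \<ge> 0" "\<And>i. norm (c i) \<le> C * (real (n i) + 1) ^ K" using poly_boundedE[OF assms(1)] by blast
  obtain D L where D: "D \<ge> 0" "\<And>i. norm (d i) \<le> D * (real (n i) + 1) ^ L" using poly_boundedE[OF assms(2)] by blast
  show ?thesis
  proof (rule poly_boundedI)
    fix i
    have "norm (c i * d i) \<le> (C * (real (n i) + 1) ^ K) * (D * (real (n i) + 1) ^ L)"
      unfolding norm_mult using C D by (intro mult_mono) auto
    then show "norm (c i * d i) \<le> (C * D) * (real (n i) + 1) ^ (K + L)"
      by (simp add: power_add mult_ac)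
  qed
qed

lemma poly_bounded_bounded: "(\<And>i. norm (c i) \<le> C) \<Longrightarrow> c \<in> poly_bounded n"
  by (rule poly_boundedI[of c C n 0]) simp

lemma poly_bounded_uminus: "c \<in> poly_bounded n \<Longrightarrow> (\<lambda>i. - c i) \<in> poly_bounded n"
  unfolding poly_bounded_def by simp

lemma poly_bounded_sum: "(\<And>j. j \<in> J \<Longrightarrow> c j \<in> poly_bounded n) \<Longrightarrow> (\<lambda>i. \<Sum>j\<in>J. c j i) \<in> poly_bounded n"
  by (induction J rule: infinite_finite_induct) (auto intro: poly_bounded_add poly_bounded_bounded[of _ 0])

lemma poly_bounded_le:
  assumes "c \<in> poly_bounded k" "\<And>i. k i \<le> n i" shows "c \<in> poly_bounded n"
proof -
  obtain C K where C: "C \<ge> 0" "\<And>i. norm (c i) \<le> C * (real (k i) + 1) ^ K" using poly_boundedE[OF assms(1)] by blast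
  show ?thesis
  proof (rule poly_boundedI)
    fix i
    have "C * (real (k i) + 1) ^ K \<le> C * (real (n i) + 1) ^ K"
      using assms(2)[of i] C(1) by (intro mult_left_mono power_mono) auto
    then show "norm (c i) \<le> C * (real (n i) + 1) ^ K" using C(2)[of i] by linarith
  qed
qed

lemma poly_bounded_reindex: "c \<in> poly_bounded n \<Longrightarrow> (\<lambda>i. c (g i)) \<in> poly_bounded (\<lambda>i. n (g i))"
  unfolding poly_bounded_def by blast

lemma poly_bounded_convergent:
  assumes "c \<longlonglongrightarrow> (l::complex)" shows "c \<in> poly_bounded n"
  using convergent_imp_Bseq[OF convergentI[OF assms]] unfolding Bseq_def
  by (auto intro: poly_bounded_bounded)

text \<open>
  Powers of a degree with a complex exponent enter through exponentials of logarithms, which grow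
  polynomially.
\<close>

lemma
  fixes \<mu> :: "'i \<Rightarrow> real"
  assumes \<mu>: "\<And>i. \<bar>\<mu> i\<bar> \<le> C + ln (real (n i) + 1)"
  shows poly_bounded_log: "(\<lambda>i. of_real (\<mu> i)) \<in> poly_bounded n"
    and poly_bounded_exp_log: "(\<lambda>i. exp (z * of_real (\<mu> i))) \<in> poly_bounded n"
proof -
  have C: "C + ln (real (n i) + 1) \<le> (\<bar>C\<bar> + 1) * (real (n i) + 1) ^ 1" for i
  proof -
    have "ln (real (n i) + 1) \<le> real (n i) + 1" using ln_le_minus_one[of "real (n i) + 1"] by linarith
    moreover have "C \<le> \<bar>C\<bar> * (real (n i) + 1)" using mult_left_mono[of 1 "real (n i) + 1" "\<bar>C\<bar>"] by simp
    ultimately show ?thesis by (simp add: algebra_simps)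
  qed
  show "(\<lambda>i. of_real (\<mu> i)) \<in> poly_bounded n"
    by (rule poly_boundedI[of _ "\<bar>C\<bar> + 1" n 1]) (use order_trans[OF \<mu> C] in simp)
  obtain K :: nat where K: "norm z \<le> real K" using real_arch_simple by blast
  show "(\<lambda>i. exp (z * of_real (\<mu> i))) \<in> poly_bounded n"
  proof (rule poly_boundedI)
    fix i
    have "norm (exp (z * of_real (\<mu> i))) = exp (Re z * \<mu> i)" by simp
    also have "Re z * \<mu> i \<le> norm z * (C + ln (real (n i) + 1))"
    proof -
      have "Re z * \<mu> i \<le> \<bar>Re z\<bar> * \<bar>\<mu> i\<bar>" by (metis abs_ge_self abs_mult)
      also have "\<dots> \<le> norm z * (C + ln (real (n i) + 1))" by (intro mult_mono abs_Re_le_cmod \<mu>) auto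
      finally show ?thesis .
    qed
    also have "\<dots> \<le> norm z * C + real K * ln (real (n i) + 1)"
      using mult_right_mono[OF K, of "ln (real (n i) + 1)"] by (simp add: distrib_left)
    finally have "norm (exp (z * of_real (\<mu> i))) \<le> exp (norm z * C + real K * ln (real (n i) + 1))" by simp
    also have "\<dots> = exp (norm z * C) * (real (n i) + 1) ^ K"
      by (simp add: exp_add exp_of_nat_mult)
    finally show "norm (exp (z * of_real (\<mu> i))) \<le> exp (norm z * C) * (real (n i) + 1) ^ K" .
  qed
qed


text \<open>
  The families to which the averages below apply: polynomially bounded, with a limit in the central region
  described by the filter.
\<close>

definition tame :: "('i \<Rightarrow> nat) \<Rightarrow> 'i filter \<Rightarrow> complex \<Rightarrow> ('i \<Rightarrow> complex) set" where
  "tame n F l = {c \<in> poly_bounded n. (c \<longlongrightarrow> l) F}"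

lemma tame_add: "c \<in> tame n F l \<Longrightarrow> d \<in> tame n F l' \<Longrightarrow> (\<lambda>i. c i + d i) \<in> tame n F (l + l')"
  by (auto simp: tame_def intro: poly_bounded_add tendsto_add)

lemma tame_mult: "c \<in> tame n F l \<Longrightarrow> d \<in> tame n F l' \<Longrightarrow> (\<lambda>i. c i * d i) \<in> tame n F (l * l')"
  by (auto simp: tame_def intro: poly_bounded_mult tendsto_mult)

lemma tame_const: "(\<lambda>i. l) \<in> tame n F l"
  by (auto simp: tame_def intro: poly_bounded_bounded[of _ "norm l"])

lemma tame_sum: "(\<And>j. j \<in> J \<Longrightarrow> c j \<in> tame n F (l j)) \<Longrightarrow> (\<lambda>i. \<Sum>j\<in>J. c j i) \<in> tame n F (sum l J)"
  by (auto simp: tame_def intro: poly_bounded_sum tendsto_sum)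

text \<open>
  The filter of pairs whose total degree tends to infinity while the share of the first degree in it tends to
  \<open>p\<close>.
\<close>

definition central :: "nat \<Rightarrow> nat \<Rightarrow> real \<Rightarrow> (nat \<times> nat) filter" where
  "central r s p = inf (filtercomap (\<lambda>x. r * fst x + s * snd x) at_top)
     (filtercomap (\<lambda>x. real (r * fst x) / real (r * fst x + s * snd x)) (nhds p))"

lemma filterlim_central_total: "filterlim (\<lambda>x. r * fst x + s * snd x) at_top (central r s p)"
  unfolding central_def by (rule filterlim_mono[OF filterlim_filtercomap order_refl inf_le1])

lemma tendsto_central_ratio: "((\<lambda>x. real (r * fst x) / real (r * fst x + s * snd x)) \<longlongrightarrow> p) (central r s p)"
  unfolding central_def by (rule filterlim_mono[OF filterlim_filtercomap order_refl inf_le2])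

lemma tendsto_central_ratio_snd:
  "((\<lambda>x. real (s * snd x) / real (r * fst x + s * snd x)) \<longlongrightarrow> 1 - p) (central r s p)"
proof (rule Lim_transform_eventually)
  show "((\<lambda>x. 1 - real (r * fst x) / real (r * fst x + s * snd x)) \<longlongrightarrow> 1 - p) (central r s p)"
    by (intro tendsto_intros tendsto_central_ratio)
  have "\<forall>\<^sub>F x in central r s p. r * fst x + s * snd x > 0"
    using filterlim_central_total[of r s p] unfolding filterlim_at_top
    by (rule allE[of _ 1]) (auto elim!: eventually_mono)
  then show "\<forall>\<^sub>F x in central r s p. 1 - real (r * fst x) / real (r * fst x + s * snd x)
      = real (s * snd x) / real (r * fst x + s * snd x)"
  proof eventually_elim
    case (elim x)
    have *: "1 - real a / real (a + b) = real b / real (a + b)" if "a + b > 0" for a b :: nat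
    proof -
      have "real a + real b > 0" using that by linarith
      then show ?thesis by (simp add: field_simps)
    qed
    show ?case by (rule *[OF elim])
  qed
qed

lemma eventually_central:
  assumes "eventually Q (central r s p)"
  obtains N \<delta> where "\<delta> > 0"
    "\<And>x. r * fst x + s * snd x \<ge> N \<Longrightarrow> \<bar>real (r * fst x) / real (r * fst x + s * snd x) - p\<bar> < \<delta> \<Longrightarrow> Q x"
proof -
  obtain Q1 Q2 where Q: "eventually Q1 (filtercomap (\<lambda>x. r * fst x + s * snd x) at_top)"
    "eventually Q2 (filtercomap (\<lambda>x. real (r * fst x) / real (r * fst x + s * snd x)) (nhds p))"
    "\<And>x. Q1 x \<Longrightarrow> Q2 x \<Longrightarrow> Q x"
    using assms unfolding central_def eventually_inf by blast
  obtain P1 where P1: "eventually P1 at_top" "\<And>x. P1 (r * fst x + s * snd x) \<Longrightarrow> Q1 x"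
    using Q(1) unfolding eventually_filtercomap by blast
  obtain P2 where P2: "eventually P2 (nhds p)" "\<And>x. P2 (real (r * fst x) / real (r * fst x + s * snd x)) \<Longrightarrow> Q2 x"
    using Q(2) unfolding eventually_filtercomap by blast
  obtain N where N: "\<And>n. n \<ge> N \<Longrightarrow> P1 n" using P1(1) unfolding eventually_at_top_linorder by blast
  obtain \<delta> where \<delta>: "\<delta> > 0" "\<And>y. dist y p < \<delta> \<Longrightarrow> P2 y" using P2(1) unfolding eventually_nhds_metric by blast
  show ?thesis
    by (rule that[of \<delta> N]) (use N \<delta> P1(2) P2(2) Q(3) in \<open>auto simp: dist_real_def\<close>)
qed

lemma binomial_weight_nonneg: "0 \<le> p \<Longrightarrow> p \<le> 1 \<Longrightarrow> 0 \<le> binomial_weight p n k"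
  by (simp add: binomial_weight_def)

lemma sum_binomial_weight: "(\<Sum>k\<le>n. binomial_weight p n k) = 1"
  using binomial_ring[of p "1 - p" n] by (simp add: binomial_weight_def)

lemma sum_binomial_weight_tail:
  assumes "0 \<le> p" "p \<le> 1" "n > 0" "\<delta> \<ge> 0"
  shows "(\<Sum>k\<in>{k\<in>{..n}. \<bar>real k / real n - p\<bar> \<ge> \<delta>}. binomial_weight p n k) \<le> 2 * exp (- 2 * real n * \<delta>\<^sup>2)"
proof -
  interpret binomial_distribution n p by unfold_locales (use assms in auto)
  have "(\<Sum>k\<in>{k\<in>{..n}. \<bar>real k / real n - p\<bar> \<ge> \<delta>}. binomial_weight p n k)
      = measure_pmf.prob (binomial_pmf n p) {k\<in>{..n}. \<bar>real k / real n - p\<bar> \<ge> \<delta>}"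
    using assms by (subst measure_measure_pmf_finite) (auto simp: binomial_weight_def)
  also have "\<dots> \<le> measure_pmf.prob (binomial_pmf n p) {x. \<bar>real x / real n - p\<bar> \<ge> \<delta>}"
    by (rule measure_pmf.finite_measure_mono) auto
  also have "\<dots> \<le> 2 * exp (- 2 * real n * \<delta>\<^sup>2)" using prob_abs_ge'[OF assms(3,4)] by simp
  finally show ?thesis .
qed

text \<open>A lattice point of given total degree is determined by its first degree.\<close>

lemma sum_lattice_le:
  assumes "r > 0" "s > 0" "\<And>k. f k \<ge> (0::real)"
  shows "(\<Sum>x\<in>{x\<in>lattice_points r s n. Q (r * fst x)}. f (r * fst x)) \<le> (\<Sum>k\<in>{k\<in>{..n}. Q k}. f k)"
proof -
  have inj: "inj_on (\<lambda>x. r * fst x) {x\<in>lattice_points r s n. Q (r * fst x)}"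
    using assms by (auto simp: inj_on_def lattice_points_def)
  have "(\<Sum>x\<in>{x\<in>lattice_points r s n. Q (r * fst x)}. f (r * fst x))
      = (\<Sum>k\<in>(\<lambda>x. r * fst x) ` {x\<in>lattice_points r s n. Q (r * fst x)}. f k)"
    by (simp add: sum.reindex[OF inj])
  also have "\<dots> \<le> (\<Sum>k\<in>{k\<in>{..n}. Q k}. f k)"
    using assms by (intro sum_mono2) (auto simp: lattice_points_def)
  finally show ?thesis .
qed

text \<open>
  Outside of the central region the weights decay exponentially by Hoeffding's inequality, which absorbs
  every polynomial bound.
\<close>

lemma tendsto_lattice_average_null:
  assumes rs: "r > 0" "s > 0" and p: "0 < p" "p < 1"
    and c: "c \<in> tame (\<lambda>x. r * fst x + s * snd x) (central r s p) 0"
  shows "(\<lambda>n. \<Sum>x\<in>lattice_points r s n. of_real (binomial_weight p n (r * fst x)) * c x) \<longlonglongrightarrow> 0"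
  unfolding LIMSEQ_iff
proof (intro allI impI)
  fix e :: real assume "e > 0"
  have "c \<in> poly_bounded (\<lambda>x. r * fst x + s * snd x)" using c by (simp add: tame_def)
  then obtain C K where C: "C \<ge> 0" "\<And>x. norm (c x) \<le> C * (real (r * fst x + s * snd x) + 1) ^ K"
    by (rule poly_boundedE) blast
  have "eventually (\<lambda>x. norm (c x) < e / 2) (central r s p)"
    using c \<open>e > 0\<close> by (auto simp: tame_def tendsto_iff dest!: spec[of _ "e / 2"])
  then obtain N \<delta> where \<delta>: "\<delta> > 0"
    "\<And>x. r * fst x + s * snd x \<ge> N \<Longrightarrow> \<bar>real (r * fst x) / real (r * fst x + s * snd x) - p\<bar> < \<delta> \<Longrightarrow> norm (c x) < e / 2"
    by (rule eventually_central) blast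
  have "(\<lambda>n. C * (real n + 1) ^ K * (2 * exp (- 2 * real n * \<delta>\<^sup>2))) \<longlonglongrightarrow> 0"
    using \<delta>(1) by real_asymp
  then have "\<forall>\<^sub>F n in sequentially. C * (real n + 1) ^ K * (2 * exp (- 2 * real n * \<delta>\<^sup>2)) < e / 2"
    using \<open>e > 0\<close> by (intro order_tendstoD(2)[of _ 0]) auto
  then obtain M where M: "\<And>n. n \<ge> M \<Longrightarrow> C * (real n + 1) ^ K * (2 * exp (- 2 * real n * \<delta>\<^sup>2)) < e / 2"
    unfolding eventually_sequentially by blast
  show "\<exists>N. \<forall>n\<ge>N. norm ((\<Sum>x\<in>lattice_points r s n. of_real (binomial_weight p n (r * fst x)) * c x) - 0) < e"
  proof (intro exI[of _ "max (max N M) 1"] allI impI)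
    fix n assume n: "max (max N M) 1 \<le> n"
    let ?b = "\<lambda>k. binomial_weight p n k"
    let ?far = "\<lambda>k. \<bar>real k / real n - p\<bar> \<ge> \<delta>"
    let ?L = "lattice_points r s n"
    have b: "?b k \<ge> 0" for k using p by (simp add: binomial_weight_nonneg)
    have fin: "finite ?L" using rs by (rule finite_lattice_points)
    have tot: "r * fst x + s * snd x = n" if "x \<in> ?L" for x using that by (auto simp: lattice_points_def)
    have "norm ((\<Sum>x\<in>?L. of_real (?b (r * fst x)) * c x) - 0) \<le> (\<Sum>x\<in>?L. ?b (r * fst x) * norm (c x))"
      using sum_norm_le[of ?L "\<lambda>x. of_real (?b (r * fst x)) * c x"] b by (simp add: norm_mult)
    also have "\<dots> = (\<Sum>x\<in>{x\<in>?L. \<not> ?far (r * fst x)}. ?b (r * fst x) * norm (c x))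
                 + (\<Sum>x\<in>{x\<in>?L. ?far (r * fst x)}. ?b (r * fst x) * norm (c x))"
      by (subst sum.union_disjoint[symmetric]) (use fin in \<open>auto intro!: sum.cong\<close>)
    also have "(\<Sum>x\<in>{x\<in>?L. \<not> ?far (r * fst x)}. ?b (r * fst x) * norm (c x))
        \<le> (\<Sum>x\<in>{x\<in>?L. \<not> ?far (r * fst x)}. ?b (r * fst x)) * (e / 2)"
      unfolding sum_distrib_right
    proof (intro sum_mono mult_left_mono b)
      fix x assume x: "x \<in> {x\<in>?L. \<not> ?far (r * fst x)}"
      then show "norm (c x) \<le> e / 2" using \<delta>(2)[of x] tot[of x] n by simp
    qed
    also have "(\<Sum>x\<in>{x\<in>?L. \<not> ?far (r * fst x)}. ?b (r * fst x)) * (e / 2) \<le> 1 * (e / 2)"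
    proof (rule mult_right_mono)
      have "(\<Sum>x\<in>{x\<in>?L. \<not> ?far (r * fst x)}. ?b (r * fst x)) \<le> (\<Sum>k\<in>{k\<in>{..n}. \<not> ?far k}. ?b k)"
        by (rule sum_lattice_le[OF rs b])
      also have "\<dots> \<le> (\<Sum>k\<le>n. ?b k)" by (intro sum_mono2 b) auto
      finally show "(\<Sum>x\<in>{x\<in>?L. \<not> ?far (r * fst x)}. ?b (r * fst x)) \<le> 1" by (simp add: sum_binomial_weight)
    qed (use \<open>e > 0\<close> in simp)
    also have "(\<Sum>x\<in>{x\<in>?L. ?far (r * fst x)}. ?b (r * fst x) * norm (c x))
        \<le> (\<Sum>x\<in>{x\<in>?L. ?far (r * fst x)}. ?b (r * fst x)) * (C * (real n + 1) ^ K)"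
      unfolding sum_distrib_right
    proof (intro sum_mono mult_left_mono b)
      fix x assume x: "x \<in> {x\<in>?L. ?far (r * fst x)}"
      then show "norm (c x) \<le> C * (real n + 1) ^ K" using C(2)[of x] tot[of x] by simp
    qed
    also have "\<dots> \<le> (2 * exp (- 2 * real n * \<delta>\<^sup>2)) * (C * (real n + 1) ^ K)"
    proof (rule mult_right_mono)
      have "(\<Sum>x\<in>{x\<in>?L. ?far (r * fst x)}. ?b (r * fst x)) \<le> (\<Sum>k\<in>{k\<in>{..n}. ?far k}. ?b k)"
        by (rule sum_lattice_le[OF rs b])
      also have "\<dots> \<le> 2 * exp (- 2 * real n * \<delta>\<^sup>2)" using p n \<delta>(1) by (intro sum_binomial_weight_tail) auto
      finally show "(\<Sum>x\<in>{x\<in>?L. ?far (r * fst x)}. ?b (r * fst x)) \<le> 2 * exp (- 2 * real n * \<delta>\<^sup>2)" .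
    qed (use C(1) in simp)
    also have "\<dots> < e / 2" using M[of n] n by (simp add: mult_ac)
    finally show "norm ((\<Sum>x\<in>?L. of_real (?b (r * fst x)) * c x) - 0) < e" by simp
  qed
qed


section \<open>Absolutely convergent series\<close>

text \<open>A power \<open>(k + 1)\<^sup>K\<close> is at most \<open>K! exp (k + 1)\<close>, which leaves an exponential series.\<close>

lemma summable_exp_poly:
  assumes "t \<ge> 0" shows "summable (\<lambda>k. t ^ k / fact k * (real k + 1) ^ K)"
proof (rule summable_comparison_test')
  show "summable (\<lambda>k. fact K * exp 1 * ((t * exp 1) ^ k / fact k))"
    using summable_exp[of "t * exp 1"] by (intro summable_mult) (simp add: divide_inverse mult.commute)
  fix k :: nat
  have "(real k + 1) ^ K / fact K \<le> exp (real k + 1)"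
  proof -
    have s: "(\<lambda>n. (real k + 1) ^ n /\<^sub>R fact n) sums exp (real k + 1)" by (rule exp_converges)
    have "sum (\<lambda>n. (real k + 1) ^ n /\<^sub>R fact n) {K} \<le> suminf (\<lambda>n. (real k + 1) ^ n /\<^sub>R fact n)"
      by (rule sum_le_suminf) (use sums_summable[OF s] in auto)
    also have "\<dots> = exp (real k + 1)" by (rule sums_unique[OF s, symmetric])
    finally show ?thesis by (simp add: divide_inverse mult.commute)
  qed
  then have "(real k + 1) ^ K \<le> fact K * (exp 1 * exp 1 ^ k)"
    by (simp add: exp_add exp_of_nat_mult[of k 1, simplified] field_simps)
  then have "t ^ k / fact k * (real k + 1) ^ K \<le> t ^ k / fact k * (fact K * (exp 1 * exp 1 ^ k))"
    using assms by (intro mult_left_mono) auto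
  then show "norm (t ^ k / fact k * (real k + 1) ^ K) \<le> fact K * exp 1 * ((t * exp 1) ^ k / fact k)"
    using assms by (simp add: power_mult_distrib field_simps)
qed

lemma summable_norm_poly_bounded:
  assumes "r > 0" "t \<ge> 0" and c: "c \<in> poly_bounded (\<lambda>i. r * i)"
  shows "summable (\<lambda>i. norm (of_real (t ^ (r * i) / fact (r * i)) * c i))"
proof -
  obtain C K where C: "C \<ge> 0" "\<And>i. norm (c i) \<le> C * (real (r * i) + 1) ^ K" using poly_boundedE[OF c] by blast
  define f where "f k = t ^ k / fact k * (real k + 1) ^ K" for k
  have f: "f k \<ge> 0" for k using assms(2) by (simp add: f_def)
  have sm: "strict_mono (\<lambda>i. r * i)" using assms(1) by (simp add: strict_mono_def)
  have "summable (\<lambda>k. if r dvd k then f k else 0)"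
    by (rule summable_comparison_test'[OF summable_exp_poly[OF assms(2), of K]]) (use f in \<open>auto simp: f_def\<close>)
  then have "summable (\<lambda>i. f (r * i))"
  proof -
    assume "summable (\<lambda>k. if r dvd k then f k else 0)"
    moreover have "(if r dvd k then f k else 0) = 0" if "k \<notin> range (\<lambda>i. r * i)" for k
      using that by (auto elim!: dvdE)
    ultimately have "summable (\<lambda>i. if r dvd r * i then f (r * i) else 0)"
      using summable_mono_reindex[OF sm, of "\<lambda>k. if r dvd k then f k else 0"] by blast
    then show ?thesis by simp
  qed
  then have "summable (\<lambda>i. C * f (r * i))" by (rule summable_mult)
  then show ?thesis
  proof (rule summable_comparison_test')
    fix i
    have "t ^ (r * i) / fact (r * i) * norm (c i) \<le> t ^ (r * i) / fact (r * i) * (C * (real (r * i) + 1) ^ K)"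
      using assms(2) by (intro mult_left_mono C) auto
    then show "norm (norm (of_real (t ^ (r * i) / fact (r * i)) * c i)) \<le> C * f (r * i)"
      using assms(2) by (simp add: f_def norm_mult norm_divide norm_power mult_ac)
  qed
qed

text \<open>
  Both partial sums run over finite sets of pairs that exhaust all pairs, so they have the same limit by
  absolute convergence of the double series.
\<close>

lemma tendsto_lattice_sums_minus_product:
  fixes f g :: "nat \<Rightarrow> complex"
  assumes rs: "r > 0" "s > 0" and fg: "summable (\<lambda>i. norm (f i))" "summable (\<lambda>i. norm (g i))"
  shows "(\<lambda>N. (\<Sum>m<N. \<Sum>x\<in>lattice_points r s (gcd r s * m). f (fst x) * g (snd x))
      - (\<Sum>i<N. f i) * (\<Sum>j<N. g j)) \<longlonglongrightarrow> 0"
proof -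
  define h where "h x = f (fst x) * g (snd x)" for x
  have "(\<lambda>x. norm (h x)) summable_on UNIV"
  proof (rule nonneg_bdd_above_summable_on)
    show "bdd_above (sum (\<lambda>x. norm (h x)) ` {F. F \<subseteq> UNIV \<and> finite F})"
    proof (rule bdd_aboveI2)
      fix F :: "(nat \<times> nat) set" assume "F \<in> {F. F \<subseteq> UNIV \<and> finite F}"
      then have F: "finite F" by simp
      obtain A where A: "fst ` F \<subseteq> {..<A}" using finite_nat_iff_bounded F by (metis finite_imageI)
      obtain B where B: "snd ` F \<subseteq> {..<B}" using finite_nat_iff_bounded F by (metis finite_imageI)
      have "(\<Sum>x\<in>F. norm (h x)) \<le> (\<Sum>x\<in>{..<A} \<times> {..<B}. norm (h x))"
        using A B by (intro sum_mono2) (auto simp: image_subset_iff)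
      also have "\<dots> = (\<Sum>i<A. norm (f i)) * (\<Sum>j<B. norm (g j))"
        by (simp add: h_def norm_mult sum_product sum.cartesian_product case_prod_unfold)
      also have "\<dots> \<le> suminf (\<lambda>i. norm (f i)) * suminf (\<lambda>j. norm (g j))"
        by (intro mult_mono sum_le_suminf fg suminf_nonneg sum_nonneg) auto
      finally show "(\<Sum>x\<in>F. norm (h x)) \<le> suminf (\<lambda>i. norm (f i)) * suminf (\<lambda>j. norm (g j))" .
    qed
  qed auto
  then have "h summable_on UNIV" by (rule abs_summable_summable)
  then have hs: "(sum h \<longlongrightarrow> infsum h UNIV) (finite_subsets_at_top UNIV)"
    using has_sum_infsum has_sum_def by blast
  define d where "d = gcd r s"
  have d: "d > 0" using rs by (simp add: d_def)
  have lim: "(\<lambda>N. sum h (A N)) \<longlonglongrightarrow> infsum h UNIV"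
    if A: "\<And>N. finite (A N)" "\<And>x. \<forall>\<^sub>F N in sequentially. x \<in> A N" for A :: "nat \<Rightarrow> (nat \<times> nat) set"
  proof (rule filterlim_compose[OF hs])
    show "filterlim A (finite_subsets_at_top UNIV) sequentially"
      unfolding filterlim_finite_subsets_at_top
    proof (intro allI impI)
      fix X :: "(nat \<times> nat) set" assume X: "finite X \<and> X \<subseteq> UNIV"
      then have "\<forall>\<^sub>F N in sequentially. \<forall>x\<in>X. x \<in> A N" using A(2) by (intro eventually_ball_finite) auto
      then show "\<forall>\<^sub>F N in sequentially. finite (A N) \<and> X \<subseteq> A N \<and> A N \<subseteq> UNIV"
        by eventually_elim (use A(1) in auto)
    qed
  qed
  have "(\<lambda>N. sum h (\<Union>m<N. lattice_points r s (d * m))) \<longlonglongrightarrow> infsum h UNIV"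
  proof (rule lim)
    show "finite (\<Union>m<N. lattice_points r s (d * m))" for N using rs by (auto intro: finite_lattice_points)
    fix x :: "nat \<times> nat"
    have "d dvd r * fst x + s * snd x" unfolding d_def by (intro dvd_add dvd_mult2) auto
    then obtain m where m: "r * fst x + s * snd x = d * m" by auto
    show "\<forall>\<^sub>F N in sequentially. x \<in> (\<Union>m<N. lattice_points r s (d * m))"
      using eventually_gt_at_top[of m]
      by eventually_elim (use m in \<open>auto simp: lattice_points_def case_prod_unfold\<close>)
  qed
  also have "(\<lambda>N. sum h (\<Union>m<N. lattice_points r s (d * m))) = (\<lambda>N. \<Sum>m<N. \<Sum>x\<in>lattice_points r s (d * m). h x)"
  proof
    fix N show "sum h (\<Union>m<N. lattice_points r s (d * m)) = (\<Sum>m<N. \<Sum>x\<in>lattice_points r s (d * m). h x)"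
    proof (rule sum.UNION_disjoint)
      show "\<forall>i\<in>{..<N}. finite (lattice_points r s (d * i))" using rs by (simp add: finite_lattice_points)
    qed (use d in \<open>auto simp: lattice_points_def\<close>)
  qed
  finally have 1: "(\<lambda>N. \<Sum>m<N. \<Sum>x\<in>lattice_points r s (d * m). h x) \<longlonglongrightarrow> infsum h UNIV" .
  have "(\<lambda>N. sum h ({..<N} \<times> {..<N})) \<longlonglongrightarrow> infsum h UNIV"
  proof (rule lim)
    fix x :: "nat \<times> nat"
    show "\<forall>\<^sub>F N in sequentially. x \<in> {..<N} \<times> {..<N}"
      using eventually_gt_at_top[of "max (fst x) (snd x)"] by eventually_elim (auto simp: mem_Times_iff)
  qed auto
  also have "(\<lambda>N. sum h ({..<N} \<times> {..<N})) = (\<lambda>N. (\<Sum>i<N. f i) * (\<Sum>j<N. g j))"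
    by (simp add: h_def sum_product sum.cartesian_product case_prod_unfold)
  finally have 2: "(\<lambda>N. (\<Sum>i<N. f i) * (\<Sum>j<N. g j)) \<longlonglongrightarrow> infsum h UNIV" .
  show ?thesis using tendsto_diff[OF 1 2] by (simp add: h_def d_def)
qed


section \<open>Normalised coefficients of a Mittag-Leffler series\<close>

text \<open>The Taylor series at \<open>z\<close> of \<open>x \<mapsto> exp (\<mu> x)\<close>, that is of the power \<open>s\<^sup>x\<close> if \<open>\<mu> = ln s\<close>.\<close>

definition fps_power :: "complex \<Rightarrow> real \<Rightarrow> complex fps" where
  "fps_power z \<mu> = fps_const (exp (z * of_real \<mu>)) * fps_exp (of_real \<mu>)"

lemma fps_power_mult: "fps_power z \<mu> * fps_power z \<nu> = fps_power z (\<mu> + \<nu>)"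
proof -
  have "fps_power z \<mu> * fps_power z \<nu>
      = (fps_const (exp (z * of_real \<mu>)) * fps_const (exp (z * of_real \<nu>))) * (fps_exp (of_real \<mu>) * fps_exp (of_real \<nu>))"
    by (simp only: fps_power_def mult_ac)
  also have "\<dots> = fps_power z (\<mu> + \<nu>)"
    unfolding fps_const_mult fps_exp_add_mult[symmetric] exp_add[symmetric] fps_power_def
    by (simp add: distrib_left)
  finally show ?thesis .
qed

lemma fps_power_zero: "fps_power z 0 = 1"
  by (simp add: fps_power_def)

lemma fps_power_nth: "fps_nth (fps_power z \<mu>) j = exp (z * of_real \<mu>) * of_real \<mu> ^ j / fact j"
  by (simp add: fps_power_def)

lemma fps_power_coefficient_poly_bounded:
  assumes "\<And>i. \<bar>\<mu> i\<bar> \<le> C + ln (real (n i) + 1)"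
  shows "(\<lambda>i. fps_nth (fps_power z (\<mu> i)) j) \<in> poly_bounded n"
proof -
  have p: "(\<lambda>i. of_real (\<mu> i) ^ j) \<in> poly_bounded n" for j
  proof (induction j)
    case 0
    show ?case by (rule poly_bounded_bounded[of _ 1]) simp
  next
    case (Suc j)
    show ?case unfolding power_Suc by (rule poly_bounded_mult[OF poly_bounded_log[OF assms] Suc])
  qed
  have "(\<lambda>i. exp (z * of_real (\<mu> i)) * of_real (\<mu> i) ^ j * (1 / fact j)) \<in> poly_bounded n"
    by (intro poly_bounded_mult poly_bounded_exp_log[OF assms] p poly_bounded_bounded[of _ "norm (1 / fact j :: complex)"]) simp
  then show ?thesis by (simp add: fps_power_nth)
qed

lemma fps_power_coefficient_tame:
  assumes "\<And>i. \<bar>\<mu> i\<bar> \<le> C + ln (real (n i) + 1)" "(\<mu> \<longlongrightarrow> 0) F"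
  shows "(\<lambda>i. fps_nth (fps_power z (\<mu> i)) j) \<in> tame n F (if j = 0 then 1 else 0)"
proof -
  have "((\<lambda>i. exp (z * of_real (\<mu> i)) * of_real (\<mu> i) ^ j / fact j) \<longlongrightarrow> exp (z * of_real 0) * of_real 0 ^ j / fact j) F"
    by (intro tendsto_intros assms) simp
  moreover have "exp (z * of_real 0) * of_real 0 ^ j / fact j = (if j = 0 then 1 else 0 :: complex)" by auto
  ultimately show ?thesis
    unfolding tame_def using fps_power_coefficient_poly_bounded[OF assms(1), where z = z and j = j] by (simp add: fps_power_nth)
qed

text \<open>
  Power series with coefficients of this kind are the correction factors of the normalised coefficients:
  their values at a nilpotent element tend to the unit.
\<close>

lemma tame_fps_mult:
  assumes "\<And>j. (\<lambda>i. fps_nth (G i) j) \<in> tame n F (if j = 0 then 1 else 0)"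
    and "\<And>j. (\<lambda>i. fps_nth (H i) j) \<in> tame n F (if j = 0 then 1 else 0)"
  shows "(\<lambda>i. fps_nth (G i * H i) j) \<in> tame n F (if j = 0 then 1 else 0)"
proof -
  have "(\<lambda>i. \<Sum>l=0..j. fps_nth (G i) l * fps_nth (H i) (j - l))
      \<in> tame n F (\<Sum>l=0..j. (if l = 0 then 1 else 0) * (if j - l = 0 then 1 else 0))"
    by (intro tame_sum tame_mult assms)
  also have "(\<Sum>l=0..j. (if l = 0 then 1 else 0) * (if j - l = 0 then 1 else 0)) = (\<Sum>l=0..j. if l = 0 then (if j = 0 then 1 else (0::complex)) else 0)"
    by (rule sum.cong) auto
  also have "\<dots> = (if j = 0 then 1 else 0)" by simp
  finally show ?thesis by (simp add: fps_mult_nth)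
qed

lemma tame_fps_gamma_ratio:
  assumes "filterlim k at_top F"
  shows "(\<lambda>i. fps_nth (fps_expansion (gamma_ratio (k i)) z) j) \<in> tame n F (if j = 0 then 1 else 0)"
  unfolding tame_def
proof (intro CollectI conjI)
  have "(\<lambda>k. fps_nth (fps_expansion (gamma_ratio k) z) j) \<in> poly_bounded (\<lambda>_. 0)"
    by (rule poly_bounded_convergent[OF tendsto_fps_gamma_ratio])
  then show "(\<lambda>i. fps_nth (fps_expansion (gamma_ratio (k i)) z) j) \<in> poly_bounded n"
    by (rule poly_bounded_le[OF poly_bounded_reindex[where g = k]]) simp
  show "((\<lambda>i. fps_nth (fps_expansion (gamma_ratio (k i)) z) j) \<longlongrightarrow> (if j = 0 then 1 else 0)) F"
    by (rule filterlim_compose[OF tendsto_fps_gamma_ratio assms])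
qed

context exponent_class
begin

text \<open>The factor in the Mittag-Leffler property is \<open>(T\<^sup>k / k!) (T / k)\<^sup>\<beta>\<close> times the value of the Gamma quotient at \<open>\<beta>\<close>.\<close>

lemma mittag_leffler_factor:
  assumes "T > 0"
  shows "class_powr R T (nat_plus R k \<beta>) \<otimes> class_fun R rGamma (nat_plus R 1 (nat_plus R k \<beta>))
    = of_real (T ^ k / fact k) \<odot> eval_P (fps_power \<beta>0 (ln T - ln (real k)) * fps_expansion (gamma_ratio k) \<beta>0)"
proof -
  have T: "exp (of_real (ln T) * of_nat k) = (of_real T ^ k :: complex)"
    using assms by (simp add: exp_of_nat2_mult exp_of_real)
  have "class_powr R T (nat_plus R k \<beta>) \<otimes> class_fun R rGamma (nat_plus R 1 (nat_plus R k \<beta>))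
     = eval_P (fps_const (exp (of_real (ln T) * (of_nat k + \<beta>0))) * fps_exp (of_real (ln T)) * fps_expansion rGamma (1 + (of_nat k + \<beta>0)))"
    by (simp add: class_powr_nat_plus class_fun_nat_plus_twice eval_P_mult)
  also have "fps_const (exp (of_real (ln T) * (of_nat k + \<beta>0))) * fps_exp (of_real (ln T)) * fps_expansion rGamma (1 + (of_nat k + \<beta>0))
     = fps_const (of_real (T ^ k / fact k)) *
        ((fps_power \<beta>0 (ln T) * fps_power \<beta>0 (- ln (real k))) * fps_expansion (gamma_ratio k) \<beta>0)"
  proof -
    have 1: "fps_const (exp (of_real (ln T) * (of_nat k + \<beta>0))) = fps_const (of_real T ^ k) * fps_const (exp (\<beta>0 * of_real (ln T)))"
      by (simp only: distrib_left exp_add T fps_const_mult mult.commute[of "of_real (ln T)" \<beta>0])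
    have 2: "fps_const (exp (- (\<beta>0 * of_real (ln (real k)))) / fact k) = fps_const (1 / fact k) * fps_const (exp (\<beta>0 * - of_real (ln (real k))))"
      by simp
    have 3: "fps_const (of_real (T ^ k / fact k) :: complex) = fps_const (of_real T ^ k) * fps_const (1 / fact k)"
      by simp
    show ?thesis
      unfolding fps_expansion_rGamma fps_power_def of_real_minus 1 2 3 by (simp only: mult.assoc mult.commute mult.left_commute)
  qed
  also have "fps_power \<beta>0 (ln T) * fps_power \<beta>0 (- ln (real k)) = fps_power \<beta>0 (ln T - ln (real k))"
    by (simp add: fps_power_mult)
  finally show ?thesis by (simp add: eval_P_const_mult)
qed

lemma class_powr_eq:
  assumes "t > 0"
  shows "class_powr R t (nat_plus R k \<beta>) = of_real (t ^ k) \<odot> eval_P (fps_power \<beta>0 (ln t))"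
proof -
  have T: "exp (of_real (ln t) * of_nat k) = (of_real t ^ k :: complex)"
    using assms by (simp add: exp_of_nat2_mult exp_of_real)
  have "fps_const (exp (of_real (ln t) * (of_nat k + \<beta>0))) * fps_exp (of_real (ln t)) = fps_const (of_real (t ^ k)) * fps_power \<beta>0 (ln t)"
    by (simp only: fps_power_def distrib_left exp_add T fps_const_mult mult.commute[of "of_real (ln t)" \<beta>0] mult.assoc[symmetric] of_real_power)
  then show ?thesis unfolding class_powr_nat_plus by (simp add: eval_P_const_mult)
qed

lemma eval_P_near_one:
  assumes "\<And>j. (\<lambda>i. fps_nth (G i) j - (if j = 0 then 1 else 0)) \<in> S"
  shows "\<exists>d\<in>span_families S. \<forall>i. eval_P (G i) = \<one> \<oplus> d i"
proof (intro bexI allI)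
  show "(\<lambda>i. eval_P (G i - 1)) \<in> span_families S"
    using assms by (intro span_families_eval_P) (simp add: fps_one_nth)
  show "eval_P (G i) = \<one> \<oplus> eval_P (G i - 1)" for i
    using fps_eval_add[OF P_closed exponent_nilpotent, of 1 "G i - 1"] by (simp add: eval_P_one)
qed

text \<open>
  The set \<open>S\<close> of scalar families stands for the null families of one kind or another; small errors in both
  factors make a small error in the product.
\<close>

lemma span_families_near_product:
  assumes d: "d \<in> span_families S" and e: "e \<in> span_families S" and A: "A \<in> carrier R"
    and S: "\<And>f z. f \<in> S \<Longrightarrow> (\<lambda>i. f i * z) \<in> S" "\<And>f g. f \<in> S \<Longrightarrow> g \<in> S \<Longrightarrow> (\<lambda>i. f i * g i) \<in> S"
  shows "\<exists>x\<in>span_families S. \<forall>i. (\<one> \<oplus> d i) \<otimes> (A \<oplus> e i) = A \<oplus> x i"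
proof (intro bexI allI)
  have A': "(\<lambda>i. A) \<in> span_families {\<lambda>i. 1}"
    using span_families.single[of "\<lambda>i. 1" "{\<lambda>i. 1}" A] A by simp
  have dA: "(\<lambda>i. d i \<otimes> A) \<in> span_families S" by (rule span_families_mult[OF d A']) (use S(1)[of _ 1] in auto)
  have de: "(\<lambda>i. d i \<otimes> e i) \<in> span_families S" by (rule span_families_mult[OF d e S(2)])
  show "(\<lambda>i. e i \<oplus> (d i \<otimes> A \<oplus> d i \<otimes> e i)) \<in> span_families S"
    by (rule span_families.add[OF e span_families.add[OF dA de]])
  fix i
  have "d i \<in> carrier R" "e i \<in> carrier R" by (rule span_families_closed[OF d], rule span_families_closed[OF e])
  then show "(\<one> \<oplus> d i) \<otimes> (A \<oplus> e i) = A \<oplus> (e i \<oplus> (d i \<otimes> A \<oplus> d i \<otimes> e i))"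
    using A by (simp add: l_distr r_distr a_ac)
qed

lemma normalised_coefficients_eventually:
  assumes mittag: "asymptotically_Mittag_Leffler R r a \<beta> T A" and T: "T > 0" and A: "A \<in> carrier R"
  obtains M e where "e \<in> span_families {c. c \<longlonglongrightarrow> 0}"
    and "\<And>m. m \<ge> M \<Longrightarrow> of_real (fact (r * m) / T ^ (r * m)) \<odot> a (r * m)
        = eval_P (fps_power \<beta>0 (ln T - ln (real (r * m))) * fps_expansion (gamma_ratio (r * m)) \<beta>0) \<otimes> (A \<oplus> e m)"
proof -
  obtain e where e: "tends_to R e \<zero>" and ev: "\<forall>\<^sub>F m in sequentially. a (r * m) =
      (class_powr R T (nat_plus R (r * m) \<beta>) \<otimes> class_fun R rGamma (nat_plus R 1 (nat_plus R (r * m) \<beta>))) \<otimes> (A \<oplus> e m)"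
    using mittag unfolding asymptotically_Mittag_Leffler_def by blast
  obtain x where x: "x \<in> span_families {c. c \<longlonglongrightarrow> 0}" "e = (\<lambda>m. \<zero> \<oplus> x m)" using tends_toD(2)[OF e] by blast
  have ex: "e = x" using x span_families_closed[OF x(1)] by simp
  obtain M where M: "\<And>m. m \<ge> M \<Longrightarrow> a (r * m) =
      (class_powr R T (nat_plus R (r * m) \<beta>) \<otimes> class_fun R rGamma (nat_plus R 1 (nat_plus R (r * m) \<beta>))) \<otimes> (A \<oplus> e m)"
    using ev unfolding eventually_sequentially by blast
  show ?thesis
  proof (rule that[OF x(1)[folded ex]])
    fix m assume "m \<ge> M"
    have xc: "A \<oplus> e m \<in> carrier R" using A span_families_closed[OF x(1)] ex by simp
    have "(of_real (fact (r * m) / T ^ (r * m)) * of_real (T ^ (r * m) / fact (r * m)) :: complex) = 1"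
      using T by simp
    then show "of_real (fact (r * m) / T ^ (r * m)) \<odot> a (r * m)
        = eval_P (fps_power \<beta>0 (ln T - ln (real (r * m))) * fps_expansion (gamma_ratio (r * m)) \<beta>0) \<otimes> (A \<oplus> e m)"
      unfolding M[OF \<open>m \<ge> M\<close>] mittag_leffler_factor[OF T]
      using xc eval_P_closed by (simp add: smult_mult_left smult_smult del: of_real_divide of_real_mult)
  qed
qed

text \<open>
  The correction \<open>(T / k)\<^sup>\<beta>\<close> grows polynomially in \<open>k\<close>; the coefficients before the asymptotic form sets in are
  finite in number.
\<close>

lemma normalised_coefficients_poly_bounded:
  assumes mittag: "asymptotically_Mittag_Leffler R r a \<beta> T A" and T: "T > 0" and A: "A \<in> carrier R"
    and a: "\<And>m. a (r * m) \<in> carrier R"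
  shows "(\<lambda>m. of_real (fact (r * m) / T ^ (r * m)) \<odot> a (r * m)) \<in> span_families (poly_bounded (\<lambda>m. r * m))"
proof -
  let ?S = "poly_bounded (\<lambda>m. r * m)"
  obtain M e where e: "e \<in> span_families {c. c \<longlonglongrightarrow> 0}"
    and M: "\<And>m. m \<ge> M \<Longrightarrow> of_real (fact (r * m) / T ^ (r * m)) \<odot> a (r * m)
        = eval_P (fps_power \<beta>0 (ln T - ln (real (r * m))) * fps_expansion (gamma_ratio (r * m)) \<beta>0) \<otimes> (A \<oplus> e m)"
    by (rule normalised_coefficients_eventually[OF mittag T A]) blast
  have e': "e \<in> span_families ?S"
    by (rule span_families_mono[OF e]) (auto intro: poly_bounded_convergent)
  have A': "(\<lambda>m. A) \<in> span_families ?S"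
    using span_families.single[of "\<lambda>i. 1" ?S A] A poly_bounded_bounded[of "\<lambda>i::nat. 1" 1 "\<lambda>m. r * m"] by simp
  have \<mu>: "\<bar>ln T - ln (real (r * m))\<bar> \<le> \<bar>ln T\<bar> + ln (real (r * m) + 1)" for m
  proof (cases "r * m = 0")
    case False
    then have "0 \<le> ln (real (r * m))" "ln (real (r * m)) \<le> ln (real (r * m) + 1)" by (auto simp del: of_nat_mult)
    then show ?thesis by linarith
  qed (auto simp del: of_nat_mult mult_eq_0_iff)
  have "(\<lambda>m. fps_nth (fps_power \<beta>0 (ln T - ln (real (r * m))) * fps_expansion (gamma_ratio (r * m)) \<beta>0) j) \<in> ?S" for j
    unfolding fps_mult_nth
  proof (intro poly_bounded_sum poly_bounded_mult fps_power_coefficient_poly_bounded[OF \<mu>])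
    fix l
    have "(\<lambda>m. fps_nth (fps_expansion (gamma_ratio m) \<beta>0) l) \<in> poly_bounded (\<lambda>m. m)"
      by (rule poly_bounded_convergent[OF tendsto_fps_gamma_ratio])
    from poly_bounded_reindex[OF this]
    show "(\<lambda>m. fps_nth (fps_expansion (gamma_ratio (r * m)) \<beta>0) l) \<in> ?S" .
  qed
  then have "(\<lambda>m. eval_P (fps_power \<beta>0 (ln T - ln (real (r * m))) * fps_expansion (gamma_ratio (r * m)) \<beta>0) \<otimes> (A \<oplus> e m)) \<in> span_families ?S"
    by (intro span_families_mult[OF span_families_eval_P span_families.add[OF A' e']] poly_bounded_mult)
  then show ?thesis
    by (rule span_families_finite_support[OF M, rotated])
      (use a in \<open>auto intro: poly_bounded_bounded[of _ 1]\<close>)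
qed

text \<open>
  The powers \<open>(T / k)\<^sup>\<beta>\<close> of the degree and \<open>(n / T')\<^sup>\<beta>\<close> of the total degree combine to the power of a ratio that tends to
  \<open>1\<close> along the filter.  The finitely many coefficients about which the Mittag-Leffler property says nothing
  do not matter since the degree \<open>k = r i\<close> tends to infinity along the filter.
\<close>

lemma normalised_coefficients_tame:
  fixes F :: "'i filter" and i n :: "'i \<Rightarrow> nat"
  assumes mittag: "asymptotically_Mittag_Leffler R r a \<beta> T A" and T: "T > 0" "T' > 0" and A: "A \<in> carrier R"
    and a: "\<And>m. a (r * m) \<in> carrier R" and r: "r > 0"
    and F: "\<And>\<iota>. r * i \<iota> \<le> n \<iota>" "filterlim n at_top F" "((\<lambda>\<iota>. real (r * i \<iota>) / real (n \<iota>)) \<longlongrightarrow> T / T') F"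
  shows "\<exists>x\<in>span_families (tame n F 0). \<forall>\<iota>.
    eval_P (fps_power \<beta>0 (ln (real (n \<iota>) / T'))) \<otimes> (of_real (fact (r * i \<iota>) / T ^ (r * i \<iota>)) \<odot> a (r * i \<iota>)) = A \<oplus> x \<iota>"
proof -
  let ?S = "tame n F 0"
  define u where "u m = of_real (fact (r * m) / T ^ (r * m)) \<odot> a (r * m)" for m
  define w where "w \<iota> = eval_P (fps_power \<beta>0 (ln (real (n \<iota>) / T')))" for \<iota>
  have uc: "u m \<in> carrier R" for m using a by (simp add: u_def)
  have wc: "w \<iota> \<in> carrier R" for \<iota> by (simp add: w_def eval_P_closed)
  obtain M0 e where e: "e \<in> span_families {c. c \<longlonglongrightarrow> 0}"
    and M0: "\<And>m. m \<ge> M0 \<Longrightarrow> u m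
        = eval_P (fps_power \<beta>0 (ln T - ln (real (r * m))) * fps_expansion (gamma_ratio (r * m)) \<beta>0) \<otimes> (A \<oplus> e m)"
    unfolding u_def by (rule normalised_coefficients_eventually[OF mittag T(1) A]) blast
  \<comment> \<open>Index \<open>0\<close> is treated as exceptional in order that the logarithm of the degree is meaningful beyond \<open>M\<close>.\<close>
  define M where "M = max M0 1"
  have ratio_lim: "filterlim (\<lambda>\<iota>. real (r * i \<iota>)) at_top F"
  proof -
    have "filterlim (\<lambda>\<iota>. real (r * i \<iota>) / real (n \<iota>) * real (n \<iota>)) at_top F"
      using T by (intro filterlim_tendsto_pos_mult_at_top[OF F(3)] filterlim_compose[OF filterlim_real_sequentially F(2)]) auto
    moreover have "real (r * i \<iota>) / real (n \<iota>) * real (n \<iota>) = real (r * i \<iota>)" for \<iota>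
      using F(1)[of \<iota>] by (cases "n \<iota> = 0") auto
    ultimately show ?thesis by simp
  qed
  have i_lim: "filterlim i at_top F"
    unfolding filterlim_at_top
  proof
    fix Z
    have "\<forall>\<^sub>F \<iota> in F. real (r * Z) \<le> real (r * i \<iota>)" using ratio_lim unfolding filterlim_at_top by blast
    then show "\<forall>\<^sub>F \<iota> in F. Z \<le> i \<iota>" by eventually_elim (use r in \<open>simp del: of_nat_mult\<close>)
  qed
  have k_lim: "filterlim (\<lambda>\<iota>. r * i \<iota>) at_top F"
    by (rule filterlim_at_top_mono[OF i_lim]) (use r in auto)
  define \<mu> where "\<mu> \<iota> = (if i \<iota> \<ge> M then ln (real (n \<iota>) / T') + (ln T - ln (real (r * i \<iota>))) else 0)" for \<iota>
  have big: "0 < real (r * i \<iota>)" "real (r * i \<iota>) \<le> real (n \<iota>)" if "i \<iota> \<ge> M" for \<iota>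
    using that r F(1)[of \<iota>] by (auto simp: M_def simp del: of_nat_mult)
  have \<mu>_bound: "\<bar>\<mu> \<iota>\<bar> \<le> \<bar>ln T - ln T'\<bar> + ln (real (n \<iota>) + 1)" for \<iota>
  proof (cases "i \<iota> \<ge> M")
    case True
    note b = big[OF True]
    have "real (r * i \<iota>) \<ge> 1" using b(1) by (simp del: of_nat_mult)
    then have "ln (real (r * i \<iota>)) \<ge> 0" by (rule ln_ge_zero)
    moreover have "ln (real (r * i \<iota>)) \<le> ln (real (n \<iota>))" using b by (subst ln_le_cancel_iff) auto
    moreover have "ln (real (n \<iota>)) \<le> ln (real (n \<iota>) + 1)" using b by (subst ln_le_cancel_iff) auto
    moreover have "ln (real (n \<iota>) / T') = ln (real (n \<iota>)) - ln T'" using b T by (intro ln_divide_pos) auto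
    ultimately show ?thesis using True by (simp add: \<mu>_def del: of_nat_mult)
  qed (auto simp: \<mu>_def)
  have \<mu>_lim: "(\<mu> \<longlongrightarrow> 0) F"
  proof (rule Lim_transform_eventually)
    have "((\<lambda>\<iota>. ln T - ln T' - ln (real (r * i \<iota>) / real (n \<iota>))) \<longlongrightarrow> ln T - ln T' - ln (T / T')) F"
      by (intro tendsto_intros F(3)) (use T in auto)
    then show "((\<lambda>\<iota>. ln T - ln T' - ln (real (r * i \<iota>) / real (n \<iota>))) \<longlongrightarrow> 0) F"
      using T by (simp add: ln_div)
    have "\<forall>\<^sub>F \<iota> in F. M \<le> i \<iota>" using i_lim unfolding filterlim_at_top by blast
    then show "\<forall>\<^sub>F \<iota> in F. ln T - ln T' - ln (real (r * i \<iota>) / real (n \<iota>)) = \<mu> \<iota>"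
    proof eventually_elim
      case (elim \<iota>)
      note b = big[OF elim]
      have n: "0 < real (n \<iota>)" using b by linarith
      have "ln (real (r * i \<iota>) / real (n \<iota>)) = ln (real (r * i \<iota>)) - ln (real (n \<iota>))"
        "ln (real (n \<iota>) / T') = ln (real (n \<iota>)) - ln T'"
        by (rule ln_divide_pos[OF b(1) n], rule ln_divide_pos[OF n T(2)])
      then show ?case using elim by (simp add: \<mu>_def del: of_nat_mult)
    qed
  qed
  have \<nu>_bound: "\<bar>ln (real (n \<iota>) / T')\<bar> \<le> \<bar>ln T'\<bar> + ln (real (n \<iota>) + 1)" for \<iota>
  proof (cases "n \<iota> = 0")
    case False
    then have "0 \<le> ln (real (n \<iota>))" "ln (real (n \<iota>)) \<le> ln (real (n \<iota>) + 1)" by auto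
    moreover have "ln (real (n \<iota>) / T') = ln (real (n \<iota>)) - ln T'" using False T by (intro ln_divide_pos) auto
    ultimately show ?thesis by linarith
  qed auto
  define G where "G \<iota> = fps_power \<beta>0 (\<mu> \<iota>) * fps_expansion (gamma_ratio (r * i \<iota>)) \<beta>0" for \<iota>
  have G: "(\<lambda>\<iota>. fps_nth (G \<iota>) j) \<in> tame n F (if j = 0 then 1 else 0)" for j
    unfolding G_def
    by (intro tame_fps_mult fps_power_coefficient_tame[OF \<mu>_bound \<mu>_lim] tame_fps_gamma_ratio k_lim)
  have "(\<lambda>\<iota>. fps_nth (G \<iota>) j - (if j = 0 then 1 else 0)) \<in> ?S" for j
    using tame_add[OF G[of j] tame_const[of "- (if j = 0 then 1 else 0)"]] by (simp split: if_splits)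
  then obtain d where d: "d \<in> span_families ?S" "\<And>\<iota>. eval_P (G \<iota>) = \<one> \<oplus> d \<iota>"
    using eval_P_near_one[of G ?S] by blast
  have e': "(\<lambda>\<iota>. e (i \<iota>)) \<in> span_families ?S"
  proof (rule span_families_reindex[OF e])
    fix f :: "nat \<Rightarrow> complex" assume f: "f \<in> {c. c \<longlonglongrightarrow> 0}"
    have "f \<in> poly_bounded (\<lambda>_. 0)" using f by (auto intro: poly_bounded_convergent)
    from poly_bounded_le[OF poly_bounded_reindex[OF this, of i], of n]
    show "(\<lambda>\<iota>. f (i \<iota>)) \<in> ?S" using f filterlim_compose[OF _ i_lim, of f "nhds 0"] by (auto simp: tame_def)
  qed
  have S: "(\<lambda>i. f i * z) \<in> ?S" "(\<lambda>i. f i * g i) \<in> ?S" if "f \<in> ?S" "g \<in> ?S" for f g z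
    using tame_mult[OF that(1) tame_const[of z]] tame_mult[OF that] by simp_all
  obtain x where x: "x \<in> span_families ?S" "\<And>\<iota>. (\<one> \<oplus> d \<iota>) \<otimes> (A \<oplus> e (i \<iota>)) = A \<oplus> x \<iota>"
    using span_families_near_product[OF d(1) e' A] S by blast
  have xc: "x \<iota> \<in> carrier R" for \<iota> by (rule span_families_closed[OF x(1)])
  have S0: "(\<lambda>\<iota>. of_bool (i \<iota> = m) * f \<iota>) \<in> ?S" if f: "f \<in> poly_bounded n" for f m
  proof -
    have "\<forall>\<^sub>F \<iota> in F. Suc m \<le> i \<iota>" using i_lim unfolding filterlim_at_top by blast
    then have "\<forall>\<^sub>F \<iota> in F. of_bool (i \<iota> = m) * f \<iota> = 0" by eventually_elim auto
    moreover have "(\<lambda>\<iota>. of_bool (i \<iota> = m) * f \<iota>) \<in> poly_bounded n"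
      by (rule poly_bounded_mult[OF poly_bounded_bounded[of _ 1] f]) auto
    ultimately show ?thesis by (auto simp: tame_def tendsto_eventually)
  qed
  have w: "w \<in> span_families (poly_bounded n)"
    unfolding w_def by (intro span_families_eval_P fps_power_coefficient_poly_bounded[OF \<nu>_bound])
  have const: "(\<lambda>\<iota>. v) \<in> span_families (poly_bounded n)" if "v \<in> carrier R" for v
    using span_families.single[of "\<lambda>i. 1" "poly_bounded n" v] that poly_bounded_bounded[of "\<lambda>i::'i. 1" 1 n] by simp
  \<comment> \<open>The errors at the exceptional indices below \<open>M\<close>, each of which is switched on only where \<open>i \<iota>\<close> is that index.\<close>
  define y where "y m \<iota> = (w \<iota> \<otimes> u m) \<ominus> (A \<oplus> x \<iota>)" for m \<iota>
  have y: "y m \<in> span_families (poly_bounded n)" for m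
    unfolding y_def
  proof (rule span_families_minus)
    show "(\<lambda>\<iota>. w \<iota> \<otimes> u m) \<in> span_families (poly_bounded n)"
      by (rule span_families_mult[OF w const[OF uc] poly_bounded_mult])
    show "(\<lambda>\<iota>. A \<oplus> x \<iota>) \<in> span_families (poly_bounded n)"
      by (rule span_families.add[OF const[OF A] span_families_mono[OF x(1)]]) (auto simp: tame_def)
  qed (rule poly_bounded_uminus)
  have yc: "y m \<iota> \<in> carrier R" for m \<iota> by (rule span_families_closed[OF y])
  define z where "z \<iota> = (\<Oplus>m\<in>{..<M}. of_bool (i \<iota> = m) \<odot> y m \<iota>)" for \<iota>
  have z: "z \<in> span_families ?S"
    unfolding z_def by (intro span_families_finsum span_families_smult[OF y] S0)
  have "w \<iota> \<otimes> u (i \<iota>) = A \<oplus> (x \<iota> \<oplus> z \<iota>)" for \<iota>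
  proof (cases "i \<iota> \<ge> M")
    case True
    have "z \<iota> = (\<Oplus>m\<in>{..<M}. \<zero>)" unfolding z_def using yc True by (intro finsum_cong') auto
    then have "z \<iota> = \<zero>" by simp
    moreover have "w \<iota> \<otimes> u (i \<iota>) = A \<oplus> x \<iota>"
    proof -
      have ec: "A \<oplus> e (i \<iota>) \<in> carrier R" using A span_families_closed[OF e] by simp
      have "w \<iota> \<otimes> u (i \<iota>) = w \<iota> \<otimes> (eval_P (fps_power \<beta>0 (ln T - ln (real (r * i \<iota>))) * fps_expansion (gamma_ratio (r * i \<iota>)) \<beta>0) \<otimes> (A \<oplus> e (i \<iota>)))"
        using True by (subst M0) (auto simp: M_def)
      also have "\<dots> = eval_P (fps_power \<beta>0 (ln (real (n \<iota>) / T')) * (fps_power \<beta>0 (ln T - ln (real (r * i \<iota>))) * fps_expansion (gamma_ratio (r * i \<iota>)) \<beta>0)) \<otimes> (A \<oplus> e (i \<iota>))"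
        unfolding w_def eval_P_mult[of "fps_power \<beta>0 (ln (real (n \<iota>) / T'))"] using ec eval_P_closed by (simp add: m_assoc)
      also have "fps_power \<beta>0 (ln (real (n \<iota>) / T')) * (fps_power \<beta>0 (ln T - ln (real (r * i \<iota>))) * fps_expansion (gamma_ratio (r * i \<iota>)) \<beta>0) = G \<iota>"
        using True by (simp add: G_def \<mu>_def mult.assoc[symmetric] fps_power_mult del: of_nat_mult)
      finally show ?thesis unfolding d(2) x(2) .
    qed
    ultimately show ?thesis using A xc by simp
  next
    case False
    have "z \<iota> = (\<Oplus>m\<in>{..<M}. if i \<iota> = m then y m \<iota> else \<zero>)"
      unfolding z_def using yc by (intro finsum_cong') auto
    also have "\<dots> = y (i \<iota>) \<iota>" using False yc by (intro finsum_singleton) auto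
    finally have "A \<oplus> (x \<iota> \<oplus> z \<iota>) = (A \<oplus> x \<iota>) \<oplus> ((w \<iota> \<otimes> u (i \<iota>)) \<ominus> (A \<oplus> x \<iota>))"
      using A xc wc uc by (simp add: y_def a_assoc)
    also have "\<dots> = w \<iota> \<otimes> u (i \<iota>)"
    proof -
      have "p \<oplus> (q \<ominus> p) = q" if "p \<in> carrier R" "q \<in> carrier R" for p q
        using that a_lcomm[of p q "\<ominus> p"] by (simp add: a_minus_def r_neg)
      then show ?thesis using A xc wc uc by simp
    qed
    finally show ?thesis by simp
  qed
  then show ?thesis
    unfolding w_def u_def by (intro bexI[OF _ span_families.add[OF x(1) z]] allI)
qed

end


section \<open>The product of two Mittag-Leffler series\<close>

text \<open>
  This identity is the reason why the scalings add: with the binomial weights, the normalisations of the two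
  coefficients become the normalisation of the coefficient of the product.
\<close>

lemma binomial_weight_factorials:
  assumes "S > 0" "T > 0"
  shows "binomial_weight (S / (S + T)) (k + l) k * (fact k / S ^ k) * (fact l / T ^ l) = fact (k + l) / (S + T) ^ (k + l)"
proof -
  have "1 - S / (S + T) = T / (S + T)" using assms by (simp add: field_simps)
  moreover have "real ((k + l) choose k) = fact (k + l) / (fact k * fact l)"
    using binomial_fact[of k "k + l", where 'a = real] by simp
  ultimately show ?thesis
    using assms by (simp add: binomial_weight_def power_divide power_add field_simps)
qed

lemma filterlim_nat_mult_at_top: "c > 0 \<Longrightarrow> filterlim (\<lambda>m::nat. c * m) at_top sequentially"
  by (rule filterlim_at_top_mono[OF filterlim_ident]) (auto intro!: always_eventually)

context complex_algebra
begin

text \<open>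
  Rearrangement of an absolutely convergent double series, in a form that mentions only partial sums, so
  that no infinite sums of classes have to be defined.
\<close>

lemma span_families_lattice_sums_minus_squares:
  assumes rs: "r > 0" "s > 0"
    and H: "H \<in> span_families {h. \<exists>f g. h = (\<lambda>x. f (fst x) * g (snd x)) \<and>
      summable (\<lambda>i::nat. norm (f i)) \<and> summable (\<lambda>j::nat. norm (g j))}"
  shows "(\<lambda>N. (\<Oplus>m\<in>{..<N}. \<Oplus>x\<in>lattice_points r s (gcd r s * m). H x) \<ominus> (\<Oplus>i\<in>{..<N}. \<Oplus>j\<in>{..<N}. H (i, j)))
    \<in> span_families {c. c \<longlonglongrightarrow> 0}"
  using H
proof induction
  case zero
  show ?case using span_families.zero[of "{c. c \<longlonglongrightarrow> 0}"] by (simp add: a_minus_def)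
next
  case (single h v)
  then obtain f g where h: "h = (\<lambda>x. f (fst x) * g (snd x))"
    and fg: "summable (\<lambda>i::nat. norm (f i))" "summable (\<lambda>j::nat. norm (g j))" by blast
  define c where "c N = (\<Sum>m<N. \<Sum>x\<in>lattice_points r s (gcd r s * m). f (fst x) * g (snd x)) - (\<Sum>i<N. f i) * (\<Sum>j<N. g j)" for N
  have "c \<longlonglongrightarrow> 0" unfolding c_def by (rule tendsto_lattice_sums_minus_product[OF rs fg])
  then have *: "(\<lambda>N. c N \<odot> v) \<in> span_families {c. c \<longlonglongrightarrow> 0}" by (intro span_families.single single) simp
  have "(\<Oplus>m\<in>{..<N}. \<Oplus>x\<in>lattice_points r s (gcd r s * m). h x \<odot> v) \<ominus> (\<Oplus>i\<in>{..<N}. \<Oplus>j\<in>{..<N}. h (i, j) \<odot> v) = c N \<odot> v" for N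
  proof -
    let ?U = "\<Sum>m<N. \<Sum>x\<in>lattice_points r s (gcd r s * m). h x" and ?V = "\<Sum>i<N. \<Sum>j<N. h (i, j)"
    have "(\<Oplus>m\<in>{..<N}. \<Oplus>x\<in>lattice_points r s (gcd r s * m). h x \<odot> v) \<ominus> (\<Oplus>i\<in>{..<N}. \<Oplus>j\<in>{..<N}. h (i, j) \<odot> v)
        = ?U \<odot> v \<ominus> ?V \<odot> v"
      by (simp only: finsum_smult_left[OF single(2)])
    also have "\<dots> = ?U \<odot> v \<oplus> (- ?V) \<odot> v"
      using single(2) by (simp add: a_minus_def smult_minus_one[symmetric] smult_smult)
    also have "\<dots> = (?U + - ?V) \<odot> v" using single(2) by (simp only: smult_l_distr)
    also have "?U + - ?V = c N" by (simp add: c_def h sum_product)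
    finally show ?thesis .
  qed
  with * show ?case by simp
next
  case (add x y)
  let ?F = "\<lambda>x N. \<Oplus>m\<in>{..<N}. \<Oplus>p\<in>lattice_points r s (gcd r s * m). x p"
  let ?G = "\<lambda>x N. \<Oplus>i\<in>{..<N}. \<Oplus>j\<in>{..<N}. x (i, j)"
  have xy: "x p \<in> carrier R" "y p \<in> carrier R" for p
    by (rule span_families_closed[OF add(1)], rule span_families_closed[OF add(2)])
  have F: "?F (\<lambda>p. x p \<oplus> y p) N = ?F x N \<oplus> ?F y N" for N
    by (simp add: finsum_addf xy Pi_iff finsum_closed)
  have G: "?G (\<lambda>p. x p \<oplus> y p) N = ?G x N \<oplus> ?G y N" for N
    by (simp add: finsum_addf xy Pi_iff finsum_closed)
  have *: "(a \<oplus> b) \<ominus> (c \<oplus> d) = (a \<ominus> c) \<oplus> (b \<ominus> d)"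
    if "a \<in> carrier R" "b \<in> carrier R" "c \<in> carrier R" "d \<in> carrier R" for a b c d
    using that by algebra
  have "?F (\<lambda>p. x p \<oplus> y p) N \<ominus> ?G (\<lambda>p. x p \<oplus> y p) N = (?F x N \<ominus> ?G x N) \<oplus> (?F y N \<ominus> ?G y N)" for N
    unfolding F G by (rule *) (auto intro!: finsum_closed simp: xy)
  then show ?case using span_families.add[OF add(3,4)] by simp
qed

end

context exponent_class
begin

text \<open>Up to the fixed factor \<open>t\<^sup>\<beta>\<close> the \<open>k\<close>-th term is \<open>(T t)\<^sup>k / k!\<close> times the normalised coefficient, which grows polynomially.\<close>

lemma series_terms_summable:
  assumes mittag: "asymptotically_Mittag_Leffler R r a \<beta> T A" and T: "T > 0" and A: "A \<in> carrier R"
    and a: "\<And>m. a (r * m) \<in> carrier R" and r: "r > 0" and t: "t > 0"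
  shows "(\<lambda>m. a (r * m) \<otimes> class_powr R t (nat_plus R (r * m) \<beta>)) \<in> span_families {f. summable (\<lambda>m. norm (f m))}"
proof -
  let ?E = "eval_P (fps_power \<beta>0 (ln t))"
  define u where "u m = of_real (fact (r * m) / T ^ (r * m)) \<odot> a (r * m)" for m
  have u: "u \<in> span_families (poly_bounded (\<lambda>m. r * m))"
    unfolding u_def by (rule normalised_coefficients_poly_bounded[OF mittag T A a])
  have E: "(\<lambda>m. ?E) \<in> span_families {\<lambda>m. 1}"
    using span_families.single[of "\<lambda>m. 1" "{\<lambda>m. 1}" ?E] by (simp add: eval_P_closed)
  have "(\<lambda>m. u m \<otimes> ?E) \<in> span_families (poly_bounded (\<lambda>m. r * m))"
    by (rule span_families_mult[OF u E]) simp
  then have "(\<lambda>m. of_real ((T * t) ^ (r * m) / fact (r * m)) \<odot> (u m \<otimes> ?E)) \<in> span_families {f. summable (\<lambda>m. norm (f m))}"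
  proof (rule span_families_smult)
    fix f assume "f \<in> poly_bounded (\<lambda>m. r * m)"
    from summable_norm_poly_bounded[OF r _ this, of "T * t"] T t
    show "(\<lambda>m. of_real ((T * t) ^ (r * m) / fact (r * m)) * f m) \<in> {f. summable (\<lambda>m. norm (f m))}" by simp
  qed
  moreover have "of_real ((T * t) ^ (r * m) / fact (r * m)) \<odot> (u m \<otimes> ?E) = a (r * m) \<otimes> class_powr R t (nat_plus R (r * m) \<beta>)" for m
  proof -
    have "complex_of_real ((T * t) ^ (r * m) / fact (r * m)) * of_real (fact (r * m) / T ^ (r * m)) = of_real (t ^ (r * m))"
      using T by (simp add: power_mult_distrib)
    then show ?thesis
      unfolding u_def class_powr_eq[OF t]
      by (simp add: smult_mult_left smult_mult_right smult_smult a eval_P_closed del: of_real_divide of_real_mult of_real_power)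
  qed
  ultimately show ?thesis by simp
qed

end

context tensor_product
begin

lemma span_families_near_tensor:
  assumes x: "x \<in> A.span_families S" and y: "y \<in> B.span_families S" and a: "a \<in> carrier A" and b: "b \<in> carrier B"
    and S: "\<And>f g. f \<in> S \<Longrightarrow> g \<in> S \<Longrightarrow> (\<lambda>i. f i * g i) \<in> S"
  shows "\<exists>z\<in>AB.span_families S. \<forall>i. tensor A B (a \<oplus>\<^bsub>A\<^esub> x i) (b \<oplus>\<^bsub>B\<^esub> y i) = tensor A B a b \<oplus>\<^bsub>AB\<^esub> z i"
proof (intro bexI allI)
  have a': "(\<lambda>i. a) \<in> A.span_families {\<lambda>i. 1}"
    using A.span_families.single[of "\<lambda>i. 1" "{\<lambda>i. 1}" a] a by simp
  have b': "(\<lambda>i. b) \<in> B.span_families {\<lambda>i. 1}"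
    using B.span_families.single[of "\<lambda>i. 1" "{\<lambda>i. 1}" b] b by simp
  have 1: "(\<lambda>i. tensor A B a (y i)) \<in> AB.span_families S"
    by (rule span_families_tensor[OF a' y]) simp
  have 2: "(\<lambda>i. tensor A B (x i) b) \<in> AB.span_families S"
    by (rule span_families_tensor[OF x b']) simp
  have 3: "(\<lambda>i. tensor A B (x i) (y i)) \<in> AB.span_families S"
    by (rule span_families_tensor[OF x y S])
  show "(\<lambda>i. tensor A B a (y i) \<oplus>\<^bsub>AB\<^esub> (tensor A B (x i) b \<oplus>\<^bsub>AB\<^esub> tensor A B (x i) (y i))) \<in> AB.span_families S"
    by (rule AB.span_families.add[OF 1 AB.span_families.add[OF 2 3]])
  fix i
  have "x i \<in> carrier A" "y i \<in> carrier B"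
    by (rule A.span_families_closed[OF x], rule B.span_families_closed[OF y])
  then show "tensor A B (a \<oplus>\<^bsub>A\<^esub> x i) (b \<oplus>\<^bsub>B\<^esub> y i)
      = tensor A B a b \<oplus>\<^bsub>AB\<^esub> (tensor A B a (y i) \<oplus>\<^bsub>AB\<^esub> (tensor A B (x i) b \<oplus>\<^bsub>AB\<^esub> tensor A B (x i) (y i)))"
    using a b by (simp add: tensor_add_left tensor_add_right AB.a_ac)
qed

end

context tensor_exponents
begin

lemma even_eval_P: "even_class A (XA.eval_P F)" "even_class B (XB.eval_P F)"
  by (rule A.even_fps_eval[OF A.even_positive_part[OF even_beta]], rule B.even_fps_eval[OF B.even_positive_part[OF even_gamma]])

lemma fps_power_tensor:
  "XAB.eval_P (fps_power (\<beta>0 + \<gamma>0) \<mu>) = tensor A B (XA.eval_P (fps_power \<beta>0 \<mu>)) (XB.eval_P (fps_power \<gamma>0 \<mu>))"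
  by (simp add: fps_power_def XA.eval_P_const_mult XB.eval_P_const_mult XAB.eval_P_const_mult fps_exp_tensor
      tensor_smult_left tensor_smult_right XA.eval_P_closed XB.eval_P_closed AB.smult_smult distrib_right exp_add mult.commute[of "exp (\<gamma>0 * of_real \<mu>)"])

lemma product_coeff_closed:
  assumes "\<And>m. a (r * m) \<in> carrier A" "\<And>m. b (s * m) \<in> carrier B"
  shows "product_coeff A B r s a b n \<in> carrier AB"
  unfolding product_coeff_def by (intro AB.finsum_closed) (auto simp: assms)

text \<open>
  The series of the product is a rearrangement of the absolutely convergent double series of the products
  of the terms.  The classes \<open>t\<^sup>\<beta>\<close> move past the coefficients of the other factor without a sign since
  they are even.
\<close>

lemma product_series_expansion:
  assumes rs: "r > 0" "s > 0" and ST: "T\<^sub>A > 0" "T\<^sub>B > 0"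
    and a: "\<And>m. a (r * m) \<in> carrier A" and b: "\<And>m. b (s * m) \<in> carrier B" and ab0: "a0 \<in> carrier A" "b0 \<in> carrier B"
    and mittag: "asymptotically_Mittag_Leffler A r a \<beta> T\<^sub>A a0" "asymptotically_Mittag_Leffler B s b \<gamma> T\<^sub>B b0"
    and series: "has_series_expansion A f r a \<beta>" "has_series_expansion B g s b \<gamma>"
  shows "has_series_expansion AB (\<lambda>t. tensor A B (f t) (g t)) (gcd r s) (product_coeff A B r s a b) \<delta>"
  unfolding has_series_expansion_def
proof (intro allI impI)
  fix t :: real assume t: "t > 0"
  let ?null = "{c. c \<longlonglongrightarrow> (0::complex)}"
  define X where "X i = a (r * i) \<otimes>\<^bsub>A\<^esub> class_powr A t (nat_plus A (r * i) \<beta>)" for i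
  define Y where "Y j = b (s * j) \<otimes>\<^bsub>B\<^esub> class_powr B t (nat_plus B (s * j) \<gamma>)" for j
  define H where "H x = tensor A B (X (fst x)) (Y (snd x))" for x
  have X: "X \<in> A.span_families {f. summable (\<lambda>m. norm (f m))}"
    unfolding X_def by (rule XA.series_terms_summable[OF mittag(1) ST(1) ab0(1) a rs(1) t])
  have Y: "Y \<in> B.span_families {f. summable (\<lambda>m. norm (f m))}"
    unfolding Y_def by (rule XB.series_terms_summable[OF mittag(2) ST(2) ab0(2) b rs(2) t])
  have XY: "X i \<in> carrier A" "Y i \<in> carrier B" for i
    by (rule A.span_families_closed[OF X], rule B.span_families_closed[OF Y])
  have H: "H \<in> AB.span_families {h. \<exists>f g. h = (\<lambda>x. f (fst x) * g (snd x)) \<and>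
      summable (\<lambda>i::nat. norm (f i)) \<and> summable (\<lambda>j::nat. norm (g j))}"
    unfolding H_def
  proof (rule span_families_tensor)
    show "(\<lambda>x. X (fst x)) \<in> A.span_families ((\<lambda>f x. f (fst x)) ` {f. summable (\<lambda>m. norm (f m))})"
      by (rule A.span_families_reindex[OF X]) auto
    show "(\<lambda>x. Y (snd x)) \<in> B.span_families ((\<lambda>f x. f (snd x)) ` {f. summable (\<lambda>m. norm (f m))})"
      by (rule B.span_families_reindex[OF Y]) auto
  qed blast
  have Hc: "H x \<in> carrier AB" for x by (simp add: H_def XY)
  obtain xa where xa: "xa \<in> A.span_families ?null" "\<And>N. (\<Oplus>\<^bsub>A\<^esub>i\<in>{..<N}. X i) = f t \<oplus>\<^bsub>A\<^esub> xa N" and ft: "f t \<in> carrier A"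
  proof -
    have "tends_to A (\<lambda>N. \<Oplus>\<^bsub>A\<^esub>i\<in>{..<N}. X i) (f t)"
      using series(1) t unfolding has_series_expansion_def X_def by blast
    from A.tends_toD[OF this] show ?thesis by (auto simp: fun_eq_iff intro: that)
  qed
  obtain xb where xb: "xb \<in> B.span_families ?null" "\<And>N. (\<Oplus>\<^bsub>B\<^esub>j\<in>{..<N}. Y j) = g t \<oplus>\<^bsub>B\<^esub> xb N" and gt: "g t \<in> carrier B"
  proof -
    have "tends_to B (\<lambda>N. \<Oplus>\<^bsub>B\<^esub>i\<in>{..<N}. Y i) (g t)"
      using series(2) t unfolding has_series_expansion_def Y_def by blast
    from B.tends_toD[OF this] show ?thesis by (auto simp: fun_eq_iff intro: that)
  qed
  have null_mult: "(\<lambda>i. c i * d i) \<in> ?null" if "c \<in> ?null" "d \<in> ?null" for c d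
    using tendsto_mult[of c 0 sequentially d 0] that by simp
  obtain z where z: "z \<in> AB.span_families ?null"
    "\<And>N. tensor A B (f t \<oplus>\<^bsub>A\<^esub> xa N) (g t \<oplus>\<^bsub>B\<^esub> xb N) = tensor A B (f t) (g t) \<oplus>\<^bsub>AB\<^esub> z N"
    using span_families_near_tensor[OF xa(1) xb(1) ft gt null_mult] by blast
  define U where "U N = (\<Oplus>\<^bsub>AB\<^esub>m\<in>{..<N}. \<Oplus>\<^bsub>AB\<^esub>x\<in>lattice_points r s (gcd r s * m). H x)" for N
  define V where "V N = (\<Oplus>\<^bsub>AB\<^esub>i\<in>{..<N}. \<Oplus>\<^bsub>AB\<^esub>j\<in>{..<N}. H (i, j))" for N
  have UV: "(\<lambda>N. U N \<ominus>\<^bsub>AB\<^esub> V N) \<in> AB.span_families ?null"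
    unfolding U_def V_def by (rule AB.span_families_lattice_sums_minus_squares[OF rs H])
  have UVc: "U N \<in> carrier AB" "V N \<in> carrier AB" for N
    unfolding U_def V_def by (auto intro!: AB.finsum_closed simp: Hc)
  have V: "V N = tensor A B (f t) (g t) \<oplus>\<^bsub>AB\<^esub> z N" for N
  proof -
    have "tensor A B (\<Oplus>\<^bsub>A\<^esub>i\<in>{..<N}. X i) (\<Oplus>\<^bsub>B\<^esub>j\<in>{..<N}. Y j) = (\<Oplus>\<^bsub>AB\<^esub>i\<in>{..<N}. tensor A B (X i) (\<Oplus>\<^bsub>B\<^esub>j\<in>{..<N}. Y j))"
      by (rule tensor_finsum_left) (auto simp: XY intro!: B.finsum_closed)
    also have "\<dots> = V N"
      unfolding V_def H_def fst_conv snd_conv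
      by (intro AB.finsum_cong' tensor_finsum_right) (auto simp: XY intro!: AB.finsum_closed)
    finally show ?thesis unfolding xa(2) xb(2) z(2) by simp
  qed
  have lim: "tends_to AB (\<lambda>N. tensor A B (f t) (g t) \<oplus>\<^bsub>AB\<^esub> (z N \<oplus>\<^bsub>AB\<^esub> (U N \<ominus>\<^bsub>AB\<^esub> V N))) (tensor A B (f t) (g t))"
    using ft gt by (intro AB.tends_to_if_span_families AB.span_families.add z(1) UV) simp
  have "tensor A B (f t) (g t) \<oplus>\<^bsub>AB\<^esub> (z N \<oplus>\<^bsub>AB\<^esub> (U N \<ominus>\<^bsub>AB\<^esub> V N)) = U N" for N
  proof -
    have zc: "z N \<in> carrier AB" by (rule AB.span_families_closed[OF z(1)])
    have *: "p \<oplus>\<^bsub>AB\<^esub> (q \<oplus>\<^bsub>AB\<^esub> (u \<ominus>\<^bsub>AB\<^esub> (p \<oplus>\<^bsub>AB\<^esub> q))) = u"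
      if "p \<in> carrier AB" "q \<in> carrier AB" "u \<in> carrier AB" for p q u
      using that by algebra
    show ?thesis unfolding V by (rule *) (use ft gt zc UVc in auto)
  qed
  moreover have "(\<Oplus>\<^bsub>AB\<^esub>m\<in>{..<N}. product_coeff A B r s a b (gcd r s * m) \<otimes>\<^bsub>AB\<^esub> class_powr AB t (nat_plus AB (gcd r s * m) \<delta>)) = U N" for N
    unfolding U_def
  proof (rule AB.finsum_cong'[OF refl])
    fix m
    let ?n = "gcd r s * m"
    let ?EA = "XA.eval_P (fps_power \<beta>0 (ln t))" and ?EB = "XB.eval_P (fps_power \<gamma>0 (ln t))"
    have Z: "class_powr AB t (nat_plus AB ?n \<delta>) = of_real (t ^ ?n) \<odot>\<^bsub>AB\<^esub> tensor A B ?EA ?EB"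
      unfolding XAB.class_powr_eq[OF t] fps_power_tensor ..
    have Zc: "class_powr AB t (nat_plus AB ?n \<delta>) \<in> carrier AB"
      unfolding Z by (simp add: XA.eval_P_closed XB.eval_P_closed)
    have "product_coeff A B r s a b ?n \<otimes>\<^bsub>AB\<^esub> class_powr AB t (nat_plus AB ?n \<delta>)
        = (\<Oplus>\<^bsub>AB\<^esub>x\<in>lattice_points r s ?n. tensor A B (a (r * fst x)) (b (s * snd x)) \<otimes>\<^bsub>AB\<^esub> class_powr AB t (nat_plus AB ?n \<delta>))"
      unfolding product_coeff_def lattice_points_def[symmetric]
      by (rule AB.finsum_ldistr[OF finite_lattice_points[OF rs] Zc]) (auto simp: a b)
    also have "\<dots> = (\<Oplus>\<^bsub>AB\<^esub>x\<in>lattice_points r s ?n. H x)"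
    proof (rule AB.finsum_cong'[OF refl])
      fix x assume "x \<in> lattice_points r s ?n"
      then have n: "?n = r * fst x + s * snd x" by (auto simp: lattice_points_def)
      have "tensor A B (a (r * fst x)) (b (s * snd x)) \<otimes>\<^bsub>AB\<^esub> class_powr AB t (nat_plus AB ?n \<delta>)
          = of_real (t ^ ?n) \<odot>\<^bsub>AB\<^esub> tensor A B (a (r * fst x) \<otimes>\<^bsub>A\<^esub> ?EA) (b (s * snd x) \<otimes>\<^bsub>B\<^esub> ?EB)"
        unfolding Z using even_eval_P
        by (simp add: AB.smult_mult_right tensor_mult a b XA.eval_P_closed XB.eval_P_closed del: of_real_power)
      also have "\<dots> = H x"
        unfolding H_def X_def Y_def XA.class_powr_eq[OF t] XB.class_powr_eq[OF t] n
        by (simp add: A.smult_mult_right B.smult_mult_right tensor_smult_left tensor_smult_right AB.smult_smult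
            a b XA.eval_P_closed XB.eval_P_closed power_add mult.commute)
      finally show "tensor A B (a (r * fst x)) (b (s * snd x)) \<otimes>\<^bsub>AB\<^esub> class_powr AB t (nat_plus AB ?n \<delta>) = H x" .
    qed (auto simp: Hc)
    finally show "product_coeff A B r s a b ?n \<otimes>\<^bsub>AB\<^esub> class_powr AB t (nat_plus AB ?n \<delta>)
      = (\<Oplus>\<^bsub>AB\<^esub>x\<in>lattice_points r s ?n. H x)" .
  qed (auto intro!: AB.finsum_closed simp: Hc)
  ultimately show "tends_to AB (\<lambda>N. \<Oplus>\<^bsub>AB\<^esub>m\<in>{..<N}. product_coeff A B r s a b (gcd r s * m) \<otimes>\<^bsub>AB\<^esub>
      class_powr AB t (nat_plus AB (gcd r s * m) \<delta>)) (tensor A B (f t) (g t))"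
    using lim by simp
qed

text \<open>
  The power with exponent \<open>\<delta> = \<beta> + \<gamma>\<close> is distributed to the two factors, which needs even exponents, and the
  factorials to the binomial weights.
\<close>

lemma product_coeff_as_average:
  assumes rs: "r > 0" "s > 0" and ST: "T\<^sub>A > 0" "T\<^sub>B > 0"
    and a: "\<And>m. a (r * m) \<in> carrier A" and b: "\<And>m. b (s * m) \<in> carrier B"
  shows "of_real (fact n / (T\<^sub>A + T\<^sub>B) ^ n) \<odot>\<^bsub>AB\<^esub> (XAB.eval_P (fps_power (\<beta>0 + \<gamma>0) \<mu>) \<otimes>\<^bsub>AB\<^esub> product_coeff A B r s a b n)
    = (\<Oplus>\<^bsub>AB\<^esub>x\<in>lattice_points r s n. of_real (binomial_weight (T\<^sub>A / (T\<^sub>A + T\<^sub>B)) n (r * fst x)) \<odot>\<^bsub>AB\<^esub>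
        tensor A B (XA.eval_P (fps_power \<beta>0 \<mu>) \<otimes>\<^bsub>A\<^esub> (of_real (fact (r * fst x) / T\<^sub>A ^ (r * fst x)) \<odot>\<^bsub>A\<^esub> a (r * fst x)))
          (XB.eval_P (fps_power \<gamma>0 \<mu>) \<otimes>\<^bsub>B\<^esub> (of_real (fact (s * snd x) / T\<^sub>B ^ (s * snd x)) \<odot>\<^bsub>B\<^esub> b (s * snd x))))"
proof -
  let ?E = "XAB.eval_P (fps_power (\<beta>0 + \<gamma>0) \<mu>)"
  let ?EA = "XA.eval_P (fps_power \<beta>0 \<mu>)" and ?EB = "XB.eval_P (fps_power \<gamma>0 \<mu>)"
  let ?t = "\<lambda>x. tensor A B (a (r * fst x)) (b (s * snd x))"
  have c: "?E \<in> carrier AB" "?EA \<in> carrier A" "?EB \<in> carrier B"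
    by (rule XAB.eval_P_closed, rule XA.eval_P_closed, rule XB.eval_P_closed)
  have "?E \<otimes>\<^bsub>AB\<^esub> product_coeff A B r s a b n = (\<Oplus>\<^bsub>AB\<^esub>x\<in>lattice_points r s n. ?E \<otimes>\<^bsub>AB\<^esub> ?t x)"
    unfolding product_coeff_def lattice_points_def[symmetric]
    by (rule AB.finsum_rdistr[OF finite_lattice_points[OF rs] c(1)]) (auto simp: a b)
  then have "of_real (fact n / (T\<^sub>A + T\<^sub>B) ^ n) \<odot>\<^bsub>AB\<^esub> (?E \<otimes>\<^bsub>AB\<^esub> product_coeff A B r s a b n)
      = (\<Oplus>\<^bsub>AB\<^esub>x\<in>lattice_points r s n. of_real (fact n / (T\<^sub>A + T\<^sub>B) ^ n) \<odot>\<^bsub>AB\<^esub> (?E \<otimes>\<^bsub>AB\<^esub> ?t x))"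
    using c by (simp only:) (rule AB.finsum_smult_right, auto simp: a b)
  also have "\<dots> = (\<Oplus>\<^bsub>AB\<^esub>x\<in>lattice_points r s n. of_real (binomial_weight (T\<^sub>A / (T\<^sub>A + T\<^sub>B)) n (r * fst x)) \<odot>\<^bsub>AB\<^esub>
        tensor A B (?EA \<otimes>\<^bsub>A\<^esub> (of_real (fact (r * fst x) / T\<^sub>A ^ (r * fst x)) \<odot>\<^bsub>A\<^esub> a (r * fst x)))
          (?EB \<otimes>\<^bsub>B\<^esub> (of_real (fact (s * snd x) / T\<^sub>B ^ (s * snd x)) \<odot>\<^bsub>B\<^esub> b (s * snd x))))"
  proof (rule AB.finsum_cong'[OF refl])
    fix x assume "x \<in> lattice_points r s n"
    then have n: "n = r * fst x + s * snd x" by (auto simp: lattice_points_def)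
    have E: "?E \<otimes>\<^bsub>AB\<^esub> ?t x = tensor A B (?EA \<otimes>\<^bsub>A\<^esub> a (r * fst x)) (?EB \<otimes>\<^bsub>B\<^esub> b (s * snd x))"
      unfolding fps_power_tensor using even_eval_P c by (intro tensor_mult) (auto simp: a b)
    define w u v where "w = binomial_weight (T\<^sub>A / (T\<^sub>A + T\<^sub>B)) n (r * fst x)"
      and "u = fact (r * fst x) / T\<^sub>A ^ (r * fst x)" and "v = fact (s * snd x) / T\<^sub>B ^ (s * snd x)"
    have w: "fact n / (T\<^sub>A + T\<^sub>B) ^ n = w * u * v"
      unfolding w_def u_def v_def n by (rule binomial_weight_factorials[OF ST, symmetric])
    show "of_real (fact n / (T\<^sub>A + T\<^sub>B) ^ n) \<odot>\<^bsub>AB\<^esub> (?E \<otimes>\<^bsub>AB\<^esub> ?t x)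
      = of_real (binomial_weight (T\<^sub>A / (T\<^sub>A + T\<^sub>B)) n (r * fst x)) \<odot>\<^bsub>AB\<^esub>
        tensor A B (?EA \<otimes>\<^bsub>A\<^esub> (of_real (fact (r * fst x) / T\<^sub>A ^ (r * fst x)) \<odot>\<^bsub>A\<^esub> a (r * fst x)))
          (?EB \<otimes>\<^bsub>B\<^esub> (of_real (fact (s * snd x) / T\<^sub>B ^ (s * snd x)) \<odot>\<^bsub>B\<^esub> b (s * snd x)))"
      unfolding w E w_def[symmetric] u_def[symmetric] v_def[symmetric]
      using c by (simp add: A.smult_mult_right B.smult_mult_right tensor_smult_left tensor_smult_right AB.smult_smult
          a b mult_ac)
  qed (use c in \<open>auto simp: a b\<close>)
  finally show ?thesis .
qed

text \<open>
  The binomial weights concentrate where the two degrees are proportional to the two scalings, and there the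
  terms of the average tend to the product of the leading classes.  What is left of the weights is their total
  mass on the lattice, which tends to its density.
\<close>

lemma product_average_limit:
  assumes rs: "r > 0" "s > 0" and ST: "T\<^sub>A > 0" "T\<^sub>B > 0"
    and a: "\<And>m. a (r * m) \<in> carrier A" and b: "\<And>m. b (s * m) \<in> carrier B" and ab0: "a0 \<in> carrier A" "b0 \<in> carrier B"
    and mittag: "asymptotically_Mittag_Leffler A r a \<beta> T\<^sub>A a0" "asymptotically_Mittag_Leffler B s b \<gamma> T\<^sub>B b0"
  shows "\<exists>q\<in>AB.span_families {c. c \<longlonglongrightarrow> 0}. \<forall>m. of_real (fact (gcd r s * m) / (T\<^sub>A + T\<^sub>B) ^ (gcd r s * m)) \<odot>\<^bsub>AB\<^esub>
      (XAB.eval_P (fps_power (\<beta>0 + \<gamma>0) (ln (real (gcd r s * m) / (T\<^sub>A + T\<^sub>B)))) \<otimes>\<^bsub>AB\<^esub> product_coeff A B r s a b (gcd r s * m))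
    = (of_nat (gcd r s) / (of_nat r * of_nat s)) \<odot>\<^bsub>AB\<^esub> tensor A B a0 b0 \<oplus>\<^bsub>AB\<^esub> q m"
proof -
  let ?null = "{c. c \<longlonglongrightarrow> (0::complex)}"
  define p where "p = T\<^sub>A / (T\<^sub>A + T\<^sub>B)"
  have p: "0 < p" "p < 1" and p': "1 - p = T\<^sub>B / (T\<^sub>A + T\<^sub>B)" using ST by (auto simp: p_def field_simps)
  define n where "n x = r * fst x + s * snd x" for x :: "nat \<times> nat"
  define F where "F = central r s p"
  have nF: "filterlim n at_top F" unfolding n_def F_def by (rule filterlim_central_total)
  have ratio: "((\<lambda>x. real (r * fst x) / real (n x)) \<longlongrightarrow> T\<^sub>A / (T\<^sub>A + T\<^sub>B)) F"
    using tendsto_central_ratio[of r s p] unfolding n_def F_def p_def .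
  have ratio': "((\<lambda>x. real (s * snd x) / real (n x)) \<longlongrightarrow> T\<^sub>B / (T\<^sub>A + T\<^sub>B)) F"
    using tendsto_central_ratio_snd[of s r p] unfolding n_def F_def p' .
  have ST': "T\<^sub>A + T\<^sub>B > 0" using ST by simp
  define xA where "xA x = XA.eval_P (fps_power \<beta>0 (ln (real (n x) / (T\<^sub>A + T\<^sub>B)))) \<otimes>\<^bsub>A\<^esub>
      (of_real (fact (r * fst x) / T\<^sub>A ^ (r * fst x)) \<odot>\<^bsub>A\<^esub> a (r * fst x))" for x
  define xB where "xB x = XB.eval_P (fps_power \<gamma>0 (ln (real (n x) / (T\<^sub>A + T\<^sub>B)))) \<otimes>\<^bsub>B\<^esub>
      (of_real (fact (s * snd x) / T\<^sub>B ^ (s * snd x)) \<odot>\<^bsub>B\<^esub> b (s * snd x))" for x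
  have n_ge: "r * fst x \<le> n x" "s * snd x \<le> n x" for x by (simp_all add: n_def)
  obtain ya where ya: "ya \<in> A.span_families (tame n F 0)" "\<And>x. xA x = a0 \<oplus>\<^bsub>A\<^esub> ya x"
    using XA.normalised_coefficients_tame[OF mittag(1) ST(1) ST' ab0(1) a rs(1) n_ge(1) nF ratio]
    unfolding xA_def by blast
  obtain yb where yb: "yb \<in> B.span_families (tame n F 0)" "\<And>x. xB x = b0 \<oplus>\<^bsub>B\<^esub> yb x"
    using XB.normalised_coefficients_tame[OF mittag(2) ST(2) ST' ab0(2) b rs(2) n_ge(2) nF ratio']
    unfolding xB_def by blast
  have tame0: "(\<lambda>i. c i * d i) \<in> tame n F 0" if "c \<in> tame n F 0" "d \<in> tame n F 0" for c d
    using tame_mult[OF that] by simp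
  obtain z where z: "z \<in> AB.span_families (tame n F 0)"
    "\<And>x. tensor A B (a0 \<oplus>\<^bsub>A\<^esub> ya x) (b0 \<oplus>\<^bsub>B\<^esub> yb x) = tensor A B a0 b0 \<oplus>\<^bsub>AB\<^esub> z x"
    using span_families_near_tensor[OF ya(1) yb(1) ab0 tame0] by blast
  have zc: "z x \<in> carrier AB" for x by (rule AB.span_families_closed[OF z(1)])
  let ?w = "\<lambda>N x. complex_of_real (binomial_weight p N (r * fst x))"
  let ?C = "tensor A B a0 b0"
  have C: "?C \<in> carrier AB" using ab0 by simp
  define Z where "Z N = (\<Oplus>\<^bsub>AB\<^esub>x\<in>lattice_points r s N. ?w N x \<odot>\<^bsub>AB\<^esub> z x)" for N
  have Z0: "Z \<in> AB.span_families ?null"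
    unfolding Z_def
  proof (rule AB.span_families_weighted_sum[OF z(1)])
    fix c assume "c \<in> tame n F 0"
    then show "(\<lambda>N. \<Sum>x\<in>lattice_points r s N. ?w N x * c x) \<in> ?null"
      using tendsto_lattice_average_null[OF rs p, of c] unfolding n_def F_def by simp
  qed
  have g: "filterlim (\<lambda>m. gcd r s * m) at_top sequentially"
    using rs by (intro filterlim_nat_mult_at_top) simp
  have Z: "(\<lambda>m. Z (gcd r s * m)) \<in> AB.span_families ?null"
    by (rule AB.span_families_reindex[OF Z0]) (use filterlim_compose[OF _ g] in auto)
  define L :: complex where "L = of_nat (gcd r s) / (of_nat r * of_nat s)"
  define W where "W N = (\<Sum>x\<in>lattice_points r s N. ?w N x)" for N
  have "(\<lambda>m. of_real (\<Sum>(i, j)\<in>lattice_points r s (gcd r s * m). binomial_weight p (gcd r s * m) (r * i))) \<longlonglongrightarrow>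
      complex_of_real (real (gcd r s) / (real r * real s))"
    by (rule tendsto_of_real[OF tendsto_sum_binomial_weight_lattice[OF rs p]])
  then have W: "(\<lambda>m. W (gcd r s * m)) \<longlonglongrightarrow> L"
    by (simp add: W_def L_def case_prod_beta)
  then have "(\<lambda>m. W (gcd r s * m) - L) \<in> ?null" using LIM_zero by auto
  from AB.span_families.add[OF AB.span_families.single[OF this C] Z]
  have "(\<lambda>m. (W (gcd r s * m) - L) \<odot>\<^bsub>AB\<^esub> ?C \<oplus>\<^bsub>AB\<^esub> Z (gcd r s * m)) \<in> AB.span_families ?null" .
  moreover have "of_real (fact N / (T\<^sub>A + T\<^sub>B) ^ N) \<odot>\<^bsub>AB\<^esub>
      (XAB.eval_P (fps_power (\<beta>0 + \<gamma>0) (ln (real N / (T\<^sub>A + T\<^sub>B)))) \<otimes>\<^bsub>AB\<^esub> product_coeff A B r s a b N)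
    = L \<odot>\<^bsub>AB\<^esub> ?C \<oplus>\<^bsub>AB\<^esub> ((W N - L) \<odot>\<^bsub>AB\<^esub> ?C \<oplus>\<^bsub>AB\<^esub> Z N)" for N
  proof -
    have "of_real (fact N / (T\<^sub>A + T\<^sub>B) ^ N) \<odot>\<^bsub>AB\<^esub>
        (XAB.eval_P (fps_power (\<beta>0 + \<gamma>0) (ln (real N / (T\<^sub>A + T\<^sub>B)))) \<otimes>\<^bsub>AB\<^esub> product_coeff A B r s a b N)
      = (\<Oplus>\<^bsub>AB\<^esub>x\<in>lattice_points r s N. ?w N x \<odot>\<^bsub>AB\<^esub> ?C \<oplus>\<^bsub>AB\<^esub> ?w N x \<odot>\<^bsub>AB\<^esub> z x)"
      unfolding product_coeff_as_average[where r = r and s = s and a = a and b = b, OF rs ST a b] p_def[symmetric]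
    proof (rule AB.finsum_cong'[OF refl])
      fix x assume "x \<in> lattice_points r s N"
      then have N: "N = n x" by (auto simp: lattice_points_def n_def)
      show "?w N x \<odot>\<^bsub>AB\<^esub> tensor A B
          (XA.eval_P (fps_power \<beta>0 (ln (real N / (T\<^sub>A + T\<^sub>B)))) \<otimes>\<^bsub>A\<^esub> (of_real (fact (r * fst x) / T\<^sub>A ^ (r * fst x)) \<odot>\<^bsub>A\<^esub> a (r * fst x)))
          (XB.eval_P (fps_power \<gamma>0 (ln (real N / (T\<^sub>A + T\<^sub>B)))) \<otimes>\<^bsub>B\<^esub> (of_real (fact (s * snd x) / T\<^sub>B ^ (s * snd x)) \<odot>\<^bsub>B\<^esub> b (s * snd x)))
        = ?w N x \<odot>\<^bsub>AB\<^esub> ?C \<oplus>\<^bsub>AB\<^esub> ?w N x \<odot>\<^bsub>AB\<^esub> z x"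
        unfolding N xA_def[symmetric] xB_def[symmetric] ya(2) yb(2) z(2)
        by (rule AB.smult_r_distr[OF C zc])
    qed (use C zc in auto)
    also have "\<dots> = (\<Oplus>\<^bsub>AB\<^esub>x\<in>lattice_points r s N. ?w N x \<odot>\<^bsub>AB\<^esub> ?C) \<oplus>\<^bsub>AB\<^esub> Z N"
      unfolding Z_def by (rule AB.finsum_addf) (use C zc in auto)
    also have "(\<Oplus>\<^bsub>AB\<^esub>x\<in>lattice_points r s N. ?w N x \<odot>\<^bsub>AB\<^esub> ?C) = (L + (W N - L)) \<odot>\<^bsub>AB\<^esub> ?C"
      unfolding AB.finsum_smult_left[OF C, symmetric] W_def by simp
    also have "\<dots> = L \<odot>\<^bsub>AB\<^esub> ?C \<oplus>\<^bsub>AB\<^esub> (W N - L) \<odot>\<^bsub>AB\<^esub> ?C"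
      by (rule AB.smult_l_distr[OF C])
    also have "\<dots> \<oplus>\<^bsub>AB\<^esub> Z N = L \<odot>\<^bsub>AB\<^esub> ?C \<oplus>\<^bsub>AB\<^esub> ((W N - L) \<odot>\<^bsub>AB\<^esub> ?C \<oplus>\<^bsub>AB\<^esub> Z N)"
      unfolding Z_def by (rule AB.a_assoc) (use C zc in \<open>auto intro!: AB.finsum_closed\<close>)
    finally show ?thesis .
  qed
  ultimately show ?thesis unfolding L_def[symmetric] by (intro bexI[rotated] allI)
qed

text \<open>
  Multiplying by the inverse of the Gamma quotient, which tends to \<open>1\<close>, turns the limit of the normalised
  coefficients back into the required form with \<open>1 / \<Gamma>\<close>.
\<close>

lemma product_asymptotically_mittag_leffler:
  assumes rs: "r > 0" "s > 0" and ST: "T\<^sub>A > 0" "T\<^sub>B > 0"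
    and a: "\<And>m. a (r * m) \<in> carrier A" and b: "\<And>m. b (s * m) \<in> carrier B" and ab0: "a0 \<in> carrier A" "b0 \<in> carrier B"
    and mittag: "asymptotically_Mittag_Leffler A r a \<beta> T\<^sub>A a0" "asymptotically_Mittag_Leffler B s b \<gamma> T\<^sub>B b0"
  shows "asymptotically_Mittag_Leffler AB (gcd r s) (product_coeff A B r s a b) \<delta> (T\<^sub>A + T\<^sub>B)
    ((of_nat (gcd r s) / (of_nat r * of_nat s)) \<odot>\<^bsub>AB\<^esub> tensor A B a0 b0)"
proof -
  let ?null = "{c. c \<longlonglongrightarrow> (0::complex)}" and ?g = "gcd r s" and ?z = "\<beta>0 + \<gamma>0" and ?U = "T\<^sub>A + T\<^sub>B"
  let ?pc = "product_coeff A B r s a b"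
  define D where "D = (of_nat ?g / (of_nat r * of_nat s)) \<odot>\<^bsub>AB\<^esub> tensor A B a0 b0"
  have D: "D \<in> carrier AB" using ab0 by (simp add: D_def)
  have U: "?U > 0" using ST by simp
  have pc: "?pc N \<in> carrier AB" for N using product_coeff_closed[of a r b s N] a b by simp
  obtain q where q: "q \<in> AB.span_families ?null"
    "\<And>m. of_real (fact (?g * m) / ?U ^ (?g * m)) \<odot>\<^bsub>AB\<^esub>
      (XAB.eval_P (fps_power ?z (ln (real (?g * m) / ?U))) \<otimes>\<^bsub>AB\<^esub> ?pc (?g * m)) = D \<oplus>\<^bsub>AB\<^esub> q m"
    using product_average_limit[OF rs ST a b ab0 mittag] unfolding D_def by blast
  define \<Psi> where "\<Psi> m = fps_expansion (gamma_ratio (?g * m)) ?z" for m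
  have g: "filterlim (\<lambda>m. ?g * m) at_top sequentially"
    using rs by (intro filterlim_nat_mult_at_top) simp
  have \<Psi>: "(\<lambda>m. fps_nth (\<Psi> m) j) \<longlonglongrightarrow> (if j = 0 then 1 else 0)" for j
    unfolding \<Psi>_def by (rule filterlim_compose[OF tendsto_fps_gamma_ratio g])
  have "(\<lambda>m. fps_nth (inverse (\<Psi> m)) j - (if j = 0 then 1 else 0)) \<in> ?null" for j
    using tendsto_diff[OF tendsto_fps_inverse[of \<Psi> j, OF \<Psi>] tendsto_const[of "if j = 0 then 1 else 0"]] by simp
  then obtain d where d: "d \<in> AB.span_families ?null" "\<And>m. XAB.eval_P (inverse (\<Psi> m)) = \<one>\<^bsub>AB\<^esub> \<oplus>\<^bsub>AB\<^esub> d m"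
    using XAB.eval_P_near_one[of "\<lambda>m. inverse (\<Psi> m)" ?null] by blast
  have null_mult: "(\<lambda>i. c i * w) \<in> ?null" "(\<lambda>i. c i * c' i) \<in> ?null" if "c \<in> ?null" "c' \<in> ?null" for c c' w
    using tendsto_mult[of c 0 sequentially "\<lambda>_. w" w] tendsto_mult[of c 0 sequentially c' 0] that by auto
  obtain e where e: "e \<in> AB.span_families ?null"
    "\<And>m. (\<one>\<^bsub>AB\<^esub> \<oplus>\<^bsub>AB\<^esub> d m) \<otimes>\<^bsub>AB\<^esub> (D \<oplus>\<^bsub>AB\<^esub> q m) = D \<oplus>\<^bsub>AB\<^esub> e m"
    using XAB.span_families_near_product[OF d(1) q(1) D] null_mult by blast
  have "tends_to AB (\<lambda>m. \<zero>\<^bsub>AB\<^esub> \<oplus>\<^bsub>AB\<^esub> e m) \<zero>\<^bsub>AB\<^esub>" by (rule AB.tends_to_if_span_families[OF e(1)]) simp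
  then have e_null: "tends_to AB e \<zero>\<^bsub>AB\<^esub>" using AB.span_families_closed[OF e(1)] by simp
  have "\<forall>\<^sub>F m in sequentially. fps_nth (\<Psi> m) 0 \<noteq> 0"
    using tendsto_imp_eventually_ne[OF \<Psi>[of 0], of 0] by simp
  moreover have "\<forall>\<^sub>F m in sequentially. m \<ge> (1::nat)" by (rule eventually_ge_at_top)
  ultimately have "\<forall>\<^sub>F m in sequentially. ?pc (?g * m) =
      (class_powr AB ?U (nat_plus AB (?g * m) \<delta>) \<otimes>\<^bsub>AB\<^esub> class_fun AB rGamma (nat_plus AB 1 (nat_plus AB (?g * m) \<delta>))) \<otimes>\<^bsub>AB\<^esub> (D \<oplus>\<^bsub>AB\<^esub> e m)"
  proof eventually_elim
    case (elim m)
    define N where "N = ?g * m"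
    have N: "real N > 0" using elim rs by (simp add: N_def)
    have inv: "\<Psi> m * inverse (\<Psi> m) = 1" using elim(1) by (simp add: inverse_mult_eq_1')
    let ?l = "ln ?U - ln (real N)"
    let ?E = "\<lambda>G. XAB.eval_P G"
    have ln: "ln (real N / ?U) = - ?l" using ln_divide_pos[OF N U] by simp
    have "?U ^ N / fact N * (fact N / ?U ^ N) = 1" using U by simp
    then have scal: "complex_of_real (?U ^ N / fact N) * of_real (fact N / ?U ^ N) = 1"
      "complex_of_real (fact N / ?U ^ N) * of_real (?U ^ N / fact N) = 1"
      by (simp_all only: of_real_mult[symmetric] of_real_1 mult.commute)
    have "(class_powr AB ?U (nat_plus AB N \<delta>) \<otimes>\<^bsub>AB\<^esub> class_fun AB rGamma (nat_plus AB 1 (nat_plus AB N \<delta>))) \<otimes>\<^bsub>AB\<^esub> (D \<oplus>\<^bsub>AB\<^esub> e m)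
      = (of_real (?U ^ N / fact N) \<odot>\<^bsub>AB\<^esub> ?E (fps_power ?z ?l * \<Psi> m)) \<otimes>\<^bsub>AB\<^esub>
          (?E (inverse (\<Psi> m)) \<otimes>\<^bsub>AB\<^esub> (of_real (fact N / ?U ^ N) \<odot>\<^bsub>AB\<^esub> (?E (fps_power ?z (- ?l)) \<otimes>\<^bsub>AB\<^esub> ?pc N)))"
      unfolding XAB.mittag_leffler_factor[OF U] e(2)[symmetric] q(2)[symmetric] d(2)[symmetric] \<Psi>_def N_def[symmetric] ln ..
    also have "\<dots> = ?E (fps_power ?z ?l * \<Psi> m) \<otimes>\<^bsub>AB\<^esub> (?E (inverse (\<Psi> m)) \<otimes>\<^bsub>AB\<^esub> (?E (fps_power ?z (- ?l)) \<otimes>\<^bsub>AB\<^esub> ?pc N))"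
      using pc scal
      by (simp add: AB.smult_mult_left AB.smult_mult_right AB.smult_smult XAB.eval_P_closed del: of_real_divide of_real_mult of_real_power)
    also have "\<dots> = ?E (fps_power ?z ?l * \<Psi> m * (inverse (\<Psi> m) * fps_power ?z (- ?l))) \<otimes>\<^bsub>AB\<^esub> ?pc N"
      using pc by (simp add: XAB.eval_P_mult XAB.eval_P_closed AB.m_assoc)
    also have "fps_power ?z ?l * \<Psi> m * (inverse (\<Psi> m) * fps_power ?z (- ?l))
        = fps_power ?z ?l * (\<Psi> m * inverse (\<Psi> m)) * fps_power ?z (- ?l)" by (simp only: mult.assoc)
    also have "\<dots> = 1" unfolding inv by (simp add: fps_power_mult fps_power_zero)
    also have "?E 1 \<otimes>\<^bsub>AB\<^esub> ?pc N = ?pc N" using pc by (simp add: XAB.eval_P_one)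
    finally show ?case unfolding N_def by simp
  qed
  then show ?thesis
    unfolding asymptotically_Mittag_Leffler_def D_def[symmetric] using e_null by blast
qed

end


section \<open>The product theorem\<close>

theorem proposition4p1:
  fixes X :: "'a topology" and Y :: "'b topology"
    and n\<^sub>X n\<^sub>Y :: nat
    and \<A>\<^sub>X :: "('a set \<times> ('a \<Rightarrow> nat \<Rightarrow> real)) set"
    and \<A>\<^sub>Y :: "('b set \<times> ('b \<Rightarrow> nat \<Rightarrow> real)) set"
    and \<alpha>\<^sub>X :: "real \<Rightarrow> 'a cochain set" and \<alpha>\<^sub>Y :: "real \<Rightarrow> 'b cochain set"
    and a\<^sub>X :: "nat \<Rightarrow> 'a cochain set" and a\<^sub>Y :: "nat \<Rightarrow> 'b cochain set"
    and \<beta>\<^sub>X A\<^sub>X :: "'a cochain set" and \<beta>\<^sub>Y A\<^sub>Y :: "'b cochain set"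
    and r\<^sub>X r\<^sub>Y :: nat and T\<^sub>X T\<^sub>Y :: real
  defines "r \<equiv> gcd r\<^sub>X r\<^sub>Y"
    and "HX \<equiv> cohomology X" and "HY \<equiv> cohomology Y"
    and "HXY \<equiv> tensor_algebra (cohomology X) (cohomology Y)"
  assumes "smooth_manifold n\<^sub>X X \<A>\<^sub>X" and "smooth_manifold n\<^sub>Y Y \<A>\<^sub>Y"
    and "connected_space X" and "connected_space Y"
    and "topspace X \<noteq> {}" and "topspace Y \<noteq> {}"
    and "finite_dimensional HX" and "finite_dimensional HY"
    and "r\<^sub>X > 0" and "r\<^sub>Y > 0" and "T\<^sub>X > 0" and "T\<^sub>Y > 0"
    and "\<And>m. a\<^sub>X (r\<^sub>X * m) \<in> carrier HX" and "\<And>m. a\<^sub>Y (r\<^sub>Y * m) \<in> carrier HY"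
    and "even_class HX \<beta>\<^sub>X" and "even_class HY \<beta>\<^sub>Y"
    and "A\<^sub>X \<in> carrier HX" and "A\<^sub>Y \<in> carrier HY"
    and "has_series_expansion HX \<alpha>\<^sub>X r\<^sub>X a\<^sub>X \<beta>\<^sub>X" and "has_series_expansion HY \<alpha>\<^sub>Y r\<^sub>Y a\<^sub>Y \<beta>\<^sub>Y"
    and "asymptotically_Mittag_Leffler HX r\<^sub>X a\<^sub>X \<beta>\<^sub>X T\<^sub>X A\<^sub>X"
    and "asymptotically_Mittag_Leffler HY r\<^sub>Y a\<^sub>Y \<beta>\<^sub>Y T\<^sub>Y A\<^sub>Y"
  shows "has_series_expansion HXY (\<lambda>t. tensor HX HY (\<alpha>\<^sub>X t) (\<alpha>\<^sub>Y t)) r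
           (product_coeff HX HY r\<^sub>X r\<^sub>Y a\<^sub>X a\<^sub>Y) (tensor_sum HX HY \<beta>\<^sub>X \<beta>\<^sub>Y) \<and>
         asymptotically_Mittag_Leffler HXY r
           (product_coeff HX HY r\<^sub>X r\<^sub>Y a\<^sub>X a\<^sub>Y) (tensor_sum HX HY \<beta>\<^sub>X \<beta>\<^sub>Y) (T\<^sub>X + T\<^sub>Y)
           ((of_nat r / (of_nat r\<^sub>X * of_nat r\<^sub>Y)) \<odot>\<^bsub>HXY\<^esub> tensor HX HY A\<^sub>X A\<^sub>Y)"
proof -
  have HX: "connected_graded_algebra HX"
    unfolding HX_def by (rule connected_graded_algebra_cohomology[OF assms(5,7,9) assms(11)[unfolded HX_def]])
  have HY: "connected_graded_algebra HY"
    unfolding HY_def by (rule connected_graded_algebra_cohomology[OF assms(6,8,10) assms(12)[unfolded HY_def]])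
  have "\<beta>\<^sub>X \<in> carrier HX" "\<beta>\<^sub>Y \<in> carrier HY"
    using assms(19,20) by (simp_all add: even_class_def)
  then obtain N\<^sub>X N\<^sub>Y \<beta>0 \<gamma>0 where "exponent_class HX \<beta>\<^sub>X \<beta>0 N\<^sub>X" "exponent_class HY \<beta>\<^sub>Y \<gamma>0 N\<^sub>Y"
    using connected_graded_algebra.exponent_class_if_closed[OF HX] connected_graded_algebra.exponent_class_if_closed[OF HY] by blast
  then have "tensor_exponents HX \<beta>\<^sub>X \<beta>0 N\<^sub>X HY \<beta>\<^sub>Y \<gamma>0 N\<^sub>Y"
    using assms(19,20) HX HY by (intro tensor_exponents.intro tensor_product.intro tensor_exponents_axioms.intro)
  then interpret tensor_exponents HX \<beta>\<^sub>X \<beta>0 N\<^sub>X HY \<beta>\<^sub>Y \<gamma>0 N\<^sub>Y .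
  have HXY: "HXY = tensor_algebra HX HY" by (simp add: HXY_def HX_def HY_def)
  show ?thesis
    unfolding HXY r_def
    using product_series_expansion[OF assms(13-18,21,22,25,26,23,24)]
      product_asymptotically_mittag_leffler[OF assms(13-18,21,22,25,26)] by (rule conjI)
qed

end
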